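(* Let $R$ be a standard graded polynomial ring in $n\ge 2$ variables over a field $k$, with maximal graded ideal $\mathfrak m$. Let $M$ be a finitely generated graded $R$-module of dimension $d\ge 1$ with $\operatorname{indeg}(M)=0$. Let $l_1,\dots,l_d$ be a filter regular sequence of linear forms on $M$; for $0\le i\le d$ set $M_i:=M/(l_1,\dots,l_i)M$, $\overline{M_i}:=M_i/H^0_{\mathfrak m}(M_i)$, $\bar r_i:=\operatorname{reg}(\overline{M_i})$, and set $B:=\dim_k(M_d)$. Then for all $0<i\le d$ and all integers $\mu$: (i) $\displaystyle\dim_k\operatorname{Ext}^{n-i}_R(M,R)_\mu\le B\binom{\bar r_{i-1}+d-i}{d-i}\binom{\mu+\bar r_{i-1}+n-1}{i-1}$; (ii) $\displaystyle\dim_kH^i_{\mathfrak m}(M)_\mu\le B\binom{\bar r_{i-1}+d-i}{d-i}\binom{-\mu+\bar r_{i-1}-1}{i-1}$.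
   Context: $\operatorname{indeg}(N)=\min\{t: N_t\neq 0\}$; $\operatorname{reg}(N)=\max\{i+t : H^i_{\mathfrak m}(N)_t\neq 0\}$ is the Castelnuovo-Mumford regularity. A sequence $l_1,\dots,l_d$ of linear forms is filter regular on $M$ if for each $j=1,\dots,d$ the kernel of multiplication by $l_j$ on $M/(l_1,\dots,l_{j-1})M$ has finite length. Binomial coefficients $\binom{a}{b}$ are $0$ if $a<b$. *)

theory Defs
  imports
    "HOL-Algebra.Module"
    "HOL-Algebra.AbelCoset"
    "HOL-Algebra.Ideal"
    "HOL-Algebra.Algebraic_Closure_Type"
    "HOL-Library.Poly_Mapping"
    "HOL-Library.Extended_Nat"
    "HOL-Library.Cardinality"
begin

section \<open>The standard graded polynomial ring\<close>

text \<open>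
  The polynomial ring over the field \<open>'k\<close> in the variables \<open>'n\<close>, where \<open>'n\<close> is a finite type;
  the number of variables is \<open>CARD('n)\<close>. The linear order on \<open>'n\<close> is an enumeration of
  the variables; it is only used for the signs in the Cech complex.
\<close>

type_synonym ('n, 'k) mpoly = "('n \<Rightarrow>\<^sub>0 nat) \<Rightarrow>\<^sub>0 'k"

abbreviation mpoly_ring :: "('n, 'k::field) mpoly ring" where
  "mpoly_ring \<equiv> ring_of_type_algebra"

definition pconst :: "'k::field \<Rightarrow> ('n, 'k) mpoly" where
  "pconst c = Poly_Mapping.single 0 c"

definition pvar :: "'n \<Rightarrow> ('n, 'k::field) mpoly" where
  "pvar s = Poly_Mapping.single (Poly_Mapping.single s 1) 1"

definition mon_deg :: "('n::finite \<Rightarrow>\<^sub>0 nat) \<Rightarrow> nat" where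
  "mon_deg a = (\<Sum>s\<in>UNIV. Poly_Mapping.lookup a s)"

definition poly_homog :: "int \<Rightarrow> ('n::finite, 'k::field) mpoly set" where
  "poly_homog t = {p. \<forall>a \<in> Poly_Mapping.keys p. int (mon_deg a) = t}"

definition irrelevant_ideal :: "('n, 'k::field) mpoly set" where
  "irrelevant_ideal = {p. Poly_Mapping.lookup p 0 = 0}"


section \<open>Graded modules\<close>

record ('r, 'm) gmodule = "('r, 'm) module" +
  homog :: "int \<Rightarrow> 'm set"

text \<open>
  The fields \<open>mult\<close> and \<open>one\<close>, which the record type of modules inherits from that of
  rings, play no role.
\<close>

definition mk_gmodule ::
  "'m set \<Rightarrow> 'm \<Rightarrow> ('m \<Rightarrow> 'm \<Rightarrow> 'm) \<Rightarrow> ('r \<Rightarrow> 'm \<Rightarrow> 'm) \<Rightarrow> (int \<Rightarrow> 'm set) \<Rightarrow> ('r, 'm) gmodule"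
where
  "mk_gmodule A z p s G =
     \<lparr>carrier = A, monoid.mult = undefined, one = undefined, zero = z, add = p, module.smult = s, homog = G\<rparr>"

definition graded_module :: "(('n::finite, 'k::field) mpoly, 'm) gmodule \<Rightarrow> bool" where
  "graded_module N \<longleftrightarrow>
     Module.module mpoly_ring N \<and>
     (\<forall>t. subgroup (homog N t) (add_monoid N)) \<and>
     (\<forall>s t. \<forall>p \<in> poly_homog s. \<forall>x \<in> homog N t. p \<odot>\<^bsub>N\<^esub> x \<in> homog N (s + t)) \<and>
     (\<forall>x \<in> carrier N. \<exists>!f. (\<forall>t. f t \<in> homog N t) \<and> finite {t. f t \<noteq> \<zero>\<^bsub>N\<^esub>} \<and>
        x = (\<Oplus>\<^bsub>N\<^esub>t \<in> {t. f t \<noteq> \<zero>\<^bsub>N\<^esub>}. f t))"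

definition finitely_generated :: "(('n, 'k::field) mpoly, 'm) gmodule \<Rightarrow> bool" where
  "finitely_generated N \<longleftrightarrow>
     (\<exists>S. finite S \<and> S \<subseteq> carrier N \<and>
        (\<forall>H. submodule H mpoly_ring N \<and> S \<subseteq> H \<longrightarrow> H = carrier N))"

definition poly_gmodule :: "(('n::finite, 'k::field) mpoly, ('n, 'k) mpoly) gmodule" where
  "poly_gmodule = mk_gmodule UNIV 0 (+) (*) poly_homog"

definition gshift :: "int \<Rightarrow> ('r, 'm) gmodule \<Rightarrow> ('r, 'm) gmodule" where
  "gshift a N = N\<lparr>homog := \<lambda>t. homog N (t + a)\<rparr>"

definition gsub :: "('r, 'm) gmodule \<Rightarrow> 'm set \<Rightarrow> ('r, 'm) gmodule" where
  "gsub N A = N\<lparr>carrier := A, homog := \<lambda>t. homog N t \<inter> A\<rparr>"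

definition gquot :: "('r, 'm) gmodule \<Rightarrow> 'm set \<Rightarrow> ('r, 'm set) gmodule" where
  "gquot N A = mk_gmodule
     (a_rcosets\<^bsub>N\<^esub> A)
     A
     (\<lambda>C D. C <+>\<^bsub>N\<^esub> D)
     (\<lambda>r C. \<Union>x \<in> C. A +>\<^bsub>N\<^esub> (r \<odot>\<^bsub>N\<^esub> x))
     (\<lambda>t. (\<lambda>x. A +>\<^bsub>N\<^esub> x) ` homog N t)"

text \<open>Direct sum of a family indexed by a finite set.\<close>

definition gsum :: "'i set \<Rightarrow> ('i \<Rightarrow> ('r, 'm) gmodule) \<Rightarrow> ('r, 'i \<Rightarrow> 'm) gmodule" where
  "gsum I N = mk_gmodule
     (\<Pi>\<^sub>E i\<in>I. carrier (N i))
     (\<lambda>i\<in>I. \<zero>\<^bsub>N i\<^esub>)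
     (\<lambda>f g. \<lambda>i\<in>I. f i \<oplus>\<^bsub>N i\<^esub> g i)
     (\<lambda>r f. \<lambda>i\<in>I. r \<odot>\<^bsub>N i\<^esub> f i)
     (\<lambda>t. \<Pi>\<^sub>E i\<in>I. homog (N i) t)"

definition mod_hom :: "('r, 'm) gmodule \<Rightarrow> ('r, 'q) gmodule \<Rightarrow> ('m \<Rightarrow> 'q) set" where
  "mod_hom N Q = {h. h \<in> carrier N \<rightarrow> carrier Q \<and>
     (\<forall>x \<in> carrier N. \<forall>y \<in> carrier N. h (x \<oplus>\<^bsub>N\<^esub> y) = h x \<oplus>\<^bsub>Q\<^esub> h y) \<and>
     (\<forall>r. \<forall>x \<in> carrier N. h (r \<odot>\<^bsub>N\<^esub> x) = r \<odot>\<^bsub>Q\<^esub> h x)}"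

definition mod_hom_deg :: "('r, 'm) gmodule \<Rightarrow> ('r, 'q) gmodule \<Rightarrow> int \<Rightarrow> ('m \<Rightarrow> 'q) set" where
  "mod_hom_deg N Q \<mu> = {h \<in> mod_hom N Q. \<forall>t. h ` homog N t \<subseteq> homog Q (t + \<mu>)}"

text \<open>
  The module of homomorphisms, represented by functions that are \<open>undefined\<close> outside
  the carrier. For finitely generated \<open>N\<close>, the only case in which it is used, the
  homogeneous homomorphisms form a grading of the module of all homomorphisms.
\<close>

definition gHom :: "('r, 'm) gmodule \<Rightarrow> ('r, 'q) gmodule \<Rightarrow> ('r, 'm \<Rightarrow> 'q) gmodule" where
  "gHom N Q = mk_gmodule
     (mod_hom N Q \<inter> extensional (carrier N))
     (\<lambda>x\<in>carrier N. \<zero>\<^bsub>Q\<^esub>)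
     (\<lambda>f g. \<lambda>x\<in>carrier N. f x \<oplus>\<^bsub>Q\<^esub> g x)
     (\<lambda>r f. \<lambda>x\<in>carrier N. r \<odot>\<^bsub>Q\<^esub> f x)
     (\<lambda>\<mu>. mod_hom_deg N Q \<mu> \<inter> extensional (carrier N))"

definition cohomology ::
  "(nat \<Rightarrow> ('r, 'c) gmodule) \<Rightarrow> (nat \<Rightarrow> 'c \<Rightarrow> 'c) \<Rightarrow> nat \<Rightarrow> ('r, 'c set) gmodule"
where
  "cohomology C \<delta> p = gquot
     (gsub (C p) {x \<in> carrier (C p). \<delta> p x = \<zero>\<^bsub>C (Suc p)\<^esub>})
     (case p of 0 \<Rightarrow> {\<zero>\<^bsub>C 0\<^esub>} | Suc q \<Rightarrow> \<delta> q ` carrier (C q))"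


section \<open>Numerical invariants\<close>

definition k_independent :: "(('n, 'k::field) mpoly, 'm) gmodule \<Rightarrow> 'm set \<Rightarrow> bool" where
  "k_independent N S \<longleftrightarrow>
     (\<forall>c. (\<Oplus>\<^bsub>N\<^esub>x \<in> S. pconst (c x) \<odot>\<^bsub>N\<^esub> x) = \<zero>\<^bsub>N\<^esub> \<longrightarrow> (\<forall>x \<in> S. c x = 0))"

text \<open>The dimension over \<open>'k\<close> of a \<open>'k\<close>-subspace \<open>V\<close> of \<open>N\<close>, possibly infinite.\<close>

definition k_dim :: "(('n, 'k::field) mpoly, 'm) gmodule \<Rightarrow> 'm set \<Rightarrow> enat" where
  "k_dim N V = Sup {enat (card S) | S. finite S \<and> S \<subseteq> V \<and> k_independent N S}"

definition mod_length :: "(('n, 'k::field) mpoly, 'm) gmodule \<Rightarrow> enat" where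
  "mod_length N = Sup {enat c | c. \<exists>H :: nat \<Rightarrow> 'm set.
     (\<forall>j \<le> c. submodule (H j) mpoly_ring N) \<and> (\<forall>j < c. H j \<subset> H (Suc j))}"

definition annihilator :: "(('n, 'k::field) mpoly, 'm) gmodule \<Rightarrow> ('n, 'k) mpoly set" where
  "annihilator N = {p. \<forall>x \<in> carrier N. p \<odot>\<^bsub>N\<^esub> x = \<zero>\<^bsub>N\<^esub>}"

text \<open>
  Krull dimension of \<open>N\<close>, that is, of the ring modulo the annihilator. The supremum is taken
  in \<open>enat\<close>, so the zero module has dimension 0 here.
\<close>

definition mod_dim :: "(('n, 'k::field) mpoly, 'm) gmodule \<Rightarrow> enat" where
  "mod_dim N = Sup {enat c | c. \<exists>P :: nat \<Rightarrow> ('n, 'k) mpoly set.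
     (\<forall>j \<le> c. primeideal (P j) mpoly_ring \<and> annihilator N \<subseteq> P j) \<and>
     (\<forall>j < c. P j \<subset> P (Suc j))}"

definition indeg :: "('r, 'm) gmodule \<Rightarrow> int" where
  "indeg N = (LEAST t. homog N t \<noteq> {\<zero>\<^bsub>N\<^esub>})"


section \<open>Local cohomology and regularity\<close>

text \<open>
  \<open>H\<^sup>0\<close> as a submodule: the elements annihilated by a power of the irrelevant ideal,
  the power being generated by products.
\<close>

definition H0_sub :: "(('n, 'k::field) mpoly, 'm) gmodule \<Rightarrow> 'm set" where
  "H0_sub N = {x \<in> carrier N. \<exists>e. \<forall>f :: nat \<Rightarrow> ('n, 'k) mpoly.
     (\<forall>j<e. f j \<in> irrelevant_ideal) \<longrightarrow> (\<Prod>j<e. f j) \<odot>\<^bsub>N\<^esub> x = \<zero>\<^bsub>N\<^esub>}"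

text \<open>
  Localization of \<open>N\<close> at the powers of the product of the variables in \<open>S\<close>;
  \<open>loc_frac N S m a\<close> is the fraction with numerator \<open>m\<close> and denominator the \<open>a\<close>-th power
  of that product, as an equivalence class of pairs.
\<close>

definition var_prod :: "'n set \<Rightarrow> ('n, 'k::field) mpoly" where
  "var_prod S = (\<Prod>s\<in>S. pvar s)"

definition loc_frac ::
  "(('n, 'k::field) mpoly, 'm) gmodule \<Rightarrow> 'n set \<Rightarrow> 'm \<Rightarrow> nat \<Rightarrow> ('m \<times> nat) set"
where
  "loc_frac N S m a = {(m', a'). m' \<in> carrier N \<and>
     (\<exists>c. var_prod S ^ (c + a') \<odot>\<^bsub>N\<^esub> m = var_prod S ^ (c + a) \<odot>\<^bsub>N\<^esub> m')}"

definition localize ::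
  "(('n, 'k::field) mpoly, 'm) gmodule \<Rightarrow> 'n set \<Rightarrow> (('n, 'k) mpoly, ('m \<times> nat) set) gmodule"
where
  "localize N S = mk_gmodule
     {loc_frac N S m a | m a. m \<in> carrier N}
     (loc_frac N S \<zero>\<^bsub>N\<^esub> 0)
     (\<lambda>C D. \<Union>(m, a) \<in> C. \<Union>(m', a') \<in> D.
        loc_frac N S (var_prod S ^ a' \<odot>\<^bsub>N\<^esub> m \<oplus>\<^bsub>N\<^esub> var_prod S ^ a \<odot>\<^bsub>N\<^esub> m') (a + a'))
     (\<lambda>r C. \<Union>(m, a) \<in> C. loc_frac N S (r \<odot>\<^bsub>N\<^esub> m) a)
     (\<lambda>t. {loc_frac N S m a | m a. m \<in> homog N (t + int (a * card S))})"

text \<open>The canonical map from the localization at \<open>S\<close> to the one at \<open>insert s S\<close>, for \<open>s \<notin> S\<close>.\<close>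

definition loc_map ::
  "(('n, 'k::field) mpoly, 'm) gmodule \<Rightarrow> 'n set \<Rightarrow> 'n \<Rightarrow> ('m \<times> nat) set \<Rightarrow> ('m \<times> nat) set"
where
  "loc_map N S s C = (\<Union>(m, a) \<in> C. loc_frac N (insert s S) (pvar s ^ a \<odot>\<^bsub>N\<^esub> m) a)"

definition cech_module ::
  "(('n::{finite,linorder}, 'k::field) mpoly, 'm) gmodule \<Rightarrow> nat \<Rightarrow>
   (('n, 'k) mpoly, 'n set \<Rightarrow> ('m \<times> nat) set) gmodule"
where
  "cech_module N p = gsum {S. card S = p} (localize N)"

definition cech_diff ::
  "(('n::{finite,linorder}, 'k::field) mpoly, 'm) gmodule \<Rightarrow> nat \<Rightarrow>
   ('n set \<Rightarrow> ('m \<times> nat) set) \<Rightarrow> ('n set \<Rightarrow> ('m \<times> nat) set)"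
where
  "cech_diff N p c = (\<lambda>T \<in> {T. card T = Suc p}.
     (\<Oplus>\<^bsub>localize N T\<^esub>s \<in> T.
        (-1) ^ card {u \<in> T. u < s} \<odot>\<^bsub>localize N T\<^esub> loc_map N (T - {s}) s (c (T - {s}))))"

text \<open>
  Local cohomology with support in the irrelevant ideal. In degree 0 it is canonically
  isomorphic to the submodule \<open>H0_sub N\<close>.
\<close>

definition local_cohomology ::
  "nat \<Rightarrow> (('n::{finite,linorder}, 'k::field) mpoly, 'm) gmodule \<Rightarrow>
   (('n, 'k) mpoly, ('n set \<Rightarrow> ('m \<times> nat) set) set) gmodule"
where
  "local_cohomology i N = cohomology (cech_module N) (cech_diff N) i"

definition reg :: "(('n::{finite,linorder}, 'k::field) mpoly, 'm) gmodule \<Rightarrow> int" where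
  "reg N = (GREATEST r. \<exists>i t. r = int i + t \<and>
     homog (local_cohomology i N) t \<noteq> {\<zero>\<^bsub>local_cohomology i N\<^esub>})"


section \<open>Graded Ext\<close>

text \<open>
  The free module with homogeneous basis elements of degrees \<open>es ! 0\<close>, \<open>es ! 1\<close>, and so on.
\<close>

definition free_gmodule ::
  "int list \<Rightarrow> (('n::finite, 'k::field) mpoly, nat \<Rightarrow> ('n, 'k) mpoly) gmodule"
where
  "free_gmodule es = gsum {..<length es} (\<lambda>a. gshift (- (es ! a)) poly_gmodule)"

text \<open>
  A graded resolution of \<open>N\<close> by free modules of finite rank: the \<open>p\<close>-th module has basis degrees
  \<open>es p\<close>, the map \<open>\<phi> p\<close> goes from the module in position \<open>p + 1\<close> to the one in
  position \<open>p\<close>, and \<open>\<epsilon>\<close> is the augmentation.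
\<close>

definition graded_free_resolution ::
  "(('n::finite, 'k::field) mpoly, 'm) gmodule \<Rightarrow> (nat \<Rightarrow> int list) \<Rightarrow>
   (nat \<Rightarrow> (nat \<Rightarrow> ('n, 'k) mpoly) \<Rightarrow> (nat \<Rightarrow> ('n, 'k) mpoly)) \<Rightarrow>
   ((nat \<Rightarrow> ('n, 'k) mpoly) \<Rightarrow> 'm) \<Rightarrow> bool"
where
  "graded_free_resolution N es \<phi> \<epsilon> \<longleftrightarrow>
     (let F = (\<lambda>p. free_gmodule (es p)) in
      \<epsilon> \<in> mod_hom_deg (F 0) N 0 \<and>
      (\<forall>p. \<phi> p \<in> mod_hom_deg (F (Suc p)) (F p) 0) \<and>
      \<epsilon> ` carrier (F 0) = carrier N \<and>
      \<phi> 0 ` carrier (F 1) = {x \<in> carrier (F 0). \<epsilon> x = \<zero>\<^bsub>N\<^esub>} \<and>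
      (\<forall>p. \<phi> (Suc p) ` carrier (F (Suc (Suc p))) =
           {x \<in> carrier (F (Suc p)). \<phi> p x = \<zero>\<^bsub>F p\<^esub>}))"

definition Ext_of ::
  "(nat \<Rightarrow> int list) \<Rightarrow> (nat \<Rightarrow> (nat \<Rightarrow> ('n, 'k) mpoly) \<Rightarrow> (nat \<Rightarrow> ('n, 'k) mpoly)) \<Rightarrow>
   nat \<Rightarrow> (('n::finite, 'k::field) mpoly, 'q) gmodule \<Rightarrow>
   (('n, 'k) mpoly, ((nat \<Rightarrow> ('n, 'k) mpoly) \<Rightarrow> 'q) set) gmodule"
where
  "Ext_of es \<phi> j Q = cohomology
     (\<lambda>p. gHom (free_gmodule (es p)) Q)
     (\<lambda>p f. \<lambda>x \<in> carrier (free_gmodule (es (Suc p))). f (\<phi> p x))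
     j"

text \<open>
  Ext is computed from a chosen resolution. Finitely generated graded modules have one,
  the polynomial ring being Noetherian.
\<close>

definition graded_Ext ::
  "nat \<Rightarrow> (('n::finite, 'k::field) mpoly, 'm) gmodule \<Rightarrow> (('n, 'k) mpoly, 'q) gmodule \<Rightarrow>
   (('n, 'k) mpoly, ((nat \<Rightarrow> ('n, 'k) mpoly) \<Rightarrow> 'q) set) gmodule"
where
  "graded_Ext j N Q =
     (let (es, \<phi>) = (SOME (es, \<phi>). \<exists>\<epsilon>. graded_free_resolution N es \<phi> \<epsilon>)
      in Ext_of es \<phi> j Q)"


section \<open>Filter regular sequences\<close>

text \<open>
  Sequences of polynomials are indexed from 1; \<open>mod_seq N l i\<close> is the quotient of \<open>N\<close> by
  the submodule generated by the multiples of \<open>l 1, \<dots>, l i\<close>.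
\<close>

definition seq_sub ::
  "(('n, 'k::field) mpoly, 'm) gmodule \<Rightarrow> (nat \<Rightarrow> ('n, 'k) mpoly) \<Rightarrow> nat \<Rightarrow> 'm set"
where
  "seq_sub N l i = {(\<Oplus>\<^bsub>N\<^esub>j \<in> {1..i}. l j \<odot>\<^bsub>N\<^esub> x j) | x. x \<in> {1..i} \<rightarrow> carrier N}"

definition mod_seq ::
  "(('n, 'k::field) mpoly, 'm) gmodule \<Rightarrow> (nat \<Rightarrow> ('n, 'k) mpoly) \<Rightarrow> nat \<Rightarrow>
   (('n, 'k) mpoly, 'm set) gmodule"
where
  "mod_seq N l i = gquot N (seq_sub N l i)"

definition filter_regular ::
  "(('n::finite, 'k::field) mpoly, 'm) gmodule \<Rightarrow> (nat \<Rightarrow> ('n, 'k) mpoly) \<Rightarrow> nat \<Rightarrow> bool"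
where
  "filter_regular N l d \<longleftrightarrow>
     (\<forall>j \<in> {1..d}. l j \<in> poly_homog 1 \<and>
        mod_length (gsub (mod_seq N l (j - 1))
          {x \<in> carrier (mod_seq N l (j - 1)).
             l j \<odot>\<^bsub>mod_seq N l (j - 1)\<^esub> x = \<zero>\<^bsub>mod_seq N l (j - 1)\<^esub>}) < \<infinity>)"

definition bar_mod :: "(('n, 'k::field) mpoly, 'm) gmodule \<Rightarrow> (('n, 'k) mpoly, 'm set) gmodule" where
  "bar_mod N = gquot N (H0_sub N)"


section \<open>Binomial coefficients\<close>

text \<open>The convention: 0 if the upper entry, a possibly negative integer, is less than the lower.\<close>

definition binom :: "int \<Rightarrow> nat \<Rightarrow> enat" where
  "binom a b = (if a < int b then 0 else enat (nat a choose b))"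

end

theory Submission
  imports Defs "HOL-Library.Function_Algebras" "HOL-Library.Product_Lexorder"
begin

text \<open>
  Present \<open>M\<close> as \<open>F/K\<close> with \<open>F\<close> graded free, and let \<open>K\<^sup>s\<^sup>a\<^sup>t\<close> be the saturation of \<open>K\<close>, so that
  \<open>F/K\<^sup>s\<^sup>a\<^sup>t\<close> is \<open>M\<close> modulo \<open>H\<^sup>0\<close>. Passing to the saturation changes no \<open>H\<^sup>i\<close> with \<open>i > 0\<close>, and a
  filter regular linear form \<open>l\<close> is a nonzerodivisor on \<open>F/K\<^sup>s\<^sup>a\<^sup>t\<close>, so its long exact sequence gives
  \<open>h\<^sup>i(M)\<^sub>t \<le> h\<^sup>i(M)\<^sub>t\<^sub>+\<^sub>1 + h\<^sup>i\<^sup>-\<^sup>1(M/lM)\<^sub>t\<^sub>+\<^sub>1\<close>. Summing this over the degrees and iterating reduces the bound on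
  \<open>H\<^sup>i\<close> to the bound on the first cohomology of the module reduced by \<open>i - 1\<close> forms, which vanishes from the
  regularity on and is controlled by the Hilbert function; that function in turn is bounded by
  sums of the Hilbert function of the finite-dimensional module reduced by all \<open>d\<close> forms.
  The binomial coefficients come from the repeated summation.
  
  The bound on Ext follows by local duality, in the weak form
  \<open>dim Ext\<^sup>q(M,R)\<^sub>\<mu> \<le> dim H\<^sup>n\<^sup>-\<^sup>q(M)\<^sub>-\<^sub>n\<^sub>-\<^sub>\<mu>\<close>: the top Cech cohomology of a free module is spanned by the
  strictly negative monomials and pairs with the dual module by taking residues. As \<open>n - i\<close> is a truncated
  subtraction, \<open>d \<le> n\<close> is needed; more than \<open>n\<close> polynomials are algebraically dependent,
  which bounds the length of a chain of primes.
\<close>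

section \<open>Relative dimension of spaces of functions\<close>

text \<open>The obstacle is that quotients, localizations, cohomology and Ext of a record-based
  module change the carrier type at every step. Hence each module is replaced by a pair of subspaces
  of one space of Laurent coefficient functions: quotients become pairs \<open>A\<close>,
  \<open>B\<close>, localization maps become inclusions, and the dimension of a subquotient is the
  relative dimension \<open>rdim\<close>, which never forms a quotient. Dimensions are extended
  naturals, where subtraction is of no use, so exact sequences enter only as inequalities between
  dimensions; all of them come from one lemma on three subspaces.

  In the bound, \<open>r\<close> is the regularity of the saturation of the module reduced by
  \<open>i - 1\<close> forms, whose first cohomology vanishes from degree \<open>r\<close> on. The
  factor with lower entry \<open>d - i\<close> is the effect of \<open>d - i\<close> cumulative
  sums, over degrees from 0 up to at most \<open>r\<close>, on the constant bound \<open>B\<close>.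
  The factor with lower entry \<open>i - 1\<close> is the effect of \<open>i - 1\<close> sums over
  all degrees above the given one, on the indicator of the degrees below \<open>r\<close>.\<close>

definition fscale :: "'k::field \<Rightarrow> ('x \<Rightarrow> 'k) \<Rightarrow> 'x \<Rightarrow> 'k" (infixr \<open>*\<^sub>f\<close> 75)
  where "c *\<^sub>f f = (\<lambda>x. c * f x)"

lemma fscale_apply [simp]: "(c *\<^sub>f f) x = c * f x"
  by (simp add: fscale_def)

lemma sum_fun_apply: "(\<Sum>i\<in>I. f i) x = (\<Sum>i\<in>I. f i x)"
  for f :: "'i \<Rightarrow> 'x \<Rightarrow> 'k::comm_monoid_add"
  by (induction I rule: infinite_finite_induct) auto

global_interpretation fun_vs: vector_space "fscale :: 'k::field \<Rightarrow> ('x \<Rightarrow> 'k) \<Rightarrow> 'x \<Rightarrow> 'k"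
  by unfold_locales (auto simp: fun_eq_iff algebra_simps)

text \<open>
  \<open>rdim Z B\<close> is the dimension of the image of \<open>Z\<close> in the quotient by \<open>B\<close>.
\<close>

definition rindep :: "('x \<Rightarrow> 'k::field) set \<Rightarrow> ('x \<Rightarrow> 'k) set \<Rightarrow> bool" where
  "rindep B S \<longleftrightarrow> finite S \<and> (\<forall>c. (\<Sum>x\<in>S. c x *\<^sub>f x) \<in> B \<longrightarrow> (\<forall>x\<in>S. c x = 0))"

definition rdim :: "('x \<Rightarrow> 'k::field) set \<Rightarrow> ('x \<Rightarrow> 'k) set \<Rightarrow> enat" where
  "rdim Z B = Sup {enat (card S) | S. S \<subseteq> Z \<and> rindep B S}"

lemma rindep_finite: "rindep B S \<Longrightarrow> finite S"
  by (simp add: rindep_def)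

lemma rindepD: "rindep B S \<Longrightarrow> (\<Sum>x\<in>S. c x *\<^sub>f x) \<in> B \<Longrightarrow> x \<in> S \<Longrightarrow> c x = 0"
  by (auto simp: rindep_def)

lemma rdim_upper: "S \<subseteq> Z \<Longrightarrow> rindep B S \<Longrightarrow> enat (card S) \<le> rdim Z B"
  unfolding rdim_def by (rule Sup_upper) auto

lemma rdim_least:
  assumes "\<And>S. S \<subseteq> Z \<Longrightarrow> rindep B S \<Longrightarrow> enat (card S) \<le> D"
  shows "rdim Z B \<le> D"
  unfolding rdim_def by (rule Sup_least) (use assms in auto)

lemma rindep_empty [simp]: "rindep B {}"
  by (simp add: rindep_def)

text \<open>Equal values at two indices would give the relation \<open>f x - f y = 0\<close>, which
  lies in \<open>B\<close>; so independence of a family forces injectivity, and the image has as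
  many elements as the index set.\<close>

lemma rindep_family:
  fixes f :: "'i \<Rightarrow> 'x \<Rightarrow> 'k::field"
  assumes "finite S" "0 \<in> B"
    and ind: "\<And>c. (\<Sum>x\<in>S. c x *\<^sub>f f x) \<in> B \<Longrightarrow> \<forall>x\<in>S. c x = 0"
  shows "inj_on f S \<and> rindep B (f ` S)"
proof -
  have inj: "inj_on f S"
  proof (rule inj_onI, rule ccontr)
    fix x y assume xy: "x \<in> S" "y \<in> S" "f x = f y" "x \<noteq> y"
    define c where "c = (\<lambda>z. if z = x then 1 else if z = y then - 1 else 0 :: 'k)"
    have "(\<Sum>z\<in>S. c z *\<^sub>f f z) = (\<Sum>z\<in>{x,y}. c z *\<^sub>f f z)"
      by (rule sum.mono_neutral_right) (use assms xy in \<open>auto simp: c_def\<close>)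
    also have "\<dots> = 0" using xy by (simp add: c_def)
    finally have "c x = 0" using ind[of c] \<open>0 \<in> B\<close> xy by auto
    thus False by (simp add: c_def)
  qed
  have "rindep B (f ` S)"
    unfolding rindep_def
  proof (intro conjI allI impI)
    fix c assume "(\<Sum>x\<in>f ` S. c x *\<^sub>f x) \<in> B"
    hence "(\<Sum>x\<in>S. c (f x) *\<^sub>f f x) \<in> B" by (simp add: sum.reindex[OF inj] o_def)
    from ind[OF this] show "\<forall>x\<in>f ` S. c x = 0" by auto
  qed (use assms in auto)
  with inj show ?thesis ..
qed

text \<open>Diagram chases choose preimages that do not depend linearly on the element. A linear
  relation \<open>R\<close> in place of a linear map allows this: partners are chosen on an
  independent set only, and additivity of \<open>R\<close> extends the correspondence to
  combinations. The last assumption is injectivity on classes.\<close>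

lemma rdim_le_rel:
  fixes R :: "('x \<Rightarrow> 'k::field) \<Rightarrow> ('y \<Rightarrow> 'k) \<Rightarrow> bool"
  assumes R0: "R 0 0"
    and Rp: "\<And>a b a' b'. R a b \<Longrightarrow> R a' b' \<Longrightarrow> R (a + a') (b + b')"
    and Rs: "\<And>c a b. R a b \<Longrightarrow> R (c *\<^sub>f a) (c *\<^sub>f b)"
    and tot: "\<And>z. z \<in> Z \<Longrightarrow> \<exists>z'\<in>Z'. R z z'"
    and B0: "0 \<in> B'"
    and inj: "\<And>z z'. R z z' \<Longrightarrow> z' \<in> B' \<Longrightarrow> z \<in> B"
  shows "rdim Z B \<le> rdim Z' B'"
proof (rule rdim_least)
  fix S assume S: "S \<subseteq> Z" "rindep B S"
  obtain f where f: "\<And>z. z \<in> Z \<Longrightarrow> f z \<in> Z' \<and> R z (f z)" using tot by metis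
  have R_sum: "R (\<Sum>x\<in>T. c x *\<^sub>f x) (\<Sum>x\<in>T. c x *\<^sub>f f x)" if "finite T" "T \<subseteq> S" for c T
    using that
  proof (induction T rule: finite_induct)
    case (insert x T)
    have "x \<in> Z" "T \<subseteq> S" using insert S by auto
    hence "R (c x *\<^sub>f x + (\<Sum>x\<in>T. c x *\<^sub>f x)) (c x *\<^sub>f f x + (\<Sum>x\<in>T. c x *\<^sub>f f x))"
      using Rp[OF Rs insert.IH] f by blast
    thus ?case unfolding sum.insert[OF insert(1,2)] .
  qed (unfold sum.empty, rule R0)
  have "inj_on f S \<and> rindep B' (f ` S)"
  proof (rule rindep_family)
    fix c assume "(\<Sum>x\<in>S. c x *\<^sub>f f x) \<in> B'"
    thus "\<forall>x\<in>S. c x = 0"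
      using inj[OF R_sum[of S c]] S rindepD[OF S(2), of c] rindep_finite[OF S(2)] by blast
  qed (use S rindep_finite B0 in auto)
  thus "enat (card S) \<le> rdim Z' B'"
    using rdim_upper[of "f ` S" Z' B'] f S by (auto simp: card_image)
qed

lemma rdim_mono:
  assumes "Z \<subseteq> Z'" "0 \<in> B'" "\<And>z. z \<in> Z \<Longrightarrow> z \<in> B' \<Longrightarrow> z \<in> B" "fun_vs.subspace Z"
  shows "rdim Z B \<le> rdim Z' B'"
  by (rule rdim_le_rel[where R = "\<lambda>a b. a = b \<and> a \<in> Z"])
     (use assms in \<open>auto simp: fun_vs.subspace_def\<close>)

lemma rdim_eq_0:
  assumes "Z \<subseteq> B"
  shows "rdim Z B = 0"
proof -
  have "rdim Z B \<le> 0"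
  proof (rule rdim_least)
    fix S assume S: "S \<subseteq> Z" "rindep B S"
    have "S = {}"
    proof (rule ccontr)
      assume "S \<noteq> {}"
      then obtain x where x: "x \<in> S" by auto
      define c where "c = (\<lambda>z. if z = x then 1 else 0 :: 'b)"
      have "(\<Sum>z\<in>S. c z *\<^sub>f z) = (\<Sum>z\<in>{x}. c z *\<^sub>f z)"
        by (rule sum.mono_neutral_right) (use x rindep_finite[OF S(2)] in \<open>auto simp: c_def\<close>)
      also have "\<dots> = x" by (simp add: c_def)
      finally have "c x = 0" using rindepD[OF S(2), of c x] x S assms by auto
      thus False by (simp add: c_def)
    qed
    thus "enat (card S) \<le> 0" by (simp add: zero_enat_def)
  qed
  thus ?thesis by simp
qed

lemma rdim_eq_0D:
  assumes "rdim Z B = 0" "fun_vs.subspace B"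
  shows "Z \<subseteq> B"
proof
  fix z assume z: "z \<in> Z"
  show "z \<in> B"
  proof (rule ccontr)
    assume zB: "z \<notin> B"
    have "rindep B {z}"
      unfolding rindep_def
    proof (intro conjI allI impI ballI)
      fix c x assume *: "(\<Sum>x\<in>{z}. c x *\<^sub>f x) \<in> B" "x \<in> {z}"
      show "c x = 0"
      proof (rule ccontr)
        assume "c x \<noteq> 0"
        have "inverse (c z) *\<^sub>f (c z *\<^sub>f z) \<in> B"
          by (rule fun_vs.subspace_scale[OF assms(2)]) (use * in simp)
        moreover have "inverse (c z) *\<^sub>f (c z *\<^sub>f z) = z"
          using \<open>c x \<noteq> 0\<close> *(2) by simp
        ultimately show False using zB by simp
      qed
    qed auto
    from rdim_upper[OF _ this, of Z] z assms show False by (simp add: zero_enat_def)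
  qed
qed

text \<open>A maximal \<open>T\<close> inside \<open>S\<close> that is independent modulo
  \<open>Y\<close> counts against the first summand. The other elements, corrected by combinations
  of \<open>T\<close>, lie in \<open>Y\<close> and stay independent modulo \<open>B\<close>. This is
  subadditivity along a short exact sequence, and the source of the exact sequences below.\<close>

lemma rdim_triple:
  assumes Y: "fun_vs.subspace Y" and B0: "0 \<in> B" and Z: "fun_vs.subspace Z"
  shows "rdim Z B \<le> rdim Z Y + rdim (Y \<inter> Z) B"
proof (rule rdim_least)
  fix S assume S: "S \<subseteq> Z" "rindep B S"
  note finS = rindep_finite[OF S(2)]
  obtain T where T: "T \<subseteq> S" "rindep Y T" and Tmax: "\<And>T'. T' \<subseteq> S \<Longrightarrow> rindep Y T' \<Longrightarrow> card T' \<le> card T"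
  proof -
    have "\<exists>T. (T \<subseteq> S \<and> rindep Y T) \<and> (\<forall>T'. T' \<subseteq> S \<and> rindep Y T' \<longrightarrow> card T' \<le> card T)"
      by (rule ex_has_greatest_nat[of _ "{}" _ "Suc (card S)"]) (auto simp: less_Suc_eq_le card_mono[OF finS])
    thus ?thesis using that by blast
  qed
  have finT: "finite T" using T finS finite_subset by blast
  have "\<exists>a. x - (\<Sum>t\<in>T. a t *\<^sub>f t) \<in> Y" if x: "x \<in> S - T" for x
  proof -
    have "\<not> rindep Y (insert x T)"
      using Tmax[of "insert x T"] T x finT by auto
    then obtain c where c: "(\<Sum>z\<in>insert x T. c z *\<^sub>f z) \<in> Y" "\<exists>z\<in>insert x T. c z \<noteq> 0"
      using finT by (auto simp: rindep_def)
    have eq: "(\<Sum>z\<in>insert x T. c z *\<^sub>f z) = c x *\<^sub>f x + (\<Sum>z\<in>T. c z *\<^sub>f z)"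
      using x finT by simp
    have "c x \<noteq> 0"
    proof
      assume "c x = 0"
      hence "(\<Sum>z\<in>T. c z *\<^sub>f z) \<in> Y" using c eq by simp
      thus False using c(2) rindepD[OF T(2)] \<open>c x = 0\<close> by auto
    qed
    have "inverse (c x) *\<^sub>f (c x *\<^sub>f x + (\<Sum>z\<in>T. c z *\<^sub>f z)) \<in> Y"
      using c(1) unfolding eq by (rule fun_vs.subspace_scale[OF Y])
    also have "inverse (c x) *\<^sub>f (c x *\<^sub>f x + (\<Sum>z\<in>T. c z *\<^sub>f z))
        = x - (\<Sum>t\<in>T. (\<lambda>t. - inverse (c x) * c t) t *\<^sub>f t)"
      using \<open>c x \<noteq> 0\<close>
      by (simp add: fun_vs.scale_right_distrib fun_vs.scale_sum_right sum_negf)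
    finally show ?thesis by (rule exI[of _ "\<lambda>t. - inverse (c x) * c t"])
  qed
  then obtain a where a: "\<And>x. x \<in> S - T \<Longrightarrow> x - (\<Sum>t\<in>T. a x t *\<^sub>f t) \<in> Y" by metis
  define y where "y = (\<lambda>x. x - (\<Sum>t\<in>T. a x t *\<^sub>f t))"
  have "inj_on y (S - T) \<and> rindep B (y ` (S - T))"
  proof (rule rindep_family)
    fix c assume *: "(\<Sum>x\<in>S - T. c x *\<^sub>f y x) \<in> B"
    \<comment> \<open>Expanding the corrected vectors turns a relation among them into one among the
      elements of \<open>S\<close>; those outside \<open>T\<close> keep their coefficients.\<close>
    define c' where "c' = (\<lambda>x. if x \<in> T then - (\<Sum>z\<in>S - T. c z * a z x) else c x)"
    have "(\<Sum>x\<in>S - T. c x *\<^sub>f y x) = (\<Sum>x\<in>S - T. c x *\<^sub>f x) - (\<Sum>x\<in>S-T. \<Sum>t\<in>T. (c x * a x t) *\<^sub>f t)"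
      by (simp add: y_def fun_vs.scale_right_diff_distrib sum_subtractf fun_vs.scale_sum_right)
    also have "(\<Sum>x\<in>S-T. \<Sum>t\<in>T. (c x * a x t) *\<^sub>f t) = (\<Sum>t\<in>T. (\<Sum>x\<in>S-T. c x * a x t) *\<^sub>f t)"
      by (subst sum.swap) (simp add: fun_vs.scale_sum_left)
    also have "(\<Sum>x\<in>S - T. c x *\<^sub>f x) - \<dots> = (\<Sum>x\<in>S - T. c' x *\<^sub>f x) + (\<Sum>x\<in>T. c' x *\<^sub>f x)"
    proof -
      have "(\<Sum>x\<in>S - T. c' x *\<^sub>f x) = (\<Sum>x\<in>S - T. c x *\<^sub>f x)"
        by (rule sum.cong) (auto simp: c'_def)
      moreover have "(\<Sum>x\<in>T. c' x *\<^sub>f x) = - (\<Sum>t\<in>T. (\<Sum>x\<in>S-T. c x * a x t) *\<^sub>f t)"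
        unfolding sum_negf[symmetric] by (rule sum.cong) (auto simp: c'_def)
      ultimately show ?thesis by (simp only: diff_conv_add_uminus)
    qed
    also have "\<dots> = (\<Sum>x\<in>S. c' x *\<^sub>f x)"
      by (rule sum.subset_diff[OF T(1) finS, symmetric])
    finally have eq: "(\<Sum>x\<in>S - T. c x *\<^sub>f y x) = (\<Sum>x\<in>S. c' x *\<^sub>f x)" .
    have "(\<Sum>x\<in>S. c' x *\<^sub>f x) \<in> B" using * unfolding eq .
    from rindepD[OF S(2) this] have "\<forall>x\<in>S. c' x = 0" by blast
    thus "\<forall>x\<in>S - T. c x = 0" by (metis Diff_iff c'_def)
  qed (use finS B0 in auto)
  moreover have "y ` (S - T) \<subseteq> Y \<inter> Z"
  proof
    fix z assume "z \<in> y ` (S - T)"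
    then obtain x where x: "x \<in> S - T" "z = y x" by auto
    have "z \<in> Y" using a x by (simp add: y_def)
    moreover have "z \<in> Z" using x S T Z
      by (auto simp: y_def intro!: fun_vs.subspace_diff fun_vs.subspace_sum fun_vs.subspace_scale)
    ultimately show "z \<in> Y \<inter> Z" by blast
  qed
  ultimately have "enat (card (S - T)) \<le> rdim (Y \<inter> Z) B"
    using rdim_upper[of "y ` (S - T)" "Y \<inter> Z" B] by (auto simp: card_image)
  moreover have "enat (card T) \<le> rdim Z Y" using rdim_upper[of T Z Y] T S by auto
  moreover have "card S = card T + card (S - T)"
    using T finS by (simp add: card_Diff_subset finT card_mono)
  ultimately show "enat (card S) \<le> rdim Z Y + rdim (Y \<inter> Z) B"
    by (metis add_mono plus_enat_simps(1))
qed

text \<open>Adding a constant is passed through the supremum. The finite case subtracts the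
  constant, which fails at infinity; hence the case distinctions.\<close>

lemma rdim_add_le:
  assumes "\<And>S. S \<subseteq> Z \<Longrightarrow> rindep B S \<Longrightarrow> enat (card S) + a \<le> D"
  shows "rdim Z B + a \<le> D"
proof (cases a)
  case (enat k)
  show ?thesis
  proof (cases D)
    case (enat x)
    have "rdim Z B \<le> enat (x - k)"
    proof (rule rdim_least)
      fix S assume "S \<subseteq> Z" "rindep B S"
      from assms[OF this] show "enat (card S) \<le> enat (x - k)" using \<open>a = enat k\<close> enat by simp
    qed
    moreover have "k \<le> x" using assms[of "{}"] \<open>a = enat k\<close> enat by simp
    ultimately show ?thesis using \<open>a = enat k\<close> enat by (cases "rdim Z B") auto
  qed simp
next
  case infinity
  thus ?thesis using assms[of "{}"] by simp
qed

text \<open>\<open>dir\<close> expresses that the sum of \<open>Z1\<close> and \<open>Z2\<close> is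
  direct modulo \<open>B\<close>. Independent sets of both are joined over the disjoint sum of their
  index sets, because as sets they are not known to be disjoint.\<close>

lemma rdim_direct_sum_le:
  assumes Z: "Z1 \<subseteq> Z" "Z2 \<subseteq> Z" and s1: "fun_vs.subspace Z1" and s2: "fun_vs.subspace Z2"
    and B: "fun_vs.subspace B"
    and dir: "\<And>a b. a \<in> Z1 \<Longrightarrow> b \<in> Z2 \<Longrightarrow> a + b \<in> B \<Longrightarrow> a \<in> B"
  shows "rdim Z1 B + rdim Z2 B \<le> rdim Z B"
proof (rule rdim_add_le)
  fix S assume S: "S \<subseteq> Z1" "rindep B S"
  have "rdim Z2 B + enat (card S) \<le> rdim Z B"
  proof (rule rdim_add_le)
    fix T assume T: "T \<subseteq> Z2" "rindep B T"
    note fin = rindep_finite[OF S(2)] rindep_finite[OF T(2)]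
    have "inj_on (case_sum (\<lambda>x. x) (\<lambda>x. x)) (S <+> T) \<and>
          rindep B (case_sum (\<lambda>x. x) (\<lambda>x. x) ` (S <+> T))"
    proof (rule rindep_family)
      fix c :: "('a \<Rightarrow> 'b) + ('a \<Rightarrow> 'b) \<Rightarrow> 'b"
      assume *: "(\<Sum>x\<in>S <+> T. c x *\<^sub>f case_sum (\<lambda>x. x) (\<lambda>x. x) x) \<in> B"
      let ?a = "\<Sum>x\<in>S. c (Inl x) *\<^sub>f x" and ?b = "\<Sum>x\<in>T. c (Inr x) *\<^sub>f x"
      have ab: "?a + ?b \<in> B" using * fin by (simp add: sum.Plus)
      have aZ: "?a \<in> Z1" using S s1 by (auto intro!: fun_vs.subspace_sum fun_vs.subspace_scale)
      have bZ: "?b \<in> Z2" using T s2 by (auto intro!: fun_vs.subspace_sum fun_vs.subspace_scale)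
      have a: "?a \<in> B" by (rule dir[OF aZ bZ ab])
      have b: "?b \<in> B" using fun_vs.subspace_diff[OF B ab a] by simp
      show "\<forall>x\<in>S <+> T. c x = 0"
        using rindepD[OF S(2) a] rindepD[OF T(2) b] by auto
    qed (use fin fun_vs.subspace_0[OF B] in auto)
    moreover have sub: "case_sum (\<lambda>x. x) (\<lambda>x. x) ` (S <+> T) \<subseteq> Z" using S T Z by auto
    ultimately have "enat (card (S <+> T)) \<le> rdim Z B"
      using rdim_upper[of "case_sum (\<lambda>x. x) (\<lambda>x. x) ` (S <+> T)" Z B] S T Z
      by (metis (no_types, lifting) card_image sub)
    thus "enat (card T) + enat (card S) \<le> rdim Z B" using fin by (simp add: card_Plus add.commute)
  qed
  thus "enat (card S) + rdim Z2 B \<le> rdim Z B" by (simp add: add.commute)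
qed

text \<open>A basis of \<open>B\<close> together with \<open>S\<close> is linearly independent, so
  the coordinate functionals of the elements of \<open>S\<close> extend to the whole space and
  vanish on \<open>B\<close>. They separate the classes of \<open>S\<close> in the duality
  argument.\<close>

lemma rindep_functionals:
  fixes S :: "('x \<Rightarrow> 'k::field) set"
  assumes B: "fun_vs.subspace B" and S: "rindep B S"
  obtains \<Lambda> :: "('x \<Rightarrow> 'k) \<Rightarrow> ('x \<Rightarrow> 'k) \<Rightarrow> 'k" where
    "\<And>s u v. \<Lambda> s (u + v) = \<Lambda> s u + \<Lambda> s v"
    "\<And>s c v. \<Lambda> s (c *\<^sub>f v) = c * \<Lambda> s v"
    "\<And>s b. b \<in> B \<Longrightarrow> \<Lambda> s b = 0"
    "\<And>s s'. s \<in> S \<Longrightarrow> s' \<in> S \<Longrightarrow> \<Lambda> s s' = (if s = s' then 1 else 0)"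
proof -
  interpret vp: vector_space_pair "fscale :: 'k \<Rightarrow> ('x \<Rightarrow> 'k) \<Rightarrow> 'x \<Rightarrow> 'k" "(*) :: 'k \<Rightarrow> 'k \<Rightarrow> 'k"
    by unfold_locales (auto simp: algebra_simps)
  obtain E where E: "E \<subseteq> B" "fun_vs.independent E" "B \<subseteq> fun_vs.span E"
    using fun_vs.maximal_independent_subset[of B] by blast
  have spanE: "fun_vs.span E = B"
    using E B by (metis fun_vs.span_mono fun_vs.span_eq_iff subset_antisym)
  have disj: "E \<inter> S = {}"
  proof (rule ccontr)
    assume "E \<inter> S \<noteq> {}"
    then obtain x where x: "x \<in> E" "x \<in> S" by auto
    have "rindep B {x}"
      unfolding rindep_def
    proof (intro conjI allI impI)
      fix c assume *: "(\<Sum>x\<in>{x}. c x *\<^sub>f x) \<in> B"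
      define c' where "c' = (\<lambda>z. if z = x then c x else 0)"
      have "(\<Sum>z\<in>S. c' z *\<^sub>f z) = (\<Sum>z\<in>{x}. c' z *\<^sub>f z)"
        by (rule sum.mono_neutral_right) (use x rindep_finite[OF S] in \<open>auto simp: c'_def\<close>)
      hence "c' x = 0" using rindepD[OF S, of c' x] * x by (auto simp: c'_def)
      thus "\<forall>x\<in>{x}. c x = 0" by (simp add: c'_def)
    qed auto
    hence "rdim {x} B \<noteq> 0" using rdim_upper[of "{x}" "{x}" B] by (auto simp: zero_enat_def)
    thus False using rdim_eq_0[of "{x}" B] x E by auto
  qed
  have ind: "fun_vs.independent (E \<union> S)"
    unfolding fun_vs.dependent_explicit
  proof clarify
    fix U u v
    assume U: "finite U" "U \<subseteq> E \<union> S" "(\<Sum>v\<in>U. u v *\<^sub>f v) = 0" "v \<in> U" "u v \<noteq> 0"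
    have split: "(\<Sum>v\<in>U. u v *\<^sub>f v) = (\<Sum>v\<in>U \<inter> E. u v *\<^sub>f v) + (\<Sum>v\<in>U \<inter> S. u v *\<^sub>f v)"
    proof -
      have eq: "U = (U \<inter> E) \<union> (U \<inter> S)" using U(2) by blast
      have dj: "(U \<inter> E) \<inter> (U \<inter> S) = {}" using disj by blast
      show ?thesis
        by (subst eq, rule sum.union_disjoint[OF _ _ dj]) (use U(1) in auto)
    qed
    have eB: "(\<Sum>v\<in>U \<inter> E. u v *\<^sub>f v) \<in> B"
      using E B by (auto intro!: fun_vs.subspace_sum fun_vs.subspace_scale)
    have "(\<Sum>v\<in>U \<inter> E. u v *\<^sub>f v) + (\<Sum>v\<in>U \<inter> S. u v *\<^sub>f v) = 0"
      using split U(3) by (rule trans[OF sym])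
    note eq = minus_unique[OF this]
    have "(\<Sum>v\<in>U \<inter> S. u v *\<^sub>f v) \<in> B"
      using fun_vs.subspace_neg[OF B eB] unfolding eq .
    moreover have "(\<Sum>v\<in>S. (if v \<in> U then u v else 0) *\<^sub>f v) = (\<Sum>v\<in>U \<inter> S. u v *\<^sub>f v)"
      using rindep_finite[OF S] by (intro sum.mono_neutral_cong_right) auto
    ultimately have uS: "\<forall>x\<in>S. x \<in> U \<longrightarrow> u x = 0"
      using rindepD[OF S, of "\<lambda>v. if v \<in> U then u v else 0"] by presburger
    hence "(\<Sum>v\<in>U \<inter> E. u v *\<^sub>f v) = 0" using split U(3) by simp
    hence "\<forall>x\<in>U \<inter> E. u x = 0" using E(2) U(1) unfolding fun_vs.dependent_explicit
      by (metis (no_types, lifting) finite_Int inf_le2)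
    with uS U show False by auto
  qed
  have "\<exists>g. Vector_Spaces.linear fscale (*) g \<and> (\<forall>x\<in>E \<union> S. g x = (if x = s then 1 else 0 :: 'k))" for s
    by (rule vp.linear_independent_extend[OF ind])
  then obtain \<Lambda> where L: "\<And>s. Vector_Spaces.linear fscale (*) (\<Lambda> s)"
      and Lv: "\<And>s x. x \<in> E \<union> S \<Longrightarrow> \<Lambda> s x = (if x = s then 1 else 0 :: 'k)" by metis
  \<comment> \<open>For \<open>s\<close> in the basis of \<open>B\<close> the functional
    \<open>\<Lambda> s\<close> does not vanish on \<open>B\<close>; replacing it by 0 outside
    \<open>S\<close> makes the vanishing hold for every \<open>s\<close>.\<close>
  define \<Lambda>' where "\<Lambda>' = (\<lambda>s. if s \<in> S then \<Lambda> s else (\<lambda>_. 0))"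
  have "\<Lambda>' s b = 0" if "b \<in> B" for s b
  proof (cases "s \<in> S")
    case True
    have "\<Lambda> s x = 0" if "x \<in> E" for x using Lv[of x s] that disj True by auto
    hence "\<Lambda> s b = 0"
      using vp.linear_eq_0_on_span[OF L, of E s b] spanE that by auto
    thus ?thesis by (simp add: \<Lambda>'_def)
  qed (simp add: \<Lambda>'_def)
  moreover have "\<Lambda>' s (u + v) = \<Lambda>' s u + \<Lambda>' s v" for s u v
    using vp.linear_add[OF L] by (simp add: \<Lambda>'_def)
  moreover have "\<Lambda>' s (c *\<^sub>f v) = c * \<Lambda>' s v" for s c v
    using vp.linear_scale[OF L] by (simp add: \<Lambda>'_def)
  moreover have "\<Lambda>' s s' = (if s = s' then 1 else 0)" if "s \<in> S" "s' \<in> S" for s s'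
    using that Lv[of s' s] by (auto simp: \<Lambda>'_def)
  ultimately show ?thesis using that by blast
qed

section \<open>Laurent vectors\<close>

text \<open>
  \<open>v (b, e)\<close> is the coefficient of the Laurent monomial with exponent vector \<open>e\<close> in the component \<open>b\<close> of \<open>v\<close>.
  In this ambient space localizations are subspaces: \<open>loc S A\<close> inverts the variables in \<open>S\<close>, and
  localization maps are inclusions. \<open>FF m\<close> is the free module of rank \<open>m\<close>.
\<close>

type_synonym ('n, 'k) vec = "nat \<times> ('n \<Rightarrow> int) \<Rightarrow> 'k"

definition expo :: "('n \<Rightarrow>\<^sub>0 nat) \<Rightarrow> 'n \<Rightarrow> int" where
  "expo a = (\<lambda>s. int (Poly_Mapping.lookup a s))"

text \<open>Multiplication by the Laurent monomial with exponent \<open>e\<close>. It is invertible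
  for every \<open>e\<close>, so denominators can be cleared and restored within the same
  space.\<close>

definition sh :: "('n \<Rightarrow> int) \<Rightarrow> ('n, 'k::field) vec \<Rightarrow> ('n, 'k) vec" where
  "sh e v = (\<lambda>(b, x). v (b, x - e))"

definition act :: "('n, 'k::field) mpoly \<Rightarrow> ('n, 'k) vec \<Rightarrow> ('n, 'k) vec" where
  "act p v = (\<Sum>a\<in>Poly_Mapping.keys p. Poly_Mapping.lookup p a *\<^sub>f sh (expo a) v)"

definition edeg :: "('n::finite \<Rightarrow> int) \<Rightarrow> int" where
  "edeg e = (\<Sum>s\<in>UNIV. e s)"

definition Vt :: "(nat \<Rightarrow> int) \<Rightarrow> int \<Rightarrow> ('n::finite, 'k::field) vec set" where
  "Vt es t = {v. \<forall>b e. v (b, e) \<noteq> 0 \<longrightarrow> edeg e + es b = t}"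

definition hcomp :: "(nat \<Rightarrow> int) \<Rightarrow> int \<Rightarrow> ('n::finite, 'k::field) vec \<Rightarrow> ('n, 'k) vec" where
  "hcomp es t v = (\<lambda>(b, e). if edeg e + es b = t then v (b, e) else 0)"

definition FF :: "nat \<Rightarrow> ('n, 'k::field) vec set" where
  "FF m = {v. finite {x. v x \<noteq> 0} \<and> (\<forall>b e. v (b, e) \<noteq> 0 \<longrightarrow> b < m \<and> (\<forall>s. 0 \<le> e s))}"

lemma expo_add [simp]: "expo (a + b) = expo a + expo b"
  by (auto simp: expo_def lookup_add)

lemma expo_zero [simp]: "expo 0 = 0"
  by (auto simp: expo_def)

lemma expo_nonneg [simp]: "0 \<le> expo a s"
  by (auto simp: expo_def)

lemma expo_exists: "(\<And>s. 0 \<le> e s) \<Longrightarrow> \<exists>a. e = expo a" for e :: "'n::finite \<Rightarrow> int"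
  by (rule exI[of _ "Abs_poly_mapping (\<lambda>s. nat (e s))"]) (auto simp: expo_def)

lemma expo_inject [simp]: "expo a = expo b \<longleftrightarrow> a = b"
  by (auto simp: expo_def fun_eq_iff poly_mapping_eq_iff)

lemma edeg_expo [simp]: "edeg (expo a) = int (mon_deg a)"
  by (simp add: edeg_def expo_def mon_deg_def)

lemma edeg_add [simp]: "edeg (a + b) = edeg a + edeg b"
  by (simp add: edeg_def sum.distrib)

lemma edeg_diff [simp]: "edeg (a - b) = edeg a - edeg b"
  by (simp add: edeg_def sum_subtractf)

lemma edeg_minus [simp]: "edeg (- a) = - edeg a"
  by (simp add: edeg_def sum_negf)

lemma edeg_zero [simp]: "edeg 0 = 0"
  by (simp add: edeg_def)

lemma sh_apply: "sh e v (b, x) = v (b, x - e)"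
  by (simp add: sh_def)

lemma sh_0 [simp]: "sh 0 v = v"
  by (auto simp: sh_def)

lemma sh_sh [simp]: "sh e (sh f v) = sh (e + f) v"
  by (auto simp: sh_def fun_eq_iff algebra_simps)

lemma sh_add: "sh e (u + v) = sh e u + sh e v"
  by (auto simp: sh_def fun_eq_iff)

lemma sh_diff: "sh e (u - v) = sh e u - sh e v"
  by (auto simp: sh_def fun_eq_iff)

lemma sh_zero [simp]: "sh e 0 = 0"
  by (auto simp: sh_def fun_eq_iff)

lemma sh_scale: "sh e (c *\<^sub>f v) = c *\<^sub>f sh e v"
  by (auto simp: sh_def fun_eq_iff)

lemma sh_sum: "sh e (\<Sum>i\<in>I. f i) = (\<Sum>i\<in>I. sh e (f i))"
  by (auto simp: fun_eq_iff sh_def sum_fun_apply)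

lemma act_superset:
  assumes "finite A" "Poly_Mapping.keys p \<subseteq> A"
  shows "act p v = (\<Sum>a\<in>A. Poly_Mapping.lookup p a *\<^sub>f sh (expo a) v)"
  unfolding act_def
  by (rule sum.mono_neutral_left) (use assms in \<open>auto simp: in_keys_iff\<close>)

lemma act_add_left: "act (p + q) v = act p v + act q v"
proof -
  let ?A = "Poly_Mapping.keys p \<union> Poly_Mapping.keys q"
  have "act (p + q) v = (\<Sum>a\<in>?A. Poly_Mapping.lookup (p + q) a *\<^sub>f sh (expo a) v)"
    by (rule act_superset) (simp, rule keys_add)
  also have "\<dots> = (\<Sum>a\<in>?A. Poly_Mapping.lookup p a *\<^sub>f sh (expo a) v) +
      (\<Sum>a\<in>?A. Poly_Mapping.lookup q a *\<^sub>f sh (expo a) v)"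
    by (simp add: lookup_add fun_vs.scale_left_distrib sum.distrib)
  also have "\<dots> = act p v + act q v"
    using act_superset[of ?A p v] act_superset[of ?A q v] by simp
  finally show ?thesis .
qed

lemma act_zero_left [simp]: "act 0 v = 0"
  by (simp add: act_def)

lemma act_sum_left: "act (\<Sum>i\<in>I. p i) v = (\<Sum>i\<in>I. act (p i) v)"
  by (induction I rule: infinite_finite_induct) (simp_all add: act_add_left)

lemma act_add: "act p (u + v) = act p u + act p v"
  by (simp add: act_def sh_add fun_vs.scale_right_distrib sum.distrib)

lemma act_zero [simp]: "act p 0 = 0"
  by (simp add: act_def)

lemma act_scale: "act p (c *\<^sub>f v) = c *\<^sub>f act p v"
  by (simp add: act_def sh_scale fun_vs.scale_sum_right mult.commute)

lemma act_minus: "act p (- v) = - act p v"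
  using act_scale[of p "-1" v] by (simp add: fun_vs.scale_minus_left)

lemma act_diff: "act p (u - v) = act p u - act p v"
  using act_add[of p u "- v"] by (simp add: act_minus)

lemma act_sum: "act p (\<Sum>i\<in>I. f i) = (\<Sum>i\<in>I. act p (f i))"
  by (simp add: act_def sh_sum fun_vs.scale_sum_right) (rule sum.swap)

lemma act_single: "act (Poly_Mapping.single a c) v = c *\<^sub>f sh (expo a) v"
  by (cases "c = 0") (simp_all add: act_def)

lemma act_sh: "act p (sh e v) = sh e (act p v)"
  by (simp add: act_def sh_sum sh_scale add.commute)

lemma poly_mapping_expand: "p = (\<Sum>a\<in>Poly_Mapping.keys p. Poly_Mapping.single a (Poly_Mapping.lookup p a))"
  for p :: "'a \<Rightarrow>\<^sub>0 'b::comm_monoid_add"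
proof (rule poly_mapping_eqI)
  fix x
  have "(\<Sum>a\<in>Poly_Mapping.keys p. Poly_Mapping.lookup p a when a = x) = Poly_Mapping.lookup p x"
    by (cases "x \<in> Poly_Mapping.keys p") (auto simp: when_def sum.delta in_keys_iff)
  thus "Poly_Mapping.lookup p x =
      Poly_Mapping.lookup (\<Sum>a\<in>Poly_Mapping.keys p. Poly_Mapping.single a (Poly_Mapping.lookup p a)) x"
    by (simp add: lookup_sum lookup_single)
qed

lemma act_mult: "act (p * q) v = act p (act q v)"
proof -
  have one: "act (Poly_Mapping.single a c * q) v = act (Poly_Mapping.single a c) (act q v)" for a c
  proof -
    have "act (Poly_Mapping.single a c * q) v =
        act (Poly_Mapping.single a c *
          (\<Sum>b\<in>Poly_Mapping.keys q. Poly_Mapping.single b (Poly_Mapping.lookup q b))) v"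
      using poly_mapping_expand[of q] by simp
    also have "\<dots> = (\<Sum>b\<in>Poly_Mapping.keys q. (c * Poly_Mapping.lookup q b) *\<^sub>f sh (expo a + expo b) v)"
      by (simp add: sum_distrib_left act_sum_left mult_single act_single)
    also have "\<dots> = act (Poly_Mapping.single a c) (act q v)"
      by (simp add: act_single) (simp add: act_def sh_sum sh_scale fun_vs.scale_sum_right)
    finally show ?thesis .
  qed
  have "act (p * q) v =
      act ((\<Sum>a\<in>Poly_Mapping.keys p. Poly_Mapping.single a (Poly_Mapping.lookup p a)) * q) v"
    using poly_mapping_expand[of p] by simp
  also have "\<dots> = (\<Sum>a\<in>Poly_Mapping.keys p. act (Poly_Mapping.single a (Poly_Mapping.lookup p a)) (act q v))"
    by (simp add: sum_distrib_right act_sum_left one)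
  also have "\<dots> = act p (act q v)"
    by (simp add: act_single) (simp add: act_def)
  finally show ?thesis .
qed

lemma act_one [simp]: "act 1 v = v"
  using act_single[of 0 1 v] by simp

lemma act_pconst: "act (pconst c) v = c *\<^sub>f v"
  by (simp add: pconst_def act_single)

lemma Vt_subspace: "fun_vs.subspace (Vt es t)"
  by (auto simp: fun_vs.subspace_def Vt_def) (metis add.right_neutral)+

lemma sh_Vt_iff: "sh e v \<in> Vt es t \<longleftrightarrow> v \<in> Vt es (t - edeg e)"
proof
  assume *: "sh e v \<in> Vt es t"
  show "v \<in> Vt es (t - edeg e)"
    unfolding Vt_def mem_Collect_eq
  proof (intro allI impI)
    fix b x assume "v (b, x) \<noteq> 0"
    hence "sh e v (b, x + e) \<noteq> 0" by (simp add: sh_apply)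
    hence "edeg (x + e) + es b = t" using * unfolding Vt_def by blast
    thus "edeg x + es b = t - edeg e" by simp
  qed
next
  assume *: "v \<in> Vt es (t - edeg e)"
  show "sh e v \<in> Vt es t"
    unfolding Vt_def mem_Collect_eq
  proof (intro allI impI)
    fix b x assume "sh e v (b, x) \<noteq> 0"
    hence "v (b, x - e) \<noteq> 0" by (simp add: sh_apply)
    hence "edeg (x - e) + es b = t - edeg e" using * unfolding Vt_def by blast
    thus "edeg x + es b = t" by simp
  qed
qed

lemma hcomp_add: "hcomp es t (u + v) = hcomp es t u + hcomp es t v"
  by (auto simp: hcomp_def fun_eq_iff)

lemma hcomp_diff: "hcomp es t (u - v) = hcomp es t u - hcomp es t v"
  by (auto simp: hcomp_def fun_eq_iff)

lemma hcomp_zero [simp]: "hcomp es t 0 = 0"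
  by (auto simp: hcomp_def fun_eq_iff)

lemma hcomp_scale: "hcomp es t (c *\<^sub>f v) = c *\<^sub>f hcomp es t v"
  by (auto simp: hcomp_def fun_eq_iff)

lemma hcomp_sum: "hcomp es t (\<Sum>i\<in>I. f i) = (\<Sum>i\<in>I. hcomp es t (f i))"
  by (auto simp: fun_eq_iff hcomp_def sum_fun_apply)

lemma hcomp_Vt [simp]: "hcomp es t v \<in> Vt es t"
  by (auto simp: hcomp_def Vt_def split: if_splits)

lemma hcomp_Vt_eq: "v \<in> Vt es s \<Longrightarrow> hcomp es t v = (if s = t then v else 0)"
  by (force simp: hcomp_def Vt_def fun_eq_iff)

lemma hcomp_sh: "hcomp es t (sh e v) = sh e (hcomp es (t - edeg e) v)"
  by (auto simp: hcomp_def sh_def fun_eq_iff)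

lemma hcomp_act: "p \<in> poly_homog s \<Longrightarrow> hcomp es t (act p v) = act p (hcomp es (t - s) v)"
  unfolding act_def hcomp_sum
  by (intro sum.cong refl) (auto simp: hcomp_scale hcomp_sh poly_homog_def)

lemma hcomp_decompose:
  assumes "finite {x. v x \<noteq> 0}"
  shows "\<exists>T. finite T \<and> v = (\<Sum>t\<in>T. hcomp es t v) \<and> (\<forall>t. t \<notin> T \<longrightarrow> hcomp es t v = 0)"
proof -
  let ?T = "(\<lambda>(b, e). edeg e + es b) ` {x. v x \<noteq> 0}"
  have out: "hcomp es t v = 0" if "t \<notin> ?T" for t
    using that by (force simp: hcomp_def fun_eq_iff)
  have "v = (\<Sum>t\<in>?T. hcomp es t v)"
  proof
    fix x :: "nat \<times> ('a \<Rightarrow> int)"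
    obtain b e where x: "x = (b, e)" by force
    have "(\<Sum>t\<in>?T. hcomp es t v) x = (\<Sum>t\<in>?T. if t = edeg e + es b then v x else 0)"
      unfolding sum_fun_apply by (rule sum.cong) (auto simp: hcomp_def x)
    also have "\<dots> = v x" using assms x by (auto simp: sum.delta' image_iff)
    finally show "v x = (\<Sum>t\<in>?T. hcomp es t v) x" ..
  qed
  with out assms show ?thesis by blast
qed

lemma FF_subspace: "fun_vs.subspace (FF m :: ('n, 'k::field) vec set)"
  unfolding fun_vs.subspace_def
proof (intro conjI ballI allI)
  show "0 \<in> FF m" by (simp add: FF_def)
next
  fix x y :: "('n, 'k) vec" assume "x \<in> FF m" "y \<in> FF m"
  moreover have "{z. (x + y) z \<noteq> 0} \<subseteq> {z. x z \<noteq> 0} \<union> {z. y z \<noteq> 0}" by auto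
  ultimately show "x + y \<in> FF m"
    by (auto simp: FF_def intro: finite_subset)
next
  fix c and x :: "('n, 'k) vec" assume "x \<in> FF m"
  thus "c *\<^sub>f x \<in> FF m" by (auto simp: FF_def elim: finite_subset[rotated])
qed

lemma sh_FF:
  assumes "v \<in> FF m" "\<And>s. 0 \<le> e s"
  shows "sh e v \<in> FF m"
proof -
  have "{x. sh e v x \<noteq> 0} \<subseteq> (\<lambda>(b, x). (b, x + e)) ` {x. v x \<noteq> 0}"
    by (force simp: sh_def image_iff)
  hence "finite {x. sh e v x \<noteq> 0}" using assms(1) finite_surj by (auto simp: FF_def)
  moreover have "b < m \<and> (\<forall>s. 0 \<le> x s)" if "sh e v (b, x) \<noteq> 0" for b x
  proof -
    have "v (b, x - e) \<noteq> 0" using that by (simp add: sh_apply)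
    hence "b < m" "\<forall>s. 0 \<le> (x - e) s" using assms(1) unfolding FF_def by blast+
    thus ?thesis using assms(2) by (metis diff_ge_0_iff_ge minus_apply order_trans)
  qed
  ultimately show ?thesis by (auto simp: FF_def)
qed

lemma hcomp_FF: "v \<in> FF m \<Longrightarrow> hcomp es t v \<in> FF m"
  by (auto simp: FF_def hcomp_def split: if_splits elim!: finite_subset[rotated])

text \<open>A graded submodule: scalars come with the subspace, so stability under monomials amounts
  to stability under \<open>act\<close>.\<close>

definition gsubm :: "(nat \<Rightarrow> int) \<Rightarrow> ('n::finite, 'k::field) vec set \<Rightarrow> bool" where
  "gsubm es A \<longleftrightarrow> fun_vs.subspace A \<and> (\<forall>a. \<forall>v\<in>A. sh (expo a) v \<in> A) \<and> (\<forall>t. \<forall>v\<in>A. hcomp es t v \<in> A)"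

lemma gsubm_FF: "gsubm es (FF m)"
  by (simp add: gsubm_def FF_subspace sh_FF hcomp_FF)

lemma gsubm_zero: "gsubm es {0}"
  by (simp add: gsubm_def fun_vs.subspace_0 fun_vs.subspace_single_0)

lemma gsubm_subspace: "gsubm es A \<Longrightarrow> fun_vs.subspace A"
  by (simp add: gsubm_def)

lemma gsubm_sh: "gsubm es A \<Longrightarrow> v \<in> A \<Longrightarrow> (\<And>s. 0 \<le> e s) \<Longrightarrow> sh e v \<in> A"
  using expo_exists[of e] by (auto simp: gsubm_def)

lemma gsubm_hcomp: "gsubm es A \<Longrightarrow> v \<in> A \<Longrightarrow> hcomp es t v \<in> A"
  by (simp add: gsubm_def)

lemma gsubm_act: "gsubm es A \<Longrightarrow> v \<in> A \<Longrightarrow> act p v \<in> A"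
  unfolding act_def
  by (intro fun_vs.subspace_sum fun_vs.subspace_scale) (auto simp: gsubm_def)

section \<open>Localization at products of variables\<close>

definition xpow :: "'n set \<Rightarrow> int \<Rightarrow> 'n \<Rightarrow> int" where
  "xpow S a = (\<lambda>s. if s \<in> S then a else 0)"

definition loc :: "'n set \<Rightarrow> ('n, 'k::field) vec set \<Rightarrow> ('n, 'k) vec set" where
  "loc S A = {v. \<exists>a::nat. sh (xpow S (int a)) v \<in> A}"

lemma xpow_add: "xpow S a + xpow S b = xpow S (a + b)"
  by (auto simp: xpow_def fun_eq_iff)

lemma xpow_minus: "- xpow S a = xpow S (- a)"
  by (auto simp: xpow_def fun_eq_iff)

lemma xpow_0 [simp]: "xpow S 0 = 0"
  by (auto simp: xpow_def fun_eq_iff)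

lemma xpow_empty [simp]: "xpow {} a = 0"
  by (auto simp: xpow_def fun_eq_iff)

lemma edeg_xpow: "edeg (xpow S a) = a * int (card S)" for S :: "'n::finite set"
  by (simp add: edeg_def xpow_def sum.If_cases mult.commute)

lemma loc_ge:
  assumes "gsubm es A" "v \<in> loc S A"
  obtains a0 where "\<And>a. a \<ge> a0 \<Longrightarrow> sh (xpow S (int a)) v \<in> A"
proof -
  obtain a0 :: nat where a0: "sh (xpow S (int a0)) v \<in> A" using assms by (auto simp: loc_def)
  have "sh (xpow S (int a)) v \<in> A" if "a \<ge> a0" for a
  proof -
    have "sh (xpow S (int (a - a0))) (sh (xpow S (int a0)) v) \<in> A"
      by (rule gsubm_sh[OF assms(1) a0]) (simp add: xpow_def)
    thus ?thesis using that by (simp add: xpow_add of_nat_diff)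
  qed
  thus ?thesis using that by blast
qed

lemma loc_subspace:
  assumes A: "gsubm es A"
  shows "fun_vs.subspace (loc S A)"
  unfolding fun_vs.subspace_def
proof (intro conjI ballI allI)
  note sub = gsubm_subspace[OF A]
  show "0 \<in> loc S A" using fun_vs.subspace_0[OF sub] by (auto simp: loc_def)
  fix x y assume xy: "x \<in> loc S A" "y \<in> loc S A"
  obtain a where a: "\<And>c. c \<ge> a \<Longrightarrow> sh (xpow S (int c)) x \<in> A" using loc_ge[OF A xy(1)] by blast
  obtain b where b: "\<And>c. c \<ge> b \<Longrightarrow> sh (xpow S (int c)) y \<in> A" using loc_ge[OF A xy(2)] by blast
  have "sh (xpow S (int (max a b))) (x + y) \<in> A"
    unfolding sh_add by (rule fun_vs.subspace_add[OF sub]) (auto intro!: a b)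
  thus "x + y \<in> loc S A" by (auto simp: loc_def)
next
  fix c x assume "x \<in> loc S A"
  thus "c *\<^sub>f x \<in> loc S A"
    using fun_vs.subspace_scale[OF gsubm_subspace[OF A]] by (auto simp: loc_def sh_scale)
qed

lemma loc_mono: "A \<subseteq> B \<Longrightarrow> loc S A \<subseteq> loc S B"
  by (auto simp: loc_def)

lemma subset_loc: "A \<subseteq> loc S A"
  by (auto simp: loc_def intro: exI[of _ 0])

lemma loc_empty [simp]: "loc {} A = A"
  by (simp add: loc_def)

lemma loc_zero [simp]: "loc S {0} = {0}"
proof -
  have "v = 0" if "sh e v = 0" for e and v :: "('n, 'k::field) vec"
    using arg_cong[OF that, of "sh (- e)"] by simp
  thus ?thesis by (auto simp: loc_def)
qed

lemma loc_mono_set: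
  assumes "gsubm es A" "S \<subseteq> T"
  shows "loc S A \<subseteq> loc T A"
proof
  fix v assume "v \<in> loc S A"
  then obtain a :: nat where a: "sh (xpow S (int a)) v \<in> A" by (auto simp: loc_def)
  have "sh (xpow (T - S) (int a)) (sh (xpow S (int a)) v) \<in> A"
    by (rule gsubm_sh[OF assms(1) a]) (simp add: xpow_def)
  moreover have "xpow (T - S) (int a) + xpow S (int a) = xpow T (int a)"
    using assms(2) by (auto simp: xpow_def fun_eq_iff)
  ultimately show "v \<in> loc T A" by (auto simp: loc_def)
qed

lemma loc_hcomp: "gsubm es A \<Longrightarrow> v \<in> loc S A \<Longrightarrow> hcomp es t v \<in> loc S A"
proof -
  assume A: "gsubm es A" "v \<in> loc S A"
  then obtain a :: nat where a: "sh (xpow S (int a)) v \<in> A" by (auto simp: loc_def)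
  have "hcomp es (t + edeg (xpow S (int a))) (sh (xpow S (int a)) v) \<in> A"
    by (rule gsubm_hcomp[OF A(1) a])
  thus ?thesis by (auto simp: loc_def hcomp_sh)
qed

lemma loc_sh: "gsubm es A \<Longrightarrow> v \<in> loc S A \<Longrightarrow> (\<And>s. 0 \<le> e s) \<Longrightarrow> sh e v \<in> loc S A"
proof -
  assume A: "gsubm es A" "v \<in> loc S A" "\<And>s. 0 \<le> e s"
  then obtain a :: nat where a: "sh (xpow S (int a)) v \<in> A" by (auto simp: loc_def)
  have "sh e (sh (xpow S (int a)) v) \<in> A" by (rule gsubm_sh[OF A(1) a A(3)])
  hence "sh (xpow S (int a)) (sh e v) \<in> A" by (simp add: add.commute)
  thus ?thesis unfolding loc_def by blast
qed

lemma loc_act: "gsubm es A \<Longrightarrow> v \<in> loc S A \<Longrightarrow> act p v \<in> loc S A"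
  unfolding act_def
  by (intro fun_vs.subspace_sum fun_vs.subspace_scale loc_subspace) (auto intro: loc_sh)

section \<open>Cech complexes of pairs\<close>

text \<open>
  \<open>hh es p t A B\<close> is the dimension of the degree \<open>t\<close> part of the \<open>p\<close>-th Cech cohomology of \<open>A/B\<close>, computed with
  cochains of \<open>A\<close> modulo those of \<open>B\<close>.
\<close>

type_synonym ('n, 'k) coch = "'n set \<times> nat \<times> ('n \<Rightarrow> int) \<Rightarrow> 'k"

definition slice :: "('n, 'k) coch \<Rightarrow> 'n set \<Rightarrow> ('n, 'k) vec" where
  "slice c S = (\<lambda>x. c (S, x))"

definition csgn :: "'n::linorder set \<Rightarrow> 'n \<Rightarrow> 'k::field" where
  "csgn T s = (- 1) ^ card {u \<in> T. u < s}"

text \<open>Localization maps are inclusions, so the Cech differential is a bare alternating sum;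
  cochains of all degrees share one space and one differential.\<close>

definition cd :: "('n::{finite,linorder}, 'k::field) coch \<Rightarrow> ('n, 'k) coch" where
  "cd c = (\<lambda>(T, x). \<Sum>s\<in>T. csgn T s * c (T - {s}, x))"

definition clift :: "(('n, 'k) vec \<Rightarrow> ('n, 'k) vec) \<Rightarrow> ('n, 'k) coch \<Rightarrow> ('n, 'k) coch" where
  "clift \<phi> c = (\<lambda>(S, x). \<phi> (slice c S) x)"

lemma coch_eqI: "(\<And>S. slice c S = slice c' S) \<Longrightarrow> c = c'"
  by (auto simp: slice_def fun_eq_iff)

lemma slice_add: "slice (c + c') S = slice c S + slice c' S"
  by (simp add: slice_def fun_eq_iff)

lemma slice_diff: "slice (c - c') S = slice c S - slice c' S"
  by (simp add: slice_def fun_eq_iff)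

lemma slice_zero [simp]: "slice 0 S = 0"
  by (simp add: slice_def fun_eq_iff)

lemma slice_scale: "slice (r *\<^sub>f c) S = r *\<^sub>f slice c S"
  by (simp add: slice_def fun_eq_iff)

lemma slice_clift [simp]: "slice (clift \<phi> c) S = \<phi> (slice c S)"
  by (simp add: slice_def clift_def fun_eq_iff)

lemma slice_cd: "slice (cd c) T = (\<Sum>s\<in>T. csgn T s *\<^sub>f slice c (T - {s}))"
  by (simp add: slice_def cd_def fun_eq_iff sum_fun_apply)

lemma cd_add: "cd (u + v) = cd u + cd v"
  by (auto simp: cd_def fun_eq_iff sum.distrib algebra_simps)

lemma cd_scale: "cd (r *\<^sub>f v) = r *\<^sub>f cd v"
  by (auto simp: cd_def fun_eq_iff sum_distrib_left algebra_simps)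

lemma cd_zero [simp]: "cd 0 = 0"
  by (auto simp: cd_def fun_eq_iff)

lemma cd_minus: "cd (- v) = - cd v"
  by (auto simp: cd_def fun_eq_iff sum_negf)

lemma cd_diff: "cd (u - v) = cd u - cd v"
  by (auto simp: cd_def fun_eq_iff sum_subtractf algebra_simps)

lemma csgn_sq [simp]: "csgn T s * csgn T s = (1 :: 'k::field)"
  by (simp add: csgn_def flip: power_mult_distrib)

lemma csgn_remove:
  fixes s r :: "'n::{finite,linorder}"
  assumes "s \<in> T"
  shows "csgn (T - {s}) r = (if s < r then - csgn T r else csgn T r :: 'k::field)"
proof (cases "s < r")
  case True
  have "{u \<in> T. u < r} = insert s {u \<in> T - {s}. u < r}" using assms True by auto
  hence "card {u \<in> T. u < r} = Suc (card {u \<in> T - {s}. u < r})" by simp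
  thus ?thesis using True by (simp add: csgn_def)
next
  case False
  have "{u \<in> T - {s}. u < r} = {u \<in> T. u < r}" using False by auto
  thus ?thesis using False by (simp add: csgn_def)
qed

lemma csgn_anticomm:
  fixes s r :: "'n::{finite,linorder}"
  assumes "s \<in> T" "r \<in> T" "s \<noteq> r"
  shows "csgn T s * csgn (T - {s}) r = - (csgn T r * csgn (T - {r}) s :: 'k::field)"
  using assms by (auto simp: csgn_remove)

text \<open>The double sum is split into pairs with \<open>r < s\<close> and pairs with
  \<open>s < r\<close>, and one half is matched with the negative of the other. Antisymmetry of the
  summand alone would only show that twice the sum is 0, which says nothing in characteristic
  2.\<close>

lemma cd_cd [simp]: "cd (cd c) = 0"
proof
  fix y :: "'a set \<times> nat \<times> ('a \<Rightarrow> int)"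
  obtain T x where y: "y = (T, x)" by (cases y)
  define f where "f = (\<lambda>s r. csgn T s * csgn (T - {s}) r * c (T - {s} - {r}, x))"
  have anti: "f s r = - f r s" if "s \<in> T" "r \<in> T" "s \<noteq> r" for s r
  proof -
    have "T - {s} - {r} = T - {r} - {s}" by auto
    thus ?thesis using csgn_anticomm[OF that, where 'k = 'b] by (simp add: f_def)
  qed
  have "cd (cd c) y = (\<Sum>s\<in>T. \<Sum>r\<in>T - {s}. f s r)"
    by (simp add: cd_def y f_def sum_distrib_left mult.assoc)
  also have "\<dots> = (\<Sum>s\<in>T. (\<Sum>r\<in>{r\<in>T. r < s}. f s r) + (\<Sum>r\<in>{r\<in>T. s < r}. f s r))"
  proof (rule sum.cong[OF refl])
    fix s assume "s \<in> T"
    have eq: "T - {s} = {r\<in>T. r < s} \<union> {r\<in>T. s < r}" by auto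
    show "(\<Sum>r\<in>T - {s}. f s r) = (\<Sum>r\<in>{r\<in>T. r < s}. f s r) + (\<Sum>r\<in>{r\<in>T. s < r}. f s r)"
      by (subst eq, rule sum.union_disjoint) auto
  qed
  also have "\<dots> = (\<Sum>s\<in>T. \<Sum>r\<in>{r\<in>T. r < s}. f s r) + (\<Sum>s\<in>T. \<Sum>r\<in>{r\<in>T. s < r}. f s r)"
    by (rule sum.distrib)
  also have "(\<Sum>s\<in>T. \<Sum>r\<in>{r\<in>T. s < r}. f s r) = (\<Sum>r\<in>T. \<Sum>s\<in>{s\<in>T. s < r}. f s r)"
    by (rule sum.swap_restrict) auto
  also have "\<dots> = (\<Sum>r\<in>T. \<Sum>s\<in>{s\<in>T. s < r}. - f r s)"
    by (intro sum.cong refl anti) auto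
  finally show "cd (cd c) y = 0 y" by (simp add: sum_negf)
qed

definition CC :: "nat \<Rightarrow> ('n, 'k::field) vec set \<Rightarrow> ('n, 'k) coch set" where
  "CC p A = {c. \<forall>S. slice c S \<in> (if card S = p then loc S A else {0})}"

definition Ct :: "(nat \<Rightarrow> int) \<Rightarrow> int \<Rightarrow> ('n::finite, 'k::field) coch set" where
  "Ct es t = {c. \<forall>S. slice c S \<in> Vt es t}"

definition Cprev :: "nat \<Rightarrow> ('n, 'k::field) vec set \<Rightarrow> ('n, 'k) coch set" where
  "Cprev p A = (case p of 0 \<Rightarrow> {0} | Suc q \<Rightarrow> CC q A)"

text \<open>Representatives of the cocycles of the quotient complex: cochains of \<open>A\<close>
  whose coboundary lies in the cochains of \<open>B\<close>. Correspondingly \<open>Bc\<close>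
  contains the cochains of \<open>B\<close> besides the coboundaries.\<close>

definition Zc where
  "Zc es p t A B = {c \<in> CC p A \<inter> Ct es t. cd c \<in> CC (Suc p) B}"

definition Bc where
  "Bc es p t A B = {cd u + w | u w. u \<in> Cprev p A \<inter> Ct es t \<and> w \<in> CC p B \<inter> Ct es t}"

definition hh :: "(nat \<Rightarrow> int) \<Rightarrow> nat \<Rightarrow> int \<Rightarrow> ('n::{finite,linorder}, 'k::field) vec set \<Rightarrow> ('n, 'k) vec set \<Rightarrow> enat" where
  "hh es p t A B = rdim (Zc es p t A B) (Bc es p t A B)"

lemma CC_subspace:
  assumes "gsubm es A"
  shows "fun_vs.subspace (CC p A)"
  unfolding fun_vs.subspace_def CC_def mem_Collect_eq
  using fun_vs.subspace_0[OF loc_subspace[OF assms]] fun_vs.subspace_add[OF loc_subspace[OF assms]]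
    fun_vs.subspace_scale[OF loc_subspace[OF assms]]
  by (simp add: slice_add slice_scale)

lemma Ct_subspace: "fun_vs.subspace (Ct es t)"
  unfolding fun_vs.subspace_def[of "Ct es t"]
  by (auto simp: Ct_def slice_add slice_scale
      intro: fun_vs.subspace_0 fun_vs.subspace_add fun_vs.subspace_scale Vt_subspace)

lemmas Ct_closed = fun_vs.subspace_0[OF Ct_subspace] fun_vs.subspace_add[OF Ct_subspace]
  fun_vs.subspace_scale[OF Ct_subspace] fun_vs.subspace_diff[OF Ct_subspace]

lemma Cprev_subspace: "gsubm es A \<Longrightarrow> fun_vs.subspace (Cprev p A)"
  by (cases p) (simp_all add: Cprev_def fun_vs.subspace_single_0 CC_subspace)

lemma CC_mono: "A \<subseteq> B \<Longrightarrow> CC p A \<subseteq> CC p B"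
  using loc_mono[of A B] by (auto simp: CC_def subset_iff)

lemma Cprev_mono: "A \<subseteq> B \<Longrightarrow> Cprev p A \<subseteq> Cprev p B"
  using CC_mono[of A B] by (auto simp: Cprev_def split: nat.splits)

lemma cd_CC:
  assumes A: "gsubm es A" and c: "c \<in> CC p A"
  shows "cd c \<in> CC (Suc p) A"
proof -
  have "slice (cd c) T \<in> (if card T = Suc p then loc T A else {0})" for T
  proof (cases "card T = Suc p")
    case True
    have "slice c (T - {s}) \<in> loc T A" if "s \<in> T" for s
    proof -
      have "card (T - {s}) = p" using True that by simp
      hence "slice c (T - {s}) \<in> loc (T - {s}) A" using c by (simp add: CC_def) metis
      thus ?thesis using loc_mono_set[OF A, of "T - {s}" T] by auto
    qed
    thus ?thesis unfolding slice_cd using True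
      by (auto intro!: fun_vs.subspace_sum[OF loc_subspace[OF A]] fun_vs.subspace_scale[OF loc_subspace[OF A]])
  next
    case False
    have "slice c (T - {s}) = 0" if "s \<in> T" for s
    proof -
      have "card T = Suc (card (T - {s}))" using that by (metis card_Suc_Diff1 finite)
      hence "card (T - {s}) \<noteq> p" using False by simp
      moreover have "slice c (T - {s}) \<in> (if card (T - {s}) = p then loc (T - {s}) A else {0})"
        using c unfolding CC_def by blast
      ultimately show ?thesis by simp
    qed
    thus ?thesis unfolding slice_cd using False by simp
  qed
  thus ?thesis by (simp add: CC_def)
qed

lemma cd_Ct: "c \<in> Ct es t \<Longrightarrow> cd c \<in> Ct es t"
  by (auto simp: Ct_def slice_cd intro!: fun_vs.subspace_sum[OF Vt_subspace] fun_vs.subspace_scale[OF Vt_subspace])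

lemma cd_Cprev: "gsubm es A \<Longrightarrow> c \<in> Cprev p A \<Longrightarrow> cd c \<in> CC p A"
  by (cases p) (auto simp: Cprev_def intro: cd_CC fun_vs.subspace_0[OF CC_subspace])

lemma Zc_subspace:
  assumes "gsubm es A" "gsubm es B"
  shows "fun_vs.subspace (Zc es p t A B)"
proof -
  note a = CC_subspace[OF assms(1), of p] and b = CC_subspace[OF assms(2), of "Suc p"]
  show ?thesis
    unfolding fun_vs.subspace_def[of "Zc es p t A B"]
    by (auto simp: Zc_def cd_add cd_scale Ct_closed
        fun_vs.subspace_0[OF a] fun_vs.subspace_0[OF b]
        intro: fun_vs.subspace_add[OF a] fun_vs.subspace_add[OF b]
          fun_vs.subspace_scale[OF a] fun_vs.subspace_scale[OF b])
qed

lemma Bc_I: "u \<in> Cprev p A \<Longrightarrow> u \<in> Ct es t \<Longrightarrow> w \<in> CC p B \<Longrightarrow> w \<in> Ct es t \<Longrightarrow> cd u + w \<in> Bc es p t A B"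
  unfolding Bc_def by blast

lemma Bc_E:
  assumes "z \<in> Bc es p t A B"
  obtains u w where "u \<in> Cprev p A" "u \<in> Ct es t" "w \<in> CC p B" "w \<in> Ct es t" "z = cd u + w"
  using assms unfolding Bc_def by blast

lemma Bc_subspace:
  assumes A: "gsubm es A" and B: "gsubm es B"
  shows "fun_vs.subspace (Bc es p t A B)"
  unfolding fun_vs.subspace_def
proof (intro conjI ballI allI)
  note c = Cprev_subspace[OF A, of p] CC_subspace[OF B, of p] Ct_subspace[of es t]
  have "cd 0 + 0 \<in> Bc es p t A B"
    by (rule Bc_I) (rule fun_vs.subspace_0[OF c(1)] fun_vs.subspace_0[OF c(2)] fun_vs.subspace_0[OF c(3)])+
  thus "0 \<in> Bc es p t A B" by simp
  fix x y assume "x \<in> Bc es p t A B" "y \<in> Bc es p t A B"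
  then obtain u w u' w' where *: "u \<in> Cprev p A" "u \<in> Ct es t" "w \<in> CC p B" "w \<in> Ct es t" "x = cd u + w"
    "u' \<in> Cprev p A" "u' \<in> Ct es t" "w' \<in> CC p B" "w' \<in> Ct es t" "y = cd u' + w'"
    by (meson Bc_E)
  have "cd (u + u') + (w + w') \<in> Bc es p t A B"
    by (rule Bc_I) (use * c in \<open>auto intro: fun_vs.subspace_add simp: Ct_closed\<close>)
  moreover have "x + y = cd (u + u') + (w + w')" using * by (simp add: cd_add)
  ultimately show "x + y \<in> Bc es p t A B" by simp
next
  note c = Cprev_subspace[OF A, of p] CC_subspace[OF B, of p] Ct_subspace[of es t]
  fix r x assume "x \<in> Bc es p t A B"
  then obtain u w where *: "u \<in> Cprev p A" "u \<in> Ct es t" "w \<in> CC p B" "w \<in> Ct es t" "x = cd u + w"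
    by (meson Bc_E)
  have "cd (r *\<^sub>f u) + r *\<^sub>f w \<in> Bc es p t A B"
    by (rule Bc_I) (use * c in \<open>auto intro: fun_vs.subspace_scale simp: Ct_closed\<close>)
  moreover have "r *\<^sub>f x = cd (r *\<^sub>f u) + r *\<^sub>f w" using * by (simp add: cd_scale fun_vs.scale_right_distrib)
  ultimately show "r *\<^sub>f x \<in> Bc es p t A B" by simp
qed

lemma Bc_0: "gsubm es A \<Longrightarrow> gsubm es B \<Longrightarrow> 0 \<in> Bc es p t A B"
  by (rule fun_vs.subspace_0[OF Bc_subspace])

lemma Bc_mono: "A \<subseteq> A' \<Longrightarrow> B \<subseteq> B' \<Longrightarrow> Bc es p t A B \<subseteq> Bc es p t A' B'"
  unfolding Bc_def using CC_mono[of B B' p] Cprev_mono[of A A' p] by blast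

section \<open>Long exact sequence of three nested submodules, as inequalities\<close>

lemma hh_triple_middle:
  assumes g: "gsubm es K" "gsubm es K'" "gsubm es K''" and sub: "K \<subseteq> K'" "K' \<subseteq> K''"
  shows "hh es p t K'' K \<le> hh es p t K'' K' + hh es p t K' K"
proof -
  let ?Z = "Zc es p t K'' K" and ?Y = "Bc es p t K'' K'" and ?B = "Bc es p t K'' K"
  \<comment> \<open>Exactness at the middle term: the first summand measures the image in the
    cohomology of \<open>K''/K'\<close>; a cocycle that becomes trivial there differs by a
    coboundary from a cocycle of \<open>K'/K\<close>.\<close>
  have "rdim ?Z ?B \<le> rdim ?Z ?Y + rdim (?Y \<inter> ?Z) ?B"
    by (rule rdim_triple) (use g in \<open>simp_all add: Bc_subspace Bc_0 Zc_subspace\<close>)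
  also have "rdim ?Z ?Y \<le> hh es p t K'' K'"
    unfolding hh_def using CC_mono[OF sub(1)]
    by (intro rdim_mono Bc_0 Zc_subspace g) (auto simp: Zc_def)
  also have "rdim (?Y \<inter> ?Z) ?B \<le> hh es p t K' K"
    unfolding hh_def
  proof (rule rdim_le_rel[where R = "\<lambda>z w. \<exists>u\<in>Cprev p K'' \<inter> Ct es t. z = cd u + w"])
    show "\<exists>u\<in>Cprev p K'' \<inter> Ct es t. 0 = cd u + 0"
      using fun_vs.subspace_0[OF Cprev_subspace[OF g(3)]] fun_vs.subspace_0[OF Ct_subspace]
      by (intro bexI[of _ 0]) auto
    show "\<exists>u\<in>Cprev p K'' \<inter> Ct es t. a + a' = cd u + (b + b')"
      if h: "\<exists>u\<in>Cprev p K'' \<inter> Ct es t. a = cd u + b" "\<exists>u\<in>Cprev p K'' \<inter> Ct es t. a' = cd u + b'" for a b a' b'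
    proof -
      obtain u u' where u: "u \<in> Cprev p K'' \<inter> Ct es t" "a = cd u + b" "u' \<in> Cprev p K'' \<inter> Ct es t" "a' = cd u' + b'"
        using h by blast
      show ?thesis
        by (rule bexI[of _ "u + u'"])
          (use u in \<open>auto simp: cd_add intro: fun_vs.subspace_add[OF Cprev_subspace[OF g(3)]] fun_vs.subspace_add[OF Ct_subspace]\<close>)
    qed
    show "\<exists>u\<in>Cprev p K'' \<inter> Ct es t. c *\<^sub>f a = cd u + c *\<^sub>f b"
      if h: "\<exists>u\<in>Cprev p K'' \<inter> Ct es t. a = cd u + b" for c a b
    proof -
      obtain u where u: "u \<in> Cprev p K'' \<inter> Ct es t" "a = cd u + b"
        using h by blast
      show ?thesis
        by (rule bexI[of _ "c *\<^sub>f u"])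
          (use u in \<open>auto simp: cd_scale fun_vs.scale_right_distrib intro: fun_vs.subspace_scale[OF Cprev_subspace[OF g(3)]] fun_vs.subspace_scale[OF Ct_subspace]\<close>)
    qed
    show "\<exists>z'\<in>Zc es p t K' K. \<exists>u\<in>Cprev p K'' \<inter> Ct es t. z = cd u + z'" if z: "z \<in> ?Y \<inter> ?Z" for z
    proof -
      obtain u w where *: "u \<in> Cprev p K''" "u \<in> Ct es t" "w \<in> CC p K'" "w \<in> Ct es t" "z = cd u + w"
        using z by (auto elim: Bc_E)
      have "cd w = cd z" using * by (simp add: cd_add)
      hence "w \<in> Zc es p t K' K" using z * by (simp add: Zc_def)
      thus ?thesis using * by blast
    qed
    show "0 \<in> Bc es p t K' K" by (intro Bc_0 g)
    show "z \<in> ?B" if h: "\<exists>u\<in>Cprev p K'' \<inter> Ct es t. z = cd u + z'" "z' \<in> Bc es p t K' K" for z z'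
    proof -
      obtain u where u: "u \<in> Cprev p K''" "u \<in> Ct es t" "z = cd u + z'" using h by blast
      have "cd u + 0 \<in> ?B"
        by (intro Bc_I u fun_vs.subspace_0[OF CC_subspace[OF g(1)]] fun_vs.subspace_0[OF Ct_subspace])
      moreover have "z' \<in> ?B" using h(2) Bc_mono[OF sub(2) order_refl] by blast
      ultimately show ?thesis using u(3) fun_vs.subspace_add[OF Bc_subspace[OF g(3,1)], of "cd u" p t z'] by simp
    qed
  qed
  finally show ?thesis by (simp add: add_mono hh_def)
qed

text \<open>Exactness of H^p(K''/K') -> H^(p+1)(K'/K) -> H^(p+1)(K''/K) in the middle. The relation
  that puts \<open>z - cd u\<close> into the cochains of \<open>K\<close> is the connecting map read
  backwards: it leads from a class that dies in \<open>K''/K\<close> to a preimage.\<close>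

lemma hh_triple_left:
  assumes g: "gsubm es K" "gsubm es K'" "gsubm es K''" and sub: "K \<subseteq> K'" "K' \<subseteq> K''"
  shows "hh es (Suc p) t K' K \<le> hh es (Suc p) t K'' K + hh es p t K'' K'"
proof -
  let ?Z = "Zc es (Suc p) t K' K" and ?Y = "Bc es (Suc p) t K'' K" and ?B = "Bc es (Suc p) t K' K"
  have "rdim ?Z ?B \<le> rdim ?Z ?Y + rdim (?Y \<inter> ?Z) ?B"
    by (rule rdim_triple) (use g in \<open>simp_all add: Bc_subspace Bc_0 Zc_subspace\<close>)
  also have "rdim ?Z ?Y \<le> hh es (Suc p) t K'' K"
    unfolding hh_def using CC_mono[OF sub(2)]
    by (intro rdim_mono Bc_0 Zc_subspace g) (auto simp: Zc_def)
  also have "rdim (?Y \<inter> ?Z) ?B \<le> hh es p t K'' K'"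
    unfolding hh_def
  proof (rule rdim_le_rel[where R = "\<lambda>z u. z - cd u \<in> CC (Suc p) K \<inter> Ct es t"])
    note s = CC_subspace[OF g(1), of "Suc p"] Ct_subspace[of es t]
    show "0 - cd 0 \<in> CC (Suc p) K \<inter> Ct es t"
      using fun_vs.subspace_0[OF s(1)] fun_vs.subspace_0[OF s(2)] by simp
    show "(a + a') - cd (b + b') \<in> CC (Suc p) K \<inter> Ct es t"
      if h: "a - cd b \<in> CC (Suc p) K \<inter> Ct es t" "a' - cd b' \<in> CC (Suc p) K \<inter> Ct es t" for a b a' b'
    proof -
      have "(a + a') - cd (b + b') = (a - cd b) + (a' - cd b')" by (simp add: cd_add)
      thus ?thesis using h fun_vs.subspace_add[OF s(1)] fun_vs.subspace_add[OF s(2)] by (metis IntE IntI)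
    qed
    show "c *\<^sub>f a - cd (c *\<^sub>f b) \<in> CC (Suc p) K \<inter> Ct es t"
      if h: "a - cd b \<in> CC (Suc p) K \<inter> Ct es t" for c a b
    proof -
      have "c *\<^sub>f a - cd (c *\<^sub>f b) = c *\<^sub>f (a - cd b)" by (simp add: cd_scale fun_vs.scale_right_diff_distrib)
      thus ?thesis using h fun_vs.subspace_scale[OF s(1)] fun_vs.subspace_scale[OF s(2)] by (metis IntE IntI)
    qed
    show "\<exists>u\<in>Zc es p t K'' K'. z - cd u \<in> CC (Suc p) K \<inter> Ct es t" if z: "z \<in> ?Y \<inter> ?Z" for z
    proof -
      obtain u w where *: "u \<in> CC p K''" "u \<in> Ct es t" "w \<in> CC (Suc p) K" "w \<in> Ct es t" "z = cd u + w"
        using z by (auto elim!: Bc_E simp: Cprev_def)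
      have "cd u = z - w" using * by simp
      also have "z - w \<in> CC (Suc p) K'"
        by (rule fun_vs.subspace_diff[OF CC_subspace[OF g(2)]])
          (use z * CC_mono[OF sub(1)] in \<open>auto simp: Zc_def\<close>)
      finally have "u \<in> Zc es p t K'' K'" using * by (simp add: Zc_def)
      thus ?thesis using * by (intro bexI[of _ u]) auto
    qed
    show "0 \<in> Bc es p t K'' K'" by (intro Bc_0 g)
    show "z \<in> ?B" if h: "z - cd u \<in> CC (Suc p) K \<inter> Ct es t" "u \<in> Bc es p t K'' K'" for z u
    proof -
      obtain u0 w0 where *: "w0 \<in> CC p K'" "w0 \<in> Ct es t" "u = cd u0 + w0" using h(2) by (auto elim!: Bc_E)
      have "cd w0 + (z - cd u) \<in> ?B"
        by (rule Bc_I) (use * h in \<open>auto simp: Cprev_def\<close>)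
      thus ?thesis using * by (simp add: cd_add)
    qed
  qed
  finally show ?thesis by (simp add: add_mono hh_def)
qed

text \<open>Exactness of H^p(K''/K) -> H^p(K''/K') -> H^(p+1)(K'/K) in the middle. The intermediate
  space \<open>Y\<close> is the kernel of the connecting map; an element of it is corrected by a
  cochain of \<open>K'\<close> to a cocycle modulo \<open>K\<close>.\<close>

lemma hh_triple_right:
  assumes g: "gsubm es K" "gsubm es K'" "gsubm es K''" and sub: "K \<subseteq> K'" "K' \<subseteq> K''"
  shows "hh es p t K'' K' \<le> hh es (Suc p) t K' K + hh es p t K'' K"
proof -
  let ?Z = "Zc es p t K'' K'" and ?Y = "{z. cd z \<in> Bc es (Suc p) t K' K}" and ?B = "Bc es p t K'' K'"
  have Y: "fun_vs.subspace ?Y"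
    using Bc_subspace[OF g(2,1), of "Suc p" t] unfolding fun_vs.subspace_def by (simp add: cd_add cd_scale)
  have "rdim ?Z ?B \<le> rdim ?Z ?Y + rdim (?Y \<inter> ?Z) ?B"
    by (rule rdim_triple[OF Y]) (use g in \<open>simp_all add: Bc_subspace Bc_0 Zc_subspace\<close>)
  also have "rdim ?Z ?Y \<le> hh es (Suc p) t K' K"
    unfolding hh_def
    by (rule rdim_le_rel[where R = "\<lambda>z w. w = cd z"])
      (auto simp: cd_add cd_scale Zc_def cd_Ct fun_vs.subspace_0[OF CC_subspace[OF g(1)]] Bc_0[OF g(2,1)])
  also have "rdim (?Y \<inter> ?Z) ?B \<le> hh es p t K'' K"
    unfolding hh_def
  proof (rule rdim_le_rel[where R = "\<lambda>z w. z - w \<in> CC p K' \<inter> Ct es t"])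
    note s = CC_subspace[OF g(2), of p] Ct_subspace[of es t]
    show "0 - 0 \<in> CC p K' \<inter> Ct es t"
      using fun_vs.subspace_0[OF s(1)] fun_vs.subspace_0[OF s(2)] by simp
    show "(a + a') - (b + b') \<in> CC p K' \<inter> Ct es t"
      if h: "a - b \<in> CC p K' \<inter> Ct es t" "a' - b' \<in> CC p K' \<inter> Ct es t" for a b a' b'
    proof -
      have "(a + a') - (b + b') = (a - b) + (a' - b')" by simp
      thus ?thesis using h fun_vs.subspace_add[OF s(1)] fun_vs.subspace_add[OF s(2)] by (metis IntE IntI)
    qed
    show "c *\<^sub>f a - c *\<^sub>f b \<in> CC p K' \<inter> Ct es t" if h: "a - b \<in> CC p K' \<inter> Ct es t" for c a b
      using h fun_vs.subspace_scale[OF s(1)]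
      by (simp add: Ct_closed flip: fun_vs.scale_right_diff_distrib)
    show "\<exists>w\<in>Zc es p t K'' K. z - w \<in> CC p K' \<inter> Ct es t" if z: "z \<in> ?Y \<inter> ?Z" for z
    proof -
      obtain d w where *: "d \<in> CC p K'" "d \<in> Ct es t" "w \<in> CC (Suc p) K" "w \<in> Ct es t" "cd z = cd d + w"
        using z by (auto elim!: Bc_E simp: Cprev_def)
      have "z - d \<in> CC p K''"
        by (rule fun_vs.subspace_diff[OF CC_subspace[OF g(3)]])
          (use z * CC_mono[OF sub(2)] in \<open>auto simp: Zc_def\<close>)
      moreover have "z - d \<in> Ct es t"
        by (rule fun_vs.subspace_diff[OF Ct_subspace]) (use z * in \<open>auto simp: Zc_def\<close>)
      moreover have "cd (z - d) = w" using * by (simp add: cd_diff)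
      ultimately have "z - d \<in> Zc es p t K'' K" using * by (simp add: Zc_def)
      thus ?thesis using * by (intro bexI[of _ "z - d"]) auto
    qed
    show "0 \<in> Bc es p t K'' K" by (intro Bc_0 g)
    show "z \<in> ?B" if h: "z - w \<in> CC p K' \<inter> Ct es t" "w \<in> Bc es p t K'' K" for z w
    proof -
      have "w \<in> ?B" using h(2) Bc_mono[OF order_refl sub(1)] by blast
      moreover have "cd 0 + (z - w) \<in> ?B"
        by (rule Bc_I) (use h fun_vs.subspace_0[OF Cprev_subspace[OF g(3)]] fun_vs.subspace_0[OF s(2)] in auto)
      ultimately show ?thesis
        using fun_vs.subspace_add[OF Bc_subspace[OF g(3,2)], of w p t "z - w"] by simp
    qed
  qed
  finally show ?thesis by (simp add: add_mono hh_def)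
qed

section \<open>Transport of cohomology along an isomorphism of quotients\<close>

lemma clift_add: "(\<And>u v. \<phi> (u + v) = \<phi> u + \<phi> v) \<Longrightarrow> clift \<phi> (c + d) = clift \<phi> c + clift \<phi> d"
  by (rule coch_eqI) (simp only: slice_add slice_clift)

lemma clift_scale: "(\<And>r v. \<phi> (r *\<^sub>f v) = r *\<^sub>f \<phi> v) \<Longrightarrow> clift \<phi> (r *\<^sub>f c) = r *\<^sub>f clift \<phi> c"
  by (rule coch_eqI) (simp only: slice_scale slice_clift)

text \<open>\<open>\<phi>\<close> only has to become bijective on the quotients of the localizations
  in the degrees considered: \<open>onto\<close> holds up to \<open>B'\<close> and
  \<open>inj\<close> up to \<open>B\<close>. Multiplication by a linear form and maps of free
  modules with a kernel are of this kind.\<close>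

locale pair_iso =
  fixes \<phi> :: "('n::{finite,linorder}, 'k::field) vec \<Rightarrow> ('n, 'k) vec"
    and es es' :: "nat \<Rightarrow> int" and t t' :: int
    and A B A' B' :: "('n, 'k) vec set"
  assumes gA: "gsubm es A" and gB: "gsubm es B" and gA': "gsubm es' A'" and gB': "gsubm es' B'"
    and BA': "B' \<subseteq> A'"
    and add: "\<phi> (u + v) = \<phi> u + \<phi> v"
    and scale: "\<phi> (c *\<^sub>f v) = c *\<^sub>f \<phi> v"
    and deg: "v \<in> Vt es t \<Longrightarrow> \<phi> v \<in> Vt es' t'"
    and fA: "v \<in> loc S A \<Longrightarrow> \<phi> v \<in> loc S A'"
    and fB: "v \<in> loc S B \<Longrightarrow> \<phi> v \<in> loc S B'"
    and onto: "v' \<in> loc S A' \<Longrightarrow> v' \<in> Vt es' t' \<Longrightarrow> \<exists>v\<in>loc S A \<inter> Vt es t. v' - \<phi> v \<in> loc S B'"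
    and inj: "v \<in> loc S A \<Longrightarrow> \<phi> v \<in> loc S B' \<Longrightarrow> v \<in> loc S B"
begin

lemma zero: "\<phi> 0 = 0"
  using scale[of 0 0] by simp

lemma diff: "\<phi> (u - v) = \<phi> u - \<phi> v"
  using add[of "u - v" v] by simp

lemma sum_eq: "\<phi> (\<Sum>i\<in>I. f i) = (\<Sum>i\<in>I. \<phi> (f i))"
proof (induction I rule: infinite_finite_induct)
  case (insert x F)
  show ?case unfolding sum.insert[OF insert(1,2)] add insert(3) ..
next
  case (infinite A)
  show ?case unfolding sum.infinite[OF infinite] zero ..
next
  case empty
  show ?case unfolding sum.empty zero ..
qed

lemma cd_clift: "cd (clift \<phi> c) = clift \<phi> (cd c)"
  by (rule coch_eqI) (simp only: slice_cd slice_clift sum_eq scale)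

lemma clift_diff: "clift \<phi> (c - d) = clift \<phi> c - clift \<phi> d"
  by (rule coch_eqI) (simp only: slice_diff slice_clift diff)

lemma clift_zero: "clift \<phi> 0 = 0"
  by (rule coch_eqI) (simp only: slice_clift slice_zero zero)

lemma clift_Ct: "c \<in> Ct es t \<Longrightarrow> clift \<phi> c \<in> Ct es' t'"
  by (simp add: Ct_def deg)

lemma clift_CC_A: "c \<in> CC p A \<Longrightarrow> clift \<phi> c \<in> CC p A'"
  by (auto simp: CC_def fA zero split: if_splits)

lemma clift_CC_B: "c \<in> CC p B \<Longrightarrow> clift \<phi> c \<in> CC p B'"
  by (auto simp: CC_def fB zero split: if_splits)

lemma clift_Cprev_A: "c \<in> Cprev p A \<Longrightarrow> clift \<phi> c \<in> Cprev p A'"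
  by (cases p) (auto simp: Cprev_def clift_CC_A clift_zero)

lemma clift_CC_inj: "c \<in> CC p A \<Longrightarrow> clift \<phi> c \<in> CC p B' \<Longrightarrow> c \<in> CC p B"
  by (auto simp: CC_def split: if_splits intro: inj)

lemma clift_CC_onto:
  assumes "c' \<in> CC p A'" "c' \<in> Ct es' t'"
  shows "\<exists>c\<in>CC p A \<inter> Ct es t. c' - clift \<phi> c \<in> CC p B'"
proof -
  have "\<exists>v. v \<in> (if card S = p then loc S A else {0}) \<and> v \<in> Vt es t \<and>
      slice c' S - \<phi> v \<in> (if card S = p then loc S B' else {0})" for S
  proof (cases "card S = p")
    case True
    have "slice c' S \<in> Vt es' t'" using assms unfolding Ct_def by blast
    moreover have "slice c' S \<in> loc S A'" 
    proof -
      have "slice c' S \<in> (if card S = p then loc S A' else {0})" using assms(1) unfolding CC_def by blast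
      thus ?thesis using True by simp
    qed
    ultimately show ?thesis using onto[of "slice c' S" S] True by auto
  next
    case False
    have "slice c' S \<in> (if card S = p then loc S A' else {0})" using assms(1) unfolding CC_def by blast
    hence "slice c' S = 0" using False by simp
    thus ?thesis using False fun_vs.subspace_0[OF Vt_subspace] by (intro exI[of _ 0]) (simp add: zero)
  qed
  then obtain f where f: "\<And>S. f S \<in> (if card S = p then loc S A else {0}) \<and> f S \<in> Vt es t \<and>
      slice c' S - \<phi> (f S) \<in> (if card S = p then loc S B' else {0})" by metis
  define c where "c = (\<lambda>(S, x). f S x)"
  have s: "slice c S = f S" for S by (simp add: c_def slice_def)
  have "c \<in> CC p A" unfolding CC_def using f s by simp
  moreover have "c \<in> Ct es t" unfolding Ct_def using f s by simp
  moreover have "c' - clift \<phi> c \<in> CC p B'" unfolding CC_def using f s by (simp add: slice_diff)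
  ultimately show ?thesis by blast
qed

lemma clift_Cprev_onto:
  assumes "c' \<in> Cprev p A'" "c' \<in> Ct es' t'"
  shows "\<exists>c\<in>Cprev p A \<inter> Ct es t. c' - clift \<phi> c \<in> Cprev p B'"
proof (cases p)
  case 0
  thus ?thesis using assms fun_vs.subspace_0[OF Ct_subspace]
    by (intro bexI[of _ 0]) (auto simp: Cprev_def clift_zero)
next
  case (Suc q)
  thus ?thesis using clift_CC_onto[of c' q] assms by (auto simp: Cprev_def)
qed

lemma hh_le: "hh es p t A B \<le> hh es' p t' A' B'"
  unfolding hh_def
proof (rule rdim_le_rel[where R = "\<lambda>z w. w = clift \<phi> z \<and> z \<in> CC p A \<inter> Ct es t"])
  show "\<exists>z'\<in>Zc es' p t' A' B'. z' = clift \<phi> z \<and> z \<in> CC p A \<inter> Ct es t" if "z \<in> Zc es p t A B" for z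
    using that by (auto simp: Zc_def clift_CC_A clift_Ct cd_clift clift_CC_B)
  show "0 \<in> Bc es' p t' A' B'" by (intro Bc_0 gA' gB')
  fix z w assume h: "w = clift \<phi> z \<and> z \<in> CC p A \<inter> Ct es t" "w \<in> Bc es' p t' A' B'"
  obtain u' w' where *: "u' \<in> Cprev p A'" "u' \<in> Ct es' t'" "w' \<in> CC p B'" "w = cd u' + w'"
    using h(2) by (auto elim: Bc_E)
  obtain u where u: "u \<in> Cprev p A" "u \<in> Ct es t" "u' - clift \<phi> u \<in> Cprev p B'"
    using clift_Cprev_onto[OF *(1,2)] by blast
  have "clift \<phi> (z - cd u) = cd (u' - clift \<phi> u) + w'"
    using h *(4) by (simp add: clift_diff cd_diff cd_clift)
  moreover have "\<dots> \<in> CC p B'"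
    by (intro fun_vs.subspace_add[OF CC_subspace[OF gB']] cd_Cprev[OF gB'] u *)
  moreover have zA: "z - cd u \<in> CC p A"
    by (rule fun_vs.subspace_diff[OF CC_subspace[OF gA]]) (use h u cd_Cprev[OF gA] in auto)
  ultimately have "z - cd u \<in> CC p B" using clift_CC_inj by metis
  moreover have "z - cd u \<in> Ct es t" using h u by (auto intro: Ct_closed cd_Ct)
  ultimately have "cd u + (z - cd u) \<in> Bc es p t A B" by (intro Bc_I u)
  thus "z \<in> Bc es p t A B" by simp
qed (auto simp: clift_zero clift_add[OF add] clift_scale[OF scale] Ct_closed
      fun_vs.subspace_0[OF CC_subspace[OF gA]]
      intro: fun_vs.subspace_add[OF CC_subspace[OF gA]] fun_vs.subspace_scale[OF CC_subspace[OF gA]])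

text \<open>\<open>\<phi>\<close> has no inverse, so the comparison runs through the relation that
  \<open>z'\<close> equals \<open>clift \<phi> z\<close> up to cochains of
  \<open>B'\<close>.\<close>

lemma hh_ge: "hh es' p t' A' B' \<le> hh es p t A B"
  unfolding hh_def
proof (rule rdim_le_rel[where R = "\<lambda>z' z. z' - clift \<phi> z \<in> CC p B' \<inter> Ct es' t'"])
  note s = CC_subspace[OF gB', of p]
  show "0 - clift \<phi> 0 \<in> CC p B' \<inter> Ct es' t'"
    using fun_vs.subspace_0[OF s] Ct_closed(1) by (simp add: clift_zero)
  show "(a + a') - clift \<phi> (b + b') \<in> CC p B' \<inter> Ct es' t'"
    if h: "a - clift \<phi> b \<in> CC p B' \<inter> Ct es' t'" "a' - clift \<phi> b' \<in> CC p B' \<inter> Ct es' t'" for a b a' b'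
  proof -
    have "(a + a') - clift \<phi> (b + b') = (a - clift \<phi> b) + (a' - clift \<phi> b')" by (simp add: clift_add[OF add])
    thus ?thesis using h fun_vs.subspace_add[OF s] Ct_closed(2) by (metis IntE IntI)
  qed
  show "c *\<^sub>f a - clift \<phi> (c *\<^sub>f b) \<in> CC p B' \<inter> Ct es' t'" if h: "a - clift \<phi> b \<in> CC p B' \<inter> Ct es' t'" for c a b
  proof -
    have "c *\<^sub>f a - clift \<phi> (c *\<^sub>f b) = c *\<^sub>f (a - clift \<phi> b)"
      by (simp add: clift_scale[OF scale] fun_vs.scale_right_diff_distrib)
    thus ?thesis using h fun_vs.subspace_scale[OF s] Ct_closed(3) by (metis IntE IntI)
  qed
  show "\<exists>w\<in>Zc es p t A B. z - clift \<phi> w \<in> CC p B' \<inter> Ct es' t'" if z: "z \<in> Zc es' p t' A' B'" for z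
  proof -
    obtain w where w: "w \<in> CC p A" "w \<in> Ct es t" "z - clift \<phi> w \<in> CC p B'"
      using clift_CC_onto[of z p] z by (auto simp: Zc_def)
    have ct: "z - clift \<phi> w \<in> Ct es' t'" using z w clift_Ct by (auto simp: Zc_def intro: Ct_closed)
    have "clift \<phi> (cd w) = cd z - cd (z - clift \<phi> w)" by (simp add: cd_diff cd_clift)
    also have "\<dots> \<in> CC (Suc p) B'"
      by (rule fun_vs.subspace_diff[OF CC_subspace[OF gB']]) (use z cd_CC[OF gB' w(3)] in \<open>auto simp: Zc_def\<close>)
    finally have "cd w \<in> CC (Suc p) B" by (rule clift_CC_inj[OF cd_CC[OF gA w(1)]])
    hence "w \<in> Zc es p t A B" using w by (simp add: Zc_def)
    thus ?thesis using w ct by blast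
  qed
  show "0 \<in> Bc es p t A B" by (intro Bc_0 gA gB)
  fix z' z assume h: "z' - clift \<phi> z \<in> CC p B' \<inter> Ct es' t'" "z \<in> Bc es p t A B"
  obtain u w where *: "u \<in> Cprev p A" "u \<in> Ct es t" "w \<in> CC p B" "w \<in> Ct es t" "z = cd u + w"
    using h(2) by (auto elim: Bc_E)
  have "cd (clift \<phi> u) + (clift \<phi> w + (z' - clift \<phi> z)) \<in> Bc es' p t' A' B'"
    using h * clift_Ct
    by (intro Bc_I clift_Cprev_A clift_Ct Ct_closed(2) fun_vs.subspace_add[OF s] clift_CC_B) auto
  thus "z' \<in> Bc es' p t' A' B'" using * by (simp add: clift_add[OF add] cd_clift)
qed

lemma hh_eq: "hh es p t A B = hh es' p t' A' B'"
  using hh_le hh_ge by (rule antisym)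

end

text \<open>An isomorphism of quotient modules that commutes with monomials induces one on all
  localizations: multiply by a common denominator, argue in the module, and divide again. The number
  \<open>\<delta>\<close> is the degree of the map.\<close>

lemma hh_module_iso:
  fixes \<phi> :: "('n::{finite,linorder}, 'k::field) vec \<Rightarrow> ('n, 'k) vec"
  assumes g: "gsubm es A" "gsubm es B" "gsubm es' A'" "gsubm es' B'" "B' \<subseteq> A'"
    and add: "\<And>u v. \<phi> (u + v) = \<phi> u + \<phi> v"
    and scale: "\<And>c v. \<phi> (c *\<^sub>f v) = c *\<^sub>f \<phi> v"
    and shift: "\<And>e v. \<phi> (sh e v) = sh e (\<phi> v)"
    and comp: "\<And>s v. hcomp es' (s + \<delta>) (\<phi> v) = \<phi> (hcomp es s v)"
    and fA: "\<And>v. v \<in> A \<Longrightarrow> \<phi> v \<in> A'" and fB: "\<And>v. v \<in> B \<Longrightarrow> \<phi> v \<in> B'"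
    and onto: "\<And>v'. v' \<in> A' \<Longrightarrow> \<exists>v\<in>A. v' - \<phi> v \<in> B'"
    and inj: "\<And>v. v \<in> A \<Longrightarrow> \<phi> v \<in> B' \<Longrightarrow> v \<in> B"
  shows "hh es p t A B = hh es' p (t + \<delta>) A' B'"
proof -
  have "pair_iso \<phi> es es' t (t + \<delta>) A B A' B'"
  proof
    fix v :: "('n, 'k) vec" assume "v \<in> Vt es t"
    hence "\<phi> v = hcomp es' (t + \<delta>) (\<phi> v)" by (simp add: comp hcomp_Vt_eq)
    thus "\<phi> v \<in> Vt es' (t + \<delta>)" using hcomp_Vt by metis
  next
    fix v :: "('n, 'k) vec" and S assume "v \<in> loc S A"
    thus "\<phi> v \<in> loc S A'" using fA by (auto simp: loc_def simp flip: shift)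
  next
    fix v :: "('n, 'k) vec" and S assume "v \<in> loc S B"
    thus "\<phi> v \<in> loc S B'" using fB by (auto simp: loc_def simp flip: shift)
  next
    fix v' :: "('n, 'k) vec" and S assume v': "v' \<in> loc S A'" "v' \<in> Vt es' (t + \<delta>)"
    then obtain a :: nat where a: "sh (xpow S (int a)) v' \<in> A'" by (auto simp: loc_def)
    let ?x = "xpow S (int a)"
    obtain u where u: "u \<in> A" "sh ?x v' - \<phi> u \<in> B'" using onto[OF a] by blast
    let ?s = "t + edeg ?x"
    have "hcomp es' (?s + \<delta>) (sh ?x v' - \<phi> u) \<in> B'" using gsubm_hcomp[OF g(4) u(2)] .
    moreover have "hcomp es' (?s + \<delta>) (sh ?x v') = sh ?x v'"
      using v'(2) by (simp add: hcomp_sh hcomp_Vt_eq[of v'])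
    ultimately have 1: "sh ?x v' - \<phi> (hcomp es ?s u) \<in> B'" by (simp add: hcomp_diff comp)
    define w where "w = sh (- ?x) (hcomp es ?s u)"
    have w: "sh ?x w = hcomp es ?s u" by (simp add: w_def)
    have "w \<in> loc S A" unfolding loc_def using w gsubm_hcomp[OF g(1) u(1)] by (auto intro!: exI[of _ a])
    moreover have "w \<in> Vt es t" by (simp add: w_def sh_Vt_iff)
    moreover have "sh ?x (v' - \<phi> w) \<in> B'" using 1 by (simp add: sh_diff w flip: shift)
    hence "v' - \<phi> w \<in> loc S B'" unfolding loc_def by blast
    ultimately show "\<exists>v\<in>loc S A \<inter> Vt es t. v' - \<phi> v \<in> loc S B'" by blast
  next
    fix v :: "('n, 'k) vec" and S assume v: "v \<in> loc S A" "\<phi> v \<in> loc S B'"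
    obtain a where a: "\<And>c. c \<ge> a \<Longrightarrow> sh (xpow S (int c)) v \<in> A" using loc_ge[OF g(1) v(1)] by blast
    obtain b where b: "\<And>c. c \<ge> b \<Longrightarrow> sh (xpow S (int c)) (\<phi> v) \<in> B'" using loc_ge[OF g(4) v(2)] by blast
    have "sh (xpow S (int (max a b))) v \<in> B"
      by (rule inj) (use a b in \<open>auto simp: shift simp del: of_nat_max\<close>)
    thus "v \<in> loc S B" unfolding loc_def by blast
  qed (fact assms)+
  thus ?thesis by (rule pair_iso.hh_eq)
qed

text \<open>In positive cohomological degree only nonempty sets of variables occur, and there every
  element of the localized \<open>A\<close> already lies in the localized \<open>B\<close>; so all
  cochains are trivial modulo \<open>B\<close>.\<close>

lemma hh_torsion:
  assumes "gsubm es A" "gsubm es B" "p > 0" "\<And>S. S \<noteq> {} \<Longrightarrow> loc S A \<subseteq> loc S B"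
  shows "hh es p t A B = 0"
  unfolding hh_def
proof (rule rdim_eq_0, rule subsetI)
  fix z assume z: "z \<in> Zc es p t A B"
  have "z \<in> CC p B"
    unfolding CC_def mem_Collect_eq
  proof
    fix S
    have "slice z S \<in> (if card S = p then loc S A else {0})" using z by (auto simp: Zc_def CC_def)
    thus "slice z S \<in> (if card S = p then loc S B else {0})"
      using assms(3) assms(4)[of S] by (cases "S = {}") (auto split: if_splits)
  qed
  hence "cd 0 + z \<in> Bc es p t A B"
    using z fun_vs.subspace_0[OF Cprev_subspace[OF assms(1)]] Ct_closed(1)
    by (intro Bc_I) (auto simp: Zc_def)
  thus "z \<in> Bc es p t A B" by simp
qed

text \<open>A cochain of degree 0 is determined by its component at the empty set, which is an
  element of \<open>A\<close> itself; there are no coboundaries, so the class is trivial only modulo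
  \<open>B\<close>.\<close>

lemma hh_zeroth_le:
  assumes g: "gsubm es A" "gsubm es B"
  shows "hh es 0 t A B \<le> rdim (A \<inter> Vt es t) B"
  unfolding hh_def
proof (rule rdim_le_rel[where R = "\<lambda>c v. slice c {} = v \<and> c \<in> Ct es t \<and> (\<forall>S. S \<noteq> {} \<longrightarrow> slice c S = 0)"])
  fix z assume z: "z \<in> Zc es 0 t A B"
  have "slice z S = 0" if "S \<noteq> {}" for S
  proof -
    have "slice z S \<in> (if card S = 0 then loc S A else {0})" using z by (auto simp: Zc_def CC_def)
    thus ?thesis using that by simp
  qed
  moreover have "slice z {} \<in> A"
  proof -
    have "slice z {} \<in> (if card ({} :: 'a set) = 0 then loc {} A else {0})" using z unfolding Zc_def CC_def by blast
    thus ?thesis by simp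
  qed
  ultimately show "\<exists>v\<in>A \<inter> Vt es t. slice z {} = v \<and> z \<in> Ct es t \<and> (\<forall>S. S \<noteq> {} \<longrightarrow> slice z S = 0)"
    using z by (auto simp: Zc_def Ct_def)
next
  fix z v assume h: "slice z {} = v \<and> z \<in> Ct es t \<and> (\<forall>S. S \<noteq> {} \<longrightarrow> slice z S = 0)" "v \<in> B"
  have "z \<in> CC 0 B"
    unfolding CC_def mem_Collect_eq
  proof
    fix S
    show "slice z S \<in> (if card S = 0 then loc S B else {0})" using h by (cases "S = {}") auto
  qed
  hence "cd 0 + z \<in> Bc es 0 t A B"
    using h fun_vs.subspace_0[OF Cprev_subspace[OF g(1)]] Ct_closed(1) by (intro Bc_I) auto
  thus "z \<in> Bc es 0 t A B" by simp
qed (auto simp: slice_add slice_scale Ct_closed fun_vs.subspace_0[OF gsubm_subspace[OF g(2)]])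

lemma hh_large:
  fixes A B :: "('n::{finite,linorder}, 'k::field) vec set"
  assumes "gsubm es A" "gsubm es B" "p > CARD('n)"
  shows "hh es p t A B = 0"
  unfolding hh_def
proof (rule rdim_eq_0, rule subsetI)
  fix z assume "z \<in> Zc es p t A B"
  hence zS: "slice z S \<in> (if card S = p then loc S A else {0})" for S by (auto simp: Zc_def CC_def)
  have "slice z S = 0" for S
  proof -
    have "card S \<noteq> p" using card_mono[of UNIV S] assms(3) by auto
    thus ?thesis using zS[of S] by simp
  qed
  hence "z = 0" by (intro coch_eqI) simp
  thus "z \<in> Bc es p t A B" using Bc_0[OF assms(1,2)] by simp
qed

section \<open>Cohomology of free modules\<close>

lemma loc_FF:
  fixes v :: "('n::finite, 'k::field) vec"
  shows "v \<in> loc S (FF m) \<longleftrightarrow>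
    finite {x. v x \<noteq> 0} \<and> (\<forall>b e. v (b, e) \<noteq> 0 \<longrightarrow> b < m \<and> (\<forall>s. s \<notin> S \<longrightarrow> 0 \<le> e s))"
proof
  assume "v \<in> loc S (FF m)"
  then obtain a :: nat where a: "sh (xpow S (int a)) v \<in> FF m" by (auto simp: loc_def)
  let ?x = "xpow S (int a)"
  have v: "v = sh (- ?x) (sh ?x v)" by simp
  have "{x. v x \<noteq> 0} \<subseteq> (\<lambda>(b, e). (b, e - ?x)) ` {x. sh ?x v x \<noteq> 0}"
  proof clarify
    fix b e assume "v (b, e) \<noteq> 0"
    thus "(b, e) \<in> (\<lambda>(b, e). (b, e - ?x)) ` {x. sh ?x v x \<noteq> 0}"
      by (intro image_eqI[of _ _ "(b, e + ?x)"]) (auto simp: sh_apply)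
  qed
  moreover have "finite {x. sh ?x v x \<noteq> 0}" using a by (simp add: FF_def)
  ultimately have "finite {x. v x \<noteq> 0}" by (rule finite_surj[rotated])
  moreover have "b < m \<and> (\<forall>s. s \<notin> S \<longrightarrow> 0 \<le> e s)" if "v (b, e) \<noteq> 0" for b e
  proof -
    have "sh ?x v (b, e + ?x) \<noteq> 0" using that by (simp add: sh_apply)
    hence "b < m \<and> (\<forall>s. 0 \<le> (e + ?x) s)" using a unfolding FF_def by blast
    thus ?thesis by (auto simp: xpow_def split: if_splits)
  qed
  ultimately show "finite {x. v x \<noteq> 0} \<and> (\<forall>b e. v (b, e) \<noteq> 0 \<longrightarrow> b < m \<and> (\<forall>s. s \<notin> S \<longrightarrow> 0 \<le> e s))"
    by blast
next
  assume *: "finite {x. v x \<noteq> 0} \<and> (\<forall>b e. v (b, e) \<noteq> 0 \<longrightarrow> b < m \<and> (\<forall>s. s \<notin> S \<longrightarrow> 0 \<le> e s))"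
  \<comment> \<open>A common denominator: the support is finite, so one number dominates all
    exponents that occur.\<close>
  define N where "N = (\<Sum>x\<in>{x. v x \<noteq> 0}. \<Sum>s\<in>UNIV. nat \<bar>snd x s\<bar>)"
  have N: "- e s \<le> int N" if "v (b, e) \<noteq> 0" for b e s
  proof -
    have "nat \<bar>e s\<bar> \<le> (\<Sum>s\<in>UNIV. nat \<bar>e s\<bar>)" by (rule member_le_sum) auto
    also have "\<dots> = (\<Sum>s\<in>UNIV. nat \<bar>snd (b, e) s\<bar>)" by simp
    also have "\<dots> \<le> N" unfolding N_def
      by (rule member_le_sum[of "(b, e)" _ "\<lambda>x. \<Sum>s\<in>UNIV. nat \<bar>snd x s\<bar>"]) (use * that in auto)
    finally show ?thesis by linarith
  qed
  let ?x = "xpow S (int N)"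
  have "{x. sh ?x v x \<noteq> 0} \<subseteq> (\<lambda>(b, e). (b, e + ?x)) ` {x. v x \<noteq> 0}"
    by (force simp: sh_def image_iff)
  hence "finite {x. sh ?x v x \<noteq> 0}" using * finite_surj by blast
  moreover have "b < m \<and> (\<forall>s. 0 \<le> e s)" if h: "sh ?x v (b, e) \<noteq> 0" for b e
  proof -
    have v: "v (b, e - ?x) \<noteq> 0" using h by (simp add: sh_apply)
    have "0 \<le> e s" for s
    proof (cases "s \<in> S")
      case True
      thus ?thesis using N[OF v, of s] by (simp add: xpow_def)
    next
      case False
      hence "0 \<le> (e - ?x) s" using * v by blast
      thus ?thesis using False by (simp add: xpow_def)
    qed
    thus ?thesis using * v by blast
  qed
  ultimately have "sh ?x v \<in> FF m" by (simp add: FF_def)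
  thus "v \<in> loc S (FF m)" unfolding loc_def by blast
qed

text \<open>
  In each exponent that is not strictly negative the complex contracts onto a variable with
  nonnegative exponent.
\<close>

lemma cech_free_exact:
  fixes z :: "('n::{finite,linorder}, 'k::field) coch"
  assumes z: "z \<in> CC p (FF m)" "z \<in> Ct es t" "cd z = 0"
    and neg: "\<And>S b e. (\<And>s. e s < 0) \<Longrightarrow> z (S, b, e) = 0"
  obtains u where "u \<in> Cprev p (FF m)" "u \<in> Ct es t" "z = cd u"
proof -
  \<comment> \<open>The chosen variable depends on the exponent only and not on the set, so that at
    each exponent the homotopy \<open>u\<close> inserts one fixed variable.\<close>
  define \<sigma> where "\<sigma> = (\<lambda>e :: 'n \<Rightarrow> int. SOME s. 0 \<le> e s)"
  have \<sigma>: "0 \<le> e (\<sigma> e)" if "\<exists>s. 0 \<le> e s" for e using someI_ex[OF that] by (simp add: \<sigma>_def)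
  define u where "u = (\<lambda>(S, b, e). if (\<exists>s. 0 \<le> e s) \<and> \<sigma> e \<notin> S
      then csgn (insert (\<sigma> e) S) (\<sigma> e) * z (insert (\<sigma> e) S, b, e) else 0)"
  have "cd u (T, b, e) = z (T, b, e)" for T b e
  proof (cases "\<exists>s. 0 \<le> e s")
    case False
    hence "z (T, b, e) = 0" by (intro neg) (simp add: not_le)
    thus ?thesis using False by (simp add: cd_def u_def)
  next
    case ex: True
    let ?s = "\<sigma> e"
    show ?thesis
    proof (cases "?s \<in> T")
      case True
      have "cd u (T, b, e) = (\<Sum>s\<in>T. if s = ?s then z (T, b, e) else 0)"
        unfolding cd_def prod.case
      proof (rule sum.cong[OF refl])
        fix s assume "s \<in> T"
        show "csgn T s * u (T - {s}, b, e) = (if s = ?s then z (T, b, e) else 0)"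
          using True ex \<open>s \<in> T\<close> by (simp add: u_def insert_absorb flip: mult.assoc)
      qed
      also have "\<dots> = z (T, b, e)" using True by simp
      finally show ?thesis .
    next
      case False
      let ?T = "insert ?s T"
      \<comment> \<open>The cocycle condition at \<open>insert (\<sigma> e) T\<close> expresses the
        value of \<open>z\<close> at \<open>T\<close> through its values at sets that contain
        \<open>\<sigma> e\<close>.\<close>
      have "0 = cd z (?T, b, e)" using z(3) by simp
      also have "\<dots> = csgn ?T ?s * z (T, b, e) + (\<Sum>s\<in>T. csgn ?T s * z (?T - {s}, b, e))"
        using False by (simp add: cd_def)
      finally have "csgn ?T ?s * z (T, b, e) = - (\<Sum>s\<in>T. csgn ?T s * z (?T - {s}, b, e))"
        by (simp only: eq_neg_iff_add_eq_0)
      hence "csgn ?T ?s * (csgn ?T ?s * z (T, b, e)) =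
          - (csgn ?T ?s * (\<Sum>s\<in>T. csgn ?T s * z (?T - {s}, b, e)))"
        by simp
      hence zT: "z (T, b, e) = (\<Sum>s\<in>T. - (csgn ?T ?s * csgn ?T s * z (?T - {s}, b, e)))"
        by (simp add: sum_distrib_left sum_negf flip: mult.assoc)
      have "cd u (T, b, e) = (\<Sum>s\<in>T. csgn T s * u (T - {s}, b, e))" by (simp add: cd_def)
      also have "\<dots> = (\<Sum>s\<in>T. - (csgn ?T ?s * csgn ?T s * z (?T - {s}, b, e)))"
      proof (rule sum.cong[OF refl])
        fix s assume s: "s \<in> T"
        have ne: "s \<noteq> ?s" using s False by auto
        have eqT: "insert ?s (T - {s}) = ?T - {s}" "?T - {?s} = T" using ne False by auto
        have "csgn ?T ?s * csgn T s = - (csgn ?T s * csgn (?T - {s}) ?s :: 'k)"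
          using csgn_anticomm[of ?s ?T s, where 'k = 'k] s ne eqT by auto
        hence "csgn ?T ?s * (csgn ?T ?s * csgn T s) * csgn (?T - {s}) ?s =
            - (csgn ?T ?s * csgn ?T s * (csgn (?T - {s}) ?s * csgn (?T - {s}) ?s) :: 'k)"
          by simp
        hence "csgn T s * csgn (?T - {s}) ?s = - (csgn ?T ?s * csgn ?T s :: 'k)"
          by (simp flip: mult.assoc)
        thus "csgn T s * u (T - {s}, b, e) = - (csgn ?T ?s * csgn ?T s * z (?T - {s}, b, e))"
          using ex False eqT by (simp add: u_def flip: mult.assoc)
      qed
      finally show ?thesis using zT by simp
    qed
  qed
  hence zu: "z = cd u" by (auto simp: fun_eq_iff)
  have uz: "z (insert (\<sigma> e) S, b, e) \<noteq> 0 \<and> \<sigma> e \<notin> S \<and> 0 \<le> e (\<sigma> e)" if "u (S, b, e) \<noteq> 0" for S b e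
    using that \<sigma>[of e] by (auto simp: u_def split: if_splits)
  have zS: "slice z S \<in> (if card S = p then loc S (FF m) else {0})" for S using z by (auto simp: CC_def)
  have "u \<in> Ct es t"
    unfolding Ct_def Vt_def
  proof clarify
    fix S b e assume "slice u S (b, e) \<noteq> 0"
    hence "slice z (insert (\<sigma> e) S) (b, e) \<noteq> 0" using uz by (simp add: slice_def)
    thus "edeg e + es b = t" using z(2) unfolding Ct_def Vt_def by blast
  qed
  have card: "card S + 1 = p" if "u (S, b, e) \<noteq> 0" for S b e
  proof -
    from uz[OF that] have "slice z (insert (\<sigma> e) S) \<noteq> 0" "\<sigma> e \<notin> S" by (auto simp: slice_def fun_eq_iff)
    hence "card (insert (\<sigma> e) S) = p" using zS by (metis singletonD)
    thus ?thesis using \<open>\<sigma> e \<notin> S\<close> by simp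
  qed
  \<comment> \<open>The component of \<open>z\<close> at \<open>insert (\<sigma> e) S\<close> might
    have a denominator in the variable \<open>\<sigma> e\<close>, but the exponent there is
    nonnegative by the choice of \<open>\<sigma>\<close>; so \<open>u\<close> needs denominators in
    \<open>S\<close> only.\<close>
  have locu: "slice u S \<in> loc S (FF m)" for S
    unfolding loc_FF
  proof (intro conjI allI impI)
    have finz: "finite {x. slice z T x \<noteq> 0}" for T
      using zS[of T] by (auto simp: loc_FF split: if_splits)
    have "{x. slice u S x \<noteq> 0} \<subseteq> (\<Union>s. {x. slice z (insert s S) x \<noteq> 0})"
      using uz by (auto simp: slice_def)
    thus "finite {x. slice u S x \<noteq> 0}" by (rule finite_subset) (auto simp: finz)
    fix b e assume h: "slice u S (b, e) \<noteq> 0"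
    hence nz: "slice z (insert (\<sigma> e) S) (b, e) \<noteq> 0" and \<sigma>e: "0 \<le> e (\<sigma> e)" using uz by (auto simp: slice_def)
    have "card (insert (\<sigma> e) S) = p" using nz zS by (metis singletonD zero_fun_apply)
    hence "slice z (insert (\<sigma> e) S) \<in> loc (insert (\<sigma> e) S) (FF m)" using zS by metis
    hence *: "b < m" "\<forall>s. s \<notin> insert (\<sigma> e) S \<longrightarrow> 0 \<le> e s" using nz unfolding loc_FF by blast+
    show "b < m" by fact
    fix s assume "s \<notin> S"
    thus "0 \<le> e s" using * \<sigma>e by (cases "s = \<sigma> e") auto
  qed
  have "u \<in> Cprev p (FF m)"
  proof (cases p)
    case 0
    hence "u = 0" using card by (auto simp: fun_eq_iff)
    thus ?thesis using 0 by (simp add: Cprev_def)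
  next
    case (Suc q)
    have "slice u S \<in> (if card S = q then loc S (FF m) else {0})" for S
    proof (cases "card S = q")
      case False
      hence "slice u S = 0" using card Suc by (force simp: slice_def fun_eq_iff)
      thus ?thesis using False by simp
    qed (simp add: locu)
    thus ?thesis using Suc by (simp add: Cprev_def CC_def)
  qed
  thus ?thesis using that zu \<open>u \<in> Ct es t\<close> by blast
qed

lemma CC_zero [simp]: "CC p {0} = {0}"
  by (auto simp: CC_def intro: coch_eqI)

lemma Bc_cdI: "u \<in> Cprev p A \<Longrightarrow> u \<in> Ct es t \<Longrightarrow> cd u \<in> Bc es p t A {0}"
  using Bc_I[of u p A es t 0 "{0}"] by (simp add: Ct_closed)

text \<open>Strictly negative exponents are the only obstruction in \<open>cech_free_exact\<close>.
  They occur at the full set of variables alone, so for \<open>p = CARD('n)\<close>, and then in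
  degrees at most \<open>es b - CARD('n)\<close>; each alternative of the assumption excludes
  this.\<close>

lemma hh_free_eq_0:
  assumes "p < CARD('n) \<or> (\<forall>b<m. t > es b - int CARD('n))"
  shows "hh es p t (FF m :: ('n::{finite,linorder}, 'k::field) vec set) {0} = 0"
  unfolding hh_def
proof (rule rdim_eq_0, rule subsetI)
  fix z :: "('n, 'k) coch" assume z: "z \<in> Zc es p t (FF m) {0}"
  have "z (S, b, e) = 0" if e: "\<And>s. e s < 0" for S b e
  proof (rule ccontr)
    assume nz: "z (S, b, e) \<noteq> 0"
    have "slice z S \<in> (if card S = p then loc S (FF m) else {0})" using z by (auto simp: Zc_def CC_def)
    moreover have "slice z S (b, e) \<noteq> 0" using nz by (simp add: slice_def)
    ultimately have "card S = p" "slice z S \<in> loc S (FF m)" by (auto split: if_splits)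
    hence S: "b < m" "\<forall>s. s \<notin> S \<longrightarrow> 0 \<le> e s" using \<open>slice z S (b, e) \<noteq> 0\<close> unfolding loc_FF by blast+
    hence "S = UNIV" using e by (auto simp: not_less[symmetric])
    hence "p = CARD('n)" using \<open>card S = p\<close> by simp
    hence "t > es b - int CARD('n)" using assms S by simp
    moreover have "edeg e + es b = t" using z nz by (auto simp: Zc_def Ct_def Vt_def slice_def)
    moreover have "edeg e \<le> - int CARD('n)"
    proof -
      have "edeg e \<le> (\<Sum>s\<in>(UNIV :: 'n set). - 1)" unfolding edeg_def
      proof (rule sum_mono)
        fix s show "e s \<le> - 1" using e[of s] by simp
      qed
      thus ?thesis by simp
    qed
    ultimately show False by simp
  qed
  moreover have "z \<in> CC p (FF m)" "z \<in> Ct es t" "cd z = 0" using z by (auto simp: Zc_def)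
  ultimately obtain u where "u \<in> Cprev p (FF m)" "u \<in> Ct es t" "z = cd u"
    using cech_free_exact[of z p m es t] by metis
  thus "z \<in> Bc es p t (FF m) {0}" using Bc_cdI by blast
qed

section \<open>Maps of free modules\<close>

text \<open>The homomorphism that sends the basis vector \<open>a\<close> to \<open>g a\<close>,
  written as a convolution over the support of \<open>g a\<close>. In this form it acts on arbitrary
  Laurent vectors, so one operator serves all localizations.\<close>

definition mat :: "nat \<Rightarrow> (nat \<Rightarrow> ('n, 'k::field) vec) \<Rightarrow> ('n, 'k) vec \<Rightarrow> ('n, 'k) vec" where
  "mat m g v = (\<lambda>(b, e). \<Sum>a<m. \<Sum>x\<in>{x. g a (b, x) \<noteq> 0}. g a (b, x) * v (a, e - x))"

definition bas :: "nat \<Rightarrow> ('n, 'k::field) vec" where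
  "bas a = (\<lambda>(b, e). if b = a \<and> e = 0 then 1 else 0)"

lemma mat_add: "mat m g (u + v) = mat m g u + mat m g v"
  by (auto simp: mat_def fun_eq_iff sum.distrib algebra_simps)

lemma mat_scale: "mat m g (c *\<^sub>f v) = c *\<^sub>f mat m g v"
  by (auto simp: mat_def fun_eq_iff sum_distrib_left algebra_simps)

lemma mat_sh: "mat m g (sh e v) = sh e (mat m g v)"
  by (auto simp: mat_def sh_def fun_eq_iff algebra_simps)

lemma mat_zero [simp]: "mat m g 0 = 0"
  by (auto simp: mat_def fun_eq_iff)

lemma mat_diff: "mat m g (u - v) = mat m g u - mat m g v"
  by (auto simp: mat_def fun_eq_iff sum_subtractf algebra_simps)

lemma mat_act: "mat m g (act p v) = act p (mat m g v)"
proof -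
  have sum: "mat m g (\<Sum>i\<in>I. f i) = (\<Sum>i\<in>I. mat m g (f i))" for I and f :: "'c \<Rightarrow> _"
  proof (induction I rule: infinite_finite_induct)
    case (insert x F)
    show ?case unfolding sum.insert[OF insert(1,2)] mat_add insert(3) ..
  next
    case (infinite A)
    show ?case unfolding sum.infinite[OF infinite] mat_zero ..
  next
    case empty
    show ?case unfolding sum.empty mat_zero ..
  qed
  show ?thesis unfolding act_def sum mat_scale mat_sh ..
qed

lemma mat_hcomp:
  assumes "\<And>a. a < m \<Longrightarrow> g a \<in> Vt es (es' a)"
  shows "hcomp es t (mat m g v) = mat m g (hcomp es' t v)"
proof
  fix y :: "nat \<times> ('a \<Rightarrow> int)"
  obtain b e where y: "y = (b, e)" by (cases y)
  have "g a (b, x) * hcomp es' t v (a, e - x) = (if edeg e + es b = t then g a (b, x) * v (a, e - x) else 0)"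
    if "a < m" "g a (b, x) \<noteq> 0" for a x
  proof -
    have "edeg x + es b = es' a" using assms that by (auto simp: Vt_def)
    hence "edeg (e - x) + es' a = edeg e + es b" by simp
    thus ?thesis by (simp add: hcomp_def)
  qed
  thus "hcomp es t (mat m g v) y = mat m g (hcomp es' t v) y"
    unfolding y by (auto simp: hcomp_def[of es] mat_def intro!: sum.cong sum.neutral)
qed

lemma mat_expand:
  assumes v: "finite {x. v x \<noteq> 0}" "\<And>b e. v (b, e) \<noteq> 0 \<Longrightarrow> b < m"
    and g: "\<And>a. a < m \<Longrightarrow> finite {x. g a x \<noteq> 0}"
  shows "mat m g v = (\<Sum>x\<in>{x. v x \<noteq> 0}. v x *\<^sub>f sh (snd x) (g (fst x)))"
proof
  fix y :: "nat \<times> ('a \<Rightarrow> int)"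
  obtain b e where y: "y = (b, e)" by (cases y)
  let ?S = "{x. v x \<noteq> 0}"
  have fing: "finite {x. g a (b, x) \<noteq> 0}" if "a < m" for a
  proof -
    have "{x. g a (b, x) \<noteq> 0} \<subseteq> snd ` {x. g a x \<noteq> 0}" by force
    thus ?thesis using g[OF that] finite_surj by blast
  qed
  have finv: "finite {y. v (a, y) \<noteq> 0}" for a
  proof -
    have "{y. v (a, y) \<noteq> 0} \<subseteq> snd ` {x. v x \<noteq> 0}" by force
    thus ?thesis using v(1) finite_surj by blast
  qed
  have inner: "(\<Sum>x\<in>{x. g a (b, x) \<noteq> 0}. g a (b, x) * v (a, e - x)) =
      (\<Sum>y\<in>{y. v (a, y) \<noteq> 0}. v (a, y) * g a (b, e - y))" if "a < m" for a
  proof -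
    let ?X = "{x. g a (b, x) \<noteq> 0 \<and> v (a, e - x) \<noteq> 0}" and ?Y = "{y. v (a, y) \<noteq> 0 \<and> g a (b, e - y) \<noteq> 0}"
    have "(\<Sum>x\<in>{x. g a (b, x) \<noteq> 0}. g a (b, x) * v (a, e - x)) = (\<Sum>x\<in>?X. g a (b, x) * v (a, e - x))"
      by (rule sum.mono_neutral_right) (use fing[OF that] in auto)
    also have "\<dots> = (\<Sum>y\<in>?Y. v (a, y) * g a (b, e - y))"
      by (rule sum.reindex_bij_witness[of _ "\<lambda>y. e - y" "\<lambda>x. e - x"]) auto
    also have "\<dots> = (\<Sum>y\<in>{y. v (a, y) \<noteq> 0}. v (a, y) * g a (b, e - y))"
      by (rule sum.mono_neutral_left) (use finv in auto)
    finally show ?thesis .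
  qed
  have S: "?S = (SIGMA a:{..<m}. {y. v (a, y) \<noteq> 0})" using v(2) by auto
  have "mat m g v y = (\<Sum>a<m. \<Sum>y\<in>{y. v (a, y) \<noteq> 0}. v (a, y) * g a (b, e - y))"
    unfolding mat_def y prod.case by (rule sum.cong[OF refl]) (simp add: inner)
  also have "\<dots> = (\<Sum>x\<in>?S. v x * g (fst x) (b, e - snd x))"
    unfolding S by (subst sum.Sigma) (use finv in \<open>auto intro!: sum.cong\<close>)
  also have "\<dots> = (\<Sum>x\<in>?S. v x *\<^sub>f sh (snd x) (g (fst x))) y"
    unfolding sum_fun_apply y by (simp add: sh_apply)
  finally show "mat m g v y = (\<Sum>x\<in>?S. v x *\<^sub>f sh (snd x) (g (fst x))) y" .
qed

lemma mat_in:
  assumes K: "gsubm es K" "K \<subseteq> FF m'" and g: "\<And>a. a < m \<Longrightarrow> g a \<in> K" and v: "v \<in> FF m"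
  shows "mat m g v \<in> K"
proof -
  have fin: "finite {x. g a x \<noteq> 0}" if "a < m" for a
    using g[OF that] K(2) by (auto simp: FF_def)
  have "mat m g v = (\<Sum>x\<in>{x. v x \<noteq> 0}. v x *\<^sub>f sh (snd x) (g (fst x)))"
    by (rule mat_expand) (use v fin in \<open>auto simp: FF_def\<close>)
  also have "\<dots> \<in> K"
    by (intro fun_vs.subspace_sum fun_vs.subspace_scale gsubm_subspace[OF K(1)] gsubm_sh[OF K(1)] g)
       (use v in \<open>auto simp: FF_def\<close>)
  finally show ?thesis .
qed

lemma bas_FF:
  assumes "a < m"
  shows "(bas a :: ('n, 'k::field) vec) \<in> FF m"
proof -
  have "{x. (bas a :: ('n, 'k) vec) x \<noteq> 0} \<subseteq> {(a, 0)}" by (auto simp: bas_def split: if_splits)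
  hence "finite {x. (bas a :: ('n, 'k) vec) x \<noteq> 0}" by (rule finite_subset) auto
  thus ?thesis using assms by (auto simp: FF_def bas_def split: if_splits)
qed

lemma bas_Vt: "bas a \<in> Vt es (es a)"
  by (auto simp: Vt_def bas_def split: if_splits)

lemma mat_bas:
  assumes "a < m" "finite {x. g a x \<noteq> 0}"
  shows "mat m g (bas a) = g a"
proof
  fix y :: "nat \<times> ('a \<Rightarrow> int)"
  obtain b e where y: "y = (b, e)" by (cases y)
  have fing: "finite {x. g a (b, x) \<noteq> 0}"
  proof -
    have "{x. g a (b, x) \<noteq> 0} \<subseteq> snd ` {x. g a x \<noteq> 0}" by force
    thus ?thesis using assms(2) finite_surj by blast
  qed
  have "mat m g (bas a) y = (\<Sum>a'<m. if a' = a then (\<Sum>x\<in>{x. g a (b, x) \<noteq> 0}. if x = e then g a (b, x) else 0) else 0)"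
    unfolding mat_def y prod.case by (intro sum.cong refl) (auto simp: bas_def intro!: sum.cong)
  also have "\<dots> = g a y" using assms(1) fing y by (simp add: sum.delta)
  finally show "mat m g (bas a) y = g a y" .
qed

lemma gsubm_kernel:
  assumes "\<And>a. a < m \<Longrightarrow> g a \<in> Vt es (es' a)"
  shows "gsubm es' {v \<in> FF m. mat m g v = 0}"
  unfolding gsubm_def
proof (intro conjI allI ballI)
  show "fun_vs.subspace {v \<in> FF m. mat m g v = 0}"
    using FF_subspace[of m] unfolding fun_vs.subspace_def by (auto simp: mat_add mat_scale)
  fix v assume v: "v \<in> {v \<in> FF m. mat m g v = 0}"
  show "sh (expo a) v \<in> {v \<in> FF m. mat m g v = 0}" for a using v by (simp add: mat_sh sh_FF)
  show "hcomp es' t v \<in> {v \<in> FF m. mat m g v = 0}" for t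
    using v mat_hcomp[of m g es es' t v] assms by (simp add: hcomp_FF)
qed

section \<open>Finite generation of graded submodules\<close>

lemma nat_seq_mono_subseq:
  fixes f :: "nat \<Rightarrow> nat"
  shows "\<exists>r :: nat \<Rightarrow> nat. strict_mono r \<and> mono (\<lambda>i. f (r i))"
proof -
  obtain r :: "nat \<Rightarrow> nat" where r: "strict_mono r" "monoseq (\<lambda>i. f (r i))"
    using seq_monosub[of f] by blast
  show ?thesis
  proof (cases "incseq (\<lambda>i. f (r i))")
    case True
    thus ?thesis using r by blast
  next
    case False
    \<comment> \<open>A decreasing sequence of natural numbers is eventually constant, so a tail of
      it is nondecreasing as well.\<close>
    hence dec: "decseq (\<lambda>i. f (r i))" using r(2) by (simp add: monoseq_iff)
    obtain N where N: "\<And>i. f (r N) \<le> f (r i)"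
      using ex_has_least_nat[of "\<lambda>_. True" 0 "\<lambda>i. f (r i)"] by auto
    have "f (r (i + N)) = f (r N)" for i
      using N[of "i + N"] decseqD[OF dec, of N "i + N"] by simp
    hence "mono (\<lambda>i. f (r (i + N)))" by (simp add: mono_def)
    moreover have "strict_mono (\<lambda>i. r (i + N))" using r(1) by (simp add: strict_mono_def)
    ultimately show ?thesis by blast
  qed
qed

lemma nat_family_mono_subseq:
  fixes F :: "'x \<Rightarrow> nat \<Rightarrow> nat"
  assumes "finite X'"
  shows "\<exists>r :: nat \<Rightarrow> nat. strict_mono r \<and> (\<forall>x\<in>X'. mono (\<lambda>i. F x (r i)))"
  using assms
proof (induction X' rule: finite_induct)
  case empty
  show ?case by (rule exI[of _ id]) (simp add: strict_mono_def)
next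
  case (insert y Y)
  then obtain r :: "nat \<Rightarrow> nat" where r: "strict_mono r" "\<forall>x\<in>Y. mono (\<lambda>i. F x (r i))" by blast
  obtain q :: "nat \<Rightarrow> nat" where q: "strict_mono q" "mono (\<lambda>i. F y (r (q i)))"
    using nat_seq_mono_subseq[of "\<lambda>i. F y (r i)"] by blast
  have "mono (\<lambda>i. F x (r (q i)))" if "x \<in> Y" for x
    using r(2) that q(1) by (simp add: mono_def strict_mono_less_eq)
  moreover have "strict_mono (\<lambda>i. r (q i))" using r(1) q(1) by (simp add: strict_mono_def)
  ultimately show ?case using q by (intro exI[of _ "\<lambda>i. r (q i)"]) auto
qed

lemma dickson:
  fixes a :: "nat \<Rightarrow> 'n::finite \<Rightarrow>\<^sub>0 nat" and b :: "nat \<Rightarrow> nat"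
  assumes "\<And>i. b i \<le> m"
  shows "\<exists>i j c. i < j \<and> b i = b j \<and> a j = c + a i"
proof -
  \<comment> \<open>The component is recorded both as \<open>b i\<close> and as
    \<open>m - b i\<close>; if both are nondecreasing, it is constant.\<close>
  define F where "F = (\<lambda>x i. case x of Inl s \<Rightarrow> Poly_Mapping.lookup (a i) s | Inr c \<Rightarrow> if c then b i else m - b i)"
  obtain r :: "nat \<Rightarrow> nat" where r: "strict_mono r" "\<forall>x\<in>(UNIV :: ('n + bool) set). mono (\<lambda>i. F x (r i))"
    using nat_family_mono_subseq[of "UNIV :: ('n + bool) set" F] by auto
  have le: "F x (r 0) \<le> F x (r 1)" for x using r(2) by (simp add: mono_def)
  have s: "Poly_Mapping.lookup (a (r 0)) s \<le> Poly_Mapping.lookup (a (r 1)) s" for s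
    using le[of "Inl s"] by (simp add: F_def)
  have "b (r 0) = b (r 1)"
    using le[of "Inr True"] le[of "Inr False"] assms[of "r 0"] assms[of "r 1"] by (simp add: F_def)
  moreover have "a (r 1) = (a (r 1) - a (r 0)) + a (r 0)"
    by (rule poly_mapping_eqI) (use s in \<open>simp add: lookup_add lookup_minus\<close>)
  moreover have "r 0 < r 1" using r(1) by (simp add: strict_mono_def)
  ultimately show ?thesis by blast
qed

lemma finite_mon_deg_le: "finite {a :: 'n::finite \<Rightarrow>\<^sub>0 nat. mon_deg a \<le> N}"
proof (rule finite_imageD)
  have "Poly_Mapping.lookup a s \<le> N" if "mon_deg a \<le> N" for a :: "'n \<Rightarrow>\<^sub>0 nat" and s
    using that member_le_sum[of s UNIV "Poly_Mapping.lookup a"] by (simp add: mon_deg_def)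
  hence "Poly_Mapping.lookup ` {a :: 'n \<Rightarrow>\<^sub>0 nat. mon_deg a \<le> N} \<subseteq> (\<Pi>\<^sub>E s\<in>UNIV. {..N})"
    by (auto simp: PiE_UNIV_domain)
  thus "finite (Poly_Mapping.lookup ` {a :: 'n \<Rightarrow>\<^sub>0 nat. mon_deg a \<le> N})"
    by (rule finite_subset) (rule finite_PiE, simp_all)
  show "inj_on Poly_Mapping.lookup {a :: 'n \<Rightarrow>\<^sub>0 nat. mon_deg a \<le> N}"
    by (rule inj_onI) (rule poly_mapping_eq_iff[THEN iffD2])
qed

section \<open>Basis theorem for graded submodules, by leading positions\<close>

definition mspan :: "('n, 'k::field) vec set \<Rightarrow> ('n, 'k) vec set" where
  "mspan G = fun_vs.span {sh (expo a) f | a f. f \<in> G}"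

lemma mspan_sh: 
  assumes "v \<in> mspan G"
  shows "sh (expo a) v \<in> mspan G"
  using assms unfolding mspan_def
proof (induction rule: fun_vs.span_induct_alt)
  case base
  show ?case by (simp only: sh_zero fun_vs.span_zero)
next
  case (step c x y)
  then obtain b f where x: "x = sh (expo b) f" "f \<in> G" by auto
  have "sh (expo a) x \<in> {sh (expo a) f |a f. f \<in> G}" using x by (auto simp flip: expo_add)
  hence "sh (expo a) x \<in> fun_vs.span {sh (expo a) f |a f. f \<in> G}" by (rule fun_vs.span_base)
  thus ?case using step unfolding sh_add sh_scale by (intro fun_vs.span_add fun_vs.span_scale)
qed

lemma mspan_zero: "0 \<in> mspan G"
  unfolding mspan_def by (rule fun_vs.span_zero)

lemma mspan_base: "f \<in> G \<Longrightarrow> f \<in> mspan G"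
proof -
  assume "f \<in> G"
  moreover have "f = sh (expo 0) f" by simp
  ultimately show ?thesis unfolding mspan_def by (intro fun_vs.span_base) blast
qed

lemma mspan_sub: "fun_vs.subspace K \<Longrightarrow> (\<And>a v. v \<in> K \<Longrightarrow> sh (expo a) v \<in> K) \<Longrightarrow> G \<subseteq> K \<Longrightarrow> mspan G \<subseteq> K"
  unfolding mspan_def by (rule fun_vs.span_minimal) auto

text \<open>
  Leading positions for the lexicographic order; only homogeneous elements are compared, so
  that finitely many positions are in play and minimal ones exist.
\<close>

definition posn :: "('n, 'k::field) vec \<Rightarrow> (nat \<times> ('n \<Rightarrow>\<^sub>0 nat)) set" where
  "posn v = {(b, a). v (b, expo a) \<noteq> 0}"

definition leadp :: "('n::linorder, 'k::field) vec \<Rightarrow> nat \<times> ('n \<Rightarrow>\<^sub>0 nat)" where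
  "leadp v = Max (posn v)"

lemma finite_posn: "v \<in> FF m \<Longrightarrow> finite (posn v)"
proof -
  assume "v \<in> FF m"
  hence "finite ((\<lambda>(b, a). (b, expo a)) ` posn v)"
    by (auto simp: FF_def posn_def elim!: finite_subset[rotated])
  thus ?thesis by (rule finite_imageD) (auto simp: inj_on_def)
qed

lemma posn_nonempty: 
  fixes v :: "('n::finite, 'k::field) vec"
  assumes "v \<in> FF m" "v \<noteq> 0" 
  shows "posn v \<noteq> {}"
proof -
  obtain b e where be: "v (b, e) \<noteq> 0" using assms(2) by (auto simp: fun_eq_iff)
  hence "\<And>s. 0 \<le> e s" using assms(1) by (auto simp: FF_def)
  then obtain a where "e = expo a" using expo_exists by blast
  thus ?thesis using be by (auto simp: posn_def)
qed

text \<open>If no finite homogeneous set generates \<open>K\<close>, pick successively a homogeneous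
  element outside the span of its predecessors whose leading position is least among such elements
  of its degree. By \<open>dickson\<close> some leading monomial divides a later one in the same
  component; cancelling it yields an element of the same degree, still outside the span, with a
  smaller leading position.\<close>

lemma noetherian_mspan:
  fixes K :: "('n::{finite,linorder}, 'k::field) vec set"
  assumes K: "gsubm es K" "K \<subseteq> FF m"
  shows "\<exists>G. finite G \<and> G \<subseteq> K \<inter> (\<Union>t. Vt es t) \<and> K \<subseteq> mspan G"
proof (rule ccontr)
  assume no: "\<not> ?thesis"
  define H where "H = K \<inter> (\<Union>t. Vt es t)"
  note Ks = gsubm_subspace[OF K(1)]
  have ex: "\<exists>f t. f \<in> K \<inter> Vt es t - mspan G \<and> (\<forall>f'\<in>K \<inter> Vt es t - mspan G. leadp f \<le> leadp f')"
    if G: "finite G" "G \<subseteq> H" for G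
  proof -
    obtain v where v: "v \<in> K" "v \<notin> mspan G" using no G unfolding H_def by blast
    have "\<exists>t. hcomp es t v \<notin> mspan G"
    proof (rule ccontr)
      assume "\<not> ?thesis"
      moreover obtain T where "v = (\<Sum>t\<in>T. hcomp es t v)"
        using hcomp_decompose[of v es] v K(2) by (auto simp: FF_def)
      ultimately have "v \<in> mspan G"
        by (metis (mono_tags, lifting) mspan_def fun_vs.subspace_span fun_vs.subspace_sum)
      thus False using v by simp
    qed
    then obtain t where t: "hcomp es t v \<in> K \<inter> Vt es t - mspan G"
      using gsubm_hcomp[OF K(1) v(1)] by auto
    let ?L = "leadp ` (K \<inter> Vt es t - mspan G)"
    have "?L \<subseteq> (\<Union>b<m. Pair b ` {a. mon_deg a \<le> nat (t - es b)})"
    proof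
      fix y assume "y \<in> ?L"
      then obtain f where y: "y = leadp f" and f: "f \<in> K" "f \<in> Vt es t" "f \<notin> mspan G" by blast
      have "f \<noteq> 0" using f(3) mspan_zero[of G] by metis
      hence "leadp f \<in> posn f" unfolding leadp_def
        using finite_posn posn_nonempty f K(2) by (intro Max_in) blast+
      then obtain b a where ba: "leadp f = (b, a)" "f (b, expo a) \<noteq> 0" by (auto simp: posn_def)
      hence "b < m" using f K(2) by (auto simp: FF_def)
      moreover have "edeg (expo a) + es b = t" using ba f unfolding Vt_def by blast
      hence "mon_deg a \<le> nat (t - es b)" by simp
      ultimately show "y \<in> (\<Union>b<m. Pair b ` {a. mon_deg a \<le> nat (t - es b)})"
        using ba y by auto
    qed
    hence fin: "finite ?L" by (rule finite_subset) (auto intro!: finite_imageI finite_mon_deg_le)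
    have "Min ?L \<in> ?L" using t by (intro Min_in fin) blast
    then obtain f where f: "f \<in> K \<inter> Vt es t - mspan G" "leadp f = Min ?L" by auto
    have "leadp f \<le> leadp f'" if "f' \<in> K \<inter> Vt es t - mspan G" for f'
      unfolding f(2) using that by (intro Min_le fin) blast
    thus ?thesis using f by blast
  qed
  define nxt where "nxt = (\<lambda>G. SOME f. \<exists>t. f \<in> K \<inter> Vt es t - mspan G \<and>
      (\<forall>f'\<in>K \<inter> Vt es t - mspan G. leadp f \<le> leadp f'))"
  define Gs where "Gs = rec_nat {} (\<lambda>_ G. insert (nxt G) G)"
  define f where "f = (\<lambda>i. nxt (Gs i))"
  have Gs: "Gs 0 = {}" "\<And>i. Gs (Suc i) = insert (f i) (Gs i)" by (simp_all add: Gs_def f_def)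
  have fin_sub: "finite (Gs i) \<and> Gs i \<subseteq> H" for i
  proof (induction i)
    case (Suc i)
    have "f i \<in> H" unfolding f_def nxt_def H_def using someI_ex[OF ex[of "Gs i"]] Suc by blast
    thus ?case using Suc by (simp add: Gs)
  qed (simp add: Gs)
  have "\<exists>t. f i \<in> K \<inter> Vt es t - mspan (Gs i) \<and> (\<forall>f'\<in>K \<inter> Vt es t - mspan (Gs i). leadp (f i) \<le> leadp f')" for i
    unfolding f_def nxt_def using someI_ex[OF ex[of "Gs i"]] fin_sub by blast
  then obtain t where f: "\<And>i. f i \<in> K" "\<And>i. f i \<in> Vt es (t i)" "\<And>i. f i \<notin> mspan (Gs i)"
      and fmin: "\<And>i f'. f' \<in> K \<Longrightarrow> f' \<in> Vt es (t i) \<Longrightarrow> f' \<notin> mspan (Gs i) \<Longrightarrow> leadp (f i) \<le> leadp f'"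
    by (metis DiffE DiffI IntE IntI)
  have Gmono: "f i \<in> Gs j" if "i < j" for i j
    using that by (induction j) (auto simp: Gs less_Suc_eq)
  have "f i \<noteq> 0" for i using f(3)[of i] mspan_zero[of "Gs i"] by metis
  hence lead: "leadp (f i) \<in> posn (f i)" for i
    unfolding leadp_def using finite_posn posn_nonempty f(1) K(2) by (intro Max_in) blast+
  define b where "b = (\<lambda>i. fst (leadp (f i)))"
  define a where "a = (\<lambda>i. snd (leadp (f i)))"
  have lc: "f i (b i, expo (a i)) \<noteq> 0" for i using lead[of i] by (auto simp: posn_def b_def a_def split: prod.splits)
  have "f i \<in> FF m" for i using f(1) K(2) by blast
  hence "b i \<le> m" for i using lc[of i] unfolding FF_def by fastforce
  then obtain i j c where ij: "i < j" "b i = b j" "a j = c + a i" using dickson[of b m a] by blast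
  define r where "r = f j (b j, expo (a j)) / f i (b i, expo (a i))"
  define h where "h = sh (expo c) (f i)"
  define f' where "f' = f j - r *\<^sub>f h"
  have hK: "h \<in> K" unfolding h_def by (rule gsubm_sh[OF K(1) f(1)]) simp
  have hval: "h (b j, expo (a j)) = f i (b i, expo (a i))" using ij by (simp add: h_def sh_apply)
  \<comment> \<open>The degrees are compared through the leading positions: the shifted
    \<open>f i\<close> has the degree of \<open>f j\<close>, so the minimality of \<open>f j\<close>
    applies to the difference.\<close>
  have "edeg (expo (a j)) + es (b j) = t j" using f(2)[of j] lc[of j] unfolding Vt_def by blast
  moreover have "edeg (expo (a i)) + es (b i) = t i" using f(2)[of i] lc[of i] unfolding Vt_def by blast
  ultimately have tt: "t j - edeg (expo c) = t i" using ij by simp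
  have hV: "h \<in> Vt es (t j)" unfolding h_def sh_Vt_iff tt by (rule f(2))
  have f'K: "f' \<in> K" unfolding f'_def by (intro fun_vs.subspace_diff fun_vs.subspace_scale Ks f hK)
  have f'V: "f' \<in> Vt es (t j)"
    unfolding f'_def by (intro fun_vs.subspace_diff fun_vs.subspace_scale Vt_subspace f hV)
  have f'n: "f' \<notin> mspan (Gs j)"
  proof
    assume "f' \<in> mspan (Gs j)"
    moreover have "r *\<^sub>f h \<in> mspan (Gs j)"
      using mspan_sh[OF mspan_base[OF Gmono[OF ij(1)]]] unfolding h_def mspan_def
      by (intro fun_vs.span_scale) blast
    ultimately have "f' + r *\<^sub>f h \<in> mspan (Gs j)" unfolding mspan_def by (rule fun_vs.span_add)
    thus False using f(3)[of j] by (simp add: f'_def)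
  qed
  have le: "leadp (f j) \<le> leadp f'" by (rule fmin[OF f'K f'V f'n])
  have f'0: "f' \<noteq> 0" using f'n mspan_zero[of "Gs j"] by metis
  have finp: "finite (posn v)" if "v \<in> K" for v using finite_posn that K(2) by blast
  have l': "leadp f' \<in> posn f'"
    unfolding leadp_def using posn_nonempty f'K f'0 K(2) by (intro Max_in finp) blast+
  have up: "y \<le> leadp (f j)" if y: "y \<in> posn f'" for y
  proof -
    obtain b' a' where ba: "y = (b', a')" by (cases y)
    have "f j (b', expo a') \<noteq> 0 \<or> h (b', expo a') \<noteq> 0" using y by (auto simp: posn_def f'_def ba)
    thus ?thesis
    proof
      assume "f j (b', expo a') \<noteq> 0"
      thus ?thesis unfolding leadp_def using ba by (intro Max_ge finp f) (auto simp: posn_def)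
    next
      assume nz: "h (b', expo a') \<noteq> 0"
      hence v: "f i (b', expo a' - expo c) \<noteq> 0" by (simp add: h_def sh_apply)
      hence "\<And>s. 0 \<le> (expo a' - expo c) s" using f(1)[of i] K(2) unfolding FF_def by blast
      then obtain a'' where a'': "expo a' - expo c = expo a''" using expo_exists by blast
      hence "expo a' = expo (c + a'')" by (simp add: algebra_simps)
      hence a': "a' = c + a''" by (simp only: expo_inject)
      have "(b', a'') \<in> posn (f i)" using v a'' by (simp add: posn_def)
      hence "(b', a'') \<le> leadp (f i)" unfolding leadp_def by (intro Max_ge finp f)
      hence "(b', a'') \<le> (b i, a i)" by (simp add: a_def b_def)
      hence "(b', c + a'') \<le> (b i, c + a i)" by (auto simp: less_eq_prod_def add_left_mono)
      moreover have "leadp (f j) = (b i, c + a i)" using ij by (simp add: prod_eq_iff a_def b_def)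
      ultimately show ?thesis using a' ba by simp
    qed
  qed
  have "leadp f' \<noteq> leadp (f j)"
  proof
    assume "leadp f' = leadp (f j)"
    hence "f' (b j, expo (a j)) \<noteq> 0" using l' by (auto simp: posn_def a_def b_def split: prod.splits)
    moreover have "f' (b j, expo (a j)) = 0" using lc[of i] by (simp add: f'_def hval r_def)
    ultimately show False by simp
  qed
  thus False using up[OF l'] le by simp
qed

lemma noetherian_generators:
  fixes K :: "('n::{finite,linorder}, 'k::field) vec set"
  assumes K: "gsubm es K" "K \<subseteq> FF m"
  obtains m' es' g where "\<And>a. a < m' \<Longrightarrow> g a \<in> K" "\<And>a. a < m' \<Longrightarrow> g a \<in> Vt es (es' a)"
    "mat m' g ` FF m' = K"
proof -
  obtain G where G: "finite G" "G \<subseteq> K \<inter> (\<Union>t. Vt es t)" "K \<subseteq> mspan G"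
    using noetherian_mspan[OF K] by blast
  obtain xs where xs: "set xs = G" using finite_list[OF G(1)] by blast
  define g where "g = (\<lambda>a. xs ! a)"
  let ?m = "length xs"
  have gG: "g a \<in> G" if "a < ?m" for a using that xs by (auto simp: g_def)
  have "\<exists>t. g a \<in> Vt es t" if "a < ?m" for a using gG[OF that] G(2) by blast
  then obtain es' where es': "\<And>a. a < ?m \<Longrightarrow> g a \<in> Vt es (es' a)" by metis
  have gK: "g a \<in> K" if "a < ?m" for a using gG[OF that] G(2) by blast
  have "mat ?m g ` FF ?m = K"
  proof
    show "mat ?m g ` FF ?m \<subseteq> K" using mat_in[OF K, of ?m g] gK by blast
    have "mspan G \<subseteq> mat ?m g ` FF ?m"
    proof (rule mspan_sub)
      show "fun_vs.subspace (mat ?m g ` FF ?m)"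
        unfolding fun_vs.subspace_def
      proof (intro conjI ballI allI)
        show "0 \<in> mat ?m g ` FF ?m"
          using fun_vs.subspace_0[OF FF_subspace] mat_zero by (metis image_eqI)
        fix x y assume "x \<in> mat ?m g ` FF ?m" "y \<in> mat ?m g ` FF ?m"
        then obtain u v where "u \<in> FF ?m" "v \<in> FF ?m" "x = mat ?m g u" "y = mat ?m g v" by blast
        thus "x + y \<in> mat ?m g ` FF ?m"
          by (intro image_eqI[of _ _ "u + v"] fun_vs.subspace_add FF_subspace) (simp only: mat_add)
      next
        fix c x assume "x \<in> mat ?m g ` FF ?m"
        then obtain u where "u \<in> FF ?m" "x = mat ?m g u" by blast
        thus "c *\<^sub>f x \<in> mat ?m g ` FF ?m"
          by (intro image_eqI[of _ _ "c *\<^sub>f u"] fun_vs.subspace_scale FF_subspace) (simp only: mat_scale)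
      qed
      fix a v assume "v \<in> mat ?m g ` FF ?m"
      then obtain u where "u \<in> FF ?m" "v = mat ?m g u" by blast
      thus "sh (expo a) v \<in> mat ?m g ` FF ?m"
        by (intro image_eqI[of _ _ "sh (expo a) u"] sh_FF) (simp_all only: mat_sh expo_nonneg)
    next
      show "G \<subseteq> mat ?m g ` FF ?m"
      proof
        fix f assume "f \<in> G"
        then obtain a where a: "a < ?m" "f = g a" using xs by (metis g_def in_set_conv_nth)
        have "finite {x. g a x \<noteq> 0}" using gK[OF a(1)] K(2) by (auto simp: FF_def)
        hence "f = mat ?m g (bas a)" using mat_bas a by metis
        thus "f \<in> mat ?m g ` FF ?m" using bas_FF[OF a(1)] by blast
      qed
    qed
    thus "K \<subseteq> mat ?m g ` FF ?m" using G(3) by blast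
  qed
  thus ?thesis using that[of ?m g es'] gK es' by blast
qed

text \<open>The free module modulo the kernel of \<open>mat m g\<close> is isomorphic to the image
  \<open>K\<close>. This trades the cohomology of a submodule for that of a quotient of another free
  module, and so passes to syzygies.\<close>

lemma hh_image_mat:
  assumes K: "gsubm es K" and g: "\<And>a. a < m \<Longrightarrow> g a \<in> Vt es (es' a)" and im: "mat m g ` FF m = K"
  shows "hh es' p t (FF m) {v \<in> FF m. mat m g v = 0} = hh es p t K {0}"
proof -
  have "hh es' p t (FF m) {v \<in> FF m. mat m g v = 0} = hh es p (t + 0) K {0}"
  proof (rule hh_module_iso[where \<phi> = "mat m g"])
    show "\<exists>v\<in>FF m. v' - mat m g v \<in> {0}" if "v' \<in> K" for v' using that im by auto
    show "{0} \<subseteq> K" using fun_vs.subspace_0[OF gsubm_subspace[OF K]] by simp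
    show "hcomp es (s + 0) (mat m g v) = mat m g (hcomp es' s v)" for s v
      using mat_hcomp[of m g es es' s v] g by simp
    show "gsubm es' {v \<in> FF m. mat m g v = 0}" by (rule gsubm_kernel[OF g])
    show "mat m g v \<in> K" if "v \<in> FF m" for v using that im by blast
  qed (simp_all only: gsubm_FF K gsubm_zero mat_add mat_scale mat_sh mem_Collect_eq singleton_iff simp_thms)
  thus ?thesis by simp
qed

text \<open>Descending induction on \<open>p\<close>, starting above the number of variables. By the
  long exact sequence, \<open>H^p\<close> of the quotient is bounded by \<open>H^p\<close> of the
  free module, which vanishes in large degrees, and \<open>H^(p+1)\<close> of \<open>K\<close>; the
  latter is a quotient of a free module by its syzygies.\<close>

lemma hh_eventually_zero:
  fixes K :: "('n::{finite,linorder}, 'k::field) vec set"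
  assumes "gsubm es K" "K \<subseteq> FF m"
  shows "\<exists>T. \<forall>t\<ge>T. hh es p t (FF m) K = 0"
  using assms
proof (induction "Suc CARD('n) - p" arbitrary: p es K m)
  case 0
  hence "p > CARD('n)" by simp
  thus ?case using hh_large[OF gsubm_FF 0(2)] by blast
next
  case (Suc k)
  note K = Suc(3,4)
  obtain m' es' and g :: "nat \<Rightarrow> ('n, 'k) vec" where g: "\<And>a. a < m' \<Longrightarrow> g a \<in> K" "\<And>a. a < m' \<Longrightarrow> g a \<in> Vt es (es' a)"
    "mat m' g ` FF m' = K"
    by (rule noetherian_generators[OF K]) blast
  have "\<exists>T. \<forall>t\<ge>T. hh es' (Suc p) t (FF m') {v \<in> FF m'. mat m' g v = 0} = 0"
    by (rule Suc(1)) (use Suc(2) gsubm_kernel[OF g(2)] in auto)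
  then obtain T where T: "\<And>t. t \<ge> T \<Longrightarrow> hh es' (Suc p) t (FF m') {v \<in> FF m'. mat m' g v = 0} = 0" by blast
  \<comment> \<open>Exceeds every basis degree \<open>es b\<close>, and so every degree in which the
    free module has cohomology.\<close>
  define T' where "T' = (\<Sum>b<m. \<bar>es b\<bar>) + 1"
  have T': "hh es p t (FF m :: ('n, 'k) vec set) {0} = 0" if "t \<ge> T'" for t
  proof (rule hh_free_eq_0, rule disjI2, intro allI impI)
    fix b assume "b < m"
    hence "\<bar>es b\<bar> \<le> (\<Sum>b<m. \<bar>es b\<bar>)" by (intro member_le_sum) auto
    thus "es b - int CARD('n) < t" using that by (simp add: T'_def)
  qed
  have "hh es p t (FF m) K = 0" if "t \<ge> max T T'" for t
  proof -
    have zK: "{0} \<subseteq> K" using fun_vs.subspace_0[OF gsubm_subspace[OF K(1)]] by simp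
    have "hh es p t (FF m) K \<le> hh es (Suc p) t K {0} + hh es p t (FF m :: ('n, 'k) vec set) {0}"
      by (intro hh_triple_right gsubm_zero K gsubm_FF zK)
    also have "hh es (Suc p) t K {0} = 0" using hh_image_mat[OF K(1) g(2,3), of "Suc p" t] T that by simp
    also have "hh es p t (FF m :: ('n, 'k) vec set) {0} = 0" by (rule T') (use that in simp)
    finally show ?thesis by simp
  qed
  thus ?case by blast
qed

section \<open>Saturation\<close>

definition sat :: "nat \<Rightarrow> ('n::finite, 'k::field) vec set \<Rightarrow> ('n, 'k) vec set" where
  "sat m K = {v \<in> FF m. \<exists>e. \<forall>a. mon_deg a \<ge> e \<longrightarrow> sh (expo a) v \<in> K}"

lemma mon_deg_add [simp]: "mon_deg (a + b) = mon_deg a + mon_deg b"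
  by (simp add: mon_deg_def lookup_add sum.distrib)

lemma mon_deg_zero [simp]: "mon_deg 0 = 0"
  by (simp add: mon_deg_def)

lemma mon_deg_single [simp]: "mon_deg (Poly_Mapping.single s k) = k"
  by (simp add: mon_deg_def lookup_single when_def)

lemma mon_split_var:
  fixes a :: "'n::finite \<Rightarrow>\<^sub>0 nat"
  assumes "k \<le> Poly_Mapping.lookup a s"
  shows "a = Poly_Mapping.single s k + (a - Poly_Mapping.single s k)"
  by (rule poly_mapping_eqI) (use assms in \<open>auto simp: lookup_add lookup_minus lookup_single when_def\<close>)

lemma mon_split:
  fixes a :: "'n::finite \<Rightarrow>\<^sub>0 nat"
  assumes "e \<le> mon_deg a"
  shows "\<exists>b c. a = b + c \<and> mon_deg b = e"
  using assms
proof (induction e)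
  case 0
  show ?case by (rule exI[of _ 0]) simp
next
  case (Suc e)
  then obtain b c where bc: "a = b + c" "mon_deg b = e" by auto
  hence "mon_deg c \<noteq> 0" using Suc by simp
  then obtain s where "Poly_Mapping.lookup c s \<noteq> 0" by (auto simp: mon_deg_def)
  hence "c = Poly_Mapping.single s 1 + (c - Poly_Mapping.single s 1)" by (intro mon_split_var) simp
  hence "a = (b + Poly_Mapping.single s 1) + (c - Poly_Mapping.single s 1)" using bc by (simp add: add.assoc)
  moreover have "mon_deg (b + Poly_Mapping.single s 1) = Suc e" using bc by simp
  ultimately show ?case by blast
qed

lemma sat_subset_FF: "sat m K \<subseteq> FF m"
  by (auto simp: sat_def)

lemma subset_sat: "gsubm es K \<Longrightarrow> K \<subseteq> FF m \<Longrightarrow> K \<subseteq> sat m K"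
  by (auto simp: sat_def gsubm_def)

lemma gsubm_sat:
  assumes K: "gsubm es K"
  shows "gsubm es (sat m K)"
  unfolding gsubm_def
proof (intro conjI allI ballI)
  note s = gsubm_subspace[OF K]
  show "fun_vs.subspace (sat m K)"
    unfolding fun_vs.subspace_def
  proof (intro conjI ballI allI)
    show "0 \<in> sat m K" using fun_vs.subspace_0[OF s] fun_vs.subspace_0[OF FF_subspace] by (auto simp: sat_def)
    fix x y assume xy: "x \<in> sat m K" "y \<in> sat m K"
    then obtain e1 e2 where e: "\<And>a. mon_deg a \<ge> e1 \<Longrightarrow> sh (expo a) x \<in> K" "\<And>a. mon_deg a \<ge> e2 \<Longrightarrow> sh (expo a) y \<in> K"
      by (auto simp: sat_def)
    have "sh (expo a) (x + y) \<in> K" if "mon_deg a \<ge> max e1 e2" for a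
      using e that fun_vs.subspace_add[OF s] by (simp add: sh_add)
    moreover have "x + y \<in> FF m" using xy fun_vs.subspace_add[OF FF_subspace] by (auto simp: sat_def)
    ultimately show "x + y \<in> sat m K" unfolding sat_def by blast
  next
    fix c x assume "x \<in> sat m K"
    then obtain e where e: "\<And>a. mon_deg a \<ge> e \<Longrightarrow> sh (expo a) x \<in> K" and x: "x \<in> FF m"
      by (auto simp: sat_def)
    have "sh (expo a) (c *\<^sub>f x) \<in> K" if "mon_deg a \<ge> e" for a
      unfolding sh_scale by (rule fun_vs.subspace_scale[OF s e[OF that]])
    moreover have "c *\<^sub>f x \<in> FF m" by (rule fun_vs.subspace_scale[OF FF_subspace x])
    ultimately show "c *\<^sub>f x \<in> sat m K" unfolding sat_def by blast
  qed
  fix v assume v: "v \<in> sat m K"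
  then obtain e where e: "\<And>a. mon_deg a \<ge> e \<Longrightarrow> sh (expo a) v \<in> K" by (auto simp: sat_def)
  have vF: "v \<in> FF m" using v by (simp add: sat_def)
  show "sh (expo c) v \<in> sat m K" for c
  proof -
    have "sh (expo a) (sh (expo c) v) \<in> K" if "mon_deg a \<ge> e" for a
      using e[of "a + c"] that by simp
    thus ?thesis unfolding sat_def using sh_FF[OF vF, of "expo c"] by auto
  qed
  show "hcomp es t v \<in> sat m K" for t
  proof -
    have "sh (expo a) (hcomp es t v) \<in> K" if "mon_deg a \<ge> e" for a
      using gsubm_hcomp[OF K e[OF that], of "t + int (mon_deg a)"] by (simp add: hcomp_sh)
    thus ?thesis unfolding sat_def using hcomp_FF[OF vF] by auto
  qed
qed

text \<open>There are finitely many monomials of degree \<open>e\<close>, so the exponents that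
  saturation provides for each of them have the common bound \<open>E'\<close>; monomials of degree
  \<open>e + E'\<close> or more split accordingly.\<close>

lemma sat_sat:
  fixes K :: "('n::finite, 'k::field) vec set"
  assumes K: "gsubm es K" and v: "v \<in> FF m" and e: "\<And>a. mon_deg a \<ge> e \<Longrightarrow> sh (expo a) v \<in> sat m K"
  shows "v \<in> sat m K"
proof -
  have "\<exists>E. \<forall>c. mon_deg c \<ge> E \<longrightarrow> sh (expo c) (sh (expo a) v) \<in> K" if "mon_deg a = e" for a
    using e[of a] that by (auto simp: sat_def)
  then obtain E where E: "\<And>a c. mon_deg a = e \<Longrightarrow> mon_deg c \<ge> E a \<Longrightarrow> sh (expo c) (sh (expo a) v) \<in> K"
    by metis
  have fin: "finite {a :: 'n \<Rightarrow>\<^sub>0 nat. mon_deg a = e}"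
    by (rule finite_subset[OF _ finite_mon_deg_le[of e]]) auto
  define E' where "E' = (\<Sum>a | mon_deg a = e. E a)"
  have E': "E a \<le> E'" if "mon_deg a = e" for a
    unfolding E'_def by (rule member_le_sum) (use that fin in auto)
  have "sh (expo a) v \<in> K" if "mon_deg a \<ge> e + E'" for a
  proof -
    have "e \<le> mon_deg a" using that by simp
    then obtain b c where bc: "a = b + c" "mon_deg b = e" using mon_split by blast
    hence "mon_deg c \<ge> E b" using that E'[OF bc(2)] by simp
    from E[OF bc(2) this] show ?thesis using bc by (simp add: add.commute)
  qed
  thus ?thesis unfolding sat_def using v by blast
qed

lemma xpow_expo: "\<exists>a. xpow S (int k) = expo a \<and> mon_deg a = k * card S" for S :: "'n::finite set"
proof -
  have "\<And>s. 0 \<le> xpow S (int k) s" by (simp add: xpow_def)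
  then obtain a where a: "xpow S (int k) = expo a" using expo_exists by blast
  have "int (mon_deg a) = int (k * card S)" using edeg_xpow[of S "int k"] a by simp
  thus ?thesis using a by (simp only: of_nat_eq_iff) blast
qed

text \<open>For nonempty \<open>S\<close> a high power of the product of its variables has degree at
  least \<open>e\<close> and pushes a saturated element into \<open>K\<close>. Hence the Cech
  complexes of \<open>K\<close> and of its saturation differ at the empty set only.\<close>

lemma loc_sat:
  assumes K: "gsubm es K" and S: "S \<noteq> {}" and v: "v \<in> loc S (sat m K)"
  shows "v \<in> loc S K"
proof -
  obtain a :: nat where "sh (xpow S (int a)) v \<in> sat m K" using v by (auto simp: loc_def)
  then obtain e where e: "\<And>c. mon_deg c \<ge> e \<Longrightarrow> sh (expo c) (sh (xpow S (int a)) v) \<in> K"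
    by (auto simp: sat_def)
  obtain c where c: "xpow S (int e) = expo c" "mon_deg c = e * card S" using xpow_expo by blast
  have "card S \<ge> 1" using S by (simp add: Suc_le_eq card_gt_0_iff)
  hence "mon_deg c \<ge> e" using c(2) by simp
  hence "sh (xpow S (int e)) (sh (xpow S (int a)) v) \<in> K" using e c(1) by metis
  hence "sh (xpow S (int (e + a))) v \<in> K" by (simp add: xpow_add)
  thus ?thesis unfolding loc_def by blast
qed

section \<open>Reduction modulo a linear form\<close>

text \<open>The submodule l F + K, so that the free module modulo it is M/lM when M = F/K.\<close>

definition addmul :: "('n::finite, 'k::field) mpoly \<Rightarrow> nat \<Rightarrow> ('n, 'k) vec set \<Rightarrow> ('n, 'k) vec set" where
  "addmul l m K = {act l u + w | u w. u \<in> FF m \<and> w \<in> K}"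

lemma addmulI: "u \<in> FF m \<Longrightarrow> w \<in> K \<Longrightarrow> act l u + w \<in> addmul l m K"
  unfolding addmul_def by blast

lemma addmulE:
  assumes "z \<in> addmul l m K"
  obtains u w where "u \<in> FF m" "w \<in> K" "z = act l u + w"
  using assms unfolding addmul_def by blast

lemma subset_addmul: "K \<subseteq> addmul l m K"
proof
  fix w assume "w \<in> K"
  hence "act l 0 + w \<in> addmul l m K" by (intro addmulI fun_vs.subspace_0[OF FF_subspace])
  thus "w \<in> addmul l m K" by simp
qed

lemma addmul_mono: "K \<subseteq> K' \<Longrightarrow> addmul l m K \<subseteq> addmul l m K'"
  unfolding addmul_def by blast

lemma addmul_FF: "K \<subseteq> FF m \<Longrightarrow> addmul l m K \<subseteq> FF m"
  by (auto simp: addmul_def intro!: fun_vs.subspace_add[OF FF_subspace] gsubm_act[OF gsubm_FF])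

lemma gsubm_addmul:
  assumes K: "gsubm es K" and l: "l \<in> poly_homog s"
  shows "gsubm es (addmul l m K)"
  unfolding gsubm_def
proof (intro conjI allI ballI)
  note s = gsubm_subspace[OF K]
  show "fun_vs.subspace (addmul l m K)"
    unfolding fun_vs.subspace_def
  proof (intro conjI ballI allI)
    show "0 \<in> addmul l m K" using fun_vs.subspace_0[OF s] subset_addmul by blast
    fix x y assume "x \<in> addmul l m K" "y \<in> addmul l m K"
    then obtain u w u' w' where uw: "u \<in> FF m" "w \<in> K" "x = act l u + w" "u' \<in> FF m" "w' \<in> K" "y = act l u' + w'"
      by (meson addmulE)
    have "act l (u + u') + (w + w') \<in> addmul l m K"
      by (intro addmulI fun_vs.subspace_add[OF s] fun_vs.subspace_add[OF FF_subspace] uw)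
    moreover have "x + y = act l (u + u') + (w + w')" using uw by (simp add: act_add)
    ultimately show "x + y \<in> addmul l m K" by simp
  next
    fix c x assume "x \<in> addmul l m K"
    then obtain u w where uw: "u \<in> FF m" "w \<in> K" "x = act l u + w" by (meson addmulE)
    have "act l (c *\<^sub>f u) + c *\<^sub>f w \<in> addmul l m K"
      by (intro addmulI fun_vs.subspace_scale[OF s] fun_vs.subspace_scale[OF FF_subspace] uw)
    moreover have "c *\<^sub>f x = act l (c *\<^sub>f u) + c *\<^sub>f w"
      using uw by (simp add: act_scale fun_vs.scale_right_distrib)
    ultimately show "c *\<^sub>f x \<in> addmul l m K" by simp
  qed
  fix v assume "v \<in> addmul l m K"
  then obtain u w where uw: "u \<in> FF m" "w \<in> K" "v = act l u + w" by (meson addmulE)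
  show "sh (expo a) v \<in> addmul l m K" for a
  proof -
    have "act l (sh (expo a) u) + sh (expo a) w \<in> addmul l m K"
      by (intro addmulI sh_FF gsubm_sh[OF K] uw expo_nonneg)
    thus ?thesis using uw by (simp add: sh_add act_sh)
  qed
  show "hcomp es t v \<in> addmul l m K" for t
  proof -
    have "act l (hcomp es (t - s) u) + hcomp es t w \<in> addmul l m K"
      by (intro addmulI hcomp_FF gsubm_hcomp[OF K] uw)
    thus ?thesis using uw by (simp add: hcomp_add hcomp_act[OF l])
  qed
qed

text \<open>\<open>fr\<close> is filter regularity in the form in which it is used: the kernel of
  \<open>l\<close> on F/K consists of elements killed by all monomials of large degree.\<close>

locale filter_step =
  fixes es :: "nat \<Rightarrow> int" and m :: nat and K :: "('n::{finite,linorder}, 'k::field) vec set"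
    and l :: "('n, 'k) mpoly"
  assumes K: "gsubm es K" "K \<subseteq> FF m" and l: "l \<in> poly_homog 1"
    and fr: "\<And>v. v \<in> FF m \<Longrightarrow> act l v \<in> K \<Longrightarrow> v \<in> sat m K"
begin

abbreviation "F \<equiv> (FF m :: ('n, 'k) vec set)"
abbreviation "S \<equiv> sat m K"
abbreviation "K1 \<equiv> addmul l m K"
abbreviation "S1 \<equiv> addmul l m S"

lemma gS: "gsubm es S" by (rule gsubm_sat[OF K(1)])
lemma gK1: "gsubm es K1" by (rule gsubm_addmul[OF K(1) l])
lemma gS1: "gsubm es S1" by (rule gsubm_addmul[OF gS l])
lemma KS: "K \<subseteq> S" by (rule subset_sat[OF K])
lemma SF: "S \<subseteq> F" by (rule sat_subset_FF)
lemma SS1: "S \<subseteq> S1" by (rule subset_addmul)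
lemma S1F: "S1 \<subseteq> F" by (rule addmul_FF[OF SF])
lemma K1S1: "K1 \<subseteq> S1" by (rule addmul_mono[OF KS])

lemma hh_S_K_zero: "p > 0 \<Longrightarrow> hh es p t S K = 0"
  by (rule hh_torsion[OF gS K(1)]) (use loc_sat[OF K(1)] in auto)

lemma hh_K_le_S: "p > 0 \<Longrightarrow> hh es p t F K \<le> hh es p t F S"
  using hh_triple_middle[OF K(1) gS gsubm_FF KS SF, of p t] by (simp add: hh_S_K_zero)

lemma hh_S_le_K: "hh es p t F S \<le> hh es p t F K"
  using hh_triple_right[OF K(1) gS gsubm_FF KS SF, of p t] by (simp add: hh_S_K_zero)

text \<open>Multiplication by \<open>l\<close> maps F/S onto S1/S and raises degrees by 1. It is
  injective because \<open>act l v\<close> in \<open>S\<close> puts all large monomial multiples of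
  \<open>v\<close> into \<open>S\<close>, and saturation is idempotent.\<close>

lemma hh_mult: "hh es p t F S = hh es p (t + 1) S1 S"
proof (rule hh_module_iso[where \<phi> = "act l"])
  show "hcomp es (s + 1) (act l v) = act l (hcomp es s v)" for s v
    using hcomp_act[OF l, of es "s + 1" v] by simp
  show "act l v \<in> S1" if "v \<in> F" for v
    using addmulI[OF that fun_vs.subspace_0[OF gsubm_subspace[OF gS]], of l] by simp
  show "act l v \<in> S" if "v \<in> S" for v by (rule gsubm_act[OF gS that])
  show "\<exists>v\<in>F. v' - act l v \<in> S" if v': "v' \<in> S1" for v'
  proof -
    obtain u w where uw: "u \<in> F" "w \<in> S" "v' = act l u + w" using v' by (rule addmulE)
    hence "v' - act l u \<in> S" by simp
    thus ?thesis using uw(1) by blast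
  qed
  show "v \<in> S" if v: "v \<in> F" "act l v \<in> S" for v
  proof -
    obtain e where "\<And>a. mon_deg a \<ge> e \<Longrightarrow> sh (expo a) (act l v) \<in> K" using v(2) by (auto simp: sat_def)
    hence "\<And>a. mon_deg a \<ge> e \<Longrightarrow> sh (expo a) v \<in> S"
      using v(1) by (intro fr) (auto simp: act_sh sh_FF)
    thus ?thesis by (rule sat_sat[OF K(1) v(1)])
  qed
qed (fact gsubm_FF gS gS1 SS1 act_add act_scale act_sh)+

text \<open>The exact sequence 0 -> S1/S -> F/S -> F/S1 -> 0, with S1/S replaced by F/S in the
  degree before.\<close>

lemma hh_S_step: "hh es (Suc p) t F S \<le> hh es (Suc p) (t + 1) F S + hh es p (t + 1) F S1"
  unfolding hh_mult[of "Suc p" t] by (rule hh_triple_left[OF gS gS1 gsubm_FF SS1 S1F])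

text \<open>S1/K1 is an image of S/K, so it vanishes after localization at any nonempty set and has
  no cohomology in positive degree.\<close>

lemma hh_S1_le_K1: "hh es p t F S1 \<le> hh es p t F K1"
proof -
  have "hh es (Suc p) t S1 K1 = 0"
  proof (rule hh_torsion[OF gS1 gK1], simp, rule subsetI)
    fix T :: "'n set" and v assume T: "T \<noteq> {}" and v: "v \<in> loc T S1"
    obtain a :: nat where "sh (xpow T (int a)) v \<in> S1" using v by (auto simp: loc_def)
    then obtain u w where uw: "u \<in> F" "w \<in> S" "sh (xpow T (int a)) v = act l u + w" by (auto elim: addmulE)
    have "w \<in> loc T K" using loc_sat[OF K(1) T] uw(2) subset_loc by blast
    then obtain c :: nat where c: "sh (xpow T (int c)) w \<in> K" by (auto simp: loc_def)
    have "act l (sh (xpow T (int c)) u) + sh (xpow T (int c)) w \<in> K1"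
      by (intro addmulI c sh_FF uw) (simp add: xpow_def)
    hence "sh (xpow T (int c)) (sh (xpow T (int a)) v) \<in> K1" unfolding uw(3) by (simp add: sh_add act_sh)
    hence "sh (xpow T (int (c + a))) v \<in> K1" by (simp add: xpow_add)
    thus "v \<in> loc T K1" unfolding loc_def by blast
  qed
  thus ?thesis using hh_triple_right[OF gK1 gS1 gsubm_FF K1S1 S1F, of p t] by simp
qed

lemma hh_K_step:
  assumes "p > 0"
  shows "hh es (Suc p) t F K \<le> hh es (Suc p) (t + 1) F K + hh es p (t + 1) F K1"
proof -
  have "hh es (Suc p) t F K \<le> hh es (Suc p) t F S" by (rule hh_K_le_S) simp
  also have "\<dots> \<le> hh es (Suc p) (t + 1) F S + hh es p (t + 1) F S1" by (rule hh_S_step)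
  also have "\<dots> \<le> hh es (Suc p) (t + 1) F K + hh es p (t + 1) F K1"
    by (intro add_mono hh_S_le_K hh_S1_le_K1)
  finally show ?thesis .
qed

lemma hh_zeroth_S1_le: "hh es 0 t F S1 \<le> rdim (F \<inter> Vt es t) K1"
proof -
  have "hh es 0 t F S1 \<le> rdim (F \<inter> Vt es t) S1" by (rule hh_zeroth_le[OF gsubm_FF gS1])
  also have "\<dots> \<le> rdim (F \<inter> Vt es t) K1"
    by (rule rdim_mono)
      (use K1S1 fun_vs.subspace_0[OF gsubm_subspace[OF gK1]] fun_vs.subspace_inter[OF FF_subspace Vt_subspace] in auto)
  finally show ?thesis .
qed

text \<open>The Hilbert function along M_t -> M_(t+1) -> (M/lM)_(t+1), where the first map is
  multiplication by \<open>l\<close>. A homogeneous element of l F + K has a homogeneous cofactor,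
  obtained by taking components.\<close>

lemma rdim_step: "rdim (F \<inter> Vt es (t + 1)) K \<le> rdim (F \<inter> Vt es t) K + rdim (F \<inter> Vt es (t + 1)) K1"
proof -
  let ?Z = "F \<inter> Vt es (t + 1)"
  note s = gsubm_subspace[OF K(1)]
  have "rdim ?Z K \<le> rdim ?Z K1 + rdim (K1 \<inter> ?Z) K"
    by (rule rdim_triple)
      (use gsubm_subspace[OF gK1] fun_vs.subspace_0[OF s] fun_vs.subspace_inter[OF FF_subspace Vt_subspace] in auto)
  also have "rdim (K1 \<inter> ?Z) K \<le> rdim (F \<inter> Vt es t) K"
  proof (rule rdim_le_rel[where R = "\<lambda>z u. z - act l u \<in> K"])
    show "0 - act l 0 \<in> K" using fun_vs.subspace_0[OF s] by simp
    show "(a + a') - act l (b + b') \<in> K" if h: "a - act l b \<in> K" "a' - act l b' \<in> K" for a b a' b'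
    proof -
      have "(a + a') - act l (b + b') = (a - act l b) + (a' - act l b')" by (simp add: act_add)
      thus ?thesis using h fun_vs.subspace_add[OF s] by metis
    qed
    show "c *\<^sub>f a - act l (c *\<^sub>f b) \<in> K" if h: "a - act l b \<in> K" for c a b
      using fun_vs.subspace_scale[OF s h, of c] by (simp add: act_scale fun_vs.scale_right_diff_distrib)
    show "\<exists>u\<in>F \<inter> Vt es t. z - act l u \<in> K" if z: "z \<in> K1 \<inter> ?Z" for z
    proof -
      obtain u w where uw: "u \<in> F" "w \<in> K" "z = act l u + w" using z by (auto elim: addmulE)
      have "z = hcomp es (t + 1) z" using z hcomp_Vt_eq[of z es "t + 1" "t + 1"] by simp
      also have "\<dots> = act l (hcomp es t u) + hcomp es (t + 1) w"
        using uw(3) hcomp_act[OF l, of es "t + 1" u] by (simp add: hcomp_add)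
      finally have "z - act l (hcomp es t u) = hcomp es (t + 1) w" by (simp add: diff_eq_eq add.commute)
      hence "z - act l (hcomp es t u) \<in> K" using gsubm_hcomp[OF K(1) uw(2)] by metis
      thus ?thesis using hcomp_FF[OF uw(1)] hcomp_Vt by blast
    qed
    show "0 \<in> K" by (rule fun_vs.subspace_0[OF s])
    show "z \<in> K" if h: "z - act l u \<in> K" "u \<in> K" for z u
      using fun_vs.subspace_add[OF s h(1) gsubm_act[OF K(1) h(2), of l]] by simp
  qed
  finally show ?thesis by (simp add: add.commute add_mono)
qed

end

text \<open>Homogeneous parts of different degrees are independent modulo a graded submodule,
  because a relation can be projected to each degree.\<close>

lemma rdim_graded_le:
  fixes K :: "('n::finite, 'k::field) vec set"
  assumes K: "gsubm es K"
  shows "(\<Sum>s\<le>N. rdim (FF m \<inter> Vt es (int s)) K) \<le> rdim (FF m) K"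
proof -
  \<comment> \<open>Truncation from above only: components in negative degrees stay in
    \<open>W N\<close>, which does no harm to an upper bound for the sum.\<close>
  define W where "W = (\<lambda>N. {v \<in> FF m :: ('n, 'k) vec set. \<forall>t > int N. hcomp es t v = 0})"
  have W: "fun_vs.subspace (W N)" for N
    using FF_subspace[of m, where 'n = 'n and 'k = 'k] unfolding fun_vs.subspace_def W_def
    by (auto simp: hcomp_add hcomp_scale)
  have inW: "FF m \<inter> Vt es (int s) \<subseteq> W N" if "s \<le> N" for s N
    using that by (auto simp: W_def hcomp_Vt_eq)
  have sub: "fun_vs.subspace (FF m \<inter> Vt es t :: ('n, 'k) vec set)" for t
    by (rule fun_vs.subspace_inter[OF FF_subspace Vt_subspace])
  note Ks = gsubm_subspace[OF K]
  have "(\<Sum>s\<le>N. rdim (FF m \<inter> Vt es (int s)) K) \<le> rdim (W N) K"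
  proof (induction N)
    case 0
    show ?case using inW[of 0 0] fun_vs.subspace_0[OF Ks] sub by (simp, intro rdim_mono) auto
  next
    case (Suc N)
    have "(\<Sum>s\<le>Suc N. rdim (FF m \<inter> Vt es (int s)) K) \<le> rdim (W N) K + rdim (FF m \<inter> Vt es (int (Suc N))) K"
      unfolding sum.atMost_Suc by (rule add_right_mono[OF Suc])
    also have "\<dots> \<le> rdim (W (Suc N)) K"
    proof (rule rdim_direct_sum_le[OF _ inW[OF order_refl] W sub Ks])
      show "W N \<subseteq> W (Suc N)" by (auto simp: W_def)
      fix a b assume ab: "a \<in> W N" "b \<in> FF m \<inter> Vt es (int (Suc N))" "a + b \<in> K"
      have "hcomp es (int (Suc N)) a = 0" using ab(1) by (simp add: W_def)
      moreover have "hcomp es (int (Suc N)) b = b"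
        using ab(2) hcomp_Vt_eq[of b es "int (Suc N)" "int (Suc N)"] by simp
      ultimately have "hcomp es (int (Suc N)) (a + b) = b" unfolding hcomp_add by simp
      hence "b \<in> K" using gsubm_hcomp[OF K ab(3)] by metis
      thus "a \<in> K" using fun_vs.subspace_diff[OF Ks ab(3)] by (metis add_diff_cancel_right')
    qed
    finally show ?case .
  qed
  also have "\<dots> \<le> rdim (FF m) K"
    by (rule rdim_mono[OF _ _ _ W]) (auto simp: W_def fun_vs.subspace_0[OF Ks])
  finally show ?thesis .
qed

section \<open>Iterated summation along a filter regular sequence\<close>

primrec Kseq :: "(nat \<Rightarrow> ('n::finite, 'k::field) mpoly) \<Rightarrow> nat \<Rightarrow> ('n, 'k) vec set \<Rightarrow> nat \<Rightarrow> ('n, 'k) vec set" where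
  "Kseq l m K 0 = K"
| "Kseq l m K (Suc j) = addmul (l (Suc j)) m (Kseq l m K j)"

lemma binom_alt: "binom a b = (if a < 0 then 0 else enat (nat a choose b))"
  by (auto simp: binom_def binomial_eq_0_iff zero_enat_def)

lemma binom_Pascal: "binom (y - 1) q + binom (y - 1) (Suc q) \<le> binom y (Suc q)"
proof (cases "y - 1 < 0")
  case False
  then obtain k where "y - 1 = int k" using nonneg_int_cases[of "y - 1"] by (auto simp: not_less)
  hence "y = int (Suc k)" by simp
  thus ?thesis by (simp add: binom_alt nat_add_distrib)
qed (simp add: binom_alt)

text \<open>Hockey-stick identity, with the truncation after \<open>N\<close> terms absorbed into an
  inequality; the bound does not depend on \<open>N\<close>, so the summation may start at any
  degree in which the cohomology has died out.\<close>

lemma binom_sum_le: "(\<Sum>s\<in>{t<..t + int N}. binom (r - 1 - s) q) \<le> binom (r - 1 - t) (Suc q)"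
proof (induction N arbitrary: t)
  case 0
  show ?case by simp
next
  case (Suc N)
  have eq: "{t<..t + int (Suc N)} = insert (t + 1) {t + 1<..(t + 1) + int N}" by auto
  have "(\<Sum>s\<in>{t<..t + int (Suc N)}. binom (r - 1 - s) q) =
      binom (r - 1 - (t + 1)) q + (\<Sum>s\<in>{t + 1<..(t + 1) + int N}. binom (r - 1 - s) q)"
    unfolding eq by (rule sum.insert) auto
  also have "\<dots> \<le> binom (r - 1 - (t + 1)) q + binom (r - 1 - (t + 1)) (Suc q)"
    by (rule add_left_mono[OF Suc])
  also have "\<dots> = binom ((r - 1 - t) - 1) q + binom ((r - 1 - t) - 1) (Suc q)"
    by (simp add: algebra_simps)
  also have "\<dots> \<le> binom (r - 1 - t) (Suc q)" by (rule binom_Pascal)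
  finally show ?case .
qed

lemma telescope_le:
  fixes f g :: "int \<Rightarrow> enat"
  assumes "\<And>t. f t \<le> f (t + 1) + g (t + 1)"
  shows "f t \<le> f (t + int N) + (\<Sum>s\<in>{t<..t + int N}. g s)"
proof (induction N)
  case (Suc N)
  have eq: "{t<..t + int (Suc N)} = insert (t + int (Suc N)) {t<..t + int N}" by auto
  have "f t \<le> f (t + int N) + (\<Sum>s\<in>{t<..t + int N}. g s)" by fact
  also have "\<dots> \<le> (f (t + int (Suc N)) + g (t + int (Suc N))) + (\<Sum>s\<in>{t<..t + int N}. g s)"
    using assms[of "t + int N"] by (intro add_right_mono) (simp add: algebra_simps)
  also have "\<dots> = f (t + int (Suc N)) + (\<Sum>s\<in>{t<..t + int (Suc N)}. g s)"
    unfolding eq by (subst sum.insert) (auto simp: add.assoc)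
  finally show ?case .
qed simp

text \<open>\<open>neg\<close> states that F/K lives in nonnegative degrees, and \<open>fr\<close>
  is filter regularity of each form on the module reduced by its predecessors.\<close>

locale filter_seq =
  fixes es :: "nat \<Rightarrow> int" and m d :: nat and K :: "('n::{finite,linorder}, 'k::field) vec set"
    and l :: "nat \<Rightarrow> ('n, 'k) mpoly"
  assumes K: "gsubm es K" "K \<subseteq> FF m"
    and neg: "\<And>t. t < 0 \<Longrightarrow> FF m \<inter> Vt es t \<subseteq> K"
    and l: "\<And>j. j \<in> {1..d} \<Longrightarrow> l j \<in> poly_homog 1"
    and fr: "\<And>j v. j < d \<Longrightarrow> v \<in> FF m \<Longrightarrow> act (l (Suc j)) v \<in> Kseq l m K j \<Longrightarrow> v \<in> sat m (Kseq l m K j)"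
begin

abbreviation "KK \<equiv> Kseq l m K"
abbreviation "DD j t \<equiv> rdim (FF m \<inter> Vt es t) (KK j)"

lemma gKK: "j \<le> d \<Longrightarrow> gsubm es (KK j) \<and> KK j \<subseteq> FF m"
proof (induction j)
  case 0
  show ?case using K by simp
next
  case (Suc j)
  thus ?case using gsubm_addmul[OF _ l[of "Suc j"]] addmul_FF[of "KK j" m "l (Suc j)"] by auto
qed

lemma step: "j < d \<Longrightarrow> filter_step es m (KK j) (l (Suc j))"
  using gKK[of j] l[of "Suc j"] fr[of j] by unfold_locales auto

lemma K_sub_KK: "K \<subseteq> KK j"
  by (induction j) (simp, metis Kseq.simps(2) order_trans subset_addmul)

lemma DD_neg: "t < 0 \<Longrightarrow> DD j t = 0"
  using neg[of t] K_sub_KK[of j] by (intro rdim_eq_0) auto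

lemma DD_le:
  assumes j: "j < d"
  shows "DD j (int t) \<le> (\<Sum>s\<le>t. DD (Suc j) (int s))"
proof (induction t)
  case 0
  have "DD j (- 1 + 1) \<le> DD j (- 1) + DD (Suc j) (- 1 + 1)"
    using filter_step.rdim_step[OF step[OF j], of "-1"] by simp
  thus ?case by (simp add: DD_neg)
next
  case (Suc t)
  have "DD j (int t + 1) \<le> DD j (int t) + DD (Suc j) (int t + 1)"
    using filter_step.rdim_step[OF step[OF j], of "int t"] by simp
  also have "\<dots> \<le> (\<Sum>s\<le>t. DD (Suc j) (int s)) + DD (Suc j) (int t + 1)" by (rule add_right_mono[OF Suc])
  finally show ?case by (simp add: add.commute)
qed

text \<open>For \<open>k = 0\<close> the graded parts of the fully reduced module add up to at most
  its total dimension. Undoing one form replaces the Hilbert function by its partial sums, and a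
  bound \<open>(t + k) choose k\<close> summed over \<open>t\<close> up to \<open>N\<close> becomes
  \<open>(N + Suc k) choose Suc k\<close>.\<close>

lemma DD_sum_le:
  assumes "k \<le> d"
  shows "(\<Sum>t\<le>N. DD (d - k) (int t)) \<le> enat ((N + k) choose k) * rdim (FF m) (KK d)"
  using assms
proof (induction k arbitrary: N)
  case 0
  have "enat ((N + 0) choose 0) = 1" by (simp add: one_enat_def)
  thus ?case using rdim_graded_le[of es "KK d" m N] gKK by (simp del: binomial_n_0)
next
  case (Suc k)
  let ?B = "rdim (FF m) (KK d)"
  have j: "d - Suc k < d" "Suc (d - Suc k) = d - k" using Suc.prems by auto
  have "(\<Sum>t\<le>N. DD (d - Suc k) (int t)) \<le> (\<Sum>t\<le>N. \<Sum>s\<le>t. DD (d - k) (int s))"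
    using DD_le[OF j(1)] unfolding j(2) by (rule sum_mono)
  also have "\<dots> \<le> (\<Sum>t\<le>N. enat ((t + k) choose k) * ?B)"
    using Suc by (intro sum_mono) simp
  also have "\<dots> = (\<Sum>t\<le>N. enat ((t + k) choose k)) * ?B" by (simp add: sum_distrib_right)
  also have "(\<Sum>t\<le>N. enat ((t + k) choose k)) = enat (\<Sum>t\<le>N. (t + k) choose k)"
    by (induction N) auto
  also have "(\<Sum>t\<le>N. (t + k) choose k) = (N + Suc k) choose Suc k"
    using choose_rising_sum(1)[of k N] by (simp add: add.commute)
  finally show ?case .
qed

text \<open>Telescoping from \<open>t\<close> up to \<open>r\<close>, where the first cohomology of
  the saturated module vanishes, leaves a sum of zeroth cohomologies. Each is at most the Hilbert
  function of the next reduction, which vanishes in negative degrees and whose sum up to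
  \<open>r\<close> is bounded by \<open>DD_sum_le\<close>.\<close>

lemma hh_first_le:
  assumes j: "j < d" and r: "\<And>t. t \<ge> r \<Longrightarrow> hh es 1 t (FF m) (sat m (KK j)) = 0"
  shows "hh es 1 t (FF m) (KK j) \<le> rdim (FF m) (KK d) * binom (r + int d - int (Suc j)) (d - Suc j) * binom (r - 1 - t) 0"
proof -
  interpret filter_step es m "KK j" "l (Suc j)" by (rule step[OF j])
  let ?B = "rdim F (KK d)"
  define g where "g = (\<lambda>s. hh es 0 s F S1)"
  have "hh es 1 t F (KK j) \<le> hh es 1 t F S" by (rule hh_K_le_S) simp
  also have "hh es 1 t F S \<le> ?B * binom (r + int d - int (Suc j)) (d - Suc j) * binom (r - 1 - t) 0"
  proof (cases "t \<ge> r")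
    case True
    show ?thesis unfolding r[OF True] by simp
  next
    case False
    have "hh es 1 t F S \<le> hh es 1 (t + int (nat (r - t))) F S + (\<Sum>s\<in>{t<..t + int (nat (r - t))}. g s)"
      by (rule telescope_le[of "\<lambda>t. hh es 1 t F S" g]) (use hh_S_step[of 0] in \<open>simp add: g_def\<close>)
    also have "\<dots> = (\<Sum>s\<in>{t<..r}. g s)" using False r[of r] by simp
    also have "\<dots> \<le> (\<Sum>s\<in>{t<..r}. DD (Suc j) s)"
      using hh_zeroth_S1_le by (intro sum_mono) (simp add: g_def)
    also have "\<dots> = (\<Sum>s\<in>{t<..r} \<inter> {0..}. DD (Suc j) s)"
    proof (rule sum.mono_neutral_right)
      show "\<forall>s\<in>{t<..r} - ({t<..r} \<inter> {0..}). DD (Suc j) s = 0"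
      proof
        fix s assume "s \<in> {t<..r} - ({t<..r} \<inter> {0..})"
        hence "s < 0" by auto
        thus "DD (Suc j) s = 0" by (rule DD_neg)
      qed
    qed auto
    also have "\<dots> \<le> ?B * binom (r + int d - int (Suc j)) (d - Suc j)"
    proof (cases "r < 0")
      case True
      hence "{t<..r} \<inter> {0..} = {}" by auto
      thus ?thesis by simp
    next
      case r0: False
      have "(\<Sum>s\<in>{t<..r} \<inter> {0..}. DD (Suc j) s) \<le> (\<Sum>s\<in>{0..r}. DD (Suc j) s)"
        by (rule sum_mono2) auto
      also have "\<dots> = (\<Sum>s\<le>nat r. DD (Suc j) (int s))"
        by (rule sum.reindex_bij_witness[of _ int nat]) (use r0 in auto)
      also have "\<dots> \<le> enat ((nat r + (d - Suc j)) choose (d - Suc j)) * ?B"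
        using DD_sum_le[of "d - Suc j" "nat r"] j by simp
      also have "\<dots> = ?B * binom (r + int d - int (Suc j)) (d - Suc j)"
      proof -
        have "nat (r + int d - int (Suc j)) = nat r + (d - Suc j)" "\<not> r + int d - int (Suc j) < 0"
          using j r0 by linarith+
        thus ?thesis by (simp add: binom_alt mult.commute)
      qed
      finally show ?thesis .
    qed
    finally have le: "hh es 1 t F S \<le> ?B * binom (r + int d - int (Suc j)) (d - Suc j)" .
    \<comment> \<open>With lower entry 0 this factor is the indicator of \<open>t < r\<close>; it is
      the seed of the summations in \<open>hh_le\<close>.\<close>
    have "binom (r - 1 - t) 0 = 1" using False by (simp add: binom_alt one_enat_def)
    thus ?thesis using le by (simp only: mult_1_right)
  qed
  finally show ?thesis .
qed

text \<open>Each induction step lowers the cohomological degree by 1 at the price of one more form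
  and one more summation over degrees. The number \<open>q + j\<close> is invariant, so
  \<open>r\<close> belongs to the same module throughout.\<close>

lemma hh_le:
  assumes "q + j < d" and r: "\<And>t. t \<ge> r \<Longrightarrow> hh es 1 t (FF m) (sat m (KK (q + j))) = 0"
  shows "hh es (Suc q) t (FF m) (KK j) \<le>
    rdim (FF m) (KK d) * binom (r + int d - int (Suc (q + j))) (d - Suc (q + j)) * binom (r - 1 - t) q"
  using assms
proof (induction q arbitrary: j t)
  case 0
  thus ?case using hh_first_le[of j r t] by simp
next
  case (Suc q)
  interpret filter_step es m "KK j" "l (Suc j)" by (rule step) (use Suc in simp)
  let ?C = "rdim F (KK d) * binom (r + int d - int (Suc (Suc q + j))) (d - Suc (Suc q + j))"
  \<comment> \<open>Any degree of vanishing will do; it only makes the telescoping sum finite and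
    disappears in \<open>binom_sum_le\<close>.\<close>
  obtain T where T: "\<And>t. t \<ge> T \<Longrightarrow> hh es (Suc (Suc q)) t F (KK j) = 0"
    using hh_eventually_zero[OF filter_step.K(1,2)[OF filter_step_axioms], of "Suc (Suc q)"] by blast
  let ?N = "nat (T - t)"
  have "hh es (Suc (Suc q)) t F (KK j) \<le> hh es (Suc (Suc q)) (t + int ?N) F (KK j) +
      (\<Sum>s\<in>{t<..t + int ?N}. hh es (Suc q) s F (KK (Suc j)))"
    by (rule telescope_le[of "\<lambda>t. hh es (Suc (Suc q)) t F (KK j)" "\<lambda>s. hh es (Suc q) s F (KK (Suc j))"])
      (use hh_K_step[of "Suc q"] in simp)
  also have "\<dots> = (\<Sum>s\<in>{t<..t + int ?N}. hh es (Suc q) s F (KK (Suc j)))" by (simp add: T)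
  also have "\<dots> \<le> (\<Sum>s\<in>{t<..t + int ?N}. ?C * binom (r - 1 - s) q)"
    using Suc.IH[of "Suc j"] Suc.prems by (intro sum_mono) simp
  also have "\<dots> = ?C * (\<Sum>s\<in>{t<..t + int ?N}. binom (r - 1 - s) q)" by (simp add: sum_distrib_left)
  also have "\<dots> \<le> ?C * binom (r - 1 - t) (Suc q)" by (rule mult_left_mono[OF binom_sum_le]) simp
  finally show ?case .
qed

end

section \<open>Duality between Ext and local cohomology\<close>

text \<open>
  The top cohomology of \<open>FF m\<close> in degree \<open>t\<close> is \<open>topv m es t\<close> modulo \<open>neg_free\<close>.
\<close>

definition neg_free :: "('n, 'k::field) vec set" where
  "neg_free = {v. \<forall>b e. (\<forall>s. e s < 0) \<longrightarrow> v (b, e) = 0}"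

definition topv :: "nat \<Rightarrow> (nat \<Rightarrow> int) \<Rightarrow> int \<Rightarrow> ('n::finite, 'k::field) vec set" where
  "topv m es t = loc UNIV (FF m) \<inter> Vt es t"

text \<open>The matrix with the single row \<open>\<gamma>\<close>: a vector read as a functional
  with values in the free module of rank 1, whose only component is 0.\<close>

definition rowm :: "('n, 'k::field) vec \<Rightarrow> nat \<Rightarrow> ('n, 'k) vec" where
  "rowm \<gamma> b = (\<lambda>(c, e). if c = 0 then \<gamma> (b, e) else 0)"

text \<open>The transpose of the matrix \<open>g\<close>: the coordinate vector of the functional
  \<open>\<gamma>\<close> composed with \<open>mat m' g\<close>.\<close>

definition tmat :: "nat \<Rightarrow> nat \<Rightarrow> (nat \<Rightarrow> ('n, 'k::field) vec) \<Rightarrow> ('n, 'k) vec \<Rightarrow> ('n, 'k) vec" where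
  "tmat m' m g \<gamma> = (\<lambda>(a, e). if a < m' then mat m (rowm \<gamma>) (g a) (0, e) else 0)"

lemma neg_free_subspace: "fun_vs.subspace neg_free"
  by (auto simp: fun_vs.subspace_def neg_free_def)

lemma topv_subspace: "fun_vs.subspace (topv m es t)"
  unfolding topv_def by (rule fun_vs.subspace_inter[OF loc_subspace[OF gsubm_FF] Vt_subspace])

lemma topv_iff: "v \<in> topv m es t \<longleftrightarrow> finite {x. v x \<noteq> 0} \<and> (\<forall>b e. v (b, e) \<noteq> 0 \<longrightarrow> b < m \<and> edeg e + es b = t)"
  by (auto simp: topv_def loc_FF Vt_def)

lemma loc_image_lift:
  fixes v :: "('n::finite, 'k::field) vec"
  assumes g: "\<And>a. a < m \<Longrightarrow> g a \<in> Vt es (es' a)"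
    and v: "v \<in> loc S (mat m g ` FF m)" "v \<in> Vt es t"
  shows "\<exists>w\<in>loc S (FF m) \<inter> Vt es' t. v = mat m g w"
proof -
  obtain a :: nat where "sh (xpow S (int a)) v \<in> mat m g ` FF m" using v by (auto simp: loc_def)
  then obtain u where u: "u \<in> FF m" "sh (xpow S (int a)) v = mat m g u" by blast
  define w where "w = hcomp es' t (sh (- xpow S (int a)) u)"
  have uloc: "sh (- xpow S (int a)) u \<in> loc S (FF m)"
    using u(1) by (auto simp: loc_def intro!: exI[of _ a])
  have "v = sh (- xpow S (int a)) (sh (xpow S (int a)) v)" by simp
  also have "\<dots> = mat m g (sh (- xpow S (int a)) u)" using u(2) by (simp only: mat_sh)
  finally have eq: "v = mat m g (sh (- xpow S (int a)) u)" .
  have "v = hcomp es t v" using v(2) hcomp_Vt_eq[of v es t t] by simp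
  also have "\<dots> = hcomp es t (mat m g (sh (- xpow S (int a)) u))" by (rule arg_cong[OF eq])
  also have "\<dots> = mat m g w" unfolding w_def by (rule mat_hcomp) (rule g)
  finally have "v = mat m g w" .
  moreover have "w \<in> loc S (FF m)" unfolding w_def by (rule loc_hcomp[OF gsubm_FF uloc])
  moreover have "w \<in> Vt es' t" unfolding w_def by (rule hcomp_Vt)
  ultimately show ?thesis by blast
qed

lemma loc_kernel:
  assumes "v \<in> loc S (FF m)" "mat m g v = 0"
  shows "v \<in> loc S {v \<in> FF m. mat m g v = 0}"
  using assms by (auto simp: loc_def mat_sh)

lemma mat_loc:
  assumes "\<And>a. a < m \<Longrightarrow> g a \<in> FF m'" "v \<in> loc S (FF m :: ('n::finite, 'k::field) vec set)"
  shows "mat m g v \<in> loc S (FF m')"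
proof -
  obtain a :: nat where "sh (xpow S (int a)) v \<in> FF m" using assms by (auto simp: loc_def)
  hence "mat m g (sh (xpow S (int a)) v) \<in> FF m'"
    by (intro mat_in[OF gsubm_FF order_refl]) (use assms in auto)
  thus ?thesis unfolding loc_def mat_sh by blast
qed

lemma mat_Vt:
  assumes "\<And>a. a < m \<Longrightarrow> g a \<in> Vt es (es' a)" "v \<in> Vt es' t"
  shows "mat m g v \<in> Vt es t"
proof -
  have "hcomp es' t v = v" using assms(2) hcomp_Vt_eq[of v es' t t] by simp
  hence "mat m g v = hcomp es t (mat m g v)" using mat_hcomp[of m g es es' t v] assms(1) by simp
  thus ?thesis using hcomp_Vt by metis
qed

lemma mat_compose:
  fixes v :: "('n::finite, 'k::field) vec"
  assumes fv: "finite {x. v x \<noteq> 0}" "\<And>b e. v (b, e) \<noteq> 0 \<Longrightarrow> b < m"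
    and fg: "\<And>a. a < m \<Longrightarrow> g a \<in> FF m'" and fh: "\<And>a. a < m' \<Longrightarrow> h a \<in> FF m''"
  shows "mat m' h (mat m g v) = mat m (\<lambda>a. mat m' h (g a)) v"
proof -
  have sum: "mat m' h (\<Sum>i\<in>I. f i) = (\<Sum>i\<in>I. mat m' h (f i))" if "finite I" for I :: "(nat \<times> ('n \<Rightarrow> int)) set" and f
    using that
  proof (induction I rule: finite_induct)
    case (insert x F)
    show ?case unfolding sum.insert[OF insert(1,2)] mat_add insert(3) ..
  next
    case empty
    show ?case unfolding sum.empty mat_zero ..
  qed
  have "mat m g v = (\<Sum>x\<in>{x. v x \<noteq> 0}. v x *\<^sub>f sh (snd x) (g (fst x)))"
    by (rule mat_expand) (use assms in \<open>auto simp: FF_def\<close>)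
  hence "mat m' h (mat m g v) = (\<Sum>x\<in>{x. v x \<noteq> 0}. v x *\<^sub>f sh (snd x) (mat m' h (g (fst x))))"
    by (simp only: sum[OF fv(1)] mat_scale mat_sh)
  also have "\<dots> = mat m (\<lambda>a. mat m' h (g a)) v"
  proof (rule mat_expand[symmetric])
    fix a assume "a < m"
    hence "mat m' h (g a) \<in> FF m''" by (intro mat_in[OF gsubm_FF order_refl fh fg])
    thus "finite {x. mat m' h (g a) x \<noteq> 0}" by (simp add: FF_def)
  qed (use fv in auto)
  finally show ?thesis .
qed

lemma rowm_FF: "\<gamma> \<in> FF m \<Longrightarrow> rowm \<gamma> b \<in> FF 1"
proof -
  assume \<gamma>: "\<gamma> \<in> FF m"
  have "{x. rowm \<gamma> b x \<noteq> 0} \<subseteq> (\<lambda>(b, e). (0, e)) ` {x. \<gamma> x \<noteq> 0}"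
    by (force simp: rowm_def split: if_splits)
  hence "finite {x. rowm \<gamma> b x \<noteq> 0}" using \<gamma> finite_surj by (auto simp: FF_def)
  thus ?thesis using \<gamma> by (auto simp: FF_def rowm_def split: if_splits)
qed

lemma mat_rowm_out: "c \<noteq> 0 \<Longrightarrow> mat m (rowm \<gamma>) v (c, e) = 0"
  by (simp add: mat_def rowm_def)

lemma mat_rowm_expand:
  assumes "\<gamma> \<in> FF m" "finite {x. v x \<noteq> 0}" "\<And>b e. v (b, e) \<noteq> 0 \<Longrightarrow> b < m"
  shows "mat m (rowm \<gamma>) v (0, e) = (\<Sum>x\<in>{x. v x \<noteq> 0}. v x * \<gamma> (fst x, e - snd x))"
proof -
  have "mat m (rowm \<gamma>) v = (\<Sum>x\<in>{x. v x \<noteq> 0}. v x *\<^sub>f sh (snd x) (rowm \<gamma> (fst x)))"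
    by (rule mat_expand) (use assms rowm_FF[OF assms(1)] in \<open>auto simp: FF_def\<close>)
  hence "mat m (rowm \<gamma>) v (0, e) = (\<Sum>x\<in>{x. v x \<noteq> 0}. (v x *\<^sub>f sh (snd x) (rowm \<gamma> (fst x))) (0, e))"
    by (simp only: sum_fun_apply)
  thus ?thesis by (simp add: sh_apply rowm_def)
qed

lemma tmat_FF:
  fixes \<gamma> :: "('n::finite, 'k::field) vec"
  assumes "\<gamma> \<in> FF m" "\<And>a. a < m' \<Longrightarrow> g a \<in> FF m"
  shows "tmat m' m g \<gamma> \<in> FF m'"
proof -
  have F: "mat m (rowm \<gamma>) (g a) \<in> FF 1" if "a < m'" for a
    by (rule mat_in[where K = "FF 1", OF gsubm_FF order_refl])
      (use rowm_FF[OF assms(1)] assms(2)[OF that] in auto)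
  have "{x. tmat m' m g \<gamma> x \<noteq> 0} \<subseteq> (\<Union>a<m'. (\<lambda>(b, e). (a, e)) ` {x. mat m (rowm \<gamma>) (g a) x \<noteq> 0})"
    by (force simp: tmat_def split: if_splits)
  moreover have "finite (\<Union>a<m'. (\<lambda>(b, e). (a, e)) ` {x. mat m (rowm \<gamma>) (g a) x \<noteq> 0})"
    using F by (auto simp: FF_def)
  ultimately have "finite {x. tmat m' m g \<gamma> x \<noteq> 0}" by (rule finite_subset)
  moreover have "b < m' \<and> (\<forall>s. 0 \<le> e s)" if "tmat m' m g \<gamma> (b, e) \<noteq> 0" for b e
  proof -
    have "b < m'" "mat m (rowm \<gamma>) (g b) (0, e) \<noteq> 0" using that by (auto simp: tmat_def split: if_splits)
    thus ?thesis using F unfolding FF_def by blast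
  qed
  ultimately show ?thesis by (simp add: FF_def)
qed

lemma tmat_Vt:
  assumes "\<gamma> \<in> Vt (\<lambda>b. - es b) \<mu>" "\<And>a. a < m' \<Longrightarrow> g a \<in> Vt es (es' a)"
  shows "tmat m' m g \<gamma> \<in> Vt (\<lambda>b. - es' b) \<mu>"
  unfolding Vt_def
proof clarify
  fix a e assume "tmat m' m g \<gamma> (a, e) \<noteq> 0"
  hence a: "a < m'" and nz: "mat m (rowm \<gamma>) (g a) (0, e) \<noteq> 0" by (auto simp: tmat_def split: if_splits)
  obtain b where b: "(\<Sum>x\<in>{x. rowm \<gamma> b (0, x) \<noteq> 0}. rowm \<gamma> b (0, x) * g a (b, e - x)) \<noteq> 0"
    using nz[unfolded mat_def prod.case] by (rule sum.not_neutral_contains_not_neutral)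
  obtain x where "rowm \<gamma> b (0, x) * g a (b, e - x) \<noteq> 0"
    using b by (rule sum.not_neutral_contains_not_neutral)
  hence "\<gamma> (b, x) * g a (b, e - x) \<noteq> 0" by (simp add: rowm_def)
  hence x: "\<gamma> (b, x) \<noteq> 0" "g a (b, e - x) \<noteq> 0" by auto
  have "edeg x - es b = \<mu>" using assms(1) x(1) by (auto simp: Vt_def)
  moreover have "edeg (e - x) + es b = es' a" using assms(2)[OF a] x(2) unfolding Vt_def by blast
  ultimately show "edeg e + - es' a = \<mu>" by simp
qed

lemma tmat_add:
  assumes "\<gamma> \<in> FF m" "\<gamma>' \<in> FF m" "\<And>a. a < m' \<Longrightarrow> g a \<in> FF m"
  shows "tmat m' m g (\<gamma> + \<gamma>') = tmat m' m g \<gamma> + tmat m' m g \<gamma>'"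
proof
  fix y :: "nat \<times> ('a \<Rightarrow> int)"
  obtain a e where y: "y = (a, e)" by (cases y)
  have s: "\<gamma> + \<gamma>' \<in> FF m" by (rule fun_vs.subspace_add[OF FF_subspace assms(1,2)])
  show "tmat m' m g (\<gamma> + \<gamma>') y = (tmat m' m g \<gamma> + tmat m' m g \<gamma>') y"
  proof (cases "a < m'")
    case True
    have ga: "finite {x. g a x \<noteq> 0}" "\<And>b e. g a (b, e) \<noteq> 0 \<Longrightarrow> b < m"
      using assms(3)[OF True] by (auto simp: FF_def)
    show ?thesis using True
      by (simp add: y tmat_def mat_rowm_expand[OF s ga] mat_rowm_expand[OF assms(1) ga]
          mat_rowm_expand[OF assms(2) ga] algebra_simps sum.distrib)
  qed (simp add: y tmat_def)
qed

lemma tmat_scale: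
  assumes "\<gamma> \<in> FF m" "\<And>a. a < m' \<Longrightarrow> g a \<in> FF m"
  shows "tmat m' m g (c *\<^sub>f \<gamma>) = c *\<^sub>f tmat m' m g \<gamma>"
proof
  fix y :: "nat \<times> ('a \<Rightarrow> int)"
  obtain a e where y: "y = (a, e)" by (cases y)
  have s: "c *\<^sub>f \<gamma> \<in> FF m" by (rule fun_vs.subspace_scale[OF FF_subspace assms(1)])
  show "tmat m' m g (c *\<^sub>f \<gamma>) y = (c *\<^sub>f tmat m' m g \<gamma>) y"
  proof (cases "a < m'")
    case True
    have ga: "finite {x. g a x \<noteq> 0}" "\<And>b e. g a (b, e) \<noteq> 0 \<Longrightarrow> b < m"
      using assms(2)[OF True] by (auto simp: FF_def)
    show ?thesis using True
      by (simp add: y tmat_def mat_rowm_expand[OF s ga] mat_rowm_expand[OF assms(1) ga] sum_distrib_left algebra_simps)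
  qed (simp add: y tmat_def)
qed

definition pairing :: "nat \<Rightarrow> ('n, 'k::field) vec \<Rightarrow> ('n, 'k) vec \<Rightarrow> 'k" where
  "pairing m \<gamma> v = mat m (rowm \<gamma>) v (0, \<lambda>_. - 1)"

text \<open>Adjointness: the transposed matrix represents composition of functionals with
  \<open>mat m' g\<close>, so it can be moved to the other side of the pairing.\<close>

lemma pairing_mat:
  fixes v :: "('n::finite, 'k::field) vec"
  assumes "\<gamma> \<in> FF m" "\<And>a. a < m' \<Longrightarrow> g a \<in> FF m"
    and v: "finite {x. v x \<noteq> 0}" "\<And>b e. v (b, e) \<noteq> 0 \<Longrightarrow> b < m'"
  shows "pairing m \<gamma> (mat m' g v) = pairing m' (tmat m' m g \<gamma>) v"
proof -
  have "mat m (rowm \<gamma>) (mat m' g v) = mat m' (\<lambda>a. mat m (rowm \<gamma>) (g a)) v"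
    by (rule mat_compose[OF v assms(2) rowm_FF[OF assms(1)]])
  also have "\<dots> = mat m' (rowm (tmat m' m g \<gamma>)) v"
  proof -
    have "rowm (tmat m' m g \<gamma>) a = mat m (rowm \<gamma>) (g a)" if "a < m'" for a
      using that by (auto simp: rowm_def tmat_def fun_eq_iff mat_rowm_out)
    thus ?thesis by (auto simp: mat_def fun_eq_iff)
  qed
  finally show ?thesis by (simp add: pairing_def)
qed

section \<open>Syzygies and dimension shifting along a free resolution\<close>

locale free_res =
  fixes m :: "nat \<Rightarrow> nat" and es :: "nat \<Rightarrow> nat \<Rightarrow> int" and g :: "nat \<Rightarrow> nat \<Rightarrow> ('n::{finite,linorder}, 'k::field) vec"
    and K :: "('n, 'k) vec set"
  assumes gF: "\<And>p a. a < m (Suc p) \<Longrightarrow> g p a \<in> FF (m p)"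
    and gV: "\<And>p a. a < m (Suc p) \<Longrightarrow> g p a \<in> Vt (es p) (es (Suc p) a)"
    and gK: "gsubm (es 0) K" "K \<subseteq> FF (m 0)"
    and im0: "mat (m 1) (g 0) ` FF (m 1) = K"
    and exact: "\<And>p. mat (m (Suc (Suc p))) (g (Suc p)) ` FF (m (Suc (Suc p))) =
      {v \<in> FF (m (Suc p)). mat (m (Suc p)) (g p) v = 0}"
begin

abbreviation "\<Phi> p \<equiv> mat (m (Suc p)) (g p)"

text \<open>The kernel of the map that leaves position \<open>p\<close>, with \<open>K\<close> as
  the kernel of the augmentation. So the free module at position \<open>p\<close> modulo
  \<open>NN p\<close> is the \<open>p\<close>-th syzygy module, and it is isomorphic to
  \<open>NN (p - 1)\<close> for positive \<open>p\<close>.\<close>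

definition "NN p = (case p of 0 \<Rightarrow> K | Suc q \<Rightarrow> {v \<in> FF (m (Suc q)). \<Phi> q v = 0})"

lemma image_NN: "\<Phi> p ` FF (m (Suc p)) = NN p"
  using im0 exact by (cases p) (auto simp: NN_def)

lemma lift_image:
  assumes "v \<in> loc S (\<Phi> p ` FF (m (Suc p)))" "v \<in> Vt (es p) t"
  shows "\<exists>w\<in>loc S (FF (m (Suc p))) \<inter> Vt (es (Suc p)) t. v = \<Phi> p w"
  by (rule loc_image_lift[OF _ assms]) (rule gV)

lemma NN_Suc: "NN (Suc p) = {v \<in> FF (m (Suc p)). \<Phi> p v = 0}"
  by (simp add: NN_def)

lemma NN_sub: "NN p \<subseteq> FF (m p)"
  using gK by (cases p) (auto simp: NN_def)

lemma gNN: "gsubm (es p) (NN p)"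
  by (cases p) (use gK gsubm_kernel[OF gV] in \<open>auto simp: NN_def\<close>)

lemma hh_shift: "hh (es (Suc p)) i t (FF (m (Suc p))) (NN (Suc p)) = hh (es p) i t (NN p) {0}"
  unfolding NN_Suc by (rule hh_image_mat[OF gNN gV image_NN])

lemma zero_NN: "{0} \<subseteq> NN p"
  using fun_vs.subspace_0[OF gsubm_subspace[OF gNN[of p]]] by simp

text \<open>Passing from one syzygy module to the next raises the cohomological degree by 1 as long
  as the free modules have no cohomology there, that is below the number of variables.\<close>

lemma hh_dim_shift:
  assumes "q < CARD('n)"
  shows "hh (es q) (CARD('n) - 1) t (FF (m q)) (NN q) \<le> hh (es 0) (CARD('n) - 1 - q) t (FF (m 0)) (NN 0)"
proof -
  \<comment> \<open>For the induction the final position \<open>q'\<close> is fixed and the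
    cohomological degree is tied to the distance from it, so that it equals
    \<open>CARD('n) - 1\<close> on arrival.\<close>
  have "hh (es q) (CARD('n) - 1 - (q' - q)) t (FF (m q)) (NN q) \<le> hh (es 0) (CARD('n) - 1 - q') t (FF (m 0)) (NN 0)"
    if "q \<le> q'" "q' < CARD('n)" for q q'
    using that
  proof (induction q)
    case (Suc q)
    let ?i = "CARD('n) - 1 - (q' - q)"
    have i: "Suc ?i = CARD('n) - 1 - (q' - Suc q)" "Suc ?i < CARD('n)" using Suc.prems by linarith+
    have "hh (es (Suc q)) (Suc ?i) t (FF (m (Suc q))) (NN (Suc q)) = hh (es q) (Suc ?i) t (NN q) {0}"
      by (rule hh_shift)
    also have "\<dots> \<le> hh (es q) (Suc ?i) t (FF (m q) :: ('n, 'k) vec set) {0} + hh (es q) ?i t (FF (m q)) (NN q)"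
      by (rule hh_triple_left[OF gsubm_zero gNN gsubm_FF zero_NN NN_sub])
    also have "hh (es q) (Suc ?i) t (FF (m q) :: ('n, 'k) vec set) {0} = 0"
      by (rule hh_free_eq_0, rule disjI1, rule i(2))
    also have "0 + hh (es q) ?i t (FF (m q)) (NN q) \<le> hh (es 0) (CARD('n) - 1 - q') t (FF (m 0)) (NN 0)"
      using Suc by simp
    finally show ?case using i by simp
  qed simp
  from this[of q q] show ?thesis using assms by simp
qed

text \<open>Cycles and boundaries, in degree \<open>t\<close> and at position \<open>q\<close>, of
  the complex formed by the top cohomology modules of the resolution. Being zero in top cohomology
  means membership in \<open>neg_free\<close>.\<close>

definition "ZH q t = {v \<in> topv (m q) (es q) t. q = 0 \<or> \<Phi> (q - 1) v \<in> neg_free}"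
definition "BH q t = {v. \<exists>w\<in>topv (m (Suc q)) (es (Suc q)) t. v - \<Phi> q w \<in> neg_free}"

text \<open>The component at the full set is a combination of components at sets missing one
  variable, and in that variable their exponents are nonnegative.\<close>

lemma cd_top_neg_free:
  assumes "u \<in> CC p (FF m') " "p < CARD('n)"
  shows "slice (cd u) UNIV \<in> (neg_free :: ('n, 'k) vec set)"
  unfolding slice_cd
proof (intro fun_vs.subspace_sum fun_vs.subspace_scale neg_free_subspace)
  fix s :: 'n
  have "slice u (UNIV - {s}) \<in> (if card (UNIV - {s}) = p then loc (UNIV - {s}) (FF m') else {0})"
    using assms(1) unfolding CC_def by blast
  hence "slice u (UNIV - {s}) \<in> loc (UNIV - {s}) (FF m')"
    using fun_vs.subspace_0[OF loc_subspace[OF gsubm_FF]] by (auto split: if_splits)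
  thus "slice u (UNIV - {s}) \<in> neg_free" unfolding neg_free_def loc_FF by (force simp: not_le[symmetric])
qed

definition topc :: "('n, 'k) vec \<Rightarrow> ('n, 'k) coch" where
  "topc v = (\<lambda>(S, x). if S = UNIV then v x else 0)"

lemma slice_topc: "slice (topc v) S = (if S = UNIV then v else 0)"
  by (auto simp: slice_def topc_def fun_eq_iff)

lemma topc_CC: "v \<in> loc UNIV A \<Longrightarrow> topc v \<in> CC (CARD('n)) A"
proof -
  assume v: "v \<in> loc UNIV A"
  have "S = UNIV" if "card S = CARD('n)" for S :: "'n set" using that card_subset_eq[of UNIV S] by simp
  thus ?thesis using v by (auto simp: CC_def slice_topc)
qed

lemma topc_Ct: "v \<in> Vt e t \<Longrightarrow> topc v \<in> Ct e t"
  using fun_vs.subspace_0[OF Vt_subspace] by (auto simp: Ct_def slice_topc)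

lemma CC_above:
  assumes "p > CARD('n)"
  shows "CC p A = ({0} :: ('n, 'k) coch set)"
proof -
  have "card S \<noteq> p" for S :: "'n set" using card_mono[of UNIV S] assms by auto
  thus ?thesis by (auto simp: CC_def intro: coch_eqI)
qed

lemma topc_add: "topc (u + v) = topc u + topc v"
  by (rule coch_eqI) (simp only: slice_add slice_topc, simp)

lemma topc_scale: "topc (c *\<^sub>f v) = c *\<^sub>f topc v"
  by (rule coch_eqI) (simp only: slice_scale slice_topc, simp)

lemma slice_CC_top: "c \<in> CC (CARD('n)) A \<Longrightarrow> slice c (UNIV :: 'n set) \<in> loc UNIV A"
proof -
  assume "c \<in> CC (CARD('n)) A"
  hence "slice c (UNIV :: 'n set) \<in> (if card (UNIV :: 'n set) = CARD('n) then loc UNIV A else {0})"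
    unfolding CC_def by blast
  thus ?thesis by simp
qed

text \<open>Top cohomology is right exact: the cokernel at position 0 embeds into the top cohomology
  of the presented module, since cochains of \<open>K\<close> lift to the next free module.\<close>

lemma rdim_ZH_zeroth: "rdim (ZH 0 t) (BH 0 t) \<le> hh (es 0) (CARD('n)) t (FF (m 0)) (NN 0)"
  unfolding hh_def
proof (rule rdim_le_rel[where R = "\<lambda>v c. c = topc v"])
  show "0 = topc 0" by (rule coch_eqI) (simp only: slice_topc, simp)
  show "\<exists>c\<in>Zc (es 0) CARD('n) t (FF (m 0)) (NN 0). c = topc v" if v: "v \<in> ZH 0 t" for v
  proof -
    have "cd (topc v) \<in> CC (Suc (CARD('n))) (FF (m 0))"
      by (rule cd_CC[OF gsubm_FF topc_CC]) (use v in \<open>simp add: ZH_def topv_def\<close>)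
    hence "cd (topc v) \<in> CC (Suc (CARD('n))) (NN 0)" by (simp add: CC_above)
    thus ?thesis using v by (auto simp: Zc_def ZH_def topv_def topc_CC topc_Ct)
  qed
  show "0 \<in> Bc (es 0) CARD('n) t (FF (m 0)) (NN 0)" by (rule Bc_0[OF gsubm_FF gNN])
  fix v c assume "c = topc v" "c \<in> Bc (es 0) CARD('n) t (FF (m 0)) (NN 0)"
  then obtain u w where uw: "u \<in> Cprev CARD('n) (FF (m 0))" "w \<in> CC CARD('n) (NN 0)" "w \<in> Ct (es 0) t"
    "topc v = cd u + w" by (auto elim: Bc_E)
  have v: "v = slice (cd u) UNIV + slice w UNIV"
    using arg_cong[OF uw(4), of "\<lambda>c. slice c UNIV"] by (simp only: slice_topc slice_add if_True simp_thms)
  have "slice (cd u) UNIV \<in> neg_free"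
    using uw(1) cd_top_neg_free[of u "CARD('n) - 1" "m 0"] by (cases "CARD('n)") (auto simp: Cprev_def)
  moreover have "\<exists>w'\<in>loc UNIV (FF (m 1)) \<inter> Vt (es 1) t. slice w UNIV = \<Phi> 0 w'"
    using lift_image[of "slice w UNIV" UNIV 0 t] slice_CC_top[OF uw(2)] uw(3) unfolding image_NN
    by (simp add: Ct_def)
  then obtain w' where "w' \<in> loc UNIV (FF (m 1)) \<inter> Vt (es 1) t" "slice w UNIV = \<Phi> 0 w'" by blast
  moreover have "v - slice w UNIV = slice (cd u) UNIV" using v by simp
  ultimately show "v \<in> BH 0 t" unfolding BH_def topv_def One_nat_def by force
qed (simp_all only: topc_add topc_scale)

text \<open>A cycle \<open>v\<close> at position \<open>q + 1\<close> maps to a vector that is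
  trivial in top cohomology, hence to a coboundary \<open>cd c\<close>; then \<open>c\<close> is a
  cocycle modulo \<open>NN q\<close>. The chase shows that \<open>v\<close> is a boundary when
  \<open>c\<close> is trivial.\<close>

lemma rdim_ZH_Suc:
  "rdim (ZH (Suc q) t) (BH (Suc q) t) \<le> hh (es q) (CARD('n) - 1) t (FF (m q)) (NN q)"
proof -
  let ?n = "CARD('n)"
  have n: "Suc (?n - 1) = ?n" by simp
  show ?thesis
    unfolding hh_def
  proof (rule rdim_le_rel[where R = "\<lambda>v c. c \<in> CC (?n - 1) (FF (m q)) \<and> c \<in> Ct (es q) t \<and>
        v \<in> topv (m (Suc q)) (es (Suc q)) t \<and> slice (cd c) UNIV = \<Phi> q v"])
    have a: "fun_vs.subspace (CC (?n - 1) (FF (m q)) :: ('n, 'k) coch set)" by (rule CC_subspace[OF gsubm_FF])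
    show "(0 :: ('n, 'k) coch) \<in> CC (?n - 1) (FF (m q)) \<and> (0 :: ('n, 'k) coch) \<in> Ct (es q) t \<and>
        (0 :: ('n, 'k) vec) \<in> topv (m (Suc q)) (es (Suc q)) t \<and> slice (cd 0) UNIV = \<Phi> q 0"
      by (intro conjI fun_vs.subspace_0[OF a] Ct_closed(1) fun_vs.subspace_0[OF topv_subspace])
        (simp only: cd_zero slice_zero mat_zero)
    show "b + b' \<in> CC (?n - 1) (FF (m q)) \<and> b + b' \<in> Ct (es q) t \<and>
        a + a' \<in> topv (m (Suc q)) (es (Suc q)) t \<and> slice (cd (b + b')) UNIV = \<Phi> q (a + a')"
      if "b \<in> CC (?n - 1) (FF (m q)) \<and> b \<in> Ct (es q) t \<and>
          a \<in> topv (m (Suc q)) (es (Suc q)) t \<and> slice (cd b) UNIV = \<Phi> q a"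
        "b' \<in> CC (?n - 1) (FF (m q)) \<and> b' \<in> Ct (es q) t \<and>
          a' \<in> topv (m (Suc q)) (es (Suc q)) t \<and> slice (cd b') UNIV = \<Phi> q a'" for a b a' b'
      using that unfolding cd_add slice_add mat_add
      by (auto simp only: intro: fun_vs.subspace_add[OF a] fun_vs.subspace_add[OF topv_subspace] Ct_closed(2))
    show "c *\<^sub>f b \<in> CC (?n - 1) (FF (m q)) \<and> c *\<^sub>f b \<in> Ct (es q) t \<and>
        c *\<^sub>f a \<in> topv (m (Suc q)) (es (Suc q)) t \<and> slice (cd (c *\<^sub>f b)) UNIV = \<Phi> q (c *\<^sub>f a)"
      if "b \<in> CC (?n - 1) (FF (m q)) \<and> b \<in> Ct (es q) t \<and>
          a \<in> topv (m (Suc q)) (es (Suc q)) t \<and> slice (cd b) UNIV = \<Phi> q a" for c a b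
      using that unfolding cd_scale slice_scale mat_scale
      by (auto simp only: intro: fun_vs.subspace_scale[OF a] fun_vs.subspace_scale[OF topv_subspace] Ct_closed(3))
    show "0 \<in> Bc (es q) (?n - 1) t (FF (m q)) (NN q)" by (rule Bc_0[OF gsubm_FF gNN])
    show "\<exists>c\<in>Zc (es q) (?n - 1) t (FF (m q)) (NN q). c \<in> CC (?n - 1) (FF (m q)) \<and> c \<in> Ct (es q) t \<and>
        v \<in> topv (m (Suc q)) (es (Suc q)) t \<and> slice (cd c) UNIV = \<Phi> q v" if v: "v \<in> ZH (Suc q) t" for v
    proof -
      have vt: "v \<in> loc UNIV (FF (m (Suc q)))" "v \<in> Vt (es (Suc q)) t" and nf: "\<Phi> q v \<in> neg_free"
        using v by (auto simp: ZH_def topv_def)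
      have 1: "\<Phi> q v \<in> loc UNIV (FF (m q))" by (rule mat_loc[OF gF vt(1)])
      have 2: "\<Phi> q v \<in> Vt (es q) t" by (rule mat_Vt[OF gV vt(2)])
      have "cd (topc (\<Phi> q v)) \<in> CC (Suc ?n) (FF (m q))" by (rule cd_CC[OF gsubm_FF topc_CC[OF 1]])
      hence 3: "cd (topc (\<Phi> q v)) = 0" by (simp add: CC_above)
      have 4: "topc (\<Phi> q v) (S, b, e) = 0" if "\<And>s. e s < 0" for S b e
        using nf that by (auto simp: neg_free_def topc_def)
      \<comment> \<open>\<open>\<Phi> q v\<close> has no strictly negative exponents, so it bounds a
        cochain of the free module; since \<open>\<Phi> q v\<close> also lies in the localized
        \<open>NN q\<close>, that cochain is a cocycle modulo \<open>NN q\<close>.\<close>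
      have "\<exists>c. c \<in> Cprev ?n (FF (m q)) \<and> c \<in> Ct (es q) t \<and> topc (\<Phi> q v) = cd c"
      proof (rule cech_free_exact[OF topc_CC[OF 1] topc_Ct[OF 2] 3])
        show "topc (\<Phi> q v) (S, b, e) = 0" if "\<And>s. e s < 0" for S b e using 4 that by blast
      qed blast
      then obtain c where c: "c \<in> Cprev ?n (FF (m q))" "c \<in> Ct (es q) t" "topc (\<Phi> q v) = cd c" by blast
      have cC: "c \<in> CC (?n - 1) (FF (m q))" 
      proof -
        have "c \<in> Cprev (Suc (?n - 1)) (FF (m q))" using c(1) by (simp only: n)
        thus ?thesis by (simp only: Cprev_def nat.case)
      qed
      have "\<Phi> q v \<in> loc UNIV (NN q)"
      proof -
        obtain a :: nat where "sh (xpow UNIV (int a)) v \<in> FF (m (Suc q))" using vt by (auto simp: loc_def)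
        hence "\<Phi> q (sh (xpow UNIV (int a)) v) \<in> NN q" using image_NN[of q] by blast
        thus ?thesis unfolding loc_def mat_sh by blast
      qed
      hence "topc (\<Phi> q v) \<in> CC ?n (NN q)" by (rule topc_CC)
      hence "cd c \<in> CC (Suc (?n - 1)) (NN q)" by (simp only: n c(3))
      hence "c \<in> Zc (es q) (?n - 1) t (FF (m q)) (NN q)" using c cC by (simp only: Zc_def) blast
      moreover have "slice (cd c) UNIV = \<Phi> q v" unfolding c(3)[symmetric] by (simp add: slice_topc)
      ultimately show ?thesis using c(2) cC v by (auto simp: ZH_def)
    qed
    fix v c
    assume R: "c \<in> CC (?n - 1) (FF (m q)) \<and> c \<in> Ct (es q) t \<and>
        v \<in> topv (m (Suc q)) (es (Suc q)) t \<and> slice (cd c) UNIV = \<Phi> q v"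
      and cB: "c \<in> Bc (es q) (?n - 1) t (FF (m q)) (NN q)"
    obtain u w where uw: "w \<in> CC (?n - 1) (NN q)" "w \<in> Ct (es q) t" "c = cd u + w"
      using cB by (auto elim: Bc_E)
    \<comment> \<open>The part of \<open>c\<close> in \<open>NN q\<close> is lifted, set by set, to
      the free module at position \<open>q + 1\<close>. Subtracting the coboundary of the lift from
      \<open>v\<close> lands in the kernel of \<open>\<Phi> q\<close>, which is the image of the
      next map.\<close>
    have "\<exists>y. y \<in> (if card S = ?n - 1 then loc S (FF (m (Suc q))) else {0}) \<and> y \<in> Vt (es (Suc q)) t \<and>
        slice w S = \<Phi> q y" for S
    proof (cases "card S = ?n - 1")
      case True
      have "slice w S \<in> (if card S = ?n - 1 then loc S (NN q) else {0})" using uw(1) unfolding CC_def by blast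
      hence "slice w S \<in> loc S (\<Phi> q ` FF (m (Suc q)))" using True image_NN by simp
      moreover have "slice w S \<in> Vt (es q) t" using uw(2) by (simp add: Ct_def)
      ultimately show ?thesis using lift_image[of "slice w S" S q t] True by auto
    next
      case False
      have "slice w S \<in> (if card S = ?n - 1 then loc S (NN q) else {0})" using uw(1) unfolding CC_def by blast
      hence "slice w S = 0" using False by simp
      thus ?thesis using False fun_vs.subspace_0[OF Vt_subspace] by (intro exI[of _ 0]) simp
    qed
    then obtain y where y: "\<And>S. y S \<in> (if card S = ?n - 1 then loc S (FF (m (Suc q))) else {0})"
        "\<And>S. y S \<in> Vt (es (Suc q)) t" "\<And>S. slice w S = \<Phi> q (y S)" by metis
    define Y :: "('n, 'k) coch" where "Y = (\<lambda>(S, x). y S x)"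
    have sY: "slice Y S = y S" for S by (simp add: Y_def slice_def)
    have YC: "Y \<in> CC (?n - 1) (FF (m (Suc q)))" "Y \<in> Ct (es (Suc q)) t" using y by (simp_all add: CC_def Ct_def sY)
    let ?d = "slice (cd Y) UNIV"
    have dnf: "?d \<in> neg_free" by (rule cd_top_neg_free[OF YC(1)]) simp
    have "\<Phi> q ?d = slice (cd w) UNIV"
    proof -
      have "\<Phi> q (\<Sum>s\<in>J. csgn UNIV s *\<^sub>f slice Y (UNIV - {s})) = (\<Sum>s\<in>J. csgn UNIV s *\<^sub>f slice w (UNIV - {s}))" for J
      proof (induction J rule: infinite_finite_induct)
        case (insert x F)
        show ?case unfolding sum.insert[OF insert(1,2)] mat_add insert(3) mat_scale unfolding sY y(3) ..
      next
        case (infinite A)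
        show ?case unfolding sum.infinite[OF infinite] mat_zero ..
      next
        case empty
        show ?case unfolding sum.empty mat_zero ..
      qed
      thus ?thesis unfolding slice_cd by blast
    qed
    also have "\<dots> = slice (cd c) UNIV" using uw(3) by (simp add: cd_add)
    also have "\<dots> = \<Phi> q v" using R by simp
    finally have ker: "\<Phi> q (v - ?d) = 0" unfolding mat_diff by simp
    have "cd Y \<in> CC ?n (FF (m (Suc q)))" using cd_CC[OF gsubm_FF YC(1)] n by simp
    hence d1: "?d \<in> loc UNIV (FF (m (Suc q)))" by (rule slice_CC_top)
    have d2: "?d \<in> Vt (es (Suc q)) t" using cd_Ct[OF YC(2)] by (simp add: Ct_def)
    have 1: "v - ?d \<in> loc UNIV (FF (m (Suc q)))"
      using R d1 by (auto simp: topv_def intro: fun_vs.subspace_diff[OF loc_subspace[OF gsubm_FF]])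
    have 2: "v - ?d \<in> Vt (es (Suc q)) t"
      using R d2 by (auto simp: topv_def intro: fun_vs.subspace_diff[OF Vt_subspace])
    have "v - ?d \<in> loc UNIV (\<Phi> (Suc q) ` FF (m (Suc (Suc q))))"
      using loc_kernel[OF 1 ker] exact by simp
    then obtain w' where w': "w' \<in> loc UNIV (FF (m (Suc (Suc q))))" "w' \<in> Vt (es (Suc (Suc q))) t" "v - ?d = \<Phi> (Suc q) w'"
      using lift_image[of "v - ?d" UNIV "Suc q" t] 2 by blast
    have "v - \<Phi> (Suc q) w' = ?d" unfolding w'(3)[symmetric] by simp
    hence "v - \<Phi> (Suc q) w' \<in> neg_free" using dnf by metis
    thus "v \<in> BH (Suc q) t" unfolding BH_def topv_def using w' by blast
  qed
qed

lemma rdim_ZH_le: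
  assumes "q < CARD('n)"
  shows "rdim (ZH q t) (BH q t) \<le> hh (es 0) (CARD('n) - q) t (FF (m 0)) (NN 0)"
proof (cases q)
  case 0
  thus ?thesis using rdim_ZH_zeroth by simp
next
  case (Suc p)
  thus ?thesis using order_trans[OF rdim_ZH_Suc[of p t] hh_dim_shift[of p t]] assms by simp
qed

section \<open>Dual complex and residue pairing\<close>

definition "GG q \<mu> = FF (m q) \<inter> Vt (\<lambda>b. - es q b) \<mu>"

abbreviation "\<Phi>t p \<equiv> tmat (m (Suc p)) (m p) (g p)"

definition "ZG q \<mu> = {\<gamma> \<in> GG q \<mu>. \<Phi>t q \<gamma> = 0}"
definition "BG q \<mu> = (case q of 0 \<Rightarrow> {0} | Suc p \<Rightarrow> \<Phi>t p ` GG p \<mu>)"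

lemma GG_subspace: "fun_vs.subspace (GG q \<mu>)"
  unfolding GG_def by (rule fun_vs.subspace_inter[OF FF_subspace Vt_subspace])

lemma \<Phi>t_GG: "\<gamma> \<in> GG p \<mu> \<Longrightarrow> \<Phi>t p \<gamma> \<in> GG (Suc p) \<mu>"
  unfolding GG_def using tmat_FF[of \<gamma> "m p" "m (Suc p)" "g p"] gF
    tmat_Vt[of \<gamma> "es p" \<mu> "m (Suc p)" "g p" "es (Suc p)" "m p"] gV by blast

lemma BG_subspace: "fun_vs.subspace (BG q \<mu>)"
proof (cases q)
  case 0
  thus ?thesis by (simp add: BG_def fun_vs.subspace_single_0)
next
  case (Suc p)
  note s = GG_subspace[of p \<mu>]
  have F: "\<gamma> \<in> FF (m p)" if "\<gamma> \<in> GG p \<mu>" for \<gamma> using that by (simp add: GG_def)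
  have add: "\<Phi>t p (u + v) = \<Phi>t p u + \<Phi>t p v" if "u \<in> GG p \<mu>" "v \<in> GG p \<mu>" for u v
    by (rule tmat_add) (use that F gF in auto)
  have scale: "\<Phi>t p (c *\<^sub>f u) = c *\<^sub>f \<Phi>t p u" if "u \<in> GG p \<mu>" for c u
    by (rule tmat_scale) (use that F gF in auto)
  have "\<Phi>t p 0 = 0" using scale[OF fun_vs.subspace_0[OF s], of 0] by simp
  hence "0 \<in> \<Phi>t p ` GG p \<mu>" using fun_vs.subspace_0[OF s] by (metis image_eqI)
  moreover have "x + y \<in> \<Phi>t p ` GG p \<mu>" if xy: "x \<in> \<Phi>t p ` GG p \<mu>" "y \<in> \<Phi>t p ` GG p \<mu>" for x y
  proof -
    obtain u v where "u \<in> GG p \<mu>" "v \<in> GG p \<mu>" "x = \<Phi>t p u" "y = \<Phi>t p v" using xy by blast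
    thus ?thesis by (intro image_eqI[of _ _ "u + v"] fun_vs.subspace_add[OF s]) (simp only: add)
  qed
  moreover have "c *\<^sub>f x \<in> \<Phi>t p ` GG p \<mu>" if x: "x \<in> \<Phi>t p ` GG p \<mu>" for c x
  proof -
    obtain u where "u \<in> GG p \<mu>" "x = \<Phi>t p u" using x by blast
    thus ?thesis by (intro image_eqI[of _ _ "c *\<^sub>f u"] fun_vs.subspace_scale[OF s]) (simp only: scale)
  qed
  ultimately show ?thesis using Suc unfolding fun_vs.subspace_def by (simp add: BG_def)
qed

text \<open>
  The pairing is the residue pairing: the coefficient of the monomial with all exponents \<open>-1\<close>.
  Independent classes in Ext are separated by functionals on a finite-dimensional space, and a
  functional is the pairing with a vector of strictly negative monomials.
\<close>

lemma rdim_ZG_le: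
  assumes t: "t = - int CARD('n) - \<mu>"
  shows "rdim (ZG q \<mu>) (BG q \<mu>) \<le> rdim (ZH q t) (BH q t)"
proof (rule rdim_least)
  fix S assume S: "S \<subseteq> ZG q \<mu>" "rindep (BG q \<mu>) S"
  obtain \<Lambda> :: "('n, 'k) vec \<Rightarrow> ('n, 'k) vec \<Rightarrow> 'k" where \<Lambda>:
    "\<And>s u v. \<Lambda> s (u + v) = \<Lambda> s u + \<Lambda> s v"
    "\<And>s c v. \<Lambda> s (c *\<^sub>f v) = c * \<Lambda> s v"
    "\<And>s b. b \<in> BG q \<mu> \<Longrightarrow> \<Lambda> s b = 0"
    "\<And>s s'. s \<in> S \<Longrightarrow> s' \<in> S \<Longrightarrow> \<Lambda> s s' = (if s = s' then 1 else 0)"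
    using rindep_functionals[OF BG_subspace S(2)] by blast
  let ?o = "(\<lambda>_. - 1) :: 'n \<Rightarrow> int"
  have edeg_o: "edeg ?o = - int CARD('n)" by (simp add: edeg_def)
  define E :: "nat \<times> ('n \<Rightarrow> int) \<Rightarrow> ('n, 'k) vec" where "E = (\<lambda>(b, y). sh y (bas b))"
  have E_apply: "E x y = (if x = y then 1 else 0)" for x y
    by (cases x; cases y) (auto simp: E_def sh_apply bas_def)
  have \<Lambda>0: "\<Lambda> s 0 = 0" for s using \<Lambda>(2)[of s 0 0] by simp
  have \<Lambda>sum: "\<Lambda> s (\<Sum>x\<in>J. f x *\<^sub>f E x) = (\<Sum>x\<in>J. f x * \<Lambda> s (E x))" if "finite J" for s J f
    using that
  proof (induction J rule: finite_induct)
    case (insert x F)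
    show ?case unfolding sum.insert[OF insert(1,2)] \<Lambda>(1,2) insert(3) ..
  next
    case empty
    show ?case unfolding sum.empty by (rule \<Lambda>0)
  qed
  have expand: "\<gamma> = (\<Sum>x\<in>{x. \<gamma> x \<noteq> 0}. \<gamma> x *\<^sub>f E x)" if "finite {x. \<gamma> x \<noteq> 0}" for \<gamma> :: "('n, 'k) vec"
  proof
    fix y
    have "(\<Sum>x\<in>{x. \<gamma> x \<noteq> 0}. \<gamma> x *\<^sub>f E x) y = (\<Sum>x\<in>{x. \<gamma> x \<noteq> 0}. if x = y then \<gamma> x else 0)"
      unfolding sum_fun_apply by (rule sum.cong) (auto simp: E_apply)
    also have "\<dots> = \<gamma> y" using that by (simp add: sum.delta)
    finally show "\<gamma> y = (\<Sum>x\<in>{x. \<gamma> x \<noteq> 0}. \<gamma> x *\<^sub>f E x) y" ..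
  qed
  \<comment> \<open>The coefficient of \<open>ve s\<close> at an exponent is the value of
    \<open>\<Lambda> s\<close> on the monomial complementary to it with respect to the exponent with
    all entries -1. Pairing with \<open>ve s\<close> therefore gives \<open>\<Lambda> s\<close>. The
    degree condition keeps the support finite.\<close>
  define ve :: "('n, 'k) vec \<Rightarrow> ('n, 'k) vec" where "ve = (\<lambda>s (b, e). if b < m q \<and> (\<forall>i. e i < 0) \<and> edeg e + es q b = t
      then \<Lambda> s (E (b, ?o - e)) else 0)"
  have fin_ve: "finite {x. ve s x \<noteq> 0}" for s
  proof -
    have "{x. ve s x \<noteq> 0} \<subseteq> (\<Union>b<m q. (\<lambda>a. (b, ?o - expo a)) ` {a. mon_deg a \<le> nat (\<mu> + es q b)})"
    proof
      fix x assume "x \<in> {x. ve s x \<noteq> 0}"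
      moreover obtain b e where x: "x = (b, e)" by (cases x)
      ultimately have be: "b < m q" "\<And>i. e i < 0" "edeg e + es q b = t" by (auto simp: ve_def split: if_splits)
      have "0 \<le> (?o - e) i" for i using be(2)[of i] by simp
      then obtain a where a: "?o - e = expo a" using expo_exists by blast
      have "int (mon_deg a) = \<mu> + es q b"
        using arg_cong[OF a, of edeg] edeg_o be(3) t by simp
      moreover have "e = ?o - expo a" using a by (simp add: algebra_simps flip: a)
      ultimately show "x \<in> (\<Union>b<m q. (\<lambda>a. (b, ?o - expo a)) ` {a. mon_deg a \<le> nat (\<mu> + es q b)})"
        using be(1) x by (intro UN_I[of b] image_eqI[of _ _ a]) auto
    qed
    thus ?thesis by (rule finite_subset) (auto intro!: finite_imageI finite_mon_deg_le)
  qed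
  have ve_top: "ve s \<in> topv (m q) (es q) t" for s
    unfolding topv_iff using fin_ve by (auto simp: ve_def split: if_splits)
  have pair_expand: "pairing (m q) \<gamma> v = (\<Sum>x\<in>{x. v x \<noteq> 0}. v x * \<gamma> (fst x, ?o - snd x))"
    if "\<gamma> \<in> GG q \<mu>" "v \<in> topv (m q) (es q) t" for \<gamma> v
    unfolding pairing_def by (rule mat_rowm_expand) (use that in \<open>auto simp: GG_def topv_iff\<close>)
  have pair_ve: "pairing (m q) \<gamma> (ve s) = \<Lambda> s \<gamma>" if \<gamma>: "\<gamma> \<in> GG q \<mu>" for \<gamma> s
  proof -
    have fin: "finite {x. \<gamma> x \<noteq> 0}" using \<gamma> by (auto simp: GG_def FF_def)
    have val: "ve s (b, ?o - e) = \<Lambda> s (E (b, e))" if "\<gamma> (b, e) \<noteq> 0" for b e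
    proof -
      have "b < m q" "\<And>i. 0 \<le> e i" "edeg e + - es q b = \<mu>"
        using \<gamma> that by (auto simp: GG_def FF_def Vt_def)
      moreover have "(?o - e) i < 0" for i using \<open>\<And>i. 0 \<le> e i\<close>[of i] by simp
      ultimately show ?thesis using edeg_o t by (simp add: ve_def)
    qed
    have "pairing (m q) \<gamma> (ve s) = (\<Sum>x\<in>{x. ve s x \<noteq> 0}. ve s x * \<gamma> (fst x, ?o - snd x))"
      by (rule pair_expand[OF \<gamma> ve_top])
    also have "\<dots> = (\<Sum>x\<in>{x. ve s x \<noteq> 0 \<and> \<gamma> (fst x, ?o - snd x) \<noteq> 0}. ve s x * \<gamma> (fst x, ?o - snd x))"
      by (rule sum.mono_neutral_right) (use fin_ve in auto)
    also have "\<dots> = (\<Sum>x\<in>{x. \<gamma> x \<noteq> 0 \<and> ve s (fst x, ?o - snd x) \<noteq> 0}. \<gamma> x * ve s (fst x, ?o - snd x))"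
      by (rule sum.reindex_bij_witness[of _ "\<lambda>x. (fst x, ?o - snd x)" "\<lambda>x. (fst x, ?o - snd x)"]) auto
    also have "\<dots> = (\<Sum>x\<in>{x. \<gamma> x \<noteq> 0}. \<gamma> x * ve s (fst x, ?o - snd x))"
      by (rule sum.mono_neutral_left) (use fin in auto)
    also have "\<dots> = (\<Sum>x\<in>{x. \<gamma> x \<noteq> 0}. \<gamma> x * \<Lambda> s (E x))"
      by (rule sum.cong) (auto simp: val)
    also have "\<dots> = \<Lambda> s (\<Sum>x\<in>{x. \<gamma> x \<noteq> 0}. \<gamma> x *\<^sub>f E x)" by (rule \<Lambda>sum[OF fin, symmetric])
    also have "\<dots> = \<Lambda> s \<gamma>" by (rule arg_cong[OF expand[OF fin, symmetric]])
    finally show ?thesis .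
  qed
  have ve_ZH: "ve s \<in> ZH q t" for s
  proof (cases q)
    case 0
    thus ?thesis using ve_top[of s] by (simp add: ZH_def)
  next
    case (Suc p)
    have top: "finite {x. ve s x \<noteq> 0}" "\<And>b e. ve s (b, e) \<noteq> 0 \<Longrightarrow> b < m (Suc p)"
      using ve_top[of s] Suc unfolding topv_iff by blast+
    \<comment> \<open>A coefficient at a strictly negative exponent is the pairing with the
      complementary monomial \<open>?\<gamma>\<close>. By adjointness it equals the value of
      \<open>\<Lambda> s\<close> on a boundary, which is 0.\<close>
    have "\<Phi> p (ve s) (b, e) = 0" if neg: "\<And>i. e i < 0" for b e
    proof (rule ccontr)
      assume nz: "\<Phi> p (ve s) (b, e) \<noteq> 0"
      have "\<Phi> p (ve s) \<in> loc UNIV (FF (m p))" by (rule mat_loc[OF gF]) (use ve_top[of s] Suc in \<open>simp_all add: topv_def\<close>)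
      hence b: "b < m p" using nz unfolding loc_FF by blast
      have "\<Phi> p (ve s) \<in> Vt (es p) t" by (rule mat_Vt[OF gV]) (use ve_top[of s] Suc in \<open>simp_all add: topv_def\<close>)
      hence deg: "edeg e + es p b = t" using nz unfolding Vt_def by blast
      let ?\<gamma> = "E (b, ?o - e)"
      have "0 \<le> (?o - e) i" for i using neg[of i] by simp
      hence F: "?\<gamma> \<in> FF (m p)" unfolding E_def prod.case by (intro sh_FF bas_FF b)
      have "?\<gamma> \<in> Vt (\<lambda>b. - es p b) \<mu>"
      proof -
        have "\<mu> - edeg (?o - e) = - es p b" using deg edeg_o t by simp
        thus ?thesis unfolding E_def prod.case sh_Vt_iff using bas_Vt[of b "\<lambda>b. - es p b"] by simp
      qed
      hence G: "?\<gamma> \<in> GG p \<mu>" using F by (simp add: GG_def)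
      have loc: "finite {x. \<Phi> p (ve s) x \<noteq> 0}" "\<And>b e. \<Phi> p (ve s) (b, e) \<noteq> 0 \<Longrightarrow> b < m p"
        using \<open>\<Phi> p (ve s) \<in> loc UNIV (FF (m p))\<close> unfolding loc_FF by blast+
      have "pairing (m p) ?\<gamma> (\<Phi> p (ve s)) = (\<Sum>x\<in>{x. \<Phi> p (ve s) x \<noteq> 0}. \<Phi> p (ve s) x * ?\<gamma> (fst x, ?o - snd x))"
        unfolding pairing_def by (rule mat_rowm_expand[OF F loc])
      also have "\<dots> = (\<Sum>x\<in>{x. \<Phi> p (ve s) x \<noteq> 0}. if x = (b, e) then \<Phi> p (ve s) x else 0)"
      proof (rule sum.cong[OF refl])
        fix x :: "nat \<times> ('n \<Rightarrow> int)"
        have "((b, ?o - e) = (fst x, ?o - snd x)) = (x = (b, e))" by (cases x) auto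
        thus "\<Phi> p (ve s) x * ?\<gamma> (fst x, ?o - snd x) = (if x = (b, e) then \<Phi> p (ve s) x else 0)"
          by (simp add: E_apply)
      qed
      also have "\<dots> = \<Phi> p (ve s) (b, e)" using loc(1) nz by (simp add: sum.delta)
      finally have "\<Phi> p (ve s) (b, e) = pairing (m p) ?\<gamma> (\<Phi> p (ve s))" ..
      also have "\<dots> = pairing (m (Suc p)) (\<Phi>t p ?\<gamma>) (ve s)" by (rule pairing_mat[OF F gF top])
      also have "\<dots> = \<Lambda> s (\<Phi>t p ?\<gamma>)" using pair_ve[of "\<Phi>t p ?\<gamma>" s] \<Phi>t_GG[OF G] Suc by simp
      also have "\<dots> = 0" by (rule \<Lambda>(3)) (use G Suc in \<open>auto simp: BG_def\<close>)
      finally show False using nz by simp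
    qed
    thus ?thesis using ve_top[of s] Suc by (simp add: ZH_def neg_free_def)
  qed
  have zBH: "0 \<in> BH q t"
    unfolding BH_def using fun_vs.subspace_0[OF topv_subspace] fun_vs.subspace_0[OF neg_free_subspace]
    by (auto intro!: bexI[of _ 0])
  have "inj_on ve S \<and> rindep (BH q t) (ve ` S)"
  proof (rule rindep_family)
    fix c assume B: "(\<Sum>s\<in>S. c s *\<^sub>f ve s) \<in> BH q t"
    let ?v = "\<Sum>s\<in>S. c s *\<^sub>f ve s"
    obtain w where w: "w \<in> topv (m (Suc q)) (es (Suc q)) t" "?v - \<Phi> q w \<in> neg_free" using B unfolding BH_def by blast
    have vt: "?v \<in> topv (m q) (es q) t"
      by (intro fun_vs.subspace_sum fun_vs.subspace_scale topv_subspace ve_top)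
    have \<Phi>w: "\<Phi> q w \<in> topv (m q) (es q) t"
      using w(1) unfolding topv_def by (auto intro: mat_loc[OF gF] mat_Vt[OF gV])
    show "\<forall>s\<in>S. c s = 0"
    proof
      fix s' assume s': "s' \<in> S"
      have G: "s' \<in> GG q \<mu>" "\<Phi>t q s' = 0" using s' S(1) by (auto simp: ZG_def)
      have padd: "pairing (m q) s' (u + v) = pairing (m q) s' u + pairing (m q) s' v" for u v
        by (simp add: pairing_def mat_add)
      have pscale: "pairing (m q) s' (r *\<^sub>f v) = r * pairing (m q) s' v" for r v
        by (simp add: pairing_def mat_scale)
      have p0: "pairing (m q) s' 0 = 0" by (simp add: pairing_def)
      have "pairing (m q) s' (\<Sum>s\<in>J. c s *\<^sub>f ve s) = (\<Sum>s\<in>J. c s * \<Lambda> s s')" if "finite J" for J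
        using that
      proof (induction J rule: finite_induct)
        case (insert x F)
        show ?case unfolding sum.insert[OF insert(1,2)] padd pscale insert(3) pair_ve[OF G(1)] ..
      next
        case empty
        show ?case unfolding sum.empty by (rule p0)
      qed
      hence "pairing (m q) s' ?v = (\<Sum>s\<in>S. c s * \<Lambda> s s')" using rindep_finite[OF S(2)] by blast
      also have "\<dots> = (\<Sum>s\<in>S. if s = s' then c s else 0)"
        by (rule sum.cong) (auto simp: \<Lambda>(4) s')
      also have "\<dots> = c s'" using s' rindep_finite[OF S(2)] by simp
      finally have 1: "pairing (m q) s' ?v = c s'" .
      \<comment> \<open>Where the polynomial vector \<open>s'\<close> can contribute to the residue,
        the other factor is evaluated at a strictly negative exponent, and there a vector of
        \<open>neg_free\<close> vanishes.\<close>
      have 2: "pairing (m q) s' (?v - \<Phi> q w) = 0"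
      proof -
        have "pairing (m q) s' (?v - \<Phi> q w) =
            (\<Sum>x\<in>{x. (?v - \<Phi> q w) x \<noteq> 0}. (?v - \<Phi> q w) x * s' (fst x, ?o - snd x))"
          by (rule pair_expand[OF G(1) fun_vs.subspace_diff[OF topv_subspace vt \<Phi>w]])
        also have "\<dots> = 0"
        proof (rule sum.neutral, rule ballI)
          fix x :: "nat \<times> ('n \<Rightarrow> int)"
          obtain b e where x: "x = (b, e)" by (cases x)
          show "(?v - \<Phi> q w) x * s' (fst x, ?o - snd x) = 0"
          proof (cases "s' (b, ?o - e) = 0")
            case False
            have "\<And>i. 0 \<le> (?o - e) i" using False G(1) unfolding GG_def FF_def by blast
            have "e i < 0" for i using \<open>\<And>i. 0 \<le> (?o - e) i\<close>[of i] by simp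
            hence "\<forall>i. e i < 0" by blast
            hence "(?v - \<Phi> q w) x = 0" using w(2) x unfolding neg_free_def by blast
            thus ?thesis by simp
          qed (simp add: x)
        qed
        finally show ?thesis .
      qed
      have "pairing (m q) s' (\<Phi> q w) = pairing (m (Suc q)) (\<Phi>t q s') w"
        by (rule pairing_mat) (use G(1) gF w(1) in \<open>auto simp: GG_def topv_iff\<close>)
      hence 3: "pairing (m q) s' (\<Phi> q w) = 0" using G(2) by (simp add: pairing_def mat_def rowm_def)
      have "pairing (m q) s' ?v = pairing (m q) s' (?v - \<Phi> q w) + pairing (m q) s' (\<Phi> q w)"
        unfolding padd[symmetric] by simp
      thus "c s' = 0" using 1 2 3 by simp
    qed
  qed (use rindep_finite[OF S(2)] zBH in auto)
  thus "enat (card S) \<le> rdim (ZH q t) (BH q t)"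
    using rdim_upper[of "ve ` S" "ZH q t" "BH q t"] ve_ZH by (auto simp: card_image)
qed

lemma ext_le:
  assumes "q < CARD('n)"
  shows "rdim (ZG q \<mu>) (BG q \<mu>) \<le> hh (es 0) (CARD('n) - q) (- int CARD('n) - \<mu>) (FF (m 0)) K"
  using order_trans[OF rdim_ZG_le[OF refl, of q \<mu>] rdim_ZH_le[OF assms]] by (simp add: NN_def)

end

section \<open>Modules represented by groups of functions\<close>

text \<open>A surjection \<open>g\<close> from a concrete group with an operation of the polynomials
  onto the record \<open>N\<close>. Subquotients of records are computed on representatives, and the
  group laws of \<open>N\<close> are derived instead of being assumed.\<close>

locale rep =
  fixes A :: "'v::ab_group_add set" and \<alpha> :: "('n, 'k::field) mpoly \<Rightarrow> 'v \<Rightarrow> 'v"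
    and g :: "'v \<Rightarrow> 'm" and N :: "(('n, 'k) mpoly, 'm) gmodule"
  assumes A0: "0 \<in> A"
    and A_add: "u \<in> A \<Longrightarrow> v \<in> A \<Longrightarrow> u + v \<in> A"
    and A_minus: "u \<in> A \<Longrightarrow> - u \<in> A"
    and A_act: "u \<in> A \<Longrightarrow> \<alpha> p u \<in> A"
    and car: "carrier N = g ` A"
    and g_add: "u \<in> A \<Longrightarrow> v \<in> A \<Longrightarrow> g (u + v) = g u \<oplus>\<^bsub>N\<^esub> g v"
    and g_zero: "g 0 = \<zero>\<^bsub>N\<^esub>"
    and g_act: "u \<in> A \<Longrightarrow> g (\<alpha> p u) = p \<odot>\<^bsub>N\<^esub> g u"
begin

lemma A_diff: "u \<in> A \<Longrightarrow> v \<in> A \<Longrightarrow> u - v \<in> A"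
  using A_add[OF _ A_minus, of u v] by simp

lemma A_sum: "(\<And>i. i \<in> I' \<Longrightarrow> f i \<in> A) \<Longrightarrow> (\<Sum>i\<in>I'. f i) \<in> A"
  by (induction I' rule: infinite_finite_induct) (auto simp: A0 A_add)

lemma abelian_group_N: "abelian_group N"
proof (rule abelian_groupI)
  fix x y z assume "x \<in> carrier N" "y \<in> carrier N" "z \<in> carrier N"
  then obtain u v w where "u \<in> A" "v \<in> A" "w \<in> A" "x = g u" "y = g v" "z = g w" by (auto simp: car)
  thus "x \<oplus>\<^bsub>N\<^esub> y \<oplus>\<^bsub>N\<^esub> z = x \<oplus>\<^bsub>N\<^esub> (y \<oplus>\<^bsub>N\<^esub> z)" by (simp add: add.assoc A_add flip: g_add)
next
  fix x y assume "x \<in> carrier N" "y \<in> carrier N"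
  then obtain u v where "u \<in> A" "v \<in> A" "x = g u" "y = g v" by (auto simp: car)
  thus "x \<oplus>\<^bsub>N\<^esub> y \<in> carrier N" "x \<oplus>\<^bsub>N\<^esub> y = y \<oplus>\<^bsub>N\<^esub> x"
    by (auto simp: car add.commute A_add simp flip: g_add)
next
  show "\<zero>\<^bsub>N\<^esub> \<in> carrier N" using A0 by (auto simp: car simp flip: g_zero)
next
  fix x assume "x \<in> carrier N"
  then obtain u where u: "u \<in> A" "x = g u" by (auto simp: car)
  thus "\<zero>\<^bsub>N\<^esub> \<oplus>\<^bsub>N\<^esub> x = x" using g_add[OF A0 u(1)] by (simp add: g_zero)
  have "g (- u) \<oplus>\<^bsub>N\<^esub> x = \<zero>\<^bsub>N\<^esub>" using g_add[OF A_minus[OF u(1)] u(1)] u by (simp add: g_zero)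
  thus "\<exists>y\<in>carrier N. y \<oplus>\<^bsub>N\<^esub> x = \<zero>\<^bsub>N\<^esub>" using A_minus[OF u(1)] by (auto simp: car)
qed

lemma g_minus: "u \<in> A \<Longrightarrow> g (- u) = \<ominus>\<^bsub>N\<^esub> g u"
proof -
  assume u: "u \<in> A"
  interpret abelian_group N by (rule abelian_group_N)
  have "g (- u) \<oplus>\<^bsub>N\<^esub> g u = \<zero>\<^bsub>N\<^esub>" using g_add[OF A_minus[OF u] u] by (simp add: g_zero)
  thus ?thesis using minus_equality[of "g (- u)" "g u"] u A_minus[OF u] by (auto simp: car)
qed

lemma g_eq_iff:
  assumes "u \<in> A" "v \<in> A"
  shows "g u = g v \<longleftrightarrow> g (u - v) = \<zero>\<^bsub>N\<^esub>"
proof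
  interpret abelian_group N by (rule abelian_group_N)
  have uv: "g u \<in> carrier N" "g v \<in> carrier N" using assms by (auto simp: car)
  have eq: "g u = g (u - v) \<oplus>\<^bsub>N\<^esub> g v" using g_add[OF A_diff[OF assms] assms(2)] by simp
  have "g (u - v) = g u \<oplus>\<^bsub>N\<^esub> \<ominus>\<^bsub>N\<^esub> g v"
    using g_add[OF assms(1) A_minus[OF assms(2)]] g_minus[OF assms(2)] by simp
  thus "g (u - v) = \<zero>\<^bsub>N\<^esub>" if "g u = g v" using that uv by (simp add: r_neg)
  show "g u = g v" if "g (u - v) = \<zero>\<^bsub>N\<^esub>" using that eq uv by simp
qed

lemma g_finsum:
  assumes "finite I'" "\<And>i. i \<in> I' \<Longrightarrow> f i \<in> A"
  shows "(\<Oplus>\<^bsub>N\<^esub>i\<in>I'. g (f i)) = g (\<Sum>i\<in>I'. f i)"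
  using assms
proof (induction I' rule: finite_induct)
  interpret abelian_group N by (rule abelian_group_N)
  case empty
  show ?case by (simp add: g_zero)
next
  interpret abelian_group N by (rule abelian_group_N)
  case (insert x I')
  have "(\<Oplus>\<^bsub>N\<^esub>i\<in>insert x I'. g (f i)) = g (f x) \<oplus>\<^bsub>N\<^esub> (\<Oplus>\<^bsub>N\<^esub>i\<in>I'. g (f i))"
    by (rule finsum_insert) (use insert in \<open>auto simp: car\<close>)
  also have "\<dots> = g (f x + (\<Sum>i\<in>I'. f i))"
    using insert by (subst g_add) (auto intro: A_sum)
  finally show ?case using insert by simp
qed

lemma rep_gsub:
  assumes A': "0 \<in> A'" "\<And>u v. u \<in> A' \<Longrightarrow> v \<in> A' \<Longrightarrow> u + v \<in> A'" "\<And>u. u \<in> A' \<Longrightarrow> - u \<in> A'"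
    "\<And>u p. u \<in> A' \<Longrightarrow> \<alpha> p u \<in> A'" "A' \<subseteq> A"
  shows "rep A' \<alpha> g (gsub N (g ` A'))"
proof
  fix u v p assume "u \<in> A'" "v \<in> A'"
  thus "g (u + v) = g u \<oplus>\<^bsub>gsub N (g ` A')\<^esub> g v" using A'(5) g_add[of u v] by (auto simp: gsub_def)
next
  fix u p assume "u \<in> A'"
  thus "g (\<alpha> p u) = p \<odot>\<^bsub>gsub N (g ` A')\<^esub> g u" using A'(5) g_act[of u p] by (auto simp: gsub_def)
qed (use A' in \<open>auto simp: gsub_def g_zero\<close>)

lemma coset_eq:
  assumes "B \<subseteq> A" "u \<in> A"
  shows "(g ` B) +>\<^bsub>N\<^esub> g u = {g (b + u) | b. b \<in> B}"
  using assms g_add[of _ u] by (force simp: a_r_coset_def' subset_iff)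

text \<open>\<open>g\<close> may have a kernel, so two representatives give the same coset when
  their difference agrees with some element of \<open>B\<close> up to that kernel.\<close>

lemma coset_eq_iff:
  assumes B: "B \<subseteq> A" "0 \<in> B" "\<And>u v. u \<in> B \<Longrightarrow> v \<in> B \<Longrightarrow> u + v \<in> B" "\<And>u. u \<in> B \<Longrightarrow> - u \<in> B"
    and uv: "u \<in> A" "v \<in> A"
  shows "(g ` B) +>\<^bsub>N\<^esub> g u = (g ` B) +>\<^bsub>N\<^esub> g v \<longleftrightarrow> (\<exists>b\<in>B. g (u - v - b) = \<zero>\<^bsub>N\<^esub>)"
proof
  assume eq: "(g ` B) +>\<^bsub>N\<^esub> g u = (g ` B) +>\<^bsub>N\<^esub> g v"
  have "g u \<in> (g ` B) +>\<^bsub>N\<^esub> g u" unfolding coset_eq[OF B(1) uv(1)] using B(2) by (auto intro!: exI[of _ 0])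
  hence "g u \<in> {g (b + v) | b. b \<in> B}" unfolding eq coset_eq[OF B(1) uv(2)] .
  then obtain b where b: "b \<in> B" "g u = g (b + v)" by blast
  hence "g (u - (b + v)) = \<zero>\<^bsub>N\<^esub>" using g_eq_iff[OF uv(1) A_add[of b v]] B(1) uv by auto
  thus "\<exists>b\<in>B. g (u - v - b) = \<zero>\<^bsub>N\<^esub>" using b by (auto simp: algebra_simps)
next
  assume "\<exists>b\<in>B. g (u - v - b) = \<zero>\<^bsub>N\<^esub>"
  then obtain b where b: "b \<in> B" "g (u - v - b) = \<zero>\<^bsub>N\<^esub>" by blast
  have bA: "b \<in> A" using b B by auto
  have e: "g (c + u) = g (c + b + v)" if c: "c \<in> B" for c
  proof -
    have "c \<in> A" using c B by auto
    hence "g (c + u) = g (c + b + v) \<longleftrightarrow> g (c + u - (c + b + v)) = \<zero>\<^bsub>N\<^esub>"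
      using uv bA by (intro g_eq_iff A_add)
    thus ?thesis using b(2) by (simp add: algebra_simps)
  qed
  have e': "g (c + v) = g (c - b + u)" if c: "c \<in> B" for c
    using e[of "c - b"] B(3)[OF c B(4)[OF b(1)]] by simp
  show "(g ` B) +>\<^bsub>N\<^esub> g u = (g ` B) +>\<^bsub>N\<^esub> g v"
    unfolding coset_eq[OF B(1) uv(1)] coset_eq[OF B(1) uv(2)]
  proof (intro equalityI subsetI)
    fix x assume "x \<in> {g (c + u) |c. c \<in> B}"
    then obtain c where c: "c \<in> B" "x = g (c + u)" by blast
    thus "x \<in> {g (c + v) |c. c \<in> B}" using e[OF c(1)] B(3)[OF c(1) b(1)] by auto
  next
    fix x assume "x \<in> {g (c + v) |c. c \<in> B}"
    then obtain c where c: "c \<in> B" "x = g (c + v)" by blast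
    moreover have "c - b \<in> B" using B(3)[OF c(1) B(4)[OF b(1)]] by simp
    ultimately show "x \<in> {g (c + u) |c. c \<in> B}" using e'[OF c(1)] by auto
  qed
qed

lemma coset_zero_iff:
  assumes B: "B \<subseteq> A" "0 \<in> B" "\<And>u v. u \<in> B \<Longrightarrow> v \<in> B \<Longrightarrow> u + v \<in> B" "\<And>u. u \<in> B \<Longrightarrow> - u \<in> B"
    and u: "u \<in> A"
  shows "(g ` B) +>\<^bsub>N\<^esub> g u = \<zero>\<^bsub>gquot N (g ` B)\<^esub> \<longleftrightarrow> (\<exists>b\<in>B. g (u - b) = \<zero>\<^bsub>N\<^esub>)"
proof -
  have "\<zero>\<^bsub>gquot N (g ` B)\<^esub> = (g ` B) +>\<^bsub>N\<^esub> g 0"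
    unfolding coset_eq[OF B(1) A0] by (auto simp: gquot_def mk_gmodule_def)
  thus ?thesis using coset_eq_iff[OF B u A0] by simp
qed

lemma rep_gquot:
  assumes B: "B \<subseteq> A" "0 \<in> B" "\<And>u v. u \<in> B \<Longrightarrow> v \<in> B \<Longrightarrow> u + v \<in> B" "\<And>u. u \<in> B \<Longrightarrow> - u \<in> B"
    "\<And>u p. u \<in> B \<Longrightarrow> \<alpha> p u \<in> B"
    and \<alpha>_add: "\<And>p u v. \<alpha> p (u + v) = \<alpha> p u + \<alpha> p v"
  shows "rep A \<alpha> (\<lambda>u. (g ` B) +>\<^bsub>N\<^esub> g u) (gquot N (g ` B))"
proof
  fix u v assume uv: "u \<in> A" "v \<in> A"
  show "(g ` B) +>\<^bsub>N\<^esub> g (u + v) = ((g ` B) +>\<^bsub>N\<^esub> g u) \<oplus>\<^bsub>gquot N (g ` B)\<^esub> ((g ` B) +>\<^bsub>N\<^esub> g v)"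
  proof -
    have "((g ` B) +>\<^bsub>N\<^esub> g u) \<oplus>\<^bsub>gquot N (g ` B)\<^esub> ((g ` B) +>\<^bsub>N\<^esub> g v) = ((g ` B) +>\<^bsub>N\<^esub> g u) <+>\<^bsub>N\<^esub> ((g ` B) +>\<^bsub>N\<^esub> g v)"
      by (simp add: gquot_def mk_gmodule_def)
    also have "\<dots> = {g (b + u) \<oplus>\<^bsub>N\<^esub> g (c + v) | b c. b \<in> B \<and> c \<in> B}"
      unfolding coset_eq[OF B(1) uv(1)] coset_eq[OF B(1) uv(2)] set_add_def' by blast
    also have "\<dots> = {g (b + (u + v)) | b. b \<in> B}"
    proof (intro equalityI subsetI)
      fix x assume "x \<in> {g (b + u) \<oplus>\<^bsub>N\<^esub> g (c + v) | b c. b \<in> B \<and> c \<in> B}"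
      then obtain b c where bc: "b \<in> B" "c \<in> B" "x = g (b + u) \<oplus>\<^bsub>N\<^esub> g (c + v)" by blast
      hence "x = g ((b + u) + (c + v))" using uv B(1) by (subst g_add) (auto intro: A_add)
      hence "x = g ((b + c) + (u + v))" by (simp add: algebra_simps)
      thus "x \<in> {g (b + (u + v)) | b. b \<in> B}" using B(3)[OF bc(1,2)] by blast
    next
      fix x assume "x \<in> {g (b + (u + v)) | b. b \<in> B}"
      then obtain b where b: "b \<in> B" "x = g (b + (u + v))" by blast
      have "g ((b + u) + (0 + v)) = g (b + u) \<oplus>\<^bsub>N\<^esub> g (0 + v)"
        using b B(1) uv A0 by (intro g_add A_add) auto
      hence "x = g (b + u) \<oplus>\<^bsub>N\<^esub> g (0 + v)" using b by (simp add: algebra_simps)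
      thus "x \<in> {g (b + u) \<oplus>\<^bsub>N\<^esub> g (c + v) | b c. b \<in> B \<and> c \<in> B}" using b(1) B(2) by blast
    qed
    also have "\<dots> = (g ` B) +>\<^bsub>N\<^esub> g (u + v)" unfolding coset_eq[OF B(1) A_add[OF uv]] ..
    finally show ?thesis ..
  qed
next
  show "carrier (gquot N (g ` B)) = (\<lambda>u. (g ` B) +>\<^bsub>N\<^esub> g u) ` A"
    by (auto simp: gquot_def mk_gmodule_def A_RCOSETS_def' car)
  show "(g ` B) +>\<^bsub>N\<^esub> g 0 = \<zero>\<^bsub>gquot N (g ` B)\<^esub>"
    unfolding coset_eq[OF B(1) A0] by (auto simp: gquot_def mk_gmodule_def)
next
  fix u p assume u: "u \<in> A"
  have "p \<odot>\<^bsub>gquot N (g ` B)\<^esub> ((g ` B) +>\<^bsub>N\<^esub> g u) = (\<Union>b\<in>B. (g ` B) +>\<^bsub>N\<^esub> (p \<odot>\<^bsub>N\<^esub> g (b + u)))"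
    unfolding coset_eq[OF B(1) u] by (auto simp: gquot_def mk_gmodule_def)
  also have "\<dots> = (\<Union>b\<in>B. (g ` B) +>\<^bsub>N\<^esub> g (\<alpha> p u))"
  proof (rule SUP_cong[OF refl])
    fix b assume b: "b \<in> B"
    have bu: "b + u \<in> A" using b B(1) u by (auto intro: A_add)
    have "\<alpha> p (b + u) - \<alpha> p u - \<alpha> p b = 0" by (simp add: \<alpha>_add)
    hence "\<exists>c\<in>B. g (\<alpha> p (b + u) - \<alpha> p u - c) = \<zero>\<^bsub>N\<^esub>" using B(5)[OF b] g_zero by metis
    hence "(g ` B) +>\<^bsub>N\<^esub> g (\<alpha> p (b + u)) = (g ` B) +>\<^bsub>N\<^esub> g (\<alpha> p u)"
      using coset_eq_iff[OF B(1-4) A_act[OF bu] A_act[OF u]] by blast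
    thus "(g ` B) +>\<^bsub>N\<^esub> (p \<odot>\<^bsub>N\<^esub> g (b + u)) = (g ` B) +>\<^bsub>N\<^esub> g (\<alpha> p u)" using g_act[OF bu] by simp
  qed
  also have "\<dots> = (g ` B) +>\<^bsub>N\<^esub> g (\<alpha> p u)" using B(2) by auto
  finally show "(g ` B) +>\<^bsub>N\<^esub> g (\<alpha> p u) = p \<odot>\<^bsub>gquot N (g ` B)\<^esub> ((g ` B) +>\<^bsub>N\<^esub> g u)" ..
qed (fact A0 A_add A_minus A_act)+

end

text \<open>Preimages of an independent set are independent modulo \<open>B\<close> as soon as the
  elements of \<open>B\<close> in \<open>Z\<close> die in \<open>N\<close>. The reverse estimate
  \<open>rdim_le_k_dim\<close> asks for the opposite inclusion, that the kernel of \<open>g\<close>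
  on \<open>Z\<close> lies in \<open>B\<close>.\<close>

lemma k_dim_le_rdim:
  fixes g :: "('x \<Rightarrow> 'k::field) \<Rightarrow> 'm"
  assumes rep: "rep A \<alpha> g N" and const: "\<And>c u. \<alpha> (pconst c) u = c *\<^sub>f u"
    and Z: "Z \<subseteq> A" "fun_vs.subspace Z" and B: "0 \<in> B" "\<And>u. u \<in> Z \<Longrightarrow> u \<in> B \<Longrightarrow> g u = \<zero>\<^bsub>N\<^esub>"
  shows "k_dim N (g ` Z) \<le> rdim Z B"
  unfolding k_dim_def
proof (rule Sup_least, clarify)
  interpret rep A \<alpha> g N by (rule rep)
  fix S assume S: "finite S" "S \<subseteq> g ` Z" "k_independent N S"
  have "\<forall>x\<in>S. \<exists>u. u \<in> Z \<and> g u = x" using S(2) by blast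
  then obtain f where f: "\<And>x. x \<in> S \<Longrightarrow> f x \<in> Z \<and> g (f x) = x" by metis
  have "inj_on f S \<and> rindep B (f ` S)"
  proof (rule rindep_family[OF S(1) B(1)])
    fix c assume c: "(\<Sum>x\<in>S. c x *\<^sub>f f x) \<in> B"
    have inA: "c x *\<^sub>f f x \<in> A" if "x \<in> S" for x
      using f[OF that] Z A_act[of "f x" "pconst (c x)"] by (auto simp: const)
    have "(\<Sum>x\<in>S. c x *\<^sub>f f x) \<in> Z"
      using f Z(2) by (intro fun_vs.subspace_sum fun_vs.subspace_scale) auto
    hence "\<zero>\<^bsub>N\<^esub> = g (\<Sum>x\<in>S. c x *\<^sub>f f x)" using B(2) c by metis
    also have "\<dots> = (\<Oplus>\<^bsub>N\<^esub>x\<in>S. g (c x *\<^sub>f f x))" by (rule g_finsum[symmetric, OF S(1) inA])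
    also have "\<dots> = (\<Oplus>\<^bsub>N\<^esub>x\<in>S. pconst (c x) \<odot>\<^bsub>N\<^esub> x)"
    proof -
      interpret abelian_group N by (rule abelian_group_N)
      have e: "g (c x *\<^sub>f f x) = pconst (c x) \<odot>\<^bsub>N\<^esub> x" if "x \<in> S" for x
        using g_act[of "f x" "pconst (c x)"] f[OF that] Z by (auto simp: const)
      have "pconst (c x) \<odot>\<^bsub>N\<^esub> x \<in> carrier N" if "x \<in> S" for x
        unfolding car e[OF that, symmetric] by (rule imageI[OF inA[OF that]])
      thus ?thesis by (intro finsum_cong') (auto simp: e)
    qed
    finally show "\<forall>x\<in>S. c x = 0" using S(3) unfolding k_independent_def by metis
  qed
  thus "enat (card S) \<le> rdim Z B" using rdim_upper[of "f ` S" Z B] f by (auto simp: card_image)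
qed

lemma rdim_le_k_dim:
  fixes g :: "('x \<Rightarrow> 'k::field) \<Rightarrow> 'm"
  assumes rep: "rep A \<alpha> g N" and const: "\<And>c u. \<alpha> (pconst c) u = c *\<^sub>f u"
    and Z: "Z \<subseteq> A" "fun_vs.subspace Z" and B: "\<And>u. u \<in> Z \<Longrightarrow> g u = \<zero>\<^bsub>N\<^esub> \<Longrightarrow> u \<in> B"
  shows "rdim Z B \<le> k_dim N (g ` Z)"
proof (rule rdim_least)
  interpret rep A \<alpha> g N by (rule rep)
  fix T assume T: "T \<subseteq> Z" "rindep B T"
  note fin = rindep_finite[OF T(2)]
  have inA: "c *\<^sub>f x \<in> A" if "x \<in> T" for x c
    using that T Z A_act[of x "pconst c"] by (auto simp: const)
  have key: "\<forall>x\<in>T. c x = 0" if "(\<Oplus>\<^bsub>N\<^esub>x\<in>T. g (c x *\<^sub>f x)) = \<zero>\<^bsub>N\<^esub>" for c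
  proof -
    have "(\<Oplus>\<^bsub>N\<^esub>x\<in>T. g (c x *\<^sub>f x)) = g (\<Sum>z\<in>T. c z *\<^sub>f z)"
      by (rule g_finsum[OF fin]) (rule inA)
    hence "g (\<Sum>x\<in>T. c x *\<^sub>f x) = \<zero>\<^bsub>N\<^esub>" using that by (rule trans[OF sym])
    moreover have "(\<Sum>x\<in>T. c x *\<^sub>f x) \<in> Z"
      using T Z(2) by (intro fun_vs.subspace_sum fun_vs.subspace_scale) auto
    ultimately have "(\<Sum>x\<in>T. c x *\<^sub>f x) \<in> B" by (intro B)
    thus ?thesis using rindepD[OF T(2)] by blast
  qed
  have inj: "inj_on g T"
  proof (rule inj_onI, rule ccontr)
    fix x y assume xy: "x \<in> T" "y \<in> T" "g x = g y" "x \<noteq> y"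
    define c where "c = (\<lambda>z. if z = x then 1 else if z = y then - 1 else 0 :: 'k)"
    have "(\<Sum>z\<in>T. c z *\<^sub>f z) = (\<Sum>z\<in>{x,y}. c z *\<^sub>f z)"
      by (rule sum.mono_neutral_right) (use fin xy in \<open>auto simp: c_def\<close>)
    also have "\<dots> = x - y" using xy by (simp add: c_def)
    finally have eq: "(\<Sum>z\<in>T. c z *\<^sub>f z) = x - y" .
    have "x \<in> A" "y \<in> A" using xy T Z by auto
    hence "g (\<Sum>z\<in>T. c z *\<^sub>f z) = \<zero>\<^bsub>N\<^esub>" unfolding eq using g_eq_iff xy(3) by blast
    moreover have "(\<Oplus>\<^bsub>N\<^esub>x\<in>T. g (c x *\<^sub>f x)) = g (\<Sum>z\<in>T. c z *\<^sub>f z)"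
      by (rule g_finsum[OF fin]) (rule inA)
    ultimately have "(\<Oplus>\<^bsub>N\<^esub>x\<in>T. g (c x *\<^sub>f x)) = \<zero>\<^bsub>N\<^esub>" by (rule trans[rotated])
    from key[OF this] have "c x = 0" using xy(1) by blast
    thus False by (simp add: c_def)
  qed
  have "k_independent N (g ` T)"
    unfolding k_independent_def
  proof (intro allI impI)
    fix c assume c: "(\<Oplus>\<^bsub>N\<^esub>x\<in>g ` T. pconst (c x) \<odot>\<^bsub>N\<^esub> x) = \<zero>\<^bsub>N\<^esub>"
    interpret abelian_group N by (rule abelian_group_N)
    have e: "g (c (g x) *\<^sub>f x) = pconst (c (g x)) \<odot>\<^bsub>N\<^esub> g x" if "x \<in> T" for x
      using g_act[of x "pconst (c (g x))"] that T Z by (auto simp: const)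
    have cl: "pconst (c (g x)) \<odot>\<^bsub>N\<^esub> g x \<in> carrier N" if "x \<in> T" for x
      unfolding car e[OF that, symmetric] by (rule imageI[OF inA[OF that]])
    have "(\<Oplus>\<^bsub>N\<^esub>x\<in>g ` T. pconst (c x) \<odot>\<^bsub>N\<^esub> x) = (\<Oplus>\<^bsub>N\<^esub>x\<in>T. pconst (c (g x)) \<odot>\<^bsub>N\<^esub> g x)"
      by (rule finsum_reindex) (use cl inj in auto)
    also have "\<dots> = (\<Oplus>\<^bsub>N\<^esub>x\<in>T. g (c (g x) *\<^sub>f x))"
      by (intro finsum_cong') (auto simp: e car inA)
    finally have "(\<Oplus>\<^bsub>N\<^esub>x\<in>T. g (c (g x) *\<^sub>f x)) = \<zero>\<^bsub>N\<^esub>" using c by simp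
    from key[OF this] show "\<forall>x\<in>g ` T. c x = 0" by auto
  qed
  hence "enat (card (g ` T)) \<le> k_dim N (g ` Z)"
    unfolding k_dim_def using T fin by (intro Sup_upper) blast
  thus "enat (card T) \<le> k_dim N (g ` Z)" using inj by (simp add: card_image)
qed

section \<open>Localization and the Cech complex of a presented module\<close>

lemma act_pvar: "act (pvar s) v = sh (xpow {s} 1) v"
  for s :: "'n::finite"
proof -
  have "expo (Poly_Mapping.single s 1) = xpow {s} 1"
    by (auto simp: expo_def xpow_def lookup_single when_def)
  thus ?thesis unfolding pvar_def act_single by simp
qed

lemma act_var_prod: "act (var_prod S) v = sh (xpow S 1) v"
  for S :: "'n::finite set"
proof -
  have "finite S" by simp
  thus ?thesis
  proof (induction S arbitrary: v rule: finite_induct)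
    case empty
    show ?case by (simp only: var_prod_def prod.empty act_one xpow_empty sh_0)
  next
    case (insert s S)
    have "xpow {s} 1 + xpow S 1 = xpow (insert s S) 1"
      using insert by (auto simp: xpow_def fun_eq_iff)
    moreover have "act (var_prod (insert s S)) v = act (pvar s) (act (var_prod S) v)"
      using insert by (simp add: var_prod_def act_mult)
    ultimately show ?case by (simp only: act_pvar insert sh_sh)
  qed
qed

lemma act_var_prod_power: "act (var_prod S ^ j) v = sh (xpow S (int j)) v"
  for S :: "'n::finite set"
proof (induction j)
  case (Suc j)
  have "act (var_prod S ^ Suc j) v = sh (xpow S 1 + xpow S (int j)) v"
    by (simp add: act_mult act_var_prod Suc)
  thus ?case by (simp add: xpow_add)
next
  case 0
  show ?case by (simp only: power_0 act_one of_nat_0 xpow_0 sh_0)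
qed

lemma act_pvar_power: "act (pvar s ^ j) v = sh (xpow {s} (int j)) v"
  for s :: "'n::finite"
  using act_var_prod_power[of "{s}" j v] by (simp add: var_prod_def)

text \<open>The bridge between records and Laurent vectors: \<open>N\<close> is \<open>FF m\<close>
  modulo the graded submodule \<open>K\<close>, with the grading induced by the basis degrees
  \<open>es\<close>.\<close>

locale presents = rep "FF m" act \<epsilon> N
  for m :: nat and \<epsilon> :: "('n::{finite,linorder}, 'k::field) vec \<Rightarrow> 'm" and N :: "(('n, 'k) mpoly, 'm) gmodule" +
  fixes es :: "nat \<Rightarrow> int" and K :: "('n, 'k) vec set"
  assumes homog_N: "homog N t = \<epsilon> ` (FF m \<inter> Vt es t)"
    and K_eq: "K = {v \<in> FF m. \<epsilon> v = \<zero>\<^bsub>N\<^esub>}"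
    and gK: "gsubm es K"
begin

lemma KF: "K \<subseteq> FF m" by (auto simp: K_eq)

lemma \<epsilon>_eq_iff: "u \<in> FF m \<Longrightarrow> v \<in> FF m \<Longrightarrow> \<epsilon> u = \<epsilon> v \<longleftrightarrow> u - v \<in> K"
  using g_eq_iff[of u v] A_diff[of u v] by (auto simp: K_eq)

text \<open>A quotient of a presented module keeps the free module and merely enlarges
  \<open>K\<close>. Thus a module, its reductions and their quotients by \<open>H0_sub\<close> are
  compared inside one ambient space.\<close>

lemma presents_gquot:
  assumes K': "gsubm es K'" "K \<subseteq> K'" "K' \<subseteq> FF m"
  shows "presents m (\<lambda>v. (\<epsilon> ` K') +>\<^bsub>N\<^esub> \<epsilon> v) (gquot N (\<epsilon> ` K')) es K'"
proof -
  note s = gsubm_subspace[OF K'(1)]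
  have *: "0 \<in> K'" "\<And>u v. u \<in> K' \<Longrightarrow> v \<in> K' \<Longrightarrow> u + v \<in> K'" "\<And>u. u \<in> K' \<Longrightarrow> - u \<in> K'"
    "\<And>u p. u \<in> K' \<Longrightarrow> act p u \<in> K'"
    using fun_vs.subspace_0[OF s] fun_vs.subspace_add[OF s] fun_vs.subspace_neg[OF s] gsubm_act[OF K'(1)] by auto
  interpret Q: rep "FF m" act "\<lambda>v. (\<epsilon> ` K') +>\<^bsub>N\<^esub> \<epsilon> v" "gquot N (\<epsilon> ` K')"
    by (rule rep_gquot[OF K'(3) * act_add])
  show ?thesis
  proof
    show "homog (gquot N (\<epsilon> ` K')) t = (\<lambda>v. (\<epsilon> ` K') +>\<^bsub>N\<^esub> \<epsilon> v) ` (FF m \<inter> Vt es t)" for t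
      by (simp add: gquot_def mk_gmodule_def homog_N image_image)
    show "K' = {v \<in> FF m. (\<epsilon> ` K') +>\<^bsub>N\<^esub> \<epsilon> v = \<zero>\<^bsub>gquot N (\<epsilon> ` K')\<^esub>}"
    proof (intro equalityI subsetI)
      fix v assume v: "v \<in> K'"
      have "\<epsilon> (v - v) = \<zero>\<^bsub>N\<^esub>" by (simp add: g_zero)
      moreover have vF: "v \<in> FF m" using v K'(3) by blast
      ultimately have "(\<epsilon> ` K') +>\<^bsub>N\<^esub> \<epsilon> v = \<zero>\<^bsub>gquot N (\<epsilon> ` K')\<^esub>"
        using v coset_zero_iff[OF K'(3) *(1-3) vF] by blast
      thus "v \<in> {v \<in> FF m. (\<epsilon> ` K') +>\<^bsub>N\<^esub> \<epsilon> v = \<zero>\<^bsub>gquot N (\<epsilon> ` K')\<^esub>}"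
        using vF by blast
    next
      fix v assume v: "v \<in> {v \<in> FF m. (\<epsilon> ` K') +>\<^bsub>N\<^esub> \<epsilon> v = \<zero>\<^bsub>gquot N (\<epsilon> ` K')\<^esub>}"
      then obtain b where b: "b \<in> K'" "\<epsilon> (v - b) = \<zero>\<^bsub>N\<^esub>" using coset_zero_iff[OF K'(3) *(1-3), of v] by auto
      have "v - b \<in> FF m" using v b K'(3) by (auto intro: A_diff)
      hence "v - b \<in> K" using b by (simp add: K_eq)
      hence "v - b + b \<in> K'" using K'(2) b *(2) by blast
      thus "v \<in> K'" by simp
    qed
  qed (fact K'(1))
qed

lemma \<epsilon>_var_prod: "v \<in> FF m \<Longrightarrow> var_prod S ^ j \<odot>\<^bsub>N\<^esub> \<epsilon> v = \<epsilon> (sh (xpow S (int j)) v)"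
  using g_act[of v "var_prod S ^ j"] by (simp add: act_var_prod_power)

text \<open>The fraction represented by a Laurent vector \<open>u\<close>, as a set of pairs: all
  ways of writing a vector congruent to \<open>u\<close> modulo the localized \<open>K\<close> with
  a power of the product of the variables as denominator.\<close>

definition lp :: "'n set \<Rightarrow> ('n, 'k) vec \<Rightarrow> ('m \<times> nat) set" where
  "lp S u = {(\<epsilon> (sh (xpow S (int a)) w), a) | w a. sh (xpow S (int a)) w \<in> FF m \<and> u - w \<in> loc S K}"

lemma xpow_nonneg: "0 \<le> xpow S (int a) s"
  by (simp add: xpow_def)

text \<open>A fraction with numerator \<open>f\<close> is the class of \<open>f\<close> divided by
  the denominator in the Laurent vectors; cross-multiplication in \<open>N\<close> becomes
  congruence modulo the localized \<open>K\<close>.\<close>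

lemma loc_frac_eq:
  assumes f: "f \<in> FF m"
  shows "loc_frac N S (\<epsilon> f) a = lp S (sh (- xpow S (int a)) f)"
proof -
  let ?u = "sh (- xpow S (int a)) f"
  have key: "(\<exists>c. var_prod S ^ (c + a') \<odot>\<^bsub>N\<^esub> \<epsilon> f = var_prod S ^ (c + a) \<odot>\<^bsub>N\<^esub> \<epsilon> f') \<longleftrightarrow>
      ?u - sh (- xpow S (int a')) f' \<in> loc S K" (is "?L \<longleftrightarrow> ?R") if f': "f' \<in> FF m" for f' a'
  proof -
    let ?d = "?u - sh (- xpow S (int a')) f'"
    \<comment> \<open>The power \<open>c + a + a'\<close> clears both denominators at once and
      produces exactly the two sides of the cross-multiplied equation.\<close>
    have sh_eq: "sh (xpow S (int (c + a + a'))) ?d = sh (xpow S (int (c + a'))) f - sh (xpow S (int (c + a))) f'" for c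
      by (simp add: sh_diff xpow_add xpow_minus)
    have "(var_prod S ^ (c + a') \<odot>\<^bsub>N\<^esub> \<epsilon> f = var_prod S ^ (c + a) \<odot>\<^bsub>N\<^esub> \<epsilon> f') \<longleftrightarrow>
        sh (xpow S (int (c + a + a'))) ?d \<in> K" for c
      unfolding sh_eq \<epsilon>_var_prod[OF f] \<epsilon>_var_prod[OF f']
      by (rule \<epsilon>_eq_iff) (intro sh_FF f f' xpow_nonneg)+
    hence "?L \<longleftrightarrow> (\<exists>c. sh (xpow S (int (c + a + a'))) ?d \<in> K)" by simp
    also have "\<dots> \<longleftrightarrow> ?d \<in> loc S K"
    proof
      assume "\<exists>c. sh (xpow S (int (c + a + a'))) ?d \<in> K"
      thus "?d \<in> loc S K" unfolding loc_def by blast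
    next
      assume "?d \<in> loc S K"
      then obtain b where b: "\<And>c. c \<ge> b \<Longrightarrow> sh (xpow S (int c)) ?d \<in> K" using loc_ge[OF gK] by blast
      have "sh (xpow S (int (b + a + a'))) ?d \<in> K" by (rule b) simp
      thus "\<exists>c. sh (xpow S (int (c + a + a'))) ?d \<in> K" by blast
    qed
    finally show ?thesis .
  qed
  show ?thesis
  proof (intro equalityI subsetI)
    fix x assume "x \<in> loc_frac N S (\<epsilon> f) a"
    then obtain m' a' where x: "x = (m', a')" "m' \<in> carrier N"
      "\<exists>c. var_prod S ^ (c + a') \<odot>\<^bsub>N\<^esub> \<epsilon> f = var_prod S ^ (c + a) \<odot>\<^bsub>N\<^esub> m'" by (auto simp: loc_frac_def)
    then obtain f' where f': "f' \<in> FF m" "m' = \<epsilon> f'" by (auto simp: car)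
    have "?u - sh (- xpow S (int a')) f' \<in> loc S K" using key[OF f'(1)] x(3) f'(2) by simp
    moreover have "sh (xpow S (int a')) (sh (- xpow S (int a')) f') = f'" by simp
    ultimately show "x \<in> lp S ?u" unfolding lp_def x(1) f'(2) using f'(1)
      by (auto intro!: exI[of _ "sh (- xpow S (int a')) f'"])
  next
    fix x assume "x \<in> lp S ?u"
    then obtain w a' where x: "x = (\<epsilon> (sh (xpow S (int a')) w), a')" and w: "sh (xpow S (int a')) w \<in> FF m" "?u - w \<in> loc S K"
      unfolding lp_def by blast
    have "?u - sh (- xpow S (int a')) (sh (xpow S (int a')) w) \<in> loc S K" using w(2) by simp
    hence "\<exists>c. var_prod S ^ (c + a') \<odot>\<^bsub>N\<^esub> \<epsilon> f = var_prod S ^ (c + a) \<odot>\<^bsub>N\<^esub> \<epsilon> (sh (xpow S (int a')) w)"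
      using key[OF w(1)] by blast
    moreover have "\<epsilon> (sh (xpow S (int a')) w) \<in> carrier N" using w(1) by (auto simp: car)
    ultimately show "x \<in> loc_frac N S (\<epsilon> f) a" unfolding x loc_frac_def by auto
  qed
qed

lemma locK_sub: "fun_vs.subspace (loc S K)" by (rule loc_subspace[OF gK])

lemma locF_sub: "fun_vs.subspace (loc S (FF m :: ('n, 'k) vec set))" by (rule loc_subspace[OF gsubm_FF])

lemma lp_eqI: "u - v \<in> loc S K \<Longrightarrow> lp S u = lp S v"
proof -
  assume uv: "u - v \<in> loc S K"
  have "u - w \<in> loc S K \<longleftrightarrow> v - w \<in> loc S K" for w
  proof
    assume "u - w \<in> loc S K"
    thus "v - w \<in> loc S K" using fun_vs.subspace_diff[OF locK_sub _ uv] by fastforce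
  next
    assume "v - w \<in> loc S K"
    thus "u - w \<in> loc S K" using fun_vs.subspace_add[OF locK_sub uv] by fastforce
  qed
  thus ?thesis unfolding lp_def by simp
qed

lemma lp_eq_iff:
  assumes u: "u \<in> loc S (FF m)"
  shows "lp S u = lp S v \<longleftrightarrow> u - v \<in> loc S K"
proof
  assume eq: "lp S u = lp S v"
  obtain a :: nat where a: "sh (xpow S (int a)) u \<in> FF m" using u by (auto simp: loc_def)
  have "u - u \<in> loc S K" using fun_vs.subspace_0[OF locK_sub] by simp
  hence "(\<epsilon> (sh (xpow S (int a)) u), a) \<in> lp S u" unfolding lp_def using a by blast
  hence "(\<epsilon> (sh (xpow S (int a)) u), a) \<in> lp S v" unfolding eq .
  then obtain w where w: "\<epsilon> (sh (xpow S (int a)) u) = \<epsilon> (sh (xpow S (int a)) w)"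
    "sh (xpow S (int a)) w \<in> FF m" "v - w \<in> loc S K" unfolding lp_def by blast
  have "sh (xpow S (int a)) (u - w) \<in> K" using w(1) \<epsilon>_eq_iff[OF a w(2)] by (simp add: sh_diff)
  hence "u - w \<in> loc S K" unfolding loc_def by blast
  thus "u - v \<in> loc S K" using fun_vs.subspace_diff[OF locK_sub _ w(3)] by fastforce
qed (rule lp_eqI)

lemma lp_nonempty:
  assumes "u \<in> loc S (FF m)"
  shows "lp S u \<noteq> {}"
proof -
  obtain a :: nat where "sh (xpow S (int a)) u \<in> FF m" using assms by (auto simp: loc_def)
  moreover have "u - u \<in> loc S K" using fun_vs.subspace_0[OF locK_sub] by simp
  ultimately show ?thesis unfolding lp_def by blast
qed

lemma lp_elem:
  assumes "(x, a) \<in> lp S u"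
  obtains w where "x = \<epsilon> (sh (xpow S (int a)) w)" "sh (xpow S (int a)) w \<in> FF m" "u - w \<in> loc S K"
  using assms unfolding lp_def by blast

lemma localize_rep: "rep (loc S (FF m)) act (lp S) (localize N S)"
proof
  show "0 \<in> loc S (FF m :: ('n, 'k) vec set)" by (rule fun_vs.subspace_0[OF locF_sub])
  fix u :: "('n, 'k) vec" and p assume u: "u \<in> loc S (FF m)"
  show "- u \<in> loc S (FF m)" by (rule fun_vs.subspace_neg[OF locF_sub u])
  show "act p u \<in> loc S (FF m)" by (rule loc_act[OF gsubm_FF u])
  have "p \<odot>\<^bsub>localize N S\<^esub> lp S u = (\<Union>(x, a) \<in> lp S u. loc_frac N S (p \<odot>\<^bsub>N\<^esub> x) a)"
    by (simp add: localize_def mk_gmodule_def)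
  also have "\<dots> = (\<Union>(x, a) \<in> lp S u. lp S (act p u))"
  proof (rule SUP_cong[OF refl], clarify)
    fix x a assume "(x, a) \<in> lp S u"
    then obtain w where w: "x = \<epsilon> (sh (xpow S (int a)) w)" "sh (xpow S (int a)) w \<in> FF m" "u - w \<in> loc S K"
      by (rule lp_elem)
    have F: "act p (sh (xpow S (int a)) w) \<in> FF m" by (rule gsubm_act[OF gsubm_FF w(2)])
    have "loc_frac N S (p \<odot>\<^bsub>N\<^esub> x) a = lp S (sh (- xpow S (int a)) (act p (sh (xpow S (int a)) w)))"
      using loc_frac_eq[OF F] g_act[OF w(2), of p] w(1) by simp
    also have "sh (- xpow S (int a)) (act p (sh (xpow S (int a)) w)) = act p w"
      by (simp flip: act_sh)
    also have "lp S (act p w) = lp S (act p u)"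
      using loc_act[OF gK w(3), of p] by (intro lp_eqI[symmetric]) (simp add: act_diff)
    finally show "loc_frac N S (p \<odot>\<^bsub>N\<^esub> x) a = lp S (act p u)" .
  qed
  also have "\<dots> = lp S (act p u)" using lp_nonempty[OF u] by auto
  finally show "lp S (act p u) = p \<odot>\<^bsub>localize N S\<^esub> lp S u" ..
next
  fix u v :: "('n, 'k) vec" assume uv: "u \<in> loc S (FF m)" "v \<in> loc S (FF m)"
  show "u + v \<in> loc S (FF m)" by (rule fun_vs.subspace_add[OF locF_sub uv])
  have "lp S u \<oplus>\<^bsub>localize N S\<^esub> lp S v = (\<Union>(x, a) \<in> lp S u. \<Union>(y, b) \<in> lp S v.
      loc_frac N S (var_prod S ^ b \<odot>\<^bsub>N\<^esub> x \<oplus>\<^bsub>N\<^esub> var_prod S ^ a \<odot>\<^bsub>N\<^esub> y) (a + b))"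
    by (simp add: localize_def mk_gmodule_def)
  also have "\<dots> = (\<Union>(x, a) \<in> lp S u. \<Union>(y, b) \<in> lp S v. lp S (u + v))"
  proof (rule SUP_cong[OF refl], clarify, rule SUP_cong[OF refl], clarify)
    fix x a y b assume "(x, a) \<in> lp S u" "(y, b) \<in> lp S v"
    then obtain w z where w: "x = \<epsilon> (sh (xpow S (int a)) w)" "sh (xpow S (int a)) w \<in> FF m" "u - w \<in> loc S K"
      and z: "y = \<epsilon> (sh (xpow S (int b)) z)" "sh (xpow S (int b)) z \<in> FF m" "v - z \<in> loc S K"
      by (metis lp_elem)
    let ?f = "sh (xpow S (int b)) (sh (xpow S (int a)) w) + sh (xpow S (int a)) (sh (xpow S (int b)) z)"
    have F1: "sh (xpow S (int b)) (sh (xpow S (int a)) w) \<in> FF m" by (rule sh_FF[OF w(2) xpow_nonneg])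
    have F2: "sh (xpow S (int a)) (sh (xpow S (int b)) z) \<in> FF m" by (rule sh_FF[OF z(2) xpow_nonneg])
    have F: "?f \<in> FF m" by (rule A_add[OF F1 F2])
    have "var_prod S ^ b \<odot>\<^bsub>N\<^esub> x \<oplus>\<^bsub>N\<^esub> var_prod S ^ a \<odot>\<^bsub>N\<^esub> y = \<epsilon> ?f"
      unfolding w(1) z(1) \<epsilon>_var_prod[OF w(2)] \<epsilon>_var_prod[OF z(2)] by (rule g_add[OF F1 F2, symmetric])
    hence "loc_frac N S (var_prod S ^ b \<odot>\<^bsub>N\<^esub> x \<oplus>\<^bsub>N\<^esub> var_prod S ^ a \<odot>\<^bsub>N\<^esub> y) (a + b) =
        lp S (sh (- xpow S (int (a + b))) ?f)" by (simp only: loc_frac_eq[OF F])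
    also have "sh (- xpow S (int (a + b))) ?f = w + z"
      by (simp add: sh_add xpow_add xpow_minus)
    also have "lp S (w + z) = lp S (u + v)"
    proof (rule lp_eqI[symmetric])
      have "(u + v) - (w + z) = (u - w) + (v - z)" by simp
      thus "(u + v) - (w + z) \<in> loc S K" using fun_vs.subspace_add[OF locK_sub w(3) z(3)] by metis
    qed
    finally show "loc_frac N S (var_prod S ^ b \<odot>\<^bsub>N\<^esub> x \<oplus>\<^bsub>N\<^esub> var_prod S ^ a \<odot>\<^bsub>N\<^esub> y) (a + b) = lp S (u + v)" .
  qed
  also have "\<dots> = lp S (u + v)" using lp_nonempty[OF uv(1)] lp_nonempty[OF uv(2)] by auto
  finally show "lp S (u + v) = lp S u \<oplus>\<^bsub>localize N S\<^esub> lp S v" ..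
next
  show "carrier (localize N S) = lp S ` loc S (FF m)"
  proof (intro equalityI subsetI)
    fix x assume "x \<in> carrier (localize N S)"
    then obtain y a where "x = loc_frac N S y a" "y \<in> carrier N" by (auto simp: localize_def mk_gmodule_def)
    then obtain f where f: "f \<in> FF m" "x = loc_frac N S (\<epsilon> f) a" by (auto simp: car)
    have "sh (- xpow S (int a)) f \<in> loc S (FF m)" using f(1) by (auto simp: loc_def intro!: exI[of _ a])
    thus "x \<in> lp S ` loc S (FF m)" using f loc_frac_eq[OF f(1)] by blast
  next
    fix x assume "x \<in> lp S ` loc S (FF m)"
    then obtain u where u: "u \<in> loc S (FF m)" "x = lp S u" by blast
    then obtain a :: nat where a: "sh (xpow S (int a)) u \<in> FF m" by (auto simp: loc_def)
    have "x = loc_frac N S (\<epsilon> (sh (xpow S (int a)) u)) a" using loc_frac_eq[OF a] u(2) by simp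
    moreover have "\<epsilon> (sh (xpow S (int a)) u) \<in> carrier N" using a by (auto simp: car)
    ultimately show "x \<in> carrier (localize N S)" by (auto simp: localize_def mk_gmodule_def)
  qed
  have "\<zero>\<^bsub>localize N S\<^esub> = loc_frac N S (\<epsilon> 0) 0" by (simp add: localize_def mk_gmodule_def g_zero)
  also have "\<dots> = lp S (sh (- xpow S (int 0)) 0)" by (rule loc_frac_eq[OF A0])
  finally show "lp S 0 = \<zero>\<^bsub>localize N S\<^esub>" by simp
qed

lemma localize_homog: "homog (localize N S) t = lp S ` (loc S (FF m) \<inter> Vt es t)"
proof (intro equalityI subsetI)
  fix x assume "x \<in> homog (localize N S) t"
  then obtain y a where x: "x = loc_frac N S y a" "y \<in> homog N (t + int (a * card S))"
    by (auto simp: localize_def mk_gmodule_def)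
  then obtain f where f: "f \<in> FF m" "f \<in> Vt es (t + int (a * card S))" "y = \<epsilon> f" by (auto simp: homog_N)
  have "sh (- xpow S (int a)) f \<in> loc S (FF m)" using f(1) by (auto simp: loc_def intro!: exI[of _ a])
  moreover have "sh (- xpow S (int a)) f \<in> Vt es t" using f(2) by (simp add: sh_Vt_iff edeg_xpow)
  ultimately show "x \<in> lp S ` (loc S (FF m) \<inter> Vt es t)" using x(1) f(3) loc_frac_eq[OF f(1)] by blast
next
  fix x assume "x \<in> lp S ` (loc S (FF m) \<inter> Vt es t)"
  then obtain u where u: "u \<in> loc S (FF m)" "u \<in> Vt es t" "x = lp S u" by blast
  then obtain a :: nat where a: "sh (xpow S (int a)) u \<in> FF m" by (auto simp: loc_def)
  have "x = loc_frac N S (\<epsilon> (sh (xpow S (int a)) u)) a" using loc_frac_eq[OF a] u(3) by simp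
  moreover have "sh (xpow S (int a)) u \<in> Vt es (t + int (a * card S))" using u(2) by (simp add: sh_Vt_iff edeg_xpow)
  hence "\<epsilon> (sh (xpow S (int a)) u) \<in> homog N (t + int (a * card S))" using a by (auto simp: homog_N)
  ultimately show "x \<in> homog (localize N S) t" unfolding localize_def mk_gmodule_def by auto
qed

text \<open>Multiplying numerator by \<open>pvar s ^ a\<close> and enlarging the denominator cancel,
  so on Laurent vectors the canonical map is the inclusion.\<close>

lemma loc_map_lp:
  assumes u: "u \<in> loc S (FF m)" and s: "s \<notin> S"
  shows "loc_map N S s (lp S u) = lp (insert s S) u"
proof -
  have "loc_map N S s (lp S u) = (\<Union>(x, a) \<in> lp S u. lp (insert s S) u)"
    unfolding loc_map_def
  proof (rule SUP_cong[OF refl], clarify)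
    fix x a assume "(x, a) \<in> lp S u"
    then obtain w where w: "x = \<epsilon> (sh (xpow S (int a)) w)" "sh (xpow S (int a)) w \<in> FF m" "u - w \<in> loc S K"
      by (rule lp_elem)
    have F: "sh (xpow {s} (int a)) (sh (xpow S (int a)) w) \<in> FF m" by (rule sh_FF[OF w(2) xpow_nonneg])
    have "pvar s ^ a \<odot>\<^bsub>N\<^esub> x = \<epsilon> (sh (xpow {s} (int a)) (sh (xpow S (int a)) w))"
      using g_act[OF w(2), of "pvar s ^ a"] w(1) by (simp add: act_pvar_power)
    hence "loc_frac N (insert s S) (pvar s ^ a \<odot>\<^bsub>N\<^esub> x) a =
        lp (insert s S) (sh (- xpow (insert s S) (int a)) (sh (xpow {s} (int a)) (sh (xpow S (int a)) w)))"
      by (simp only: loc_frac_eq[OF F])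
    also have "xpow {s} (int a) + xpow S (int a) = xpow (insert s S) (int a)"
      using s by (auto simp: xpow_def fun_eq_iff)
    hence "sh (- xpow (insert s S) (int a)) (sh (xpow {s} (int a)) (sh (xpow S (int a)) w)) = w"
      by simp
    also have "lp (insert s S) w = lp (insert s S) u"
      using w(3) loc_mono_set[OF gK, of S "insert s S"] by (intro lp_eqI[symmetric]) auto
    finally show "loc_frac N (insert s S) (pvar s ^ a \<odot>\<^bsub>N\<^esub> x) a = lp (insert s S) u" .
  qed
  also have "\<dots> = lp (insert s S) u" using lp_nonempty[OF u] by auto
  finally show ?thesis .
qed

end

section \<open>Cech complex and local cohomology of a presented module\<close>

context presents
begin

definition cp :: "nat \<Rightarrow> ('n, 'k) coch \<Rightarrow> 'n set \<Rightarrow> ('m \<times> nat) set" where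
  "cp p c = (\<lambda>S\<in>{S. card S = p}. lp S (slice c S))"

abbreviation cact :: "('n, 'k) mpoly \<Rightarrow> ('n, 'k) coch \<Rightarrow> ('n, 'k) coch" where
  "cact r \<equiv> clift (act r)"

abbreviation FC :: "nat \<Rightarrow> ('n, 'k) coch set" where
  "FC p \<equiv> CC p (FF m)"

lemma slice_CC: "c \<in> CC p A \<Longrightarrow> card S = p \<Longrightarrow> slice c S \<in> loc S A"
proof -
  assume "c \<in> CC p A" "card S = p"
  moreover from this have "slice c S \<in> (if card S = p then loc S A else {0})" unfolding CC_def by blast
  ultimately show ?thesis by simp
qed

lemma CC_I: "(\<And>S. card S = p \<Longrightarrow> slice c S \<in> loc S A) \<Longrightarrow> (\<And>S. card S \<noteq> p \<Longrightarrow> slice c S = 0) \<Longrightarrow> c \<in> CC p A"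
  by (simp add: CC_def)

lemma slice_CC_zero: "c \<in> CC p A \<Longrightarrow> card S \<noteq> p \<Longrightarrow> slice c S = 0"
proof -
  assume "c \<in> CC p A" "card S \<noteq> p"
  moreover from this have "slice c S \<in> (if card S = p then loc S A else {0})" unfolding CC_def by blast
  ultimately show ?thesis by simp
qed

lemma cact_CC: "gsubm e A \<Longrightarrow> c \<in> CC p A \<Longrightarrow> cact r c \<in> CC p A"
  by (rule CC_I) (auto simp: slice_CC_zero intro: loc_act slice_CC)

lemma slices_exist:
  assumes "\<And>S. card S = p \<Longrightarrow> u S \<in> loc S A"
  shows "\<exists>c\<in>CC p A. (\<forall>S. card S = p \<longrightarrow> slice c S = u S) \<and> (\<forall>S. card S \<noteq> p \<longrightarrow> slice c S = 0)"
proof -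
  define c where "c = (\<lambda>(S, x). if card S = p then u S x else 0)"
  have 1: "slice c S = u S" if "card S = p" for S using that by (simp add: c_def slice_def)
  have 2: "slice c S = 0" if "card S \<noteq> p" for S using that by (simp add: c_def slice_def fun_eq_iff)
  have "c \<in> CC p A" by (rule CC_I) (use assms 1 2 in auto)
  thus ?thesis using 1 2 by blast
qed

lemma FC_sub: "fun_vs.subspace (FC p)" by (rule CC_subspace[OF gsubm_FF])

lemma KC_sub: "fun_vs.subspace (CC p K)" by (rule CC_subspace[OF gK])

lemma cech_carrier: "carrier (cech_module N p) = (\<Pi>\<^sub>E S\<in>{S. card S = p}. lp S ` loc S (FF m))"
  by (simp add: cech_module_def gsum_def mk_gmodule_def rep.car[OF localize_rep])

lemma cech_rep: "rep (FC p) cact (cp p) (cech_module N p)"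
proof
  show "0 \<in> FC p" by (rule fun_vs.subspace_0[OF FC_sub])
  show "u + v \<in> FC p" if "u \<in> FC p" "v \<in> FC p" for u v by (rule fun_vs.subspace_add[OF FC_sub that])
  show "- u \<in> FC p" if "u \<in> FC p" for u by (rule fun_vs.subspace_neg[OF FC_sub that])
  show "cact r u \<in> FC p" if "u \<in> FC p" for r u by (rule cact_CC[OF gsubm_FF that])
  show "cp p (u + v) = cp p u \<oplus>\<^bsub>cech_module N p\<^esub> cp p v" if uv: "u \<in> FC p" "v \<in> FC p" for u v
  proof -
    have "cp p u \<oplus>\<^bsub>cech_module N p\<^esub> cp p v = (\<lambda>S\<in>{S. card S = p}. lp S (slice u S) \<oplus>\<^bsub>localize N S\<^esub> lp S (slice v S))"
      by (auto simp: cech_module_def gsum_def mk_gmodule_def cp_def fun_eq_iff)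
    also have "\<dots> = cp p (u + v)"
      unfolding cp_def
      by (rule restrict_ext) (use uv in \<open>simp add: slice_add rep.g_add[OF localize_rep] slice_CC\<close>)
    finally show ?thesis ..
  qed
  show "cp p 0 = \<zero>\<^bsub>cech_module N p\<^esub>"
    by (simp add: cech_module_def gsum_def mk_gmodule_def cp_def rep.g_zero[OF localize_rep])
  show "cp p (cact r u) = r \<odot>\<^bsub>cech_module N p\<^esub> cp p u" if u: "u \<in> FC p" for r u
  proof -
    have "r \<odot>\<^bsub>cech_module N p\<^esub> cp p u = (\<lambda>S\<in>{S. card S = p}. r \<odot>\<^bsub>localize N S\<^esub> lp S (slice u S))"
      by (auto simp: cech_module_def gsum_def mk_gmodule_def cp_def fun_eq_iff)
    also have "\<dots> = cp p (cact r u)"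
      unfolding cp_def
      by (rule restrict_ext) (use u in \<open>simp add: rep.g_act[OF localize_rep] slice_CC\<close>)
    finally show ?thesis ..
  qed
  show "carrier (cech_module N p) = cp p ` FC p"
  proof (intro equalityI subsetI)
    fix x assume x: "x \<in> carrier (cech_module N p)"
    hence xS: "x S \<in> lp S ` loc S (FF m)" if "card S = p" for S
      using that unfolding cech_carrier by (auto simp: PiE_iff)
    have "\<exists>u. card S = p \<longrightarrow> u \<in> loc S (FF m) \<and> x S = lp S u" for S using xS[of S] by blast
    then obtain u where u: "\<And>S. card S = p \<Longrightarrow> u S \<in> loc S (FF m) \<and> x S = lp S (u S)" by metis
    have uS: "\<And>S. card S = p \<Longrightarrow> u S \<in> loc S (FF m)" using u by simp
    obtain c where c: "c \<in> FC p" "\<And>S. card S = p \<Longrightarrow> slice c S = u S"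
      using slices_exist[OF uS] by blast
    have "x = cp p c"
    proof
      fix S
      show "x S = cp p c S"
      proof (cases "card S = p")
        case False
        have "x S = undefined" using PiE_arb[OF x[unfolded cech_carrier], of S] False by simp
        thus ?thesis using False by (simp add: cp_def)
      next
        case True
        thus ?thesis using u[OF True] c(2)[OF True] by (simp add: cp_def)
      qed
    qed
    thus "x \<in> cp p ` FC p" using c(1) by blast
  next
    fix x assume "x \<in> cp p ` FC p"
    then obtain c where c: "c \<in> FC p" "x = cp p c" by blast
    thus "x \<in> carrier (cech_module N p)" unfolding cech_carrier cp_def by (simp add: slice_CC)
  qed
qed

lemma cech_homog: "homog (cech_module N p) t = cp p ` (FC p \<inter> Ct es t)"
proof (intro equalityI subsetI)
  fix x assume x: "x \<in> homog (cech_module N p) t"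
  hence xS: "x S \<in> lp S ` (loc S (FF m) \<inter> Vt es t)" if "card S = p" for S
    using that by (auto simp: cech_module_def gsum_def mk_gmodule_def localize_homog)
  have "\<exists>u. card S = p \<longrightarrow> u \<in> loc S (FF m) \<and> u \<in> Vt es t \<and> x S = lp S u" for S using xS[of S] by blast
  then obtain u where u: "\<And>S. card S = p \<Longrightarrow> u S \<in> loc S (FF m) \<and> u S \<in> Vt es t \<and> x S = lp S (u S)" by metis
  have uS: "\<And>S. card S = p \<Longrightarrow> u S \<in> loc S (FF m)" using u by simp
  obtain c where c: "c \<in> FC p" "\<And>S. card S = p \<Longrightarrow> slice c S = u S" "\<And>S. card S \<noteq> p \<Longrightarrow> slice c S = 0"
    using slices_exist[OF uS] by blast
  have "x = cp p c"
  proof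
    fix S
    show "x S = cp p c S"
    proof (cases "card S = p")
      case False
      thus ?thesis using x by (auto simp: cech_module_def gsum_def mk_gmodule_def cp_def PiE_def extensional_def)
    next
      case True
      thus ?thesis using u[OF True] c(2)[OF True] by (simp add: cp_def)
    qed
  qed
  moreover have "slice c S \<in> Vt es t" for S
    using c(2,3) u fun_vs.subspace_0[OF Vt_subspace] by (cases "card S = p") simp_all
  hence "c \<in> Ct es t" by (simp add: Ct_def)
  ultimately show "x \<in> cp p ` (FC p \<inter> Ct es t)" using c(1) by blast
next
  fix x assume "x \<in> cp p ` (FC p \<inter> Ct es t)"
  then obtain c where c: "c \<in> FC p" "c \<in> Ct es t" "x = cp p c" by blast
  have "slice c S \<in> Vt es t" for S using c(2) by (simp add: Ct_def)
  thus "x \<in> homog (cech_module N p) t" using c(1,3)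
    by (auto simp: cech_module_def gsum_def mk_gmodule_def localize_homog cp_def slice_CC)
qed

lemma cp_zero_iff:
  assumes c: "c \<in> FC p"
  shows "cp p c = \<zero>\<^bsub>cech_module N p\<^esub> \<longleftrightarrow> c \<in> CC p K"
proof -
  have "cp p c = \<zero>\<^bsub>cech_module N p\<^esub> \<longleftrightarrow> cp p c = cp p 0" using rep.g_zero[OF cech_rep] by simp
  also have "\<dots> \<longleftrightarrow> (\<forall>S. card S = p \<longrightarrow> lp S (slice c S) = lp S 0)"
    by (auto simp: cp_def fun_eq_iff restrict_def slice_zero)
  also have "\<dots> \<longleftrightarrow> (\<forall>S. card S = p \<longrightarrow> slice c S \<in> loc S K)"
    using lp_eq_iff[OF slice_CC[OF c], of _ 0] by (simp only: diff_0_right) blast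
  also have "\<dots> \<longleftrightarrow> c \<in> CC p K"
    using slice_CC_zero[OF c] slice_CC[of c p K] CC_I[of p c K] by blast
  finally show ?thesis .
qed

lemma act_sign: "act ((- 1) ^ k) v = (- 1) ^ k *\<^sub>f v"
  for v :: "('n, 'k) vec"
proof -
  have "pconst (- 1) = (- 1 :: ('n, 'k) mpoly)" by (simp add: pconst_def single_uminus)
  hence m1: "act (- 1) w = (- 1) *\<^sub>f w" for w :: "('n, 'k) vec" using act_pconst[of "- 1" w] by simp
  show ?thesis
  proof (induction k)
    case (Suc k)
    have "act ((- 1) ^ Suc k) v = act (- 1) (act ((- 1) ^ k) v)" by (simp only: power_Suc act_mult)
    also have "\<dots> = (- 1) *\<^sub>f ((- 1) ^ k *\<^sub>f v)" by (simp only: m1 Suc)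
    finally show ?case by (simp only: fun_vs.scale_scale power_Suc)
  next
    case 0
    show ?case by (simp only: power_0 act_one fun_vs.scale_one)
  qed
qed

lemma cech_diff_cp:
  assumes c: "c \<in> FC p"
  shows "cech_diff N p (cp p c) = cp (Suc p) (cd c)"
  unfolding cech_diff_def cp_def[of "Suc p"]
proof (rule restrict_ext)
  fix T :: "'n set" assume "T \<in> {T. card T = Suc p}"
  hence T: "card T = Suc p" by simp
  interpret L: rep "loc T (FF m)" act "lp T" "localize N T" by (rule localize_rep)
  interpret G: abelian_group "localize N T" by (rule L.abelian_group_N)
  have inT: "slice c (T - {s}) \<in> loc T (FF m)" if "s \<in> T" for s
  proof -
    have "card (T - {s}) = p" using T that by simp
    hence "slice c (T - {s}) \<in> loc (T - {s}) (FF m)" by (rule slice_CC[OF c])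
    thus ?thesis using loc_mono_set[OF gsubm_FF, of "T - {s}" T] by blast
  qed
  have term_eq: "(- 1) ^ card {u \<in> T. u < s} \<odot>\<^bsub>localize N T\<^esub> loc_map N (T - {s}) s (cp p c (T - {s})) =
      lp T (csgn T s *\<^sub>f slice c (T - {s}))" if s: "s \<in> T" for s
  proof -
    have cT: "card (T - {s}) = p" using T s by simp
    have "cp p c (T - {s}) = lp (T - {s}) (slice c (T - {s}))" using cT by (simp add: cp_def)
    moreover have "loc_map N (T - {s}) s (lp (T - {s}) (slice c (T - {s}))) = lp (insert s (T - {s})) (slice c (T - {s}))"
      by (rule loc_map_lp[OF slice_CC[OF c cT]]) simp
    moreover have "insert s (T - {s}) = T" using s by auto
    ultimately have "loc_map N (T - {s}) s (cp p c (T - {s})) = lp T (slice c (T - {s}))" by simp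
    thus ?thesis using L.g_act[OF inT[OF s], of "(- 1) ^ card {u \<in> T. u < s}"]
      by (simp only: act_sign csgn_def)
  qed
  have sc: "csgn T s *\<^sub>f slice c (T - {s}) \<in> loc T (FF m)" if "s \<in> T" for s
    by (rule fun_vs.subspace_scale[OF locF_sub inT[OF that]])
  have "(\<Oplus>\<^bsub>localize N T\<^esub>s\<in>T. (- 1) ^ card {u \<in> T. u < s} \<odot>\<^bsub>localize N T\<^esub> loc_map N (T - {s}) s (cp p c (T - {s}))) =
      (\<Oplus>\<^bsub>localize N T\<^esub>s\<in>T. lp T (csgn T s *\<^sub>f slice c (T - {s})))"
    by (rule G.finsum_cong') (use term_eq sc in \<open>auto simp: L.car\<close>)
  also have "\<dots> = lp T (\<Sum>s\<in>T. csgn T s *\<^sub>f slice c (T - {s}))"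
    by (rule L.g_finsum) (use sc in auto)
  also have "\<dots> = lp T (slice (cd c) T)" unfolding slice_cd ..
  finally show "(\<Oplus>\<^bsub>localize N T\<^esub>s\<in>T. (- 1) ^ card {u \<in> T. u < s} \<odot>\<^bsub>localize N T\<^esub> loc_map N (T - {s}) s (cp p c (T - {s}))) =
      lp T (slice (cd c) T)" .
qed

text \<open>Cocycles and coboundaries without degree restriction. In contrast to \<open>Bc\<close>,
  the cochains of \<open>K\<close> are left out of \<open>Bu\<close>: they are already sent to zero
  by \<open>cp\<close>.\<close>

definition "Zu i = {c \<in> FC i. cd c \<in> CC (Suc i) K}"
definition "Bu i = cd ` Cprev i (FF m :: ('n, 'k) vec set)"

lemma cact_cd: "cd (cact r c) = cact r (cd c)"
  for c :: "('n, 'k) coch"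
proof (rule coch_eqI)
  fix S :: "'n set"
  show "slice (cd (cact r c)) S = slice (cact r (cd c)) S"
    unfolding slice_clift slice_cd act_sum act_scale ..
qed

lemma Zu_closed:
  "0 \<in> Zu i" "u \<in> Zu i \<Longrightarrow> v \<in> Zu i \<Longrightarrow> u + v \<in> Zu i" "u \<in> Zu i \<Longrightarrow> - u \<in> Zu i" "u \<in> Zu i \<Longrightarrow> cact r u \<in> Zu i"
proof -
  show "0 \<in> Zu i" using fun_vs.subspace_0[OF FC_sub] fun_vs.subspace_0[OF KC_sub] by (simp add: Zu_def)
  show "u \<in> Zu i \<Longrightarrow> v \<in> Zu i \<Longrightarrow> u + v \<in> Zu i"
    using fun_vs.subspace_add[OF FC_sub] fun_vs.subspace_add[OF KC_sub] by (simp add: Zu_def cd_add)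
  show "u \<in> Zu i \<Longrightarrow> - u \<in> Zu i"
    using fun_vs.subspace_neg[OF FC_sub] fun_vs.subspace_neg[OF KC_sub] by (simp add: Zu_def cd_minus)
  show "u \<in> Zu i \<Longrightarrow> cact r u \<in> Zu i"
    using cact_CC[OF gsubm_FF] cact_CC[OF gK] by (auto simp: Zu_def cact_cd)
qed

lemma cact_zero: "cact r 0 = (0 :: ('n, 'k) coch)"
  by (rule coch_eqI) (simp only: slice_clift slice_zero act_zero)

lemma cact_add: "cact r (u + v) = cact r u + cact r v"
  for u v :: "('n, 'k) coch"
  by (rule clift_add[OF act_add])

lemma Cprev_FF_sub: "fun_vs.subspace (Cprev i (FF m :: ('n, 'k) vec set))"
  by (rule Cprev_subspace[OF gsubm_FF])

lemma Bu_closed: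
  "Bu i \<subseteq> Zu i" "0 \<in> Bu i" "u \<in> Bu i \<Longrightarrow> v \<in> Bu i \<Longrightarrow> u + v \<in> Bu i" "u \<in> Bu i \<Longrightarrow> - u \<in> Bu i"
  "u \<in> Bu i \<Longrightarrow> cact r u \<in> Bu i"
proof -
  have "cd 0 \<in> Bu i" unfolding Bu_def by (rule imageI[OF fun_vs.subspace_0[OF Cprev_FF_sub]])
  thus "0 \<in> Bu i" by simp
  show "Bu i \<subseteq> Zu i"
    using cd_Cprev[OF gsubm_FF] fun_vs.subspace_0[OF KC_sub] by (auto simp: Bu_def Zu_def)
  show "u \<in> Bu i \<Longrightarrow> v \<in> Bu i \<Longrightarrow> u + v \<in> Bu i"
    unfolding Bu_def using fun_vs.subspace_add[OF Cprev_FF_sub] by (auto simp flip: cd_add)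
  show "u \<in> Bu i \<Longrightarrow> - u \<in> Bu i"
    unfolding Bu_def using fun_vs.subspace_neg[OF Cprev_FF_sub] by (auto simp flip: cd_minus)
  have "cact r c \<in> Cprev i (FF m)" if "c \<in> Cprev i (FF m)" for c
    using that cact_CC[OF gsubm_FF] by (cases i) (auto simp: Cprev_def cact_zero)
  thus "u \<in> Bu i \<Longrightarrow> cact r u \<in> Bu i"
    unfolding Bu_def by (auto simp flip: cact_cd)
qed

abbreviation "CZ i \<equiv> gsub (cech_module N i) (cp i ` Zu i)"

definition lcp :: "nat \<Rightarrow> ('n, 'k) coch \<Rightarrow> ('n set \<Rightarrow> ('m \<times> nat) set) set" where
  "lcp i c = (cp i ` Bu i) +>\<^bsub>CZ i\<^esub> cp i c"

lemma local_cohomology_eq: "local_cohomology i N = gquot (CZ i) (cp i ` Bu i)"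
proof -
  have "{x \<in> carrier (cech_module N i). cech_diff N i x = \<zero>\<^bsub>cech_module N (Suc i)\<^esub>} = cp i ` Zu i"
  proof -
    have "cech_diff N i (cp i c) = \<zero>\<^bsub>cech_module N (Suc i)\<^esub> \<longleftrightarrow> cd c \<in> CC (Suc i) K" if "c \<in> FC i" for c
      unfolding cech_diff_cp[OF that] by (rule cp_zero_iff[OF cd_CC[OF gsubm_FF that]])
    thus ?thesis unfolding rep.car[OF cech_rep] Zu_def by auto
  qed
  moreover have "(case i of 0 \<Rightarrow> {\<zero>\<^bsub>cech_module N 0\<^esub>} | Suc q \<Rightarrow> cech_diff N q ` carrier (cech_module N q)) = cp i ` Bu i"
  proof (cases i)
    case 0
    have "Bu i = {0}" using 0 by (simp add: Bu_def Cprev_def)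
    thus ?thesis using 0 rep.g_zero[OF cech_rep, of 0] by simp
  next
    case (Suc q)
    have "cech_diff N q ` carrier (cech_module N q) = cech_diff N q ` cp q ` FC q" by (simp only: rep.car[OF cech_rep])
    also have "\<dots> = cp i ` cd ` FC q" unfolding image_image using cech_diff_cp[of _ q] Suc by (intro image_cong) simp_all
    finally show ?thesis using Suc by (simp add: Bu_def Cprev_def)
  qed
  ultimately show ?thesis unfolding local_cohomology_def cohomology_def by simp
qed

lemma CZ_rep: "rep (Zu i) cact (cp i) (CZ i)"
  by (rule rep.rep_gsub[OF cech_rep]) (use Zu_closed in \<open>auto simp: Zu_def\<close>)

lemma lc_rep: "rep (Zu i) cact (lcp i) (local_cohomology i N)"
  unfolding lcp_def[abs_def] local_cohomology_eq
  by (rule rep.rep_gquot[OF CZ_rep Bu_closed cact_add])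

lemma lcp_zero_iff:
  assumes "c \<in> Zu i"
  shows "lcp i c = \<zero>\<^bsub>local_cohomology i N\<^esub> \<longleftrightarrow> (\<exists>b\<in>Bu i. c - b \<in> CC i K)"
proof -
  have "lcp i c = \<zero>\<^bsub>local_cohomology i N\<^esub> \<longleftrightarrow> (\<exists>b\<in>Bu i. cp i (c - b) = \<zero>\<^bsub>CZ i\<^esub>)"
    unfolding lcp_def local_cohomology_eq
    by (rule rep.coset_zero_iff[OF CZ_rep Bu_closed(1-4) assms])
  moreover have "cp i (c - b) = \<zero>\<^bsub>CZ i\<^esub> \<longleftrightarrow> c - b \<in> CC i K" if "b \<in> Bu i" for b
  proof -
    have "c - b \<in> FC i" using rep.A_diff[OF CZ_rep assms, of b] that Bu_closed(1)[of i] by (auto simp: Zu_def)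
    from cp_zero_iff[OF this] show ?thesis by (simp add: gsub_def)
  qed
  ultimately show ?thesis by simp
qed

lemma lc_homog: "homog (local_cohomology i N) t = lcp i ` Zc es i t (FF m) K"
proof -
  have "homog (local_cohomology i N) t = (\<lambda>x. (cp i ` Bu i) +>\<^bsub>CZ i\<^esub> x) ` (cp i ` (FC i \<inter> Ct es t) \<inter> cp i ` Zu i)"
    unfolding local_cohomology_eq by (simp add: gquot_def mk_gmodule_def gsub_def cech_homog)
  \<comment> \<open>An element of both images has a homogeneous representative and a cocycle
    representative. They differ by a cochain of \<open>K\<close>, so the homogeneous one is a
    cocycle too.\<close>
  also have "cp i ` (FC i \<inter> Ct es t) \<inter> cp i ` Zu i = cp i ` Zc es i t (FF m) K"
  proof (intro equalityI subsetI)
    fix x assume "x \<in> cp i ` (FC i \<inter> Ct es t) \<inter> cp i ` Zu i"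
    then obtain c c' where c: "c \<in> FC i" "c \<in> Ct es t" "x = cp i c" and c': "c' \<in> Zu i" "x = cp i c'" by auto
    have "cp i (c - c') = \<zero>\<^bsub>cech_module N i\<^esub>"
      using rep.g_eq_iff[OF cech_rep c(1), of c'] c c' by (auto simp: Zu_def)
    moreover have "c - c' \<in> FC i" using fun_vs.subspace_diff[OF FC_sub c(1)] c' by (simp add: Zu_def)
    ultimately have "c - c' \<in> CC i K" using cp_zero_iff by blast
    moreover have "cd c' \<in> CC (Suc i) K" using c' by (simp add: Zu_def)
    ultimately have "cd (c - c') + cd c' \<in> CC (Suc i) K"
      by (intro fun_vs.subspace_add[OF KC_sub cd_CC[OF gK]])
    hence "cd c \<in> CC (Suc i) K" by (simp add: cd_diff)
    hence "c \<in> Zc es i t (FF m) K" using c by (simp add: Zc_def)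
    thus "x \<in> cp i ` Zc es i t (FF m) K" using c(3) by blast
  next
    fix x assume "x \<in> cp i ` Zc es i t (FF m) K"
    thus "x \<in> cp i ` (FC i \<inter> Ct es t) \<inter> cp i ` Zu i" by (auto simp: Zc_def Zu_def)
  qed
  finally show ?thesis by (simp add: image_image lcp_def[abs_def])
qed

lemma Zc_Zu: "Zc es i t (FF m) K \<subseteq> Zu i"
  by (auto simp: Zc_def Zu_def)

lemma hcomp_CC: "gsubm es A \<Longrightarrow> c \<in> CC p A \<Longrightarrow> clift (hcomp es t) c \<in> CC p A"
  by (rule CC_I) (auto simp: slice_CC_zero intro: loc_hcomp slice_CC)

lemma hcomp_cd: "clift (hcomp es t) (cd c) = cd (clift (hcomp es t) c)"
  for c :: "('n, 'k) coch"
proof (rule coch_eqI)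
  fix S :: "'n set"
  show "slice (clift (hcomp es t) (cd c)) S = slice (cd (clift (hcomp es t) c)) S"
    unfolding slice_clift slice_cd hcomp_sum hcomp_scale ..
qed

lemma lcp_zero_iff_Bc:
  assumes c: "c \<in> Zc es i t (FF m) K"
  shows "lcp i c = \<zero>\<^bsub>local_cohomology i N\<^esub> \<longleftrightarrow> c \<in> Bc es i t (FF m) K"
proof
  assume "lcp i c = \<zero>\<^bsub>local_cohomology i N\<^esub>"
  moreover have "c \<in> Zu i" using c Zc_Zu by blast
  ultimately obtain b where "b \<in> Bu i" "c - b \<in> CC i K" using lcp_zero_iff by blast
  then obtain u where u: "u \<in> Cprev i (FF m)" "c - cd u \<in> CC i K" unfolding Bu_def by blast
  \<comment> \<open>The bounding cochain need not be homogeneous. Taking components of degree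
    \<open>t\<close> commutes with \<open>cd\<close> and fixes \<open>c\<close>, so it may be
    replaced by its component.\<close>
  let ?h = "clift (hcomp es t) :: ('n, 'k) coch \<Rightarrow> _"
  have hCt: "?h x \<in> Ct es t" for x by (simp add: Ct_def)
  have add: "?h (x + y) = ?h x + ?h y" for x y by (rule clift_add[OF hcomp_add])
  have "c = ?h c"
  proof (rule coch_eqI)
    fix S
    have "slice c S \<in> Vt es t" using c by (simp add: Zc_def Ct_def)
    thus "slice c S = slice (?h c) S" using hcomp_Vt_eq[of "slice c S" es t t] by simp
  qed
  also have "?h c = ?h (cd u + (c - cd u))" by simp
  also have "\<dots> = cd (?h u) + ?h (c - cd u)" unfolding add hcomp_cd ..
  finally have "c = cd (?h u) + ?h (c - cd u)" .
  moreover have "cd (?h u) + ?h (c - cd u) \<in> Bc es i t (FF m) K"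
  proof (rule Bc_I)
    have "?h 0 = 0" by (rule coch_eqI) (simp only: slice_clift slice_zero hcomp_zero)
    thus "?h u \<in> Cprev i (FF m)"
      using u(1) hcomp_CC[OF gsubm_FF] by (cases i) (auto simp: Cprev_def)
    show "?h (c - cd u) \<in> CC i K" by (rule hcomp_CC[OF gK u(2)])
  qed (rule hCt)+
  ultimately show "c \<in> Bc es i t (FF m) K" by metis
next
  assume "c \<in> Bc es i t (FF m) K"
  then obtain u w where uw: "u \<in> Cprev i (FF m)" "w \<in> CC i K" "c = cd u + w" by (auto elim: Bc_E)
  have "c - cd u \<in> CC i K" using uw by simp
  moreover have "c \<in> Zu i" using c Zc_Zu by blast
  moreover have "cd u \<in> Bu i" using uw(1) by (simp add: Bu_def)
  ultimately show "lcp i c = \<zero>\<^bsub>local_cohomology i N\<^esub>" using lcp_zero_iff by blast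
qed

lemma cact_pconst: "cact (pconst r) c = r *\<^sub>f c"
  for c :: "('n, 'k) coch"
  by (rule coch_eqI) (simp only: slice_clift slice_scale act_pconst)

theorem k_dim_local_cohomology: "k_dim (local_cohomology i N) (homog (local_cohomology i N) t) \<le> hh es i t (FF m) K"
  unfolding lc_homog hh_def
  by (rule k_dim_le_rdim[OF lc_rep cact_pconst Zc_Zu Zc_subspace[OF gsubm_FF gK] Bc_0[OF gsubm_FF gK]])
     (use lcp_zero_iff_Bc in blast)

theorem local_cohomology_nonzero_iff:
  "homog (local_cohomology i N) t \<noteq> {\<zero>\<^bsub>local_cohomology i N\<^esub>} \<longleftrightarrow> hh es i t (FF m) K \<noteq> 0"
proof -
  have zero: "\<zero>\<^bsub>local_cohomology i N\<^esub> \<in> lcp i ` Zc es i t (FF m) K"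
    by (rule image_eqI[where x = 0], rule rep.g_zero[OF lc_rep, symmetric],
        rule fun_vs.subspace_0[OF Zc_subspace[OF gsubm_FF gK]])
  have "homog (local_cohomology i N) t = {\<zero>\<^bsub>local_cohomology i N\<^esub>} \<longleftrightarrow> Zc es i t (FF m) K \<subseteq> Bc es i t (FF m) K"
    unfolding lc_homog
  proof
    assume h: "lcp i ` Zc es i t (FF m) K = {\<zero>\<^bsub>local_cohomology i N\<^esub>}"
    show "Zc es i t (FF m) K \<subseteq> Bc es i t (FF m) K"
    proof
      fix c assume c: "c \<in> Zc es i t (FF m) K"
      hence "lcp i c = \<zero>\<^bsub>local_cohomology i N\<^esub>" using h by blast
      thus "c \<in> Bc es i t (FF m) K" using lcp_zero_iff_Bc[OF c] by simp
    qed
  next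
    assume "Zc es i t (FF m) K \<subseteq> Bc es i t (FF m) K"
    hence "lcp i c = \<zero>\<^bsub>local_cohomology i N\<^esub>" if "c \<in> Zc es i t (FF m) K" for c
      using that lcp_zero_iff_Bc[OF that] by blast
    hence "lcp i ` Zc es i t (FF m) K \<subseteq> {\<zero>\<^bsub>local_cohomology i N\<^esub>}" by (simp add: image_subset_iff)
    thus "lcp i ` Zc es i t (FF m) K = {\<zero>\<^bsub>local_cohomology i N\<^esub>}" using zero by blast
  qed
  also have "\<dots> \<longleftrightarrow> hh es i t (FF m) K = 0"
    unfolding hh_def using rdim_eq_0[of "Zc es i t (FF m) K" "Bc es i t (FF m) K"]
      rdim_eq_0D[OF _ Bc_subspace[OF gsubm_FF gK], of "Zc es i t (FF m) K" i t] by metis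
  finally show ?thesis by blast
qed

end

lemma Greatest_int_ge:
  fixes P :: "int \<Rightarrow> bool"
  assumes "P x" "\<And>y. P y \<Longrightarrow> y \<le> b"
  shows "x \<le> (GREATEST y. P y)"
proof -
  let ?S = "{y. P y \<and> x \<le> y}"
  have fin: "finite ?S" by (rule finite_subset[of _ "{x..b}"]) (use assms in auto)
  have ne: "?S \<noteq> {}" using assms by auto
  have "Max ?S \<in> ?S" by (rule Max_in[OF fin ne])
  moreover have "y \<le> Max ?S" if "P y" for y
  proof (cases "x \<le> y")
    case True
    thus ?thesis using that by (intro Max_ge fin) auto
  next
    case False
    thus ?thesis using \<open>Max ?S \<in> ?S\<close> by auto
  qed
  ultimately have "(GREATEST y. P y) = Max ?S" by (intro Greatest_equality) auto
  thus ?thesis using \<open>Max ?S \<in> ?S\<close> by auto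
qed

text \<open>\<open>GREATEST\<close> is meaningful only for a nonempty set that is bounded above.
  Nonvanishing of the given cohomology provides a member; the bound comes from the finitely many
  cohomological degrees and the eventual vanishing in each of them.\<close>

lemma (in presents) hh_zero_above_reg:
  assumes "int i + t > reg N"
  shows "hh es i t (FF m) K = 0"
proof (rule ccontr)
  assume nz: "hh es i t (FF m) K \<noteq> 0"
  have "\<exists>T. \<forall>t\<ge>T. hh es j t (FF m) K = 0" for j by (rule hh_eventually_zero[OF gK KF])
  then obtain T where T: "\<And>j t. t \<ge> T j \<Longrightarrow> hh es j t (FF m) K = 0" by metis
  define b where "b = int CARD('n) + (\<Sum>j\<le>CARD('n). \<bar>T j\<bar>)"
  have "int i + t \<le> reg N"
    unfolding reg_def
  proof (rule Greatest_int_ge)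
    show "\<exists>j s. int i + t = int j + s \<and> homog (local_cohomology j N) s \<noteq> {\<zero>\<^bsub>local_cohomology j N\<^esub>}"
      by (intro exI conjI, rule refl, rule local_cohomology_nonzero_iff[THEN iffD2, OF nz])
    fix y assume "\<exists>j s. y = int j + s \<and> homog (local_cohomology j N) s \<noteq> {\<zero>\<^bsub>local_cohomology j N\<^esub>}"
    then obtain j s where y: "y = int j + s" and h: "homog (local_cohomology j N) s \<noteq> {\<zero>\<^bsub>local_cohomology j N\<^esub>}"
      by blast
    note js = y local_cohomology_nonzero_iff[THEN iffD1, OF h]
    have j: "j \<le> CARD('n)"
    proof (rule ccontr)
      assume "\<not> ?thesis"
      hence "hh es j s (FF m) K = 0" by (intro hh_large gsubm_FF gK) simp
      thus False using js(2) by simp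
    qed
    have "s < T j"
    proof (rule ccontr)
      assume "\<not> ?thesis"
      hence "hh es j s (FF m) K = 0" by (intro T) simp
      thus False using js(2) by simp
    qed
    moreover have "\<bar>T j\<bar> \<le> (\<Sum>j\<le>CARD('n). \<bar>T j\<bar>)" by (rule member_le_sum) (use j in auto)
    ultimately show "y \<le> b" using js(1) j unfolding b_def by linarith
  qed
  thus False using assms by simp
qed

section \<open>Free graded modules\<close>

definition toexp :: "('n \<Rightarrow> int) \<Rightarrow> 'n \<Rightarrow>\<^sub>0 nat" where
  "toexp e = Abs_poly_mapping (\<lambda>s. nat (e s))"

definition coefz :: "('n, 'k::field) mpoly \<Rightarrow> ('n \<Rightarrow> int) \<Rightarrow> 'k" where
  "coefz q e = (if \<forall>s. 0 \<le> e s then Poly_Mapping.lookup q (toexp e) else 0)"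

definition emb :: "nat \<Rightarrow> (nat \<Rightarrow> ('n, 'k::field) mpoly) \<Rightarrow> ('n, 'k) vec" where
  "emb m f = (\<lambda>(b, e). if b < m then coefz (f b) e else 0)"

definition unemb :: "nat \<Rightarrow> ('n, 'k::field) vec \<Rightarrow> nat \<Rightarrow> ('n, 'k) mpoly" where
  "unemb m v = (\<lambda>b\<in>{..<m}. Abs_poly_mapping (\<lambda>a. v (b, expo a)))"

lemma expo_toexp: "(\<And>s. 0 \<le> e s) \<Longrightarrow> expo (toexp e) = e" for e :: "'n::finite \<Rightarrow> int"
  by (auto simp: expo_def toexp_def)

lemma toexp_expo [simp]: "toexp (expo a) = a" for a :: "'n::finite \<Rightarrow>\<^sub>0 nat"
  by (rule poly_mapping_eqI) (simp add: expo_def toexp_def)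

lemma coefz_expo [simp]: "coefz q (expo a) = Poly_Mapping.lookup q a" for a :: "'n::finite \<Rightarrow>\<^sub>0 nat"
  by (simp add: coefz_def)

lemma coefz_add: "coefz (p + q) e = coefz p e + coefz q e"
  by (simp add: coefz_def lookup_add)

lemma coefz_zero [simp]: "coefz 0 e = 0"
  by (simp add: coefz_def)

lemma coefz_sum: "coefz (\<Sum>i\<in>J. p i) e = (\<Sum>i\<in>J. coefz (p i) e)"
  by (induction J rule: infinite_finite_induct) (simp_all add: coefz_add)

lemma coefz_single: "coefz (Poly_Mapping.single a c) e = (if e = expo a then c else 0)" for a :: "'n::finite \<Rightarrow>\<^sub>0 nat"
proof (cases "\<forall>s. 0 \<le> e s")
  case True
  hence e: "expo (toexp e) = e" by (simp add: expo_toexp)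
  have "toexp e = a \<longleftrightarrow> e = expo a" using e by auto
  thus ?thesis using True by (auto simp: coefz_def lookup_single when_def)
next
  case False
  hence "e \<noteq> expo a" by auto
  thus ?thesis using False by (auto simp: coefz_def)
qed

lemma coefz_single_mult:
  fixes q :: "('n::finite, 'k::field) mpoly"
  shows "coefz (Poly_Mapping.single c k * q) e = k * coefz q (e - expo c)"
proof -
  have "coefz (Poly_Mapping.single c k * q) e =
      coefz (Poly_Mapping.single c k * (\<Sum>b\<in>Poly_Mapping.keys q. Poly_Mapping.single b (Poly_Mapping.lookup q b))) e"
    using poly_mapping_expand[of q] by simp
  also have "\<dots> = (\<Sum>b\<in>Poly_Mapping.keys q. if e = expo c + expo b then k * Poly_Mapping.lookup q b else 0)"
    by (simp add: sum_distrib_left mult_single coefz_sum coefz_single)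
  also have "\<dots> = (\<Sum>b\<in>Poly_Mapping.keys q. k * coefz (Poly_Mapping.single b (Poly_Mapping.lookup q b)) (e - expo c))"
    by (rule sum.cong) (auto simp: coefz_single algebra_simps)
  also have "\<dots> = k * coefz (\<Sum>b\<in>Poly_Mapping.keys q. Poly_Mapping.single b (Poly_Mapping.lookup q b)) (e - expo c)"
    by (simp add: coefz_sum sum_distrib_left)
  also have "\<dots> = k * coefz q (e - expo c)" using poly_mapping_expand[of q] by simp
  finally show ?thesis .
qed

lemma coefz_mult:
  fixes p q :: "('n::finite, 'k::field) mpoly"
  shows "coefz (p * q) e = (\<Sum>a\<in>Poly_Mapping.keys p. Poly_Mapping.lookup p a * coefz q (e - expo a))"
proof -
  have "coefz (p * q) e =
      coefz ((\<Sum>a\<in>Poly_Mapping.keys p. Poly_Mapping.single a (Poly_Mapping.lookup p a)) * q) e"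
    using poly_mapping_expand[of p] by simp
  thus ?thesis by (simp add: sum_distrib_right coefz_sum coefz_single_mult)
qed

lemma act_apply: "act p v (b, e) = (\<Sum>a\<in>Poly_Mapping.keys p. Poly_Mapping.lookup p a * v (b, e - expo a))"
  unfolding act_def sum_fun_apply by (simp add: sh_apply)

lemma emb_FF: "emb m f \<in> FF m" for f :: "nat \<Rightarrow> ('n::finite, 'k::field) mpoly"
proof -
  have "{x. emb m f x \<noteq> 0} \<subseteq> (\<Union>b<m. (\<lambda>a. (b, expo a)) ` Poly_Mapping.keys (f b))"
  proof clarify
    fix b e assume "emb m f (b, e) \<noteq> 0"
    hence be: "b < m" "\<forall>s. 0 \<le> e s" "Poly_Mapping.lookup (f b) (toexp e) \<noteq> 0"
      by (auto simp: emb_def coefz_def split: if_splits)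
    hence "e = expo (toexp e)" using expo_toexp by metis
    thus "(b, e) \<in> (\<Union>b<m. (\<lambda>a. (b, expo a)) ` Poly_Mapping.keys (f b))"
      using be by (intro UN_I[of b] image_eqI[of _ _ "toexp e"]) (auto simp: in_keys_iff)
  qed
  hence "finite {x. emb m f x \<noteq> 0}" by (rule finite_subset) auto
  thus ?thesis by (auto simp: FF_def emb_def coefz_def split: if_splits)
qed

lemma lookup_unemb:
  fixes v :: "('n::finite, 'k::field) vec"
  assumes "v \<in> FF m" "b < m"
  shows "Poly_Mapping.lookup (unemb m v b) a = v (b, expo a)"
proof -
  have "finite ((\<lambda>a. (b, expo a)) ` {a. v (b, expo a) \<noteq> 0})"
    by (rule finite_subset[of _ "{x. v x \<noteq> 0}"]) (use assms in \<open>auto simp: FF_def\<close>)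
  hence "finite {a. v (b, expo a) \<noteq> 0}" by (rule finite_imageD) (auto simp: inj_on_def)
  thus ?thesis using assms(2) by (simp add: unemb_def)
qed

lemma emb_unemb: "v \<in> FF m \<Longrightarrow> emb m (unemb m v) = v" for v :: "('n::finite, 'k::field) vec"
proof
  fix x :: "nat \<times> ('n \<Rightarrow> int)" assume v: "v \<in> FF m"
  obtain b e where x: "x = (b, e)" by (cases x)
  show "emb m (unemb m v) x = v x"
  proof (cases "b < m \<and> (\<forall>s. 0 \<le> e s)")
    case True
    thus ?thesis using lookup_unemb[OF v, of b "toexp e"] expo_toexp[of e] by (simp add: x emb_def coefz_def)
  next
    case False
    hence "v x = 0" using v x unfolding FF_def by blast
    moreover have "emb m (unemb m v) x = 0" using False by (auto simp: x emb_def coefz_def)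
    ultimately show ?thesis by simp
  qed
qed

lemma unemb_emb: "f \<in> extensional {..<m} \<Longrightarrow> unemb m (emb m f) = f" for f :: "nat \<Rightarrow> ('n::finite, 'k::field) mpoly"
proof
  fix b assume f: "f \<in> extensional {..<m}"
  show "unemb m (emb m f) b = f b"
  proof (cases "b < m")
    case True
    show ?thesis
      by (rule poly_mapping_eqI) (simp add: lookup_unemb[OF emb_FF True], simp add: emb_def True)
  next
    case False
    thus ?thesis using f by (simp add: unemb_def extensional_def)
  qed
qed

lemma unemb_ext: "unemb m v \<in> extensional {..<m}"
  by (simp add: unemb_def)

lemma unemb_eqI:
  fixes v :: "('n::finite, 'k::field) vec"
  assumes "f \<in> extensional {..<m}" "v = emb m f"
  shows "unemb m v = f"
  using assms unemb_emb by simp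

lemma emb_add: "emb m (\<lambda>b\<in>{..<m}. f b + f' b) = emb m f + emb m f'"
  by (auto simp: emb_def fun_eq_iff coefz_add)

lemma emb_act: "emb m (\<lambda>b\<in>{..<m}. p * f b) = act p (emb m f)" for p :: "('n::finite, 'k::field) mpoly"
  by (auto simp: fun_eq_iff act_apply emb_def coefz_mult)

lemma emb_zero: "emb m (\<lambda>b\<in>{..<m}. 0) = 0"
  by (auto simp: emb_def fun_eq_iff)

lemma free_carrier: "carrier (free_gmodule es) = extensional {..<length es}"
  by (auto simp: free_gmodule_def gsum_def mk_gmodule_def gshift_def poly_gmodule_def PiE_def)

lemma free_ops:
  "\<zero>\<^bsub>free_gmodule es\<^esub> = (\<lambda>b\<in>{..<length es}. 0)"
  "f \<oplus>\<^bsub>free_gmodule es\<^esub> f' = (\<lambda>b\<in>{..<length es}. f b + f' b)"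
  "p \<odot>\<^bsub>free_gmodule es\<^esub> f = (\<lambda>b\<in>{..<length es}. p * f b)"
  by (simp_all add: free_gmodule_def gsum_def mk_gmodule_def gshift_def poly_gmodule_def)

lemma free_homog:
  fixes es :: "int list"
  shows "homog (free_gmodule es) t = {f \<in> extensional {..<length es}. \<forall>b<length es. (f b :: ('n::finite, 'k::field) mpoly) \<in> poly_homog (t - es ! b)}"
  by (auto simp: free_gmodule_def gsum_def mk_gmodule_def gshift_def poly_gmodule_def PiE_def Pi_def)

lemma emb_Vt_iff:
  fixes f :: "nat \<Rightarrow> ('n::finite, 'k::field) mpoly"
  shows "emb m f \<in> Vt es t \<longleftrightarrow> (\<forall>b<m. f b \<in> poly_homog (t - es b))"
proof
  assume v: "emb m f \<in> Vt es t"
  show "\<forall>b<m. f b \<in> poly_homog (t - es b)"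
  proof (intro allI impI)
    fix b assume b: "b < m"
    show "f b \<in> poly_homog (t - es b)"
      unfolding poly_homog_def
    proof (intro CollectI ballI)
      fix a assume "a \<in> Poly_Mapping.keys (f b)"
      hence "emb m f (b, expo a) \<noteq> 0" using b by (simp add: emb_def in_keys_iff)
      hence "edeg (expo a) + es b = t" using v unfolding Vt_def by blast
      thus "int (mon_deg a) = t - es b" by simp
    qed
  qed
next
  assume h: "\<forall>b<m. f b \<in> poly_homog (t - es b)"
  show "emb m f \<in> Vt es t"
    unfolding Vt_def
  proof clarify
    fix b e assume "emb m f (b, e) \<noteq> 0"
    hence be: "b < m" "\<forall>s. 0 \<le> e s" "Poly_Mapping.lookup (f b) (toexp e) \<noteq> 0"
      by (auto simp: emb_def coefz_def split: if_splits)
    hence "int (mon_deg (toexp e)) = t - es b" using h by (auto simp: poly_homog_def in_keys_iff)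
    moreover have "edeg e = int (mon_deg (toexp e))" using be(2) expo_toexp[of e] edeg_expo[of "toexp e"] by simp
    ultimately show "edeg e + es b = t" by simp
  qed
qed

lemma unemb_closed: "unemb (length es) v \<in> carrier (free_gmodule es)"
  by (simp add: free_carrier unemb_ext)

lemma unemb_ops:
  fixes u v :: "('n::finite, 'k::field) vec"
  assumes "u \<in> FF (length es)" "v \<in> FF (length es)"
  shows "unemb (length es) (u + v) = unemb (length es) u \<oplus>\<^bsub>free_gmodule es\<^esub> unemb (length es) v"
    and "unemb (length es) (act p u) = p \<odot>\<^bsub>free_gmodule es\<^esub> unemb (length es) u"
  using assms by (auto intro!: unemb_eqI simp: free_ops emb_add emb_act emb_unemb)

lemma unemb_zero: "unemb (length es) (0 :: ('n::finite, 'k::field) vec) = \<zero>\<^bsub>free_gmodule es\<^esub>"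
  by (auto intro!: unemb_eqI simp: free_ops emb_zero)

lemma unemb_image: "unemb (length es) ` FF (length es) = carrier (free_gmodule es :: (('n::finite, 'k::field) mpoly, _) gmodule)"
proof (intro equalityI subsetI)
  fix f :: "nat \<Rightarrow> ('n, 'k) mpoly" assume "f \<in> carrier (free_gmodule es)"
  hence "f = unemb (length es) (emb (length es) f)" by (simp add: free_carrier unemb_emb)
  thus "f \<in> unemb (length es) ` FF (length es)" using emb_FF by blast
qed (use unemb_closed in auto)

lemma unemb_image_homog:
  "unemb (length es) ` (FF (length es) \<inter> Vt (\<lambda>b. es ! b) t) =
    homog (free_gmodule es :: (('n::finite, 'k::field) mpoly, _) gmodule) t"
proof (intro equalityI subsetI)
  fix f :: "nat \<Rightarrow> ('n, 'k) mpoly" assume f: "f \<in> homog (free_gmodule es) t"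
  hence "emb (length es) f \<in> Vt (\<lambda>b. es ! b) t" by (simp add: free_homog emb_Vt_iff)
  moreover have "f = unemb (length es) (emb (length es) f)" using f by (simp add: free_homog unemb_emb)
  ultimately show "f \<in> unemb (length es) ` (FF (length es) \<inter> Vt (\<lambda>b. es ! b) t)" using emb_FF by blast
next
  fix f :: "nat \<Rightarrow> ('n, 'k) mpoly" assume "f \<in> unemb (length es) ` (FF (length es) \<inter> Vt (\<lambda>b. es ! b) t)"
  then obtain v where v: "v \<in> FF (length es)" "v \<in> Vt (\<lambda>b. es ! b) t" "f = unemb (length es) v" by blast
  have "emb (length es) f \<in> Vt (\<lambda>b. es ! b) t" using v emb_unemb[OF v(1)] by simp
  thus "f \<in> homog (free_gmodule es) t" using v(3) by (simp add: free_homog emb_Vt_iff unemb_ext)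
qed

text \<open>Linearity on \<open>FF m\<close> is assumed only with respect to polynomials, so
  \<open>v\<close> is expanded into monomial multiples of basis vectors with nonnegative exponents,
  all of them inside \<open>FF m\<close>.\<close>

lemma linear_eq_mat:
  fixes \<psi> :: "('n::finite, 'k::field) vec \<Rightarrow> ('n, 'k) vec"
  assumes add: "\<And>u v. u \<in> FF m \<Longrightarrow> v \<in> FF m \<Longrightarrow> \<psi> (u + v) = \<psi> u + \<psi> v"
    and act: "\<And>p u. u \<in> FF m \<Longrightarrow> \<psi> (act p u) = act p (\<psi> u)"
    and F: "\<And>a. a < m \<Longrightarrow> \<psi> (bas a) \<in> FF m'" and v: "v \<in> FF m"
  shows "\<psi> v = mat m (\<lambda>a. \<psi> (bas a)) v"
proof -
  define E :: "nat \<times> ('n \<Rightarrow> int) \<Rightarrow> ('n, 'k) vec" where "E = (\<lambda>x. sh (snd x) (bas (fst x)))"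
  have E_apply: "E x y = (if x = y then 1 else 0)" for x y
    by (cases x; cases y) (auto simp: E_def sh_apply bas_def)
  let ?S = "{x. v x \<noteq> 0}"
  have fin: "finite ?S" using v by (simp add: FF_def)
  have S: "fst x < m \<and> (\<forall>s. 0 \<le> snd x s)" if "x \<in> ?S" for x
    using v that unfolding FF_def by (cases x) auto
  have expand: "v = (\<Sum>x\<in>?S. v x *\<^sub>f E x)"
  proof
    fix y
    have "(\<Sum>x\<in>?S. v x *\<^sub>f E x) y = (\<Sum>x\<in>?S. if x = y then v x else 0)"
      unfolding sum_fun_apply by (rule sum.cong) (auto simp: E_apply)
    also have "\<dots> = v y" using fin by (simp add: sum.delta)
    finally show "v y = (\<Sum>x\<in>?S. v x *\<^sub>f E x) y" ..
  qed
  have EF: "E x \<in> FF m" if "x \<in> ?S" for x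
    unfolding E_def using S[OF that] by (intro sh_FF bas_FF) auto
  have scale: "\<psi> (c *\<^sub>f u) = c *\<^sub>f \<psi> u" if "u \<in> FF m" for c u
    using act[OF that, of "pconst c"] by (simp only: act_pconst)
  have \<psi>0: "\<psi> 0 = 0" using scale[OF fun_vs.subspace_0[OF FF_subspace], of 0] by simp
  have \<psi>E: "\<psi> (E x) = sh (snd x) (\<psi> (bas (fst x)))" if x: "x \<in> ?S" for x
  proof -
    have sn: "\<And>s. 0 \<le> snd x s" using S[OF x] by blast
    then obtain a where a: "snd x = expo a" using expo_exists by blast
    have "E x = act (Poly_Mapping.single a 1) (bas (fst x))" unfolding E_def act_single a by simp
    moreover have "(bas (fst x) :: ('n, 'k) vec) \<in> FF m" using S[OF x] by (intro bas_FF) blast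
    ultimately have "\<psi> (E x) = act (Poly_Mapping.single a 1) (\<psi> (bas (fst x)))" by (simp only: act)
    thus ?thesis unfolding act_single a by simp
  qed
  have "\<psi> (\<Sum>x\<in>J. v x *\<^sub>f E x) = (\<Sum>x\<in>J. v x *\<^sub>f \<psi> (E x))" if "finite J" "J \<subseteq> ?S" for J
    using that
  proof (induction J rule: finite_induct)
    case (insert x J)
    have 1: "v x *\<^sub>f E x \<in> FF m" using insert EF by (intro fun_vs.subspace_scale FF_subspace) auto
    have 2: "(\<Sum>x\<in>J. v x *\<^sub>f E x) \<in> FF m"
      using insert EF by (intro fun_vs.subspace_sum fun_vs.subspace_scale FF_subspace) auto
    have 3: "E x \<in> FF m" using insert EF by auto
    have IH: "\<psi> (\<Sum>x\<in>J. v x *\<^sub>f E x) = (\<Sum>x\<in>J. v x *\<^sub>f \<psi> (E x))" using insert by blast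
    show ?case unfolding sum.insert[OF insert(1,2)] add[OF 1 2] scale[OF 3] IH ..
  next
    case empty
    show ?case unfolding sum.empty by (rule \<psi>0)
  qed
  from this[OF fin order_refl] have "\<psi> v = (\<Sum>x\<in>?S. v x *\<^sub>f \<psi> (E x))" using expand by metis
  also have "\<dots> = (\<Sum>x\<in>?S. v x *\<^sub>f sh (snd x) (\<psi> (bas (fst x))))"
    by (rule sum.cong[OF refl]) (simp only: \<psi>E)
  also have "\<dots> = mat m (\<lambda>a. \<psi> (bas a)) v"
    by (rule mat_expand[symmetric]) (use v F in \<open>auto simp: FF_def\<close>)
  finally show ?thesis .
qed

section \<open>Presentations of graded modules\<close>

text \<open>The sum over \<open>T\<close> and the single element \<open>x\<close> are two
  homogeneous decompositions of \<open>x\<close>; extended by zero they must coincide by the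
  uniqueness in \<open>graded_module\<close>.\<close>

lemma graded_module_sum:
  assumes N: "graded_module N" and T: "finite T" and f: "\<And>s. s \<in> T \<Longrightarrow> f s \<in> homog N s"
    and x: "x \<in> homog N t" "(\<Oplus>\<^bsub>N\<^esub>s\<in>T. f s) = x" and s: "s \<in> T"
  shows "f s = (if s = t then x else \<zero>\<^bsub>N\<^esub>)"
    and "t \<notin> T \<Longrightarrow> x = \<zero>\<^bsub>N\<^esub>"
proof -
  interpret Module.module mpoly_ring N using N by (simp add: graded_module_def)
  have sub: "subgroup (homog N s) (add_monoid N)" for s using N by (simp add: graded_module_def)
  have car: "homog N s \<subseteq> carrier N" for s using subgroup.subset[OF sub[of s]] by simp
  have z: "\<zero>\<^bsub>N\<^esub> \<in> homog N s" for s using subgroup.one_closed[OF sub[of s]] by simp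
  define F1 where "F1 = (\<lambda>s. if s \<in> T then f s else \<zero>\<^bsub>N\<^esub>)"
  define F2 where "F2 = (\<lambda>s. if s = t then x else \<zero>\<^bsub>N\<^esub>)"
  let ?P = "\<lambda>F. (\<forall>s. F s \<in> homog N s) \<and> finite {s. F s \<noteq> \<zero>\<^bsub>N\<^esub>} \<and> x = (\<Oplus>\<^bsub>N\<^esub>s\<in>{s. F s \<noteq> \<zero>\<^bsub>N\<^esub>}. F s)"
  have "finite {s. F1 s \<noteq> \<zero>\<^bsub>N\<^esub>}" by (rule finite_subset[OF _ T]) (auto simp: F1_def)
  moreover have "(\<Oplus>\<^bsub>N\<^esub>s\<in>{s. F1 s \<noteq> \<zero>\<^bsub>N\<^esub>}. F1 s) = (\<Oplus>\<^bsub>N\<^esub>s\<in>T. f s)"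
    by (rule M.add.finprod_mono_neutral_cong_left[OF T])
      (use f car in \<open>auto simp: F1_def split: if_splits\<close>)
  ultimately have P1: "?P F1" using f z x(2) by (auto simp: F1_def)
  have "(\<Oplus>\<^bsub>N\<^esub>s\<in>{s. F2 s \<noteq> \<zero>\<^bsub>N\<^esub>}. F2 s) = (\<Oplus>\<^bsub>N\<^esub>s\<in>{t}. F2 s)"
    by (rule M.add.finprod_mono_neutral_cong_left)
      (use x car in \<open>auto simp: F2_def split: if_splits\<close>)
  also have "\<dots> = F2 t \<oplus>\<^bsub>N\<^esub> (\<Oplus>\<^bsub>N\<^esub>s\<in>{}. F2 s)"
    by (rule M.finsum_insert) (use x car in \<open>auto simp: F2_def\<close>)
  also have "\<dots> = x" using x car[of t] by (simp add: F2_def subset_iff)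
  finally have "x = (\<Oplus>\<^bsub>N\<^esub>s\<in>{s. F2 s \<noteq> \<zero>\<^bsub>N\<^esub>}. F2 s)" ..
  moreover have "finite {s. F2 s \<noteq> \<zero>\<^bsub>N\<^esub>}" by (rule finite_subset[of _ "{t}"]) (auto simp: F2_def)
  ultimately have P2: "?P F2" using x z by (auto simp: F2_def)
  have "x \<in> carrier N" using x car by blast
  hence "\<exists>!F. ?P F" using N by (simp add: graded_module_def)
  hence eq: "F1 = F2" using P1 P2 by blast
  show "f s = (if s = t then x else \<zero>\<^bsub>N\<^esub>)" using fun_cong[OF eq, of s] s by (simp add: F1_def F2_def)
  show "t \<notin> T \<Longrightarrow> x = \<zero>\<^bsub>N\<^esub>" using fun_cong[OF eq, of t] by (simp add: F1_def F2_def)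
qed

lemma presents_of_hom:
  fixes N :: "(('n::{finite,linorder}, 'k::field) mpoly, 'm) gmodule"
  assumes N: "graded_module N" and \<epsilon>: "\<epsilon> \<in> mod_hom_deg (free_gmodule es) N 0"
    and onto: "\<epsilon> ` carrier (free_gmodule es) = carrier N"
  defines "m \<equiv> length es"
  shows "presents m (\<lambda>v. \<epsilon> (unemb m v)) N (\<lambda>b. es ! b) {v \<in> FF m. \<epsilon> (unemb m v) = \<zero>\<^bsub>N\<^esub>}"
proof -
  interpret NM: Module.module mpoly_ring N using N by (simp add: graded_module_def)
  let ?F = "free_gmodule es :: (('n, 'k) mpoly, _) gmodule"
  have hom: "\<And>x. x \<in> carrier ?F \<Longrightarrow> \<epsilon> x \<in> carrier N"
    "\<And>x y. x \<in> carrier ?F \<Longrightarrow> y \<in> carrier ?F \<Longrightarrow> \<epsilon> (x \<oplus>\<^bsub>?F\<^esub> y) = \<epsilon> x \<oplus>\<^bsub>N\<^esub> \<epsilon> y"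
    "\<And>r x. x \<in> carrier ?F \<Longrightarrow> \<epsilon> (r \<odot>\<^bsub>?F\<^esub> x) = r \<odot>\<^bsub>N\<^esub> \<epsilon> x"
    using \<epsilon> by (auto simp: mod_hom_deg_def mod_hom_def)
  have homdeg: "\<epsilon> ` homog ?F t \<subseteq> homog N t" for t using \<epsilon> by (auto simp: mod_hom_deg_def)
  have sub: "subgroup (homog N s) (add_monoid N)" for s using N by (simp add: graded_module_def)
  have hcar: "homog N s \<subseteq> carrier N" for s using subgroup.subset[OF sub[of s]] by simp
  let ?\<epsilon> = "\<lambda>v. \<epsilon> (unemb m v)"
  have add: "?\<epsilon> (u + v) = ?\<epsilon> u \<oplus>\<^bsub>N\<^esub> ?\<epsilon> v" if "u \<in> FF m" "v \<in> FF m" for u v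
    unfolding m_def unemb_ops(1)[OF that[unfolded m_def]] by (rule hom(2)[OF unemb_closed unemb_closed])
  have act: "?\<epsilon> (act p u) = p \<odot>\<^bsub>N\<^esub> ?\<epsilon> u" if "u \<in> FF m" for p u
    unfolding m_def unemb_ops(2)[OF that[unfolded m_def] that[unfolded m_def]] by (rule hom(3)[OF unemb_closed])
  have cl: "?\<epsilon> u \<in> carrier N" for u unfolding m_def by (rule hom(1)[OF unemb_closed])
  have z: "?\<epsilon> 0 = \<zero>\<^bsub>N\<^esub>"
  proof -
    have zF: "(0 :: ('n, 'k) vec) \<in> FF m" by (rule fun_vs.subspace_0[OF FF_subspace])
    have "?\<epsilon> 0 \<oplus>\<^bsub>N\<^esub> ?\<epsilon> 0 = ?\<epsilon> 0" using add[OF zF zF, symmetric] by (simp only: add_0_left)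
    thus ?thesis using cl[of 0] by (simp add: NM.M.add.l_cancel_one')
  qed
  interpret R: rep "FF m" act ?\<epsilon> N
  proof
    show "carrier N = ?\<epsilon> ` FF m" using onto unemb_image[of es, where 'n = 'n and 'k = 'k] by (simp add: m_def image_image[symmetric])
  qed (use add act z gsubm_act[OF gsubm_FF] in \<open>auto intro: fun_vs.subspace_0[OF FF_subspace] fun_vs.subspace_add[OF FF_subspace] fun_vs.subspace_neg[OF FF_subspace]\<close>)
  let ?es = "\<lambda>b. es ! b"
  have hV: "?\<epsilon> v \<in> homog N t" if "v \<in> FF m" "v \<in> Vt ?es t" for v t
    using homdeg[of t] unemb_image_homog[of es t, where 'n = 'n and 'k = 'k] that by (auto simp: m_def)
  \<comment> \<open>The map preserves degrees, so a preimage of a homogeneous element can be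
    replaced by its component. For \<open>x = 0\<close>, which is homogeneous of every degree, this
    says that the kernel is graded.\<close>
  have comps: "?\<epsilon> (hcomp ?es t v) = x" if v: "v \<in> FF m" and x: "?\<epsilon> v = x" "x \<in> homog N t" for v x t
  proof -
    obtain T where T: "finite T" "v = (\<Sum>s\<in>T. hcomp ?es s v)" "\<forall>s. s \<notin> T \<longrightarrow> hcomp ?es s v = 0"
      using hcomp_decompose[of v ?es] v by (auto simp: FF_def)
    have "(\<Oplus>\<^bsub>N\<^esub>s\<in>T. ?\<epsilon> (hcomp ?es s v)) = ?\<epsilon> (\<Sum>s\<in>T. hcomp ?es s v)"
      by (rule R.g_finsum[OF T(1)]) (rule hcomp_FF[OF v])
    also have "\<dots> = ?\<epsilon> v" by (rule arg_cong[OF T(2)[symmetric]])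
    finally have sum: "(\<Oplus>\<^bsub>N\<^esub>s\<in>T. ?\<epsilon> (hcomp ?es s v)) = x" using x by simp
    have h: "?\<epsilon> (hcomp ?es s v) \<in> homog N s" for s by (rule hV[OF hcomp_FF[OF v] hcomp_Vt])
    show ?thesis
    proof (cases "t \<in> T")
      case True
      show ?thesis using graded_module_sum(1)[OF N T(1) h x(2) sum True] by simp
    next
      case False
      have "?\<epsilon> (hcomp ?es t v) = \<zero>\<^bsub>N\<^esub>" using T(3) False z by simp
      moreover have "x = \<zero>\<^bsub>N\<^esub>"
      proof (cases "T = {}")
        case True
        thus ?thesis using sum by simp
      next
        case ne: False
        then obtain s where "s \<in> T" by blast
        from graded_module_sum(2)[OF N T(1) h x(2) sum this False] show ?thesis .
      qed
      ultimately show ?thesis by simp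
    qed
  qed
  show ?thesis
  proof
    show "homog N t = ?\<epsilon> ` (FF m \<inter> Vt ?es t)" for t
    proof (intro equalityI subsetI)
      fix x assume x: "x \<in> homog N t"
      then obtain v where v: "v \<in> FF m" "x = ?\<epsilon> v" using hcar[of t] R.car by auto
      have "x = ?\<epsilon> (hcomp ?es t v)" using comps[OF v(1) _ x] v(2) by simp
      thus "x \<in> ?\<epsilon> ` (FF m \<inter> Vt ?es t)" using hcomp_FF[OF v(1)] hcomp_Vt by blast
    qed (use hV in auto)
    show "gsubm ?es {v \<in> FF m. ?\<epsilon> v = \<zero>\<^bsub>N\<^esub>}"
      unfolding gsubm_def fun_vs.subspace_def
    proof (intro conjI allI ballI)
      show "0 \<in> {v \<in> FF m. ?\<epsilon> v = \<zero>\<^bsub>N\<^esub>}" using z R.A0 by simp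
      show "u + v \<in> {v \<in> FF m. ?\<epsilon> v = \<zero>\<^bsub>N\<^esub>}" if "u \<in> {v \<in> FF m. ?\<epsilon> v = \<zero>\<^bsub>N\<^esub>}" "v \<in> {v \<in> FF m. ?\<epsilon> v = \<zero>\<^bsub>N\<^esub>}" for u v
        using that add R.A_add by simp
      have actK: "act p v \<in> {v \<in> FF m. ?\<epsilon> v = \<zero>\<^bsub>N\<^esub>}" if "v \<in> {v \<in> FF m. ?\<epsilon> v = \<zero>\<^bsub>N\<^esub>}" for p v
        using that act[of v p] R.A_act NM.smult_r_null[of p] by (simp add: ring_of_type_algebra_def)
      show "c *\<^sub>f v \<in> {v \<in> FF m. ?\<epsilon> v = \<zero>\<^bsub>N\<^esub>}" if "v \<in> {v \<in> FF m. ?\<epsilon> v = \<zero>\<^bsub>N\<^esub>}" for c v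
        using actK[OF that, of "pconst c"] by (simp only: act_pconst)
      show "sh (expo a) v \<in> {v \<in> FF m. ?\<epsilon> v = \<zero>\<^bsub>N\<^esub>}" if "v \<in> {v \<in> FF m. ?\<epsilon> v = \<zero>\<^bsub>N\<^esub>}" for a v
        using actK[OF that, of "Poly_Mapping.single a 1"] by (simp only: act_single fun_vs.scale_one)
      show "hcomp ?es t v \<in> {v \<in> FF m. ?\<epsilon> v = \<zero>\<^bsub>N\<^esub>}" if "v \<in> {v \<in> FF m. ?\<epsilon> v = \<zero>\<^bsub>N\<^esub>}" for t v
        using that comps[of v "\<zero>\<^bsub>N\<^esub>" t] subgroup.one_closed[OF sub[of t]] hcomp_FF[of v m ?es t] by simp
    qed
  qed simp
qed

section \<open>Graded free resolutions\<close>

lemma (in abelian_group) finsum_in_closed_set: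
  assumes "finite J" "\<And>i. i \<in> J \<Longrightarrow> f i \<in> H" "H \<subseteq> carrier G" "\<zero> \<in> H" "\<And>x y. x \<in> H \<Longrightarrow> y \<in> H \<Longrightarrow> x \<oplus> y \<in> H"
  shows "finsum G f J \<in> H"
  using assms(1,2)
proof (induction J rule: finite_induct)
  case (insert x J)
  have "finsum G f (insert x J) = f x \<oplus> finsum G f J"
    by (rule finsum_insert) (use insert assms in auto)
  thus ?case using insert assms by simp
qed (simp add: assms)

text \<open>The homogeneous components of finitely many generators are finitely many homogeneous
  generators; they serve as images of a basis with the matching degrees.\<close>

lemma graded_generators:
  fixes M :: "(('n::finite, 'k::field) mpoly, 'm) gmodule"
  assumes M: "graded_module M" and fg: "finitely_generated M"
  shows "\<exists>es \<epsilon>. \<epsilon> \<in> mod_hom_deg (free_gmodule es) M 0 \<and> \<epsilon> ` carrier (free_gmodule es) = carrier M"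
proof -
  interpret MM: Module.module mpoly_ring M using M by (simp add: graded_module_def)
  have RU: "carrier (mpoly_ring :: ('n, 'k) mpoly ring) = UNIV" by (simp add: ring_of_type_algebra_def)
  have Radd: "p \<oplus>\<^bsub>mpoly_ring\<^esub> q = p + q" for p q :: "('n, 'k) mpoly" by (simp add: ring_of_type_algebra_def)
  have Rmult: "p \<otimes>\<^bsub>mpoly_ring\<^esub> q = p * q" for p q :: "('n, 'k) mpoly" by (simp add: ring_of_type_algebra_def)
  have Rone: "\<one>\<^bsub>mpoly_ring\<^esub> = (1 :: ('n, 'k) mpoly)" by (simp add: ring_of_type_algebra_def)
  have Rzero: "\<zero>\<^bsub>mpoly_ring\<^esub> = (0 :: ('n, 'k) mpoly)" by (simp add: ring_of_type_algebra_def)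
  have sub: "subgroup (homog M s) (add_monoid M)" for s using M by (simp add: graded_module_def)
  have hcar: "homog M s \<subseteq> carrier M" for s using subgroup.subset[OF sub[of s]] by simp
  have hz: "\<zero>\<^bsub>M\<^esub> \<in> homog M s" for s using subgroup.one_closed[OF sub[of s]] by simp
  have hadd: "x \<oplus>\<^bsub>M\<^esub> y \<in> homog M s" if "x \<in> homog M s" "y \<in> homog M s" for x y s
    using subgroup.m_closed[OF sub[of s]] that by simp
  have hsm: "p \<odot>\<^bsub>M\<^esub> x \<in> homog M (s + t)" if "p \<in> poly_homog s" "x \<in> homog M t" for p x s t
    using M that by (simp add: graded_module_def)
  obtain S where S: "finite S" "S \<subseteq> carrier M" "\<And>H. submodule H mpoly_ring M \<Longrightarrow> S \<subseteq> H \<Longrightarrow> H = carrier M"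
    using fg unfolding finitely_generated_def by blast
  have "\<exists>f. x \<in> S \<longrightarrow> (\<forall>t. f t \<in> homog M t) \<and> finite {t. f t \<noteq> \<zero>\<^bsub>M\<^esub>} \<and> x = (\<Oplus>\<^bsub>M\<^esub>t\<in>{t. f t \<noteq> \<zero>\<^bsub>M\<^esub>}. f t)" for x
  proof (cases "x \<in> S")
    case True
    hence "\<exists>!f. (\<forall>t. f t \<in> homog M t) \<and> finite {t. f t \<noteq> \<zero>\<^bsub>M\<^esub>} \<and> x = (\<Oplus>\<^bsub>M\<^esub>t\<in>{t. f t \<noteq> \<zero>\<^bsub>M\<^esub>}. f t)"
      using M S(2) unfolding graded_module_def by blast
    thus ?thesis by blast
  qed auto
  then obtain f where f: "\<And>x t. x \<in> S \<Longrightarrow> f x t \<in> homog M t" "\<And>x. x \<in> S \<Longrightarrow> finite {t. f x t \<noteq> \<zero>\<^bsub>M\<^esub>}"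
    "\<And>x. x \<in> S \<Longrightarrow> x = (\<Oplus>\<^bsub>M\<^esub>t\<in>{t. f x t \<noteq> \<zero>\<^bsub>M\<^esub>}. f x t)" by metis
  \<comment> \<open>The nonzero components are paired with their degrees, from which the degrees of
    the basis are read off.\<close>
  define P where "P = (\<Union>x\<in>S. (\<lambda>t. (t, f x t)) ` {t. f x t \<noteq> \<zero>\<^bsub>M\<^esub>})"
  have "finite P" unfolding P_def using S(1) f(2) by blast
  then obtain xs where xs: "set xs = P" using finite_list by blast
  define es where "es = map fst xs"
  define y where "y = (\<lambda>a. snd (xs ! a))"
  let ?m = "length es"
  let ?F = "free_gmodule es :: (('n, 'k) mpoly, _) gmodule"
  have yh: "y a \<in> homog M (es ! a)" if "a < ?m" for a
  proof -
    have "xs ! a \<in> P" using that xs by (auto simp: es_def)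
    thus ?thesis using f(1) that by (auto simp: P_def y_def es_def)
  qed
  have yc: "y a \<in> carrier M" if "a < ?m" for a using yh[OF that] hcar by blast
  define \<epsilon> where "\<epsilon> = (\<lambda>h. \<Oplus>\<^bsub>M\<^esub>a\<in>{..<?m}. h a \<odot>\<^bsub>M\<^esub> y a)"
  have tc: "p \<odot>\<^bsub>M\<^esub> y a \<in> carrier M" if "a < ?m" for a p using MM.smult_closed yc[OF that] RU by simp
  have \<epsilon>c: "\<epsilon> h \<in> carrier M" for h unfolding \<epsilon>_def by (rule MM.M.finsum_closed) (use tc in auto)
  have \<epsilon>add: "\<epsilon> (h \<oplus>\<^bsub>?F\<^esub> h') = \<epsilon> h \<oplus>\<^bsub>M\<^esub> \<epsilon> h'" for h h'
  proof -
    have "\<epsilon> (h \<oplus>\<^bsub>?F\<^esub> h') = (\<Oplus>\<^bsub>M\<^esub>a\<in>{..<?m}. h a \<odot>\<^bsub>M\<^esub> y a \<oplus>\<^bsub>M\<^esub> h' a \<odot>\<^bsub>M\<^esub> y a)"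
      unfolding \<epsilon>_def
    proof (rule MM.M.finsum_cong')
      fix a assume "a \<in> {..<?m}"
      thus "(h \<oplus>\<^bsub>?F\<^esub> h') a \<odot>\<^bsub>M\<^esub> y a = h a \<odot>\<^bsub>M\<^esub> y a \<oplus>\<^bsub>M\<^esub> h' a \<odot>\<^bsub>M\<^esub> y a"
        using MM.smult_l_distr[of "h a" "h' a" "y a"] yc[of a] by (simp add: free_ops RU Radd)
    qed (use tc in auto)
    also have "\<dots> = \<epsilon> h \<oplus>\<^bsub>M\<^esub> \<epsilon> h'" unfolding \<epsilon>_def by (rule MM.M.finsum_addf) (use tc in auto)
    finally show ?thesis .
  qed
  have \<epsilon>sm: "\<epsilon> (r \<odot>\<^bsub>?F\<^esub> h) = r \<odot>\<^bsub>M\<^esub> \<epsilon> h" for r h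
  proof -
    have "\<epsilon> (r \<odot>\<^bsub>?F\<^esub> h) = (\<Oplus>\<^bsub>M\<^esub>a\<in>{..<?m}. r \<odot>\<^bsub>M\<^esub> (h a \<odot>\<^bsub>M\<^esub> y a))"
      unfolding \<epsilon>_def
    proof (rule MM.M.finsum_cong')
      fix a assume "a \<in> {..<?m}"
      thus "(r \<odot>\<^bsub>?F\<^esub> h) a \<odot>\<^bsub>M\<^esub> y a = r \<odot>\<^bsub>M\<^esub> (h a \<odot>\<^bsub>M\<^esub> y a)"
        using MM.smult_assoc1[of r "h a" "y a"] yc[of a] by (simp add: free_ops RU Rmult)
    qed (use tc MM.smult_closed RU in auto)
    also have "\<dots> = r \<odot>\<^bsub>M\<^esub> \<epsilon> h"
      unfolding \<epsilon>_def by (rule MM.finsum_smult_ldistr[symmetric]) (use tc RU in auto)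
    finally show ?thesis .
  qed
  have deg: "\<epsilon> h \<in> homog M t" if h: "h \<in> homog ?F t" for h t
    unfolding \<epsilon>_def
  proof (rule MM.M.finsum_in_closed_set)
    fix a assume a: "a \<in> {..<?m}"
    hence "h a \<in> poly_homog (t - es ! a)" using h by (simp add: free_homog)
    from hsm[OF this yh[of a]] a show "h a \<odot>\<^bsub>M\<^esub> y a \<in> homog M t" by simp
  qed (use hcar hz hadd in auto)
  have hom: "\<epsilon> \<in> mod_hom_deg ?F M 0"
    unfolding mod_hom_deg_def mod_hom_def using \<epsilon>c \<epsilon>add \<epsilon>sm deg by auto
  have Fc: "h \<oplus>\<^bsub>?F\<^esub> h' \<in> carrier ?F" "r \<odot>\<^bsub>?F\<^esub> h \<in> carrier ?F" "\<zero>\<^bsub>?F\<^esub> \<in> carrier ?F" for h h' r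
    by (auto simp: free_carrier free_ops)
  have zim: "\<zero>\<^bsub>M\<^esub> \<in> \<epsilon> ` carrier ?F"
  proof -
    have "\<epsilon> (0 \<odot>\<^bsub>?F\<^esub> \<zero>\<^bsub>?F\<^esub>) = \<zero>\<^bsub>M\<^esub>" unfolding \<epsilon>sm using MM.smult_l_null[OF \<epsilon>c] Rzero by simp
    thus ?thesis using Fc(2) by (metis image_eqI)
  qed
  have addim: "x \<oplus>\<^bsub>M\<^esub> z \<in> \<epsilon> ` carrier ?F" if "x \<in> \<epsilon> ` carrier ?F" "z \<in> \<epsilon> ` carrier ?F" for x z
    using that Fc(1) \<epsilon>add by (auto simp flip: \<epsilon>add)
  have smim: "r \<odot>\<^bsub>M\<^esub> x \<in> \<epsilon> ` carrier ?F" if "x \<in> \<epsilon> ` carrier ?F" for x r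
    using that Fc(2) by (auto simp flip: \<epsilon>sm)
  have imc: "\<epsilon> ` carrier ?F \<subseteq> carrier M" using \<epsilon>c by auto
  have neg: "\<ominus>\<^bsub>M\<^esub> x = (- 1) \<odot>\<^bsub>M\<^esub> x" if "x \<in> carrier M" for x
  proof -
    have "(- 1) \<odot>\<^bsub>M\<^esub> x \<oplus>\<^bsub>M\<^esub> x = \<zero>\<^bsub>M\<^esub>"
      using MM.smult_l_distr[of "- 1" 1 x] that MM.smult_one[OF that] MM.smult_l_null[OF that]
      by (simp add: RU Radd Rone Rzero)
    thus ?thesis using MM.M.minus_equality[of "(- 1) \<odot>\<^bsub>M\<^esub> x" x] that MM.smult_closed RU by simp
  qed
  have "submodule (\<epsilon> ` carrier ?F) mpoly_ring M"
    by (rule MM.submoduleI) (use imc zim addim smim neg in auto)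
  moreover have "S \<subseteq> \<epsilon> ` carrier ?F"
  proof
    fix x assume x: "x \<in> S"
    have "(\<Oplus>\<^bsub>M\<^esub>t\<in>{t. f x t \<noteq> \<zero>\<^bsub>M\<^esub>}. f x t) \<in> \<epsilon> ` carrier ?F"
    proof (rule MM.M.finsum_in_closed_set[OF f(2)[OF x] _ imc zim addim])
      fix t assume t: "t \<in> {t. f x t \<noteq> \<zero>\<^bsub>M\<^esub>}"
      hence "(t, f x t) \<in> set xs" using x xs by (auto simp: P_def)
      then obtain a where a: "a < ?m" "xs ! a = (t, f x t)" by (auto simp: in_set_conv_nth es_def)
      define h where "h = (\<lambda>b\<in>{..<?m}. if b = a then 1 else 0 :: ('n, 'k) mpoly)"
      have hc: "h \<in> carrier ?F" by (simp add: h_def free_carrier)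
      have null: "0 \<odot>\<^bsub>M\<^esub> y b = \<zero>\<^bsub>M\<^esub>" if "b < ?m" for b using MM.smult_l_null[OF yc[OF that]] Rzero by simp
      have "\<epsilon> h = (\<Oplus>\<^bsub>M\<^esub>b\<in>{a}. y b)"
        unfolding \<epsilon>_def
        by (rule MM.M.add.finprod_mono_neutral_cong_right)
          (use a tc null MM.smult_one[OF yc] Rone in \<open>auto simp: h_def\<close>)
      also have "\<dots> = y a \<oplus>\<^bsub>M\<^esub> (\<Oplus>\<^bsub>M\<^esub>b\<in>{}. y b)" by (rule MM.M.finsum_insert) (use yc a in auto)
      also have "\<dots> = f x t" using a yc[OF a(1)] MM.M.r_zero[of "y a"] by (simp add: y_def)
      finally show "f x t \<in> \<epsilon> ` carrier ?F" using hc by (metis image_eqI)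
    qed
    thus "x \<in> \<epsilon> ` carrier ?F" using f(3)[OF x] by simp
  qed
  ultimately have "\<epsilon> ` carrier ?F = carrier M" by (rule S(3))
  thus ?thesis using hom by blast
qed

lemma unemb_inj:
  fixes u v :: "('n::finite, 'k::field) vec"
  assumes "u \<in> FF m" "v \<in> FF m" "unemb m u = unemb m v"
  shows "u = v"
proof -
  have "emb m (unemb m u) = emb m (unemb m v)" by (rule arg_cong[OF assms(3)])
  thus ?thesis unfolding emb_unemb[OF assms(1)] emb_unemb[OF assms(2)] .
qed

lemma emb_image: "emb (length es) ` carrier (free_gmodule es :: (('n::finite, 'k::field) mpoly, _) gmodule) = FF (length es)"
proof (intro equalityI subsetI)
  fix v :: "('n, 'k) vec" assume "v \<in> FF (length es)"
  hence "v = emb (length es) (unemb (length es) v)" by (simp add: emb_unemb)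
  thus "v \<in> emb (length es) ` carrier (free_gmodule es)" using unemb_closed by blast
qed (use emb_FF in auto)

lemma mat_hom:
  fixes g :: "nat \<Rightarrow> ('n::finite, 'k::field) vec"
  assumes gF: "\<And>a. a < length es' \<Longrightarrow> g a \<in> FF (length es)"
    and gV: "\<And>a. a < length es' \<Longrightarrow> g a \<in> Vt (\<lambda>b. es ! b) (es' ! a)"
  shows "(\<lambda>f. unemb (length es) (mat (length es') g (emb (length es') f))) \<in> mod_hom_deg (free_gmodule es') (free_gmodule es) 0"
proof -
  have F: "mat (length es') g (emb (length es') f) \<in> FF (length es)" for f
    by (rule mat_in[OF gsubm_FF order_refl gF emb_FF])
  have "unemb (length es) (mat (length es') g (emb (length es') f)) \<in> homog (free_gmodule es) t"
    if f: "f \<in> homog (free_gmodule es') t" for f t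
  proof -
    have "emb (length es') f \<in> Vt (\<lambda>b. es' ! b) t" using f by (simp add: free_homog emb_Vt_iff)
    hence "mat (length es') g (emb (length es') f) \<in> Vt (\<lambda>b. es ! b) t" by (intro mat_Vt[OF gV])
    thus ?thesis using F unemb_image_homog[of es t, where 'n = 'n and 'k = 'k] by blast
  qed
  moreover have "emb (length es') (x \<oplus>\<^bsub>free_gmodule es'\<^esub> y) = emb (length es') x + emb (length es') y" for x y :: "nat \<Rightarrow> ('n, 'k) mpoly"
    unfolding free_ops by (rule emb_add)
  moreover have "emb (length es') (r \<odot>\<^bsub>free_gmodule es'\<^esub> x) = act r (emb (length es') x)" for r and x :: "nat \<Rightarrow> ('n, 'k) mpoly"
    unfolding free_ops by (rule emb_act)
  ultimately show ?thesis
    unfolding mod_hom_deg_def mod_hom_def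
    using unemb_ops(1)[OF F F] unemb_ops(2)[OF F F] unemb_closed[of es]
    by (auto simp: mat_add mat_act)
qed

text \<open>The kernel of each map is a graded submodule of a free module, so
  \<open>noetherian_generators\<close> covers it by the next free module; the choices are iterated
  by recursion.\<close>

theorem graded_free_resolution_exists:
  fixes M :: "(('n::{finite,linorder}, 'k::field) mpoly, 'm) gmodule"
  assumes M: "graded_module M" "finitely_generated M"
  shows "\<exists>es \<phi> \<epsilon>. graded_free_resolution M es \<phi> \<epsilon>"
proof -
  obtain es0 and \<epsilon> :: "(nat \<Rightarrow> ('n, 'k) mpoly) \<Rightarrow> 'm"
    where \<epsilon>: "\<epsilon> \<in> mod_hom_deg (free_gmodule es0) M 0" "\<epsilon> ` carrier (free_gmodule es0) = carrier M"
    using graded_generators[OF M] by blast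
  define K0 where "K0 = {v \<in> FF (length es0). \<epsilon> (unemb (length es0) v) = \<zero>\<^bsub>M\<^esub>}"
  interpret P: presents "length es0" "\<lambda>v. \<epsilon> (unemb (length es0) v)" M "\<lambda>b. es0 ! b" K0
    unfolding K0_def by (rule presents_of_hom[OF M(1) \<epsilon>])
  \<comment> \<open>A state consists of basis degrees, a submodule to be covered next and the matrix
    into the preceding free module. \<open>Q\<close> states that the next state covers this
    submodule and records the new syzygies.\<close>
  define Inv where "Inv = (\<lambda>(es :: int list, K :: ('n, 'k) vec set, g :: nat \<Rightarrow> ('n, 'k) vec). gsubm (\<lambda>b. es ! b) K \<and> K \<subseteq> FF (length es))"
  define Q where "Q = (\<lambda>(es :: int list, K :: ('n, 'k) vec set, g :: nat \<Rightarrow> ('n, 'k) vec) (es' :: int list, K' :: ('n, 'k) vec set, g' :: nat \<Rightarrow> ('n, 'k) vec).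
      (\<forall>a<length es'. g' a \<in> K \<and> g' a \<in> Vt (\<lambda>b. es ! b) (es' ! a)) \<and>
      mat (length es') g' ` FF (length es') = K \<and> K' = {v \<in> FF (length es'). mat (length es') g' v = 0})"
  have step: "\<exists>y. Inv y \<and> Q x y" if x: "Inv x" for x
  proof -
    obtain es K g where xe: "x = (es, K, g)" by (cases x)
    have K: "gsubm (\<lambda>b. es ! b) K" "K \<subseteq> FF (length es)" using x by (auto simp: Inv_def xe)
    have "\<exists>m' e' h. (\<forall>a<m'. h a \<in> K \<and> h a \<in> Vt (\<lambda>b. es ! b) (e' a)) \<and> mat m' h ` FF m' = K"
      by (rule noetherian_generators[OF K]) blast
    then obtain m' e' and h :: "nat \<Rightarrow> ('n, 'k) vec" where h: "\<forall>a<m'. h a \<in> K \<and> h a \<in> Vt (\<lambda>b. es ! b) (e' a)" "mat m' h ` FF m' = K"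
      by blast
    define es' where "es' = map e' [0..<m']"
    have l: "length es' = m'" "\<And>a. a < m' \<Longrightarrow> es' ! a = e' a" by (simp_all add: es'_def)
    let ?K = "{v \<in> FF m'. mat m' h v = 0}"
    have "gsubm (\<lambda>b. es' ! b) ?K"
      by (rule gsubm_kernel[of m' h "\<lambda>b. es ! b"]) (use h l in auto)
    hence "Inv (es', ?K, h)" by (auto simp: Inv_def l)
    moreover have "Q x (es', ?K, h)" using h by (simp add: Q_def xe l)
    ultimately show ?thesis by blast
  qed
  have inv0: "Inv (es0, K0, undefined)" using P.gK P.KF by (simp add: Inv_def)
  obtain st where st: "st 0 = (es0, K0, undefined)" "\<And>p. Inv (st p)" "\<And>p. Q (st p) (st (Suc p))"
  proof -
    define st where "st = rec_nat (es0, K0, undefined) (\<lambda>_ x. SOME y. Inv y \<and> Q x y)"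
    have s0: "st 0 = (es0, K0, undefined)" by (simp add: st_def)
    have sS: "st (Suc p) = (SOME y. Inv y \<and> Q (st p) y)" for p by (simp add: st_def)
    have I: "Inv (st p)" for p
    proof (induction p)
      case (Suc p)
      show ?case unfolding sS using someI_ex[OF step[OF Suc]] by blast
    qed (simp add: s0 inv0)
    have "Q (st p) (st (Suc p))" for p unfolding sS using someI_ex[OF step[OF I]] by blast
    thus ?thesis using that s0 I by blast
  qed
  define es where "es = (\<lambda>p. fst (st p))"
  define KK where "KK = (\<lambda>p. fst (snd (st p)))"
  define g where "g = (\<lambda>p. snd (snd (st (Suc p))))"
  have KF: "KK p \<subseteq> FF (length (es p))" for p using st(2)[of p] by (auto simp: Inv_def es_def KK_def split: prod.splits)
  have gK: "g p a \<in> KK p" "g p a \<in> Vt (\<lambda>b. es p ! b) (es (Suc p) ! a)" if "a < length (es (Suc p))" for p a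
    using st(3)[of p] that by (auto simp: Q_def es_def KK_def g_def split: prod.splits)
  have im: "mat (length (es (Suc p))) (g p) ` FF (length (es (Suc p))) = KK p" for p
    using st(3)[of p] by (auto simp: Q_def es_def KK_def g_def split: prod.splits)
  have ker: "KK (Suc p) = {v \<in> FF (length (es (Suc p))). mat (length (es (Suc p))) (g p) v = 0}" for p
    using st(3)[of p] by (auto simp: Q_def es_def KK_def g_def split: prod.splits)
  have es0: "es 0 = es0" "KK 0 = K0" by (simp_all add: es_def KK_def st(1))
  have gF: "g p a \<in> FF (length (es p))" if "a < length (es (Suc p))" for p a using gK(1)[OF that] KF by blast
  define \<phi> where "\<phi> = (\<lambda>p f. unemb (length (es p)) (mat (length (es (Suc p))) (g p) (emb (length (es (Suc p))) f)))"
  let ?F = "\<lambda>p. free_gmodule (es p) :: (('n, 'k) mpoly, _) gmodule"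
  have \<phi>im: "\<phi> p ` carrier (?F (Suc p)) = unemb (length (es p)) ` KK p" for p
  proof -
    have "\<phi> p ` carrier (?F (Suc p)) = unemb (length (es p)) ` mat (length (es (Suc p))) (g p) ` emb (length (es (Suc p))) ` carrier (?F (Suc p))"
      unfolding \<phi>_def image_image ..
    thus ?thesis unfolding emb_image im .
  qed
  have "graded_free_resolution M es \<phi> \<epsilon>"
    unfolding graded_free_resolution_def Let_def
  proof (intro conjI allI)
    show "\<epsilon> \<in> mod_hom_deg (?F 0) M 0" "\<epsilon> ` carrier (?F 0) = carrier M" using \<epsilon> es0 by simp_all
    show "\<phi> p \<in> mod_hom_deg (?F (Suc p)) (?F p) 0" for p
      unfolding \<phi>_def by (rule mat_hom[OF gF gK(2)])
    show "\<phi> 0 ` carrier (?F 1) = {x \<in> carrier (?F 0). \<epsilon> x = \<zero>\<^bsub>M\<^esub>}"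
    proof -
      have "\<phi> 0 ` carrier (?F 1) = unemb (length es0) ` K0" using \<phi>im[of 0] es0 by simp
      also have "\<dots> = {x \<in> unemb (length es0) ` FF (length es0). \<epsilon> x = \<zero>\<^bsub>M\<^esub>}" unfolding K0_def by auto
      finally show ?thesis unfolding unemb_image using es0 by simp
    qed
    show "\<phi> (Suc p) ` carrier (?F (Suc (Suc p))) = {x \<in> carrier (?F (Suc p)). \<phi> p x = \<zero>\<^bsub>?F p\<^esub>}" for p
    proof -
      have "\<phi> p (unemb (length (es (Suc p))) v) = \<zero>\<^bsub>?F p\<^esub> \<longleftrightarrow> mat (length (es (Suc p))) (g p) v = 0"
        if v: "v \<in> FF (length (es (Suc p)))" for v
      proof -
        have F: "mat (length (es (Suc p))) (g p) v \<in> FF (length (es p))"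
          by (rule mat_in[OF gsubm_FF order_refl gF v])
        show ?thesis
          unfolding \<phi>_def emb_unemb[OF v] unemb_zero[symmetric]
          using unemb_inj[OF F fun_vs.subspace_0[OF FF_subspace]] by metis
      qed
      hence "unemb (length (es (Suc p))) ` KK (Suc p) = {x \<in> unemb (length (es (Suc p))) ` FF (length (es (Suc p))). \<phi> p x = \<zero>\<^bsub>?F p\<^esub>}"
        unfolding ker by auto
      thus ?thesis unfolding \<phi>im unemb_image .
    qed
  qed
  thus ?thesis by blast
qed

text \<open>The resolution behind \<open>graded_Ext\<close> is an arbitrary choice, so its maps are
  known only as homogeneous homomorphisms; their matrices are recovered from the images of the
  basis.\<close>

lemma hom_mat:
  fixes \<phi> :: "(nat \<Rightarrow> ('n::finite, 'k::field) mpoly) \<Rightarrow> (nat \<Rightarrow> ('n, 'k) mpoly)"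
  assumes \<phi>: "\<phi> \<in> mod_hom_deg (free_gmodule es') (free_gmodule es) 0"
  defines "g \<equiv> \<lambda>a. emb (length es) (\<phi> (unemb (length es') (bas a)))"
  shows "\<And>v. v \<in> FF (length es') \<Longrightarrow> emb (length es) (\<phi> (unemb (length es') v)) = mat (length es') g v"
    and "\<And>a. g a \<in> FF (length es)"
    and "\<And>a. a < length es' \<Longrightarrow> g a \<in> Vt (\<lambda>b. es ! b) (es' ! a)"
proof -
  let ?F' = "free_gmodule es' :: (('n, 'k) mpoly, _) gmodule" and ?F = "free_gmodule es :: (('n, 'k) mpoly, _) gmodule"
  have hom: "\<And>x. x \<in> carrier ?F' \<Longrightarrow> \<phi> x \<in> carrier ?F"
    "\<And>x y. x \<in> carrier ?F' \<Longrightarrow> y \<in> carrier ?F' \<Longrightarrow> \<phi> (x \<oplus>\<^bsub>?F'\<^esub> y) = \<phi> x \<oplus>\<^bsub>?F\<^esub> \<phi> y"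
    "\<And>r x. x \<in> carrier ?F' \<Longrightarrow> \<phi> (r \<odot>\<^bsub>?F'\<^esub> x) = r \<odot>\<^bsub>?F\<^esub> \<phi> x"
    "\<And>t. \<phi> ` homog ?F' t \<subseteq> homog ?F t"
    using \<phi> by (auto simp: mod_hom_deg_def mod_hom_def)
  let ?\<psi> = "\<lambda>v. emb (length es) (\<phi> (unemb (length es') v))"
  show gF: "g a \<in> FF (length es)" for a unfolding g_def by (rule emb_FF)
  show "?\<psi> v = mat (length es') g v" if v: "v \<in> FF (length es')" for v
    unfolding g_def
  proof (rule linear_eq_mat[where \<psi> = ?\<psi>, OF _ _ _ v])
    fix u w :: "('n, 'k) vec" assume uw: "u \<in> FF (length es')" "w \<in> FF (length es')"
    show "?\<psi> (u + w) = ?\<psi> u + ?\<psi> w"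
      by (simp only: unemb_ops(1)[OF uw] hom(2)[OF unemb_closed unemb_closed]) (simp only: free_ops emb_add)
  next
    fix p and u :: "('n, 'k) vec" assume u: "u \<in> FF (length es')"
    show "?\<psi> (act p u) = act p (?\<psi> u)"
      by (simp only: unemb_ops(2)[OF u u] hom(3)[OF unemb_closed]) (simp only: free_ops emb_act)
  qed (rule emb_FF)
  show "g a \<in> Vt (\<lambda>b. es ! b) (es' ! a)" if a: "a < length es'" for a
  proof -
    have "unemb (length es') (bas a) \<in> homog ?F' (es' ! a)"
      using unemb_image_homog[of es' "es' ! a", where 'n = 'n and 'k = 'k] bas_FF[OF a, where 'n = 'n and 'k = 'k]
        bas_Vt[of a "\<lambda>b. es' ! b", where 'a = 'n and 'b = 'k] by blast
    hence "\<phi> (unemb (length es') (bas a)) \<in> homog ?F (es' ! a)" using hom(4) by blast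
    thus ?thesis unfolding g_def emb_Vt_iff by (simp add: free_homog)
  qed
qed

lemma resolution_free_res:
  fixes M :: "(('n::{finite,linorder}, 'k::field) mpoly, 'm) gmodule"
  assumes M: "graded_module M" and res: "graded_free_resolution M es \<phi> \<epsilon>"
  defines "m \<equiv> \<lambda>p. length (es p)"
  defines "g \<equiv> \<lambda>p a. emb (m p) (\<phi> p (unemb (m (Suc p)) (bas a)))"
  defines "K \<equiv> {v \<in> FF (m 0). \<epsilon> (unemb (m 0) v) = \<zero>\<^bsub>M\<^esub>}"
  shows "presents (m 0) (\<lambda>v. \<epsilon> (unemb (m 0) v)) M (\<lambda>b. es 0 ! b) K"
    and "free_res m (\<lambda>p b. es p ! b) g K"
proof -
  let ?F = "\<lambda>p. free_gmodule (es p) :: (('n, 'k) mpoly, _) gmodule"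
  have r: "\<epsilon> \<in> mod_hom_deg (?F 0) M 0" "\<And>p. \<phi> p \<in> mod_hom_deg (?F (Suc p)) (?F p) 0"
    "\<epsilon> ` carrier (?F 0) = carrier M"
    "\<phi> 0 ` carrier (?F 1) = {x \<in> carrier (?F 0). \<epsilon> x = \<zero>\<^bsub>M\<^esub>}"
    "\<And>p. \<phi> (Suc p) ` carrier (?F (Suc (Suc p))) = {x \<in> carrier (?F (Suc p)). \<phi> p x = \<zero>\<^bsub>?F p\<^esub>}"
    using res by (auto simp: graded_free_resolution_def Let_def)
  show pr: "presents (m 0) (\<lambda>v. \<epsilon> (unemb (m 0) v)) M (\<lambda>b. es 0 ! b) K"
    unfolding K_def m_def by (rule presents_of_hom[OF M r(1,3)])
  note hm = hom_mat[OF r(2)]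
  have mat: "emb (m p) (\<phi> p (unemb (m (Suc p)) v)) = mat (m (Suc p)) (g p) v" if "v \<in> FF (m (Suc p))" for p v
    unfolding m_def g_def by (rule hm(1)) (use that in \<open>simp add: m_def\<close>)
  have im: "mat (m (Suc p)) (g p) ` FF (m (Suc p)) = emb (m p) ` \<phi> p ` carrier (?F (Suc p))" for p
  proof -
    have "mat (m (Suc p)) (g p) ` FF (m (Suc p)) = (\<lambda>v. emb (m p) (\<phi> p (unemb (m (Suc p)) v))) ` FF (m (Suc p))"
      using mat by (intro image_cong) auto
    also have "\<dots> = emb (m p) ` \<phi> p ` unemb (m (Suc p)) ` FF (m (Suc p))" by (simp only: image_image)
    finally show ?thesis unfolding m_def unemb_image .
  qed
  show "free_res m (\<lambda>p b. es p ! b) g K"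
  proof
    show "g p a \<in> FF (m p)" if "a < m (Suc p)" for p a unfolding g_def by (rule emb_FF)
    show "g p a \<in> Vt (\<lambda>b. es p ! b) (es (Suc p) ! a)" if "a < m (Suc p)" for p a
      unfolding g_def m_def by (rule hm(3)) (use that in \<open>simp add: m_def\<close>)
    show "gsubm (\<lambda>b. es 0 ! b) K" by (rule presents.gK[OF pr])
    show "K \<subseteq> FF (m 0)" by (auto simp: K_def)
    have "mat (m (Suc 0)) (g 0) ` FF (m (Suc 0)) = emb (m 0) ` {x \<in> carrier (?F 0). \<epsilon> x = \<zero>\<^bsub>M\<^esub>}"
      unfolding im using r(4) by simp
    also have "\<dots> = K"
    proof (intro equalityI subsetI)
      fix v assume "v \<in> emb (m 0) ` {x \<in> carrier (?F 0). \<epsilon> x = \<zero>\<^bsub>M\<^esub>}"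
      then obtain x where x: "x \<in> carrier (?F 0)" "\<epsilon> x = \<zero>\<^bsub>M\<^esub>" "v = emb (m 0) x" by blast
      hence "unemb (m 0) v = x" by (simp add: free_carrier m_def unemb_emb)
      thus "v \<in> K" using x emb_FF by (simp add: K_def)
    next
      fix v assume v: "v \<in> K"
      hence "v = emb (m 0) (unemb (m 0) v)" by (simp add: K_def emb_unemb)
      moreover have "unemb (m 0) v \<in> carrier (?F 0)" unfolding m_def by (rule unemb_closed)
      ultimately show "v \<in> emb (m 0) ` {x \<in> carrier (?F 0). \<epsilon> x = \<zero>\<^bsub>M\<^esub>}" using v unfolding K_def by blast
    qed
    finally show "mat (m 1) (g 0) ` FF (m 1) = K" by simp
    show "mat (m (Suc (Suc p))) (g (Suc p)) ` FF (m (Suc (Suc p))) = {v \<in> FF (m (Suc p)). mat (m (Suc p)) (g p) v = 0}" for p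
      unfolding im r(5)
    proof (intro equalityI subsetI)
      fix v assume "v \<in> emb (m (Suc p)) ` {x \<in> carrier (?F (Suc p)). \<phi> p x = \<zero>\<^bsub>?F p\<^esub>}"
      then obtain x where x: "x \<in> carrier (?F (Suc p))" "\<phi> p x = \<zero>\<^bsub>?F p\<^esub>" "v = emb (m (Suc p)) x" by blast
      hence u: "unemb (m (Suc p)) v = x" by (simp add: free_carrier m_def unemb_emb)
      have vF: "v \<in> FF (m (Suc p))" using x emb_FF by simp
      have "mat (m (Suc p)) (g p) v = emb (m p) \<zero>\<^bsub>?F p\<^esub>" using mat[OF vF] u x(2) by simp
      also have "\<dots> = 0" unfolding free_ops m_def by (rule emb_zero)
      finally show "v \<in> {v \<in> FF (m (Suc p)). mat (m (Suc p)) (g p) v = 0}" using vF by simp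
    next
      fix v assume v: "v \<in> {v \<in> FF (m (Suc p)). mat (m (Suc p)) (g p) v = 0}"
      let ?x = "unemb (m (Suc p)) v"
      have xc: "?x \<in> carrier (?F (Suc p))" unfolding m_def by (rule unemb_closed)
      have "emb (m p) (\<phi> p ?x) = 0" using mat[of v p] v by simp
      moreover have "\<phi> p ?x \<in> carrier (?F p)" using r(2)[of p] xc by (auto simp: mod_hom_deg_def mod_hom_def)
      hence "unemb (m p) (emb (m p) (\<phi> p ?x)) = \<phi> p ?x" by (simp add: free_carrier m_def unemb_emb)
      ultimately have "\<phi> p ?x = \<zero>\<^bsub>?F p\<^esub>" using unemb_zero[of "es p", where 'n = 'n and 'k = 'k] by (simp add: m_def)
      moreover have "v = emb (m (Suc p)) ?x" using v by (simp add: emb_unemb)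
      ultimately show "v \<in> emb (m (Suc p)) ` {x \<in> carrier (?F (Suc p)). \<phi> p x = \<zero>\<^bsub>?F p\<^esub>}" using xc by blast
    qed
  qed
qed

section \<open>Ext as the cohomology of the dual complex\<close>

lemma poly_homog_zero: "0 \<in> poly_homog t"
  by (simp add: poly_homog_def)

lemma poly_homog_one: "1 \<in> poly_homog 0"
  by (simp add: poly_homog_def mon_deg_def flip: single_one)

lemma poly_homog_mult: "p \<in> poly_homog s \<Longrightarrow> q \<in> poly_homog t \<Longrightarrow> p * q \<in> poly_homog (s + t)"
  using keys_mult[of p q] by (force simp: poly_homog_def mon_deg_add)

lemma poly_homog_sum: "(\<And>i. i \<in> J \<Longrightarrow> f i \<in> poly_homog t) \<Longrightarrow> (\<Sum>i\<in>J. f i) \<in> poly_homog t"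
proof (induction J rule: infinite_finite_induct)
  case (insert x F)
  thus ?case using Poly_Mapping.keys_add[of "f x" "sum f F"] by (auto simp: poly_homog_def)
qed (auto simp: poly_homog_zero)

text \<open>The functional with coordinate vector \<open>\<gamma>\<close> in the dual basis, cut off
  outside the carrier because \<open>gHom\<close> consists of extensional functions.\<close>

definition hp :: "int list \<Rightarrow> ('n::finite, 'k::field) vec \<Rightarrow> (nat \<Rightarrow> ('n, 'k) mpoly) \<Rightarrow> ('n, 'k) mpoly" where
  "hp es \<gamma> = (\<lambda>x\<in>carrier (free_gmodule es). \<Sum>b<length es. x b * unemb (length es) \<gamma> b)"

definition ubas :: "nat \<Rightarrow> nat \<Rightarrow> nat \<Rightarrow> ('n, 'k::field) mpoly" where
  "ubas m b = (\<lambda>c\<in>{..<m}. if c = b then 1 else 0)"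

lemma ubas_closed: "ubas (length es) b \<in> carrier (free_gmodule es)"
  by (simp add: ubas_def free_carrier)

lemma ubas_homog: "b < length es \<Longrightarrow> ubas (length es) b \<in> homog (free_gmodule es) (es ! b)"
  by (auto simp: ubas_def free_homog poly_homog_zero poly_homog_one)

lemma unemb_bas: "unemb m (bas b) = (ubas m b :: nat \<Rightarrow> ('n::finite, 'k::field) mpoly)" if "b < m"
proof (rule unemb_eqI)
  have one: "coefz (1 :: ('n, 'k) mpoly) e = (if e = 0 then 1 else 0)" for e
    using coefz_single[of 0 "1 :: 'k" e] by simp
  show "bas b = emb m (ubas m b :: nat \<Rightarrow> ('n, 'k) mpoly)"
    using that by (auto simp: bas_def emb_def ubas_def one fun_eq_iff)
qed (simp add: ubas_def)

lemma hp_ext: "hp es \<gamma> \<in> extensional (carrier (free_gmodule es))"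
  by (simp add: hp_def)

lemma hp_ubas: "b < length es \<Longrightarrow> hp es \<gamma> (ubas (length es) b) = unemb (length es) \<gamma> b"
  by (simp add: hp_def ubas_closed) (simp add: ubas_def if_distrib[of "\<lambda>x. x * _"] cong: if_cong)

lemma hp_inj:
  assumes "\<gamma> \<in> FF (length es)" "\<gamma>' \<in> FF (length es)" "hp es \<gamma> = hp es \<gamma>'"
  shows "\<gamma> = \<gamma>'"
proof (rule unemb_inj[OF assms(1,2)], rule extensionalityI[OF unemb_ext unemb_ext])
  fix b assume "b \<in> {..<length es}"
  thus "unemb (length es) \<gamma> b = unemb (length es) \<gamma>' b"
    using hp_ubas[of b es \<gamma>] hp_ubas[of b es \<gamma>'] assms(3) by simp
qed

lemma hom_expand:
  fixes f :: "(nat \<Rightarrow> ('n::finite, 'k::field) mpoly) \<Rightarrow> ('n, 'k) mpoly"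
  assumes f: "f \<in> mod_hom (free_gmodule es) poly_gmodule" and x: "x \<in> carrier (free_gmodule es)"
  shows "f x = (\<Sum>b<length es. x b * f (ubas (length es) b))"
proof -
  let ?F = "free_gmodule es :: (('n, 'k) mpoly, _) gmodule" and ?m = "length es"
  have add: "f (x \<oplus>\<^bsub>?F\<^esub> y) = f x + f y" if "x \<in> carrier ?F" "y \<in> carrier ?F" for x y
    using f that by (auto simp: mod_hom_def poly_gmodule_def mk_gmodule_def)
  have sm: "f (r \<odot>\<^bsub>?F\<^esub> x) = r * f x" if "x \<in> carrier ?F" for r x
    using f that by (auto simp: mod_hom_def poly_gmodule_def mk_gmodule_def)
  have part: "j \<le> ?m \<Longrightarrow> f (\<lambda>c\<in>{..<?m}. if c < j then x c else 0) = (\<Sum>b<j. x b * f (ubas ?m b))" for j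
  proof (induction j)
    case 0
    have "(\<lambda>c\<in>{..<?m}. if c < 0 then x c else 0) = 0 \<odot>\<^bsub>?F\<^esub> x" by (auto simp: free_ops)
    thus ?case using sm[OF x, of 0] by simp
  next
    case (Suc j)
    let ?y = "\<lambda>c\<in>{..<?m}. if c < j then x c else 0"
    have "(\<lambda>c\<in>{..<?m}. if c < Suc j then x c else 0) = ?y \<oplus>\<^bsub>?F\<^esub> (x j \<odot>\<^bsub>?F\<^esub> ubas ?m j)"
      by (auto simp: free_ops ubas_def fun_eq_iff less_Suc_eq)
    moreover have "?y \<in> carrier ?F" "x j \<odot>\<^bsub>?F\<^esub> ubas ?m j \<in> carrier ?F" by (auto simp: free_carrier free_ops)
    moreover have "f ?y = (\<Sum>b<j. x b * f (ubas ?m b))" by (rule Suc.IH) (use Suc.prems in simp)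
    ultimately show ?case using sm[OF ubas_closed, of "x j" j] add[of ?y "x j \<odot>\<^bsub>?F\<^esub> ubas ?m j"]
      by (simp only: sum.lessThan_Suc)
  qed
  have "(\<lambda>c\<in>{..<?m}. if c < ?m then x c else 0) = x"
    using x by (auto simp: free_carrier fun_eq_iff extensional_def)
  thus ?thesis using part[OF order_refl] by (simp only:)
qed

lemma hom_eq_hp:
  fixes f :: "(nat \<Rightarrow> ('n::finite, 'k::field) mpoly) \<Rightarrow> ('n, 'k) mpoly"
  assumes f: "f \<in> mod_hom (free_gmodule es) poly_gmodule" "f \<in> extensional (carrier (free_gmodule es))"
  shows "f = hp es (emb (length es) (\<lambda>b\<in>{..<length es}. f (ubas (length es) b)))"
proof (rule extensionalityI[OF f(2)])
  show "hp es (emb (length es) (\<lambda>b\<in>{..<length es}. f (ubas (length es) b))) \<in> extensional (carrier (free_gmodule es))"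
    by (simp add: hp_def)
  fix x assume x: "x \<in> carrier (free_gmodule es :: (('n, 'k) mpoly, _) gmodule)"
  show "f x = hp es (emb (length es) (\<lambda>b\<in>{..<length es}. f (ubas (length es) b))) x"
    by (simp add: hom_expand[OF f(1) x] hp_def x unemb_emb)
qed

lemma hp_hom: "hp es \<gamma> \<in> mod_hom (free_gmodule es) poly_gmodule"
  unfolding mod_hom_def by (simp add: hp_def free_carrier, simp add: free_ops poly_gmodule_def mk_gmodule_def)
    (auto simp: sum.distrib sum_distrib_left algebra_simps)

lemma rep_Hom:
  "rep (FF (length es)) act (hp es) (gHom (free_gmodule es) (poly_gmodule :: (('n::finite, 'k::field) mpoly, _) gmodule))"
proof
  let ?F = "free_gmodule es :: (('n, 'k) mpoly, _) gmodule" and ?m = "length es"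
  have s: "fun_vs.subspace (FF ?m :: ('n, 'k) vec set)" by (rule FF_subspace)
  show "(0 :: ('n, 'k) vec) \<in> FF ?m" by (rule fun_vs.subspace_0[OF s])
  show "u + v \<in> FF ?m" if "u \<in> FF ?m" "v \<in> FF ?m" for u v :: "('n, 'k) vec" by (rule fun_vs.subspace_add[OF s that])
  show "- u \<in> FF ?m" if "u \<in> FF ?m" for u :: "('n, 'k) vec" by (rule fun_vs.subspace_neg[OF s that])
  show "act p u \<in> FF ?m" if "u \<in> FF ?m" for u :: "('n, 'k) vec" and p by (rule gsubm_act[OF gsubm_FF that])
  show "carrier (gHom ?F poly_gmodule) = hp es ` FF ?m"
  proof (intro equalityI subsetI)
    fix f assume "f \<in> carrier (gHom ?F poly_gmodule)"
    hence "f \<in> mod_hom ?F poly_gmodule" "f \<in> extensional (carrier ?F)" by (auto simp: gHom_def mk_gmodule_def)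
    from hom_eq_hp[OF this] show "f \<in> hp es ` FF ?m" using emb_FF by blast
  qed (use hp_hom in \<open>auto simp: gHom_def mk_gmodule_def hp_def\<close>)
  show "hp es (u + v) = hp es u \<oplus>\<^bsub>gHom ?F poly_gmodule\<^esub> hp es v" if "u \<in> FF ?m" "v \<in> FF ?m" for u v
    unfolding hp_def unemb_ops(1)[OF that]
    by (auto simp: gHom_def mk_gmodule_def poly_gmodule_def fun_eq_iff free_ops sum.distrib algebra_simps)
  show "hp es (act p u) = p \<odot>\<^bsub>gHom ?F poly_gmodule\<^esub> hp es u" if "u \<in> FF ?m" for u p
    unfolding hp_def unemb_ops(2)[OF that that]
    by (auto simp: gHom_def mk_gmodule_def poly_gmodule_def fun_eq_iff free_ops sum_distrib_left algebra_simps)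
  show "hp es 0 = \<zero>\<^bsub>gHom ?F poly_gmodule\<^esub>"
    unfolding hp_def unemb_zero
    by (auto simp: gHom_def mk_gmodule_def poly_gmodule_def fun_eq_iff free_ops)
qed

lemma homog_Hom:
  "homog (gHom (free_gmodule es) (poly_gmodule :: (('n::finite, 'k::field) mpoly, _) gmodule)) \<mu> =
    hp es ` (FF (length es) \<inter> Vt (\<lambda>b. - (es ! b)) \<mu>)"
proof (intro equalityI subsetI)
  let ?F = "free_gmodule es :: (('n, 'k) mpoly, _) gmodule" and ?m = "length es"
  fix f assume "f \<in> homog (gHom ?F poly_gmodule) \<mu>"
  hence f: "f \<in> mod_hom ?F poly_gmodule" "f \<in> extensional (carrier ?F)"
    "\<And>t. f ` homog ?F t \<subseteq> poly_homog (t + \<mu>)"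
    by (auto simp: gHom_def mk_gmodule_def mod_hom_deg_def poly_gmodule_def)
  have "f (ubas ?m b) \<in> poly_homog (\<mu> - - (es ! b))" if "b < ?m" for b
    using f(3)[of "es ! b"] ubas_homog[OF that] by (auto simp: add.commute)
  hence "emb ?m (\<lambda>b\<in>{..<?m}. f (ubas ?m b)) \<in> FF ?m \<inter> Vt (\<lambda>b. - (es ! b)) \<mu>"
    unfolding Int_iff emb_Vt_iff using emb_FF by auto
  thus "f \<in> hp es ` (FF ?m \<inter> Vt (\<lambda>b. - (es ! b)) \<mu>)" using hom_eq_hp[OF f(1,2)] by blast
next
  let ?F = "free_gmodule es :: (('n, 'k) mpoly, _) gmodule" and ?m = "length es"
  fix f assume "f \<in> hp es ` (FF ?m \<inter> Vt (\<lambda>b. - (es ! b)) \<mu> :: ('n, 'k) vec set)"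
  then obtain \<gamma> :: "('n, 'k) vec" where \<gamma>: "\<gamma> \<in> FF ?m" "\<gamma> \<in> Vt (\<lambda>b. - (es ! b)) \<mu>" "f = hp es \<gamma>" by blast
  have "emb ?m (unemb ?m \<gamma>) \<in> Vt (\<lambda>b. - (es ! b)) \<mu>" using \<gamma>(2) emb_unemb[OF \<gamma>(1)] by simp
  hence u: "unemb ?m \<gamma> b \<in> poly_homog (\<mu> + es ! b)" if "b < ?m" for b using that by (simp add: emb_Vt_iff)
  have "hp es \<gamma> x \<in> poly_homog (t + \<mu>)" if x: "x \<in> homog ?F t" for t x
  proof -
    have "x b * unemb ?m \<gamma> b \<in> poly_homog (t + \<mu>)" if b: "b < ?m" for b
      using poly_homog_mult[of "x b" "t - es ! b" "unemb ?m \<gamma> b" "\<mu> + es ! b"] u[OF b] x b by (simp add: free_homog)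
    moreover have "x \<in> carrier ?F" using x by (simp add: free_homog free_carrier)
    ultimately show ?thesis by (auto simp: hp_def intro!: poly_homog_sum)
  qed
  thus "f \<in> homog (gHom ?F poly_gmodule) \<mu>"
    using \<gamma>(3) hp_hom[of es \<gamma>] hp_ext[of es \<gamma>] by (auto simp: gHom_def mk_gmodule_def mod_hom_deg_def poly_gmodule_def)
qed

lemma rowm_apply:
  fixes \<gamma> :: "('n::finite, 'k::field) vec"
  assumes \<gamma>: "\<gamma> \<in> FF m"
  shows "mat m (rowm \<gamma>) (emb m y) (0, e) = coefz (\<Sum>b<m. y b * unemb m \<gamma> b) e"
proof -
  have "(\<Sum>x\<in>{x. rowm \<gamma> b (0, x) \<noteq> 0}. rowm \<gamma> b (0, x) * emb m y (b, e - x)) = coefz (unemb m \<gamma> b * y b) e"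
    if b: "b < m" for b
  proof -
    have "{x. \<gamma> (b, x) \<noteq> 0} = expo ` Poly_Mapping.keys (unemb m \<gamma> b)"
    proof (intro equalityI subsetI)
      fix x assume "x \<in> {x. \<gamma> (b, x) \<noteq> 0}"
      hence x: "\<gamma> (b, x) \<noteq> 0" "x = expo (toexp x)" using \<gamma> expo_toexp[of x] unfolding FF_def by auto
      hence "toexp x \<in> Poly_Mapping.keys (unemb m \<gamma> b)" using lookup_unemb[OF \<gamma> b, of "toexp x"] by (simp add: in_keys_iff)
      thus "x \<in> expo ` Poly_Mapping.keys (unemb m \<gamma> b)" using x(2) by blast
    qed (use lookup_unemb[OF \<gamma> b] in \<open>auto simp: in_keys_iff\<close>)
    moreover have "inj_on expo (Poly_Mapping.keys (unemb m \<gamma> b))" by (metis inj_onI toexp_expo)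
    ultimately show ?thesis
      using b by (simp add: rowm_def sum.reindex coefz_mult lookup_unemb[OF \<gamma> b] emb_def)
  qed
  thus ?thesis by (simp add: mat_def coefz_sum mult.commute)
qed

text \<open>Composition with the differential of the resolution is the transposed matrix on
  coordinate vectors. A functional is determined by its values on the basis, so it suffices to
  compare those.\<close>

lemma hp_diff:
  fixes \<phi> :: "(nat \<Rightarrow> ('n::finite, 'k::field) mpoly) \<Rightarrow> (nat \<Rightarrow> ('n, 'k) mpoly)"
  assumes \<phi>: "\<phi> \<in> mod_hom_deg (free_gmodule es') (free_gmodule es) 0" and \<gamma>: "\<gamma> \<in> FF (length es)"
  defines "g \<equiv> \<lambda>a. emb (length es) (\<phi> (unemb (length es') (bas a)))"
  shows "(\<lambda>x\<in>carrier (free_gmodule es'). hp es \<gamma> (\<phi> x)) = hp es' (tmat (length es') (length es) g \<gamma>)"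
    (is "?f = _")
proof -
  let ?m = "length es" and ?m' = "length es'"
  let ?F' = "free_gmodule es' :: (('n, 'k) mpoly, _) gmodule" and ?F = "free_gmodule es :: (('n, 'k) mpoly, _) gmodule"
  have \<phi>h: "\<phi> x \<in> carrier ?F" "\<phi> (x \<oplus>\<^bsub>?F'\<^esub> y) = \<phi> x \<oplus>\<^bsub>?F\<^esub> \<phi> y" "\<phi> (r \<odot>\<^bsub>?F'\<^esub> x) = r \<odot>\<^bsub>?F\<^esub> \<phi> x"
    if "x \<in> carrier ?F'" "y \<in> carrier ?F'" for x y r
    using \<phi> that by (auto simp: mod_hom_deg_def mod_hom_def)
  have hh: "hp es \<gamma> (x \<oplus>\<^bsub>?F\<^esub> y) = hp es \<gamma> x + hp es \<gamma> y" "hp es \<gamma> (r \<odot>\<^bsub>?F\<^esub> x) = r * hp es \<gamma> x"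
    if "x \<in> carrier ?F" "y \<in> carrier ?F" for x y r
    using hp_hom[of es \<gamma>] that by (auto simp: mod_hom_def poly_gmodule_def mk_gmodule_def)
  have cl: "x \<oplus>\<^bsub>?F'\<^esub> y \<in> carrier ?F'" "r \<odot>\<^bsub>?F'\<^esub> x \<in> carrier ?F'" for x y r by (simp_all add: free_carrier free_ops)
  have "?f \<in> mod_hom ?F' poly_gmodule"
    using hh(1)[OF \<phi>h(1) \<phi>h(1)] hh(2)[OF \<phi>h(1) \<phi>h(1)] cl by (auto simp: mod_hom_def poly_gmodule_def mk_gmodule_def \<phi>h(2,3))
  hence "?f = hp es' (emb ?m' (\<lambda>a\<in>{..<?m'}. ?f (ubas ?m' a)))" by (rule hom_eq_hp) simp
  also have "emb ?m' (\<lambda>a\<in>{..<?m'}. ?f (ubas ?m' a)) = tmat ?m' ?m g \<gamma>"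
  proof
    fix x :: "nat \<times> ('n \<Rightarrow> int)"
    obtain a e where x: "x = (a, e)" by (cases x)
    show "emb ?m' (\<lambda>a\<in>{..<?m'}. ?f (ubas ?m' a)) x = tmat ?m' ?m g \<gamma> x"
    proof (cases "a < ?m'")
      case True
      have "?f (ubas ?m' a) = (\<Sum>b<?m. \<phi> (ubas ?m' a) b * unemb ?m \<gamma> b)"
        by (simp add: ubas_closed, simp add: hp_def \<phi>h(1)[OF ubas_closed ubas_closed])
      moreover have "g a = emb ?m (\<phi> (ubas ?m' a))" by (simp only: g_def unemb_bas[OF True])
      ultimately show ?thesis using True rowm_apply[OF \<gamma>, of "\<phi> (ubas ?m' a)" e]
        by (simp add: x emb_def[of ?m'] tmat_def ubas_closed)
    qed (simp add: x emb_def tmat_def)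
  qed
  finally show ?thesis .
qed

lemma k_dim_Ext_le:
  fixes M :: "(('n::{finite,linorder}, 'k::field) mpoly, 'm) gmodule"
  assumes M: "graded_module M" and res: "graded_free_resolution M es \<phi> \<epsilon>" and q: "q < CARD('n)"
  defines "m \<equiv> \<lambda>p. length (es p)"
  shows "k_dim (Ext_of es \<phi> q poly_gmodule) (homog (Ext_of es \<phi> q poly_gmodule) \<mu>)
    \<le> hh (\<lambda>b. es 0 ! b) (CARD('n) - q) (- int CARD('n) - \<mu>) (FF (m 0)) {v \<in> FF (m 0). \<epsilon> (unemb (m 0) v) = \<zero>\<^bsub>M\<^esub>}"
proof -
  define g where "g = (\<lambda>p a. emb (m p) (\<phi> p (unemb (m (Suc p)) (bas a))))"
  define K where "K = {v \<in> FF (m 0). \<epsilon> (unemb (m 0) v) = \<zero>\<^bsub>M\<^esub>}"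
  let ?F = "\<lambda>p. free_gmodule (es p) :: (('n, 'k) mpoly, _) gmodule"
  let ?H = "\<lambda>p. gHom (?F p) poly_gmodule"
  interpret R: free_res m "\<lambda>p b. es p ! b" g K
    unfolding m_def g_def K_def by (rule resolution_free_res(2)[OF M res])
  let ?D = "\<lambda>p. tmat (m (Suc p)) (m p) (g p)"
  have \<phi>: "\<phi> p \<in> mod_hom_deg (?F (Suc p)) (?F p) 0" for p using res by (auto simp: graded_free_resolution_def Let_def)
  have \<phi>\<phi>: "\<phi> p (\<phi> (Suc p) x) = \<zero>\<^bsub>?F p\<^esub>" if "x \<in> carrier (?F (Suc (Suc p)))" for p x
  proof -
    have "\<phi> (Suc p) x \<in> {x \<in> carrier (?F (Suc p)). \<phi> p x = \<zero>\<^bsub>?F p\<^esub>}"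
      using res that unfolding graded_free_resolution_def Let_def by blast
    thus ?thesis by simp
  qed
  have \<phi>c: "\<phi> p x \<in> carrier (?F p)" if "x \<in> carrier (?F (Suc p))" for p x
    using \<phi>[of p] that by (auto simp: mod_hom_deg_def mod_hom_def)
  have rH: "rep (FF (m p)) act (hp (es p)) (?H p)" for p unfolding m_def by (rule rep_Hom)
  have DF: "?D p \<gamma> \<in> FF (m (Suc p))" if "\<gamma> \<in> FF (m p)" for p \<gamma> by (rule tmat_FF[OF that R.gF])
  have inj: "\<gamma> = \<gamma>'" if "\<gamma> \<in> FF (m p)" "\<gamma>' \<in> FF (m p)" "hp (es p) \<gamma> = hp (es p) \<gamma>'" for p \<gamma> \<gamma>'
    using hp_inj[of \<gamma> "es p" \<gamma>'] that by (simp only: m_def)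
  have D: "(\<lambda>x\<in>carrier (?F (Suc p)). hp (es p) \<gamma> (\<phi> p x)) = hp (es (Suc p)) (?D p \<gamma>)" if "\<gamma> \<in> FF (m p)" for p \<gamma>
    unfolding m_def g_def by (rule hp_diff[OF \<phi>]) (use that in \<open>simp only: m_def\<close>)
  have Dadd: "?D p (u + v) = ?D p u + ?D p v" if "u \<in> FF (m p)" "v \<in> FF (m p)" for p u v by (rule tmat_add[OF that R.gF])
  have Dscale: "?D p (c *\<^sub>f u) = c *\<^sub>f ?D p u" if "u \<in> FF (m p)" for p c u by (rule tmat_scale[OF that R.gF])
  have D0: "?D p 0 = 0" for p using Dscale[OF rep.A0[OF rH], of p 0] by simp
  have Dneg: "?D p (- u) = - ?D p u" if "u \<in> FF (m p)" for p u
    using Dadd[OF that rep.A_minus[OF rH that]] D0 by (simp add: eq_neg_iff_add_eq_0 add.commute)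
  \<comment> \<open>Compared after applying the injective \<open>hp\<close>: there the dual map is
    composition with \<open>\<phi> p\<close>, and compatibility with the action is evident. The same
    device turns the composition of two maps of the resolution being zero into
    \<open>DD\<close>.\<close>
  have Dact: "?D p (act r u) = act r (?D p u)" if u: "u \<in> FF (m p)" for p r u
  proof (rule inj[OF DF[OF rep.A_act[OF rH u]] rep.A_act[OF rH DF[OF u]]])
    have "hp (es (Suc p)) (?D p (act r u)) = (\<lambda>x\<in>carrier (?F (Suc p)). (r \<odot>\<^bsub>?H p\<^esub> hp (es p) u) (\<phi> p x))"
      unfolding D[OF rep.A_act[OF rH u], symmetric] rep.g_act[OF rH u] ..
    also have "\<dots> = r \<odot>\<^bsub>?H (Suc p)\<^esub> (\<lambda>x\<in>carrier (?F (Suc p)). hp (es p) u (\<phi> p x))"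
      using \<phi>c by (auto simp: gHom_def mk_gmodule_def fun_eq_iff)
    also have "\<dots> = hp (es (Suc p)) (act r (?D p u))" unfolding D[OF u] rep.g_act[OF rH DF[OF u]] ..
    finally show "hp (es (Suc p)) (?D p (act r u)) = hp (es (Suc p)) (act r (?D p u))" .
  qed
  have DD: "?D (Suc p) (?D p u) = 0" if u: "u \<in> FF (m p)" for p u
  proof (rule inj[OF DF[OF DF[OF u]] rep.A0[OF rH]])
    have "hp (es (Suc (Suc p))) (?D (Suc p) (?D p u)) =
        (\<lambda>x\<in>carrier (?F (Suc (Suc p))). hp (es p) u (\<phi> p (\<phi> (Suc p) x)))"
      unfolding D[OF DF[OF u], symmetric] D[OF u, symmetric] using \<phi>c by (auto simp: fun_eq_iff)
    also have "\<dots> = (\<lambda>x\<in>carrier (?F (Suc (Suc p))). hp (es p) u \<zero>\<^bsub>?F p\<^esub>)"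
      by (rule restrict_ext) (simp only: \<phi>\<phi>)
    also have "\<dots> = \<zero>\<^bsub>?H (Suc (Suc p))\<^esub>"
      by (auto simp: gHom_def mk_gmodule_def poly_gmodule_def hp_def free_ops free_carrier fun_eq_iff)
    also have "\<dots> = hp (es (Suc (Suc p))) 0" by (rule rep.g_zero[OF rH, symmetric])
    finally show "hp (es (Suc (Suc p))) (?D (Suc p) (?D p u)) = hp (es (Suc (Suc p))) 0" .
  qed
  define Z where "Z = {\<gamma> \<in> FF (m q). ?D q \<gamma> = 0}"
  define Bd where "Bd = (case q of 0 \<Rightarrow> {0} | Suc p \<Rightarrow> ?D p ` FF (m p))"
  let ?h = "hp (es q)"
  let ?A = "gsub (?H q) (?h ` Z)"
  have Zs: "{x \<in> carrier (?H q). (\<lambda>y\<in>carrier (?F (Suc q)). x (\<phi> q y)) = \<zero>\<^bsub>?H (Suc q)\<^esub>} = ?h ` Z"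
  proof -
    have "(\<lambda>y\<in>carrier (?F (Suc q)). ?h \<gamma> (\<phi> q y)) = \<zero>\<^bsub>?H (Suc q)\<^esub> \<longleftrightarrow> ?D q \<gamma> = 0" if "\<gamma> \<in> FF (m q)" for \<gamma>
      unfolding D[OF that] rep.g_zero[OF rH, symmetric]
      using inj[OF DF[OF that] rep.A0[OF rH]] by auto
    thus ?thesis unfolding rep.car[OF rH] Z_def by auto
  qed
  have Bs: "(case q of 0 \<Rightarrow> {\<zero>\<^bsub>?H 0\<^esub>} | Suc p \<Rightarrow> (\<lambda>f. \<lambda>x\<in>carrier (?F (Suc p)). f (\<phi> p x)) ` carrier (?H p)) = ?h ` Bd"
  proof (cases q)
    case 0
    show ?thesis using rep.g_zero[OF rH, of 0] unfolding Bd_def 0 by simp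
  next
    case (Suc p)
    have "(\<lambda>f. \<lambda>x\<in>carrier (?F (Suc p)). f (\<phi> p x)) ` hp (es p) ` FF (m p) = hp (es (Suc p)) ` ?D p ` FF (m p)"
      unfolding image_image using D by (intro image_cong) auto
    thus ?thesis unfolding Bd_def Suc rep.car[OF rH] by simp
  qed
  have Ext: "Ext_of es \<phi> q poly_gmodule = gquot ?A (?h ` Bd)"
    unfolding Ext_of_def cohomology_def Zs Bs ..
  have Z: "0 \<in> Z" "\<And>u v. u \<in> Z \<Longrightarrow> v \<in> Z \<Longrightarrow> u + v \<in> Z" "\<And>u. u \<in> Z \<Longrightarrow> - u \<in> Z" "\<And>u p. u \<in> Z \<Longrightarrow> act p u \<in> Z" "Z \<subseteq> FF (m q)"
    unfolding Z_def using rep.A0[OF rH[of q]] rep.A_add[OF rH[of q]] rep.A_minus[OF rH[of q]] rep.A_act[OF rH[of q]]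
    by (auto simp: D0 Dadd Dneg Dact)
  have rA: "rep Z act ?h ?A" by (rule rep.rep_gsub[OF rH Z])
  have BdZ: "Bd \<subseteq> Z"
    unfolding Bd_def by (cases q) (use Z(1) DD DF in \<open>auto simp: Z_def\<close>)
  have Bd: "0 \<in> Bd \<and> (\<forall>u v. u \<in> Bd \<longrightarrow> v \<in> Bd \<longrightarrow> u + v \<in> Bd) \<and> (\<forall>u. u \<in> Bd \<longrightarrow> - u \<in> Bd) \<and> (\<forall>u p. u \<in> Bd \<longrightarrow> act p u \<in> Bd)"
  proof (cases q)
    case 0
    show ?thesis unfolding Bd_def 0 by simp
  next
    case (Suc p)
    have eq: "Bd = ?D p ` FF (m p)" by (simp add: Bd_def Suc)
    note r = rep.A0[OF rH[of p]] rep.A_add[OF rH[of p]] rep.A_minus[OF rH[of p]] rep.A_act[OF rH[of p]]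
    have "0 \<in> ?D p ` FF (m p)" using r(1) D0 by (metis image_eqI)
    moreover have "u + v \<in> ?D p ` FF (m p)" if "u \<in> ?D p ` FF (m p)" "v \<in> ?D p ` FF (m p)" for u v
      using that r(2) by (auto simp flip: Dadd)
    moreover have "- u \<in> ?D p ` FF (m p)" if "u \<in> ?D p ` FF (m p)" for u using that r(3) by (auto simp flip: Dneg)
    moreover have "act c u \<in> ?D p ` FF (m p)" if "u \<in> ?D p ` FF (m p)" for u c using that r(4) by (auto simp flip: Dact)
    ultimately show ?thesis unfolding eq by blast
  qed
  let ?e = "\<lambda>u. (?h ` Bd) +>\<^bsub>?A\<^esub> ?h u"
  have rE: "rep Z act ?e (gquot ?A (?h ` Bd))"
    by (rule rep.rep_gquot[OF rA BdZ _ _ _ _ act_add]) (use Bd in blast)+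
  have ZG: "R.ZG q \<mu> = Z \<inter> Vt (\<lambda>b. - (es q ! b)) \<mu>" unfolding R.ZG_def R.GG_def Z_def by blast
  have homog: "homog (gquot ?A (?h ` Bd)) \<mu> = ?e ` R.ZG q \<mu>"
  proof -
    have "homog ?A \<mu> = ?h ` (FF (m q) \<inter> Vt (\<lambda>b. - (es q ! b)) \<mu>) \<inter> ?h ` Z"
      by (simp add: gsub_def homog_Hom m_def)
    \<comment> \<open>Coordinate vectors are unique, so \<open>?h\<close> is injective on
      \<open>FF (m q)\<close> and images intersect like the sets themselves.\<close>
    also have "\<dots> = ?h ` (FF (m q) \<inter> Vt (\<lambda>b. - (es q ! b)) \<mu> \<inter> Z)"
      by (rule inj_on_image_Int[of _ "FF (m q)", symmetric]) (use inj[of _ q] Z(5) in \<open>auto intro: inj_onI\<close>)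
    also have "FF (m q) \<inter> Vt (\<lambda>b. - (es q ! b)) \<mu> \<inter> Z = R.ZG q \<mu>" unfolding ZG using Z(5) by blast
    finally have "homog ?A \<mu> = ?h ` R.ZG q \<mu>" .
    moreover have "homog (gquot ?A (?h ` Bd)) \<mu> = (\<lambda>x. (?h ` Bd) +>\<^bsub>?A\<^esub> x) ` homog ?A \<mu>"
      by (simp add: gquot_def mk_gmodule_def)
    ultimately show ?thesis by (simp only: image_image)
  qed
  have sZ: "fun_vs.subspace Z"
    unfolding fun_vs.subspace_def using Z(1,2) Z(4)[of _ "pconst _"] by (simp only: act_pconst) blast
  have "k_dim (gquot ?A (?h ` Bd)) (?e ` R.ZG q \<mu>) \<le> rdim (R.ZG q \<mu>) (R.BG q \<mu>)"
  proof (rule k_dim_le_rdim[OF rE act_pconst])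
    show "R.ZG q \<mu> \<subseteq> Z" unfolding ZG by blast
    show "fun_vs.subspace (R.ZG q \<mu>)" unfolding ZG by (rule fun_vs.subspace_inter[OF sZ Vt_subspace])
    show "0 \<in> R.BG q \<mu>" by (rule fun_vs.subspace_0[OF R.BG_subspace])
    fix u assume u: "u \<in> R.ZG q \<mu>" "u \<in> R.BG q \<mu>"
    \<comment> \<open>Boundaries of homogeneous elements are boundaries; for an upper bound on the
      dimension this inclusion suffices.\<close>
    have uB: "u \<in> Bd" using u(2) unfolding R.BG_def Bd_def R.GG_def by (cases q) auto
    have "\<exists>b\<in>Bd. ?h (u - b) = \<zero>\<^bsub>?A\<^esub>" by (rule bexI[OF _ uB]) (simp add: rep.g_zero[OF rA])
    thus "?e u = \<zero>\<^bsub>gquot ?A (?h ` Bd)\<^esub>"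
      using rep.coset_zero_iff[OF rA BdZ, of u] Bd uB BdZ by blast
  qed
  also have "\<dots> \<le> hh (\<lambda>b. es 0 ! b) (CARD('n) - q) (- int CARD('n) - \<mu>) (FF (m 0)) K" by (rule R.ext_le[OF q])
  finally show ?thesis unfolding Ext homog K_def .
qed

section \<open>Quotients, saturation and filter regularity of presented modules\<close>

lemma Kseq_sub:
  assumes "gsubm es K" "K \<subseteq> FF m" "\<And>j. j \<in> {1..i} \<Longrightarrow> l j \<in> poly_homog 1"
  shows "gsubm es (Kseq l m K i) \<and> K \<subseteq> Kseq l m K i \<and> Kseq l m K i \<subseteq> FF m"
  using assms(3)
proof (induction i)
  case (Suc i)
  thus ?case using gsubm_addmul[of es "Kseq l m K i" "l (Suc i)" 1 m] subset_addmul[of "Kseq l m K i" "l (Suc i)" m]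
      addmul_FF[of "Kseq l m K i" m "l (Suc i)"] by auto
qed (use assms in auto)

lemma Kseq_eq:
  fixes K :: "('n::finite, 'k::field) vec set"
  shows "Kseq l m K i = {(\<Sum>j\<in>{1..i}. act (l j) (x j)) + w | x w. (\<forall>j\<in>{1..i}. x j \<in> FF m) \<and> w \<in> K}"
proof (induction i)
  case 0
  show ?case by (simp add: set_eq_iff)
next
  case (Suc i)
  show ?case
  proof (intro equalityI subsetI)
    fix z assume "z \<in> Kseq l m K (Suc i)"
    then obtain u w' where u: "u \<in> FF m" "w' \<in> Kseq l m K i" "z = act (l (Suc i)) u + w'" by (auto elim: addmulE)
    then obtain x w where x: "\<forall>j\<in>{1..i}. x j \<in> FF m" "w \<in> K" "w' = (\<Sum>j\<in>{1..i}. act (l j) (x j)) + w"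
      unfolding Suc by blast
    let ?x = "x(Suc i := u)"
    have "(\<Sum>j\<in>{1..i}. act (l j) (x j)) = (\<Sum>j\<in>{1..i}. act (l j) (?x j))" by (rule sum.cong) auto
    hence "z = (\<Sum>j\<in>{1..Suc i}. act (l j) (?x j)) + w"
      unfolding u(3) x(3) by (simp add: sum.atLeast_Suc_atMost_Suc_shift algebra_simps)
    moreover have "\<forall>j\<in>{1..Suc i}. ?x j \<in> FF m" using x(1) u(1) by auto
    ultimately show "z \<in> {(\<Sum>j\<in>{1..Suc i}. act (l j) (x j)) + w | x w. (\<forall>j\<in>{1..Suc i}. x j \<in> FF m) \<and> w \<in> K}"
      using x(2) by blast
  next
    fix z assume "z \<in> {(\<Sum>j\<in>{1..Suc i}. act (l j) (x j)) + w | x w. (\<forall>j\<in>{1..Suc i}. x j \<in> FF m) \<and> w \<in> K}"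
    then obtain x w where x: "\<forall>j\<in>{1..Suc i}. x j \<in> FF m" "w \<in> K" "z = (\<Sum>j\<in>{1..Suc i}. act (l j) (x j)) + w" by blast
    have "(\<Sum>j\<in>{1..i}. act (l j) (x j)) + w \<in> Kseq l m K i" unfolding Suc using x(1,2) by fastforce
    moreover have "z = act (l (Suc i)) (x (Suc i)) + ((\<Sum>j\<in>{1..i}. act (l j) (x j)) + w)"
      unfolding x(3) by (simp add: algebra_simps)
    ultimately show "z \<in> Kseq l m K (Suc i)" using x(1) addmulI[of "x (Suc i)" m _ "Kseq l m K i" "l (Suc i)"] by simp
  qed
qed

section \<open>Powers of the irrelevant ideal and monomials of large degree\<close>

lemma keys_prod_irrelevant:
  fixes f :: "nat \<Rightarrow> ('n::finite, 'k::field) mpoly"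
  assumes "\<And>j. j < e \<Longrightarrow> f j \<in> irrelevant_ideal" "a \<in> Poly_Mapping.keys (\<Prod>j<e. f j)"
  shows "mon_deg a \<ge> e"
  using assms
proof (induction e arbitrary: a)
  case (Suc e)
  have "a \<in> Poly_Mapping.keys ((\<Prod>j<e. f j) * f e)" using Suc.prems(2) by simp
  then obtain b c where bc: "a = b + c" "b \<in> Poly_Mapping.keys (\<Prod>j<e. f j)" "c \<in> Poly_Mapping.keys (f e)"
    using keys_mult[of "\<Prod>j<e. f j" "f e"] by blast
  have "c \<noteq> 0" using bc(3) Suc.prems(1)[of e] by (auto simp: irrelevant_ideal_def in_keys_iff)
  then obtain s where "Poly_Mapping.lookup c s \<noteq> 0" by (metis lookup_zero poly_mapping_eqI)
  hence "mon_deg c \<noteq> 0" by (auto simp: mon_deg_def)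
  moreover have "mon_deg b \<ge> e" using Suc.IH[OF _ bc(2)] Suc.prems(1) by simp
  ultimately show ?case using bc(1) by simp
qed simp

text \<open>\<open>H0_sub\<close> speaks of products of elements of the irrelevant ideal,
  \<open>sat\<close> of monomials of large degree. Splitting off variables one by one leads from the
  former to the latter; \<open>keys_prod_irrelevant\<close> serves the converse.\<close>

lemma monomial_as_product:
  fixes a :: "'n::finite \<Rightarrow>\<^sub>0 nat"
  assumes "e \<le> mon_deg a"
  shows "\<exists>f b. (\<forall>j<e. f j \<in> irrelevant_ideal) \<and>
    Poly_Mapping.single a (1 :: 'k::field) = Poly_Mapping.single b 1 * (\<Prod>j<e. f j)"
  using assms
proof (induction e arbitrary: a)
  case 0
  show ?case by auto
next
  case (Suc e)
  have "mon_deg a \<noteq> 0" using Suc.prems by simp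
  then obtain s where s: "Poly_Mapping.lookup a s \<noteq> 0" by (auto simp: mon_deg_def)
  define a' where "a' = a - Poly_Mapping.single s 1"
  have a: "a = Poly_Mapping.single s 1 + a'" unfolding a'_def by (rule mon_split_var) (use s in simp)
  hence "e \<le> mon_deg a'" using Suc.prems by simp
  then obtain f b where f: "\<forall>j<e. f j \<in> irrelevant_ideal" "Poly_Mapping.single a' (1 :: 'k) = Poly_Mapping.single b 1 * (\<Prod>j<e. f j)"
    using Suc.IH by blast
  let ?f = "f(e := pvar s)"
  have "(\<Prod>j<e. ?f j) = (\<Prod>j<e. f j)" by (rule prod.cong) auto
  hence "Poly_Mapping.single b 1 * (\<Prod>j<Suc e. ?f j) = Poly_Mapping.single a' (1 :: 'k) * pvar s"
    by (simp add: f(2) mult.assoc)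
  also have "\<dots> = Poly_Mapping.single a 1" by (simp add: pvar_def mult_single a add.commute)
  finally have "Poly_Mapping.single a (1 :: 'k) = Poly_Mapping.single b 1 * (\<Prod>j<Suc e. ?f j)" by simp
  moreover have "pvar s \<in> (irrelevant_ideal :: ('n, 'k) mpoly set)"
    by (auto simp: irrelevant_ideal_def pvar_def lookup_single when_def dest!: arg_cong[where f = "\<lambda>p. Poly_Mapping.lookup p s"])
  hence "\<forall>j<Suc e. ?f j \<in> irrelevant_ideal" using f(1) by auto
  ultimately show ?case by blast
qed

context presents
begin

lemma seq_sub_eq: "seq_sub N l i = \<epsilon> ` Kseq l m K i"
proof (intro equalityI subsetI)
  interpret ab: abelian_group N by (rule abelian_group_N)
  fix y assume "y \<in> seq_sub N l i"
  then obtain x where x: "x \<in> {1..i} \<rightarrow> carrier N" "y = (\<Oplus>\<^bsub>N\<^esub>j\<in>{1..i}. l j \<odot>\<^bsub>N\<^esub> x j)" by (auto simp: seq_sub_def)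
  have "\<forall>j. \<exists>v. j \<in> {1..i} \<longrightarrow> v \<in> FF m \<and> x j = \<epsilon> v" using x(1) car by (metis PiE imageE)
  then obtain v where v: "\<And>j. j \<in> {1..i} \<Longrightarrow> v j \<in> FF m" "\<And>j. j \<in> {1..i} \<Longrightarrow> x j = \<epsilon> (v j)" by metis
  have aF: "act (l j) (v j) \<in> FF m" if "j \<in> {1..i}" for j by (rule A_act[OF v(1)[OF that]])
  have "y = (\<Oplus>\<^bsub>N\<^esub>j\<in>{1..i}. \<epsilon> (act (l j) (v j)))"
    unfolding x(2) by (rule ab.finsum_cong') (use v g_act aF car in auto)
  also have "\<dots> = \<epsilon> (\<Sum>j\<in>{1..i}. act (l j) (v j))" by (rule g_finsum) (use aF in auto)
  finally have "y = \<epsilon> ((\<Sum>j\<in>{1..i}. act (l j) (v j)) + 0)" by simp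
  moreover have "(\<Sum>j\<in>{1..i}. act (l j) (v j)) + 0 \<in> Kseq l m K i"
    unfolding Kseq_eq using v(1) fun_vs.subspace_0[OF gsubm_subspace[OF gK]] by blast
  ultimately show "y \<in> \<epsilon> ` Kseq l m K i" by blast
next
  interpret ab: abelian_group N by (rule abelian_group_N)
  fix y assume "y \<in> \<epsilon> ` Kseq l m K i"
  then obtain x w where x: "\<forall>j\<in>{1..i}. x j \<in> FF m" "w \<in> K" "y = \<epsilon> ((\<Sum>j\<in>{1..i}. act (l j) (x j)) + w)"
    unfolding Kseq_eq by blast
  have aF: "act (l j) (x j) \<in> FF m" if "j \<in> {1..i}" for j by (rule A_act) (use x(1) that in blast)
  have "y = \<epsilon> (\<Sum>j\<in>{1..i}. act (l j) (x j)) \<oplus>\<^bsub>N\<^esub> \<epsilon> w"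
    unfolding x(3) by (rule g_add[OF A_sum]) (use aF x(2) KF in auto)
  also have "\<epsilon> w = \<zero>\<^bsub>N\<^esub>" using x(2) by (simp add: K_eq)
  also have "\<epsilon> (\<Sum>j\<in>{1..i}. act (l j) (x j)) = (\<Oplus>\<^bsub>N\<^esub>j\<in>{1..i}. \<epsilon> (act (l j) (x j)))"
    by (rule g_finsum[symmetric]) (use aF in auto)
  also have "\<dots> = (\<Oplus>\<^bsub>N\<^esub>j\<in>{1..i}. l j \<odot>\<^bsub>N\<^esub> \<epsilon> (x j))"
    by (rule ab.finsum_cong') (use x(1) g_act aF car in \<open>auto simp flip: g_act\<close>)
  also have "\<dots> \<oplus>\<^bsub>N\<^esub> \<zero>\<^bsub>N\<^esub> = \<dots>"
    by (rule ab.r_zero, rule ab.finsum_closed) (use x(1) aF car in \<open>auto simp flip: g_act\<close>)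
  finally have "y = (\<Oplus>\<^bsub>N\<^esub>j\<in>{1..i}. l j \<odot>\<^bsub>N\<^esub> \<epsilon> (x j))" .
  moreover have "(\<lambda>j. \<epsilon> (x j)) \<in> {1..i} \<rightarrow> carrier N" using x(1) car by auto
  ultimately show "y \<in> seq_sub N l i" unfolding seq_sub_def by (intro CollectI exI[of _ "\<lambda>j. \<epsilon> (x j)"] conjI)
qed

lemma presents_mod_seq:
  assumes "\<And>j. j \<in> {1..i} \<Longrightarrow> l j \<in> poly_homog 1"
  shows "\<exists>\<epsilon>'. presents m \<epsilon>' (mod_seq N l i) es (Kseq l m K i)"
  unfolding mod_seq_def seq_sub_eq using presents_gquot[of "Kseq l m K i"] Kseq_sub[of es K m i l] gK KF assms by blast

lemma H0_sub_eq: "H0_sub N = \<epsilon> ` sat m K"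
proof (intro equalityI subsetI)
  fix x assume "x \<in> H0_sub N"
  then obtain e where x: "x \<in> carrier N"
    "\<And>f :: nat \<Rightarrow> ('n, 'k) mpoly. (\<forall>j<e. f j \<in> irrelevant_ideal) \<Longrightarrow> (\<Prod>j<e. f j) \<odot>\<^bsub>N\<^esub> x = \<zero>\<^bsub>N\<^esub>"
    by (auto simp: H0_sub_def)
  then obtain v where v: "v \<in> FF m" "x = \<epsilon> v" by (auto simp: car)
  have "sh (expo a) v \<in> K" if "mon_deg a \<ge> e" for a
  proof -
    obtain f and b :: "'n \<Rightarrow>\<^sub>0 nat" where f: "\<forall>j<e. f j \<in> irrelevant_ideal"
      "Poly_Mapping.single a (1 :: 'k) = Poly_Mapping.single b 1 * (\<Prod>j<e. f j)"
      using monomial_as_product[OF \<open>mon_deg a \<ge> e\<close>, where 'k = 'k] by blast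
    have "\<epsilon> (act (\<Prod>j<e. f j) v) = \<zero>\<^bsub>N\<^esub>" using x(2)[OF f(1)] g_act[OF v(1)] v(2) by simp
    hence "act (\<Prod>j<e. f j) v \<in> K" using A_act[OF v(1)] by (simp add: K_eq)
    hence "act (Poly_Mapping.single b 1) (act (\<Prod>j<e. f j) v) \<in> K" by (rule gsubm_act[OF gK])
    hence "act (Poly_Mapping.single a 1) v \<in> K" by (simp only: f(2) act_mult)
    thus ?thesis unfolding act_single by simp
  qed
  thus "x \<in> \<epsilon> ` sat m K" using v by (auto simp: sat_def)
next
  fix x assume "x \<in> \<epsilon> ` sat m K"
  then obtain v e where v: "v \<in> FF m" "\<And>a. mon_deg a \<ge> e \<Longrightarrow> sh (expo a) v \<in> K" "x = \<epsilon> v" by (auto simp: sat_def)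
  have "(\<Prod>j<e. f j) \<odot>\<^bsub>N\<^esub> x = \<zero>\<^bsub>N\<^esub>" if "\<forall>j<e. f j \<in> irrelevant_ideal" for f :: "nat \<Rightarrow> ('n, 'k) mpoly"
  proof -
    have "act (\<Prod>j<e. f j) v \<in> K"
      unfolding act_def
      by (intro fun_vs.subspace_sum fun_vs.subspace_scale gsubm_subspace[OF gK] v(2) keys_prod_irrelevant[of e f])
        (use that in auto)
    thus ?thesis using g_act[OF v(1)] v(3) by (simp add: K_eq)
  qed
  moreover have "x \<in> carrier N" using v by (simp add: car)
  ultimately show "x \<in> H0_sub N" unfolding H0_sub_def by blast
qed

lemma presents_bar_mod: "\<exists>\<epsilon>'. presents m \<epsilon>' (bar_mod N) es (sat m K)"
  unfolding bar_mod_def H0_sub_eq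
  using presents_gquot[OF gsubm_sat[OF gK] subset_sat[OF gK KF] sat_subset_FF] by blast

text \<open>If the kernel of \<open>l\<close> were nonzero in infinitely many degrees, truncating it
  at these degrees would give strict chains of submodules of any length, contrary to finite
  length.\<close>

lemma torsion_degrees_finite:
  assumes l: "l \<in> poly_homog s"
    and len: "mod_length (gsub N {x \<in> carrier N. l \<odot>\<^bsub>N\<^esub> x = \<zero>\<^bsub>N\<^esub>}) < \<infinity>"
  defines "Q \<equiv> {v \<in> FF m. act l v \<in> K}"
  shows "finite {t. \<not> Q \<inter> Vt es t \<subseteq> K}"
proof (rule ccontr)
  note s = gsubm_subspace[OF gK]
  assume inf: "infinite {t. \<not> Q \<inter> Vt es t \<subseteq> K}"
  have Q: "0 \<in> Q" "\<And>u v. u \<in> Q \<Longrightarrow> v \<in> Q \<Longrightarrow> u + v \<in> Q" "\<And>u. u \<in> Q \<Longrightarrow> - u \<in> Q" "\<And>u p. u \<in> Q \<Longrightarrow> act p u \<in> Q" "Q \<subseteq> FF m"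
    unfolding Q_def using A0 A_add A_minus A_act fun_vs.subspace_0[OF s] fun_vs.subspace_add[OF s] fun_vs.subspace_neg[OF s]
      gsubm_act[OF gK] by (auto simp: act_add act_minus) (metis act_mult mult.commute)
  have eq: "{x \<in> carrier N. l \<odot>\<^bsub>N\<^esub> x = \<zero>\<^bsub>N\<^esub>} = \<epsilon> ` Q"
    unfolding Q_def car K_eq using g_act A_act by auto
  let ?N = "gsub N (\<epsilon> ` Q)"
  interpret S: rep Q act \<epsilon> ?N by (rule rep_gsub[OF Q])
  \<comment> \<open>The elements that vanish in the quotient in all degrees below \<open>T\<close>;
    the action of a polynomial does not lower degrees, so this is stable.\<close>
  define W where "W = (\<lambda>T. {v \<in> Q. \<forall>s<T. hcomp es s v \<in> K})"
  have W: "0 \<in> W T" "u \<in> W T \<Longrightarrow> v \<in> W T \<Longrightarrow> u + v \<in> W T" "u \<in> W T \<Longrightarrow> - u \<in> W T" for T u v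
    unfolding W_def using Q fun_vs.subspace_0[OF s] fun_vs.subspace_add[OF s] fun_vs.subspace_neg[OF s]
      hcomp_diff[of es _ 0 u] by (auto simp: hcomp_add)
  have Wact: "act p u \<in> W T" if u: "u \<in> W T" for T u p
  proof -
    have "hcomp es t (act p u) \<in> K" if t: "t < T" for t
    proof -
      have "hcomp es t (act p u) = (\<Sum>a\<in>Poly_Mapping.keys p. Poly_Mapping.lookup p a *\<^sub>f sh (expo a) (hcomp es (t - int (mon_deg a)) u))"
        unfolding act_def hcomp_sum hcomp_scale hcomp_sh edeg_expo ..
      also have "\<dots> \<in> K"
        by (intro fun_vs.subspace_sum fun_vs.subspace_scale s gsubm_sh[OF gK]) (use u t in \<open>auto simp: W_def\<close>)
      finally show ?thesis .
    qed
    thus ?thesis using u Q(4) unfolding W_def by blast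
  qed
  have sub: "submodule (\<epsilon> ` W T) mpoly_ring ?N" for T
  proof
    have WQ: "W T \<subseteq> Q" unfolding W_def by blast
    show "\<epsilon> ` W T \<subseteq> carrier (add_monoid ?N)" using WQ S.car by auto
    show "x \<otimes>\<^bsub>add_monoid ?N\<^esub> y \<in> \<epsilon> ` W T" if xy: "x \<in> \<epsilon> ` W T" "y \<in> \<epsilon> ` W T" for x y
    proof -
      obtain u v where u: "u \<in> W T" "v \<in> W T" "x = \<epsilon> u" "y = \<epsilon> v" using xy by blast
      have "x \<oplus>\<^bsub>?N\<^esub> y = \<epsilon> (u + v)" unfolding u(3,4) by (rule S.g_add[symmetric]) (use u WQ in blast)+
      thus ?thesis using W(2)[OF u(1,2)] by simp
    qed
    show "\<one>\<^bsub>add_monoid ?N\<^esub> \<in> \<epsilon> ` W T" using S.g_zero W(1)[of T] by (metis image_eqI monoid.select_convs(2))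
    show "inv\<^bsub>add_monoid ?N\<^esub> x \<in> \<epsilon> ` W T" if x: "x \<in> \<epsilon> ` W T" for x
    proof -
      obtain u where u: "u \<in> W T" "x = \<epsilon> u" using x by blast
      have "inv\<^bsub>add_monoid ?N\<^esub> x = \<epsilon> (- u)" unfolding u(2) a_inv_def[symmetric] by (rule S.g_minus[symmetric]) (use u WQ in blast)
      thus ?thesis using W(3)[OF u(1)] by simp
    qed
    show "a \<odot>\<^bsub>?N\<^esub> x \<in> \<epsilon> ` W T" if x: "x \<in> \<epsilon> ` W T" for a x
    proof -
      obtain u where u: "u \<in> W T" "x = \<epsilon> u" using x by blast
      have "a \<odot>\<^bsub>?N\<^esub> x = \<epsilon> (act a u)" unfolding u(2) by (rule S.g_act[symmetric]) (use u WQ in blast)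
      thus ?thesis using Wact[OF u(1)] by simp
    qed
  qed
  have large: "enat c \<le> mod_length ?N" for c
  proof -
    obtain D where D: "D \<subseteq> {t. \<not> Q \<inter> Vt es t \<subseteq> K}" "finite D" "card D = Suc c"
      using infinite_arbitrarily_large[OF inf] by blast
    define xs where "xs = sorted_list_of_set D"
    have xs: "length xs = Suc c" "sorted_wrt (<) xs" "set xs = D"
      using D by (simp_all add: xs_def)
    \<comment> \<open>\<open>W T\<close> shrinks as \<open>T\<close> grows, while chains in
      \<open>mod_length\<close> ascend; hence the reversed index.\<close>
    define H where "H = (\<lambda>j. \<epsilon> ` W (xs ! (c - j)))"
    have "H j \<subset> H (Suc j)" if j: "j < c" for j
    proof
      let ?t = "xs ! (c - Suc j)" and ?t' = "xs ! (c - j)"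
      have lt: "?t < ?t'" by (rule sorted_wrt_nth_less[OF xs(2)]) (use j xs(1) in auto)
      have "W ?t' \<subseteq> W ?t" unfolding W_def using lt by auto
      thus "H j \<subseteq> H (Suc j)" unfolding H_def by blast
      have "?t \<in> D" using xs j by (metis nth_mem diff_less_Suc)
      then obtain u where u: "u \<in> Q" "u \<in> Vt es ?t" "u \<notin> K" using D(1) by blast
      have "u \<in> W ?t" unfolding W_def using u(1) hcomp_Vt_eq[OF u(2)] fun_vs.subspace_0[OF s] by auto
      hence "\<epsilon> u \<in> H (Suc j)" unfolding H_def by blast
      moreover have "\<epsilon> u \<notin> H j"
      proof
        assume "\<epsilon> u \<in> H j"
        then obtain v where v: "v \<in> W ?t'" "\<epsilon> u = \<epsilon> v" unfolding H_def by blast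
        have "u \<in> FF m" "v \<in> FF m" using u(1) v(1) Q(5) unfolding W_def by auto
        hence "u - v \<in> K" using v(2) \<epsilon>_eq_iff by blast
        hence "hcomp es ?t (u - v) \<in> K" by (rule gsubm_hcomp[OF gK])
        moreover have "hcomp es ?t v \<in> K" using v(1) lt unfolding W_def by blast
        ultimately have "hcomp es ?t (u - v) + hcomp es ?t v \<in> K" by (rule fun_vs.subspace_add[OF s])
        thus False using u(3) hcomp_Vt_eq[OF u(2), of ?t] by (simp add: hcomp_diff)
      qed
      ultimately show "H j \<noteq> H (Suc j)" by blast
    qed
    moreover have "\<forall>j\<le>c. submodule (H j) mpoly_ring ?N" using sub by (simp add: H_def)
    ultimately show ?thesis unfolding mod_length_def by (intro Sup_upper) blast
  qed
  have "mod_length ?N = \<infinity>"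
  proof (cases "mod_length ?N")
    case (enat c)
    thus ?thesis using large[of "Suc c"] by simp
  qed
  thus False using len unfolding eq by simp
qed

lemma sat_of_finite_length:
  assumes l: "l \<in> poly_homog s"
    and len: "mod_length (gsub N {x \<in> carrier N. l \<odot>\<^bsub>N\<^esub> x = \<zero>\<^bsub>N\<^esub>}) < \<infinity>"
    and v: "v \<in> FF m" "act l v \<in> K"
  shows "v \<in> sat m K"
proof -
  define Q where "Q = {v \<in> FF m. act l v \<in> K}"
  have "finite {t. \<not> Q \<inter> Vt es t \<subseteq> K}" unfolding Q_def by (rule torsion_degrees_finite[OF l len])
  from bdd_above_finite[OF this] obtain T where T: "\<And>t. t \<in> {t. \<not> Q \<inter> Vt es t \<subseteq> K} \<Longrightarrow> t \<le> T"
    unfolding bdd_above_def by (elim exE) (rule that, erule bspec)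
  have "finite {x. v x \<noteq> 0}" using v(1) by (simp add: FF_def)
  from hcomp_decompose[OF this, of es] obtain D where D: "finite D" "v = (\<Sum>t\<in>D. hcomp es t v)" by blast
  obtain T' where T': "\<And>t. t \<in> D \<Longrightarrow> T' \<le> t" using bdd_below_finite[OF D(1), unfolded bdd_below_def] by blast
  \<comment> \<open>A monomial of this degree moves all components of \<open>v\<close>, which start
    in degree \<open>T'\<close> or later, beyond \<open>T\<close>, the last degree in which the
    kernel of \<open>l\<close> can be nonzero modulo \<open>K\<close>.\<close>
  have "sh (expo a) v \<in> K" if a: "mon_deg a \<ge> nat (T + 1 - T')" for a
  proof -
    have "sh (expo a) (hcomp es t v) \<in> K" if t: "t \<in> D" for t
    proof -
      let ?w = "sh (expo a) (hcomp es t v)"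
      have "act l ?w = sh (expo a) (hcomp es (t + s) (act l v))"
        by (simp only: hcomp_act[OF l] act_sh add_diff_cancel_right')
      hence "act l ?w \<in> K" using gsubm_sh[OF gK gsubm_hcomp[OF gK v(2)]] by simp
      moreover have "?w \<in> FF m" by (rule sh_FF[OF hcomp_FF[OF v(1)]]) simp
      ultimately have "?w \<in> Q" by (simp add: Q_def)
      moreover have "?w \<in> Vt es (t + int (mon_deg a))" by (simp add: sh_Vt_iff)
      moreover have "\<not> t + int (mon_deg a) \<le> T" using a T'[OF t] by linarith
      ultimately show ?thesis using T by blast
    qed
    moreover have "sh (expo a) v = (\<Sum>t\<in>D. sh (expo a) (hcomp es t v))" by (subst D(2)) (rule sh_sum)
    ultimately show ?thesis by (simp add: fun_vs.subspace_sum[OF gsubm_subspace[OF gK]])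
  qed
  thus ?thesis unfolding sat_def using v(1) by blast
qed

text \<open>\<open>LEAST\<close> over the integers is meaningful only for a set bounded below. Here
  no nonzero degree lies below the least basis degree, so finitely many candidates remain up to
  \<open>t\<close>.\<close>

lemma below_indeg:
  assumes "indeg N = t0" "t < t0"
  shows "FF m \<inter> Vt es t \<subseteq> K"
proof (rule ccontr)
  assume neg: "\<not> FF m \<inter> Vt es t \<subseteq> K"
  let ?P = "\<lambda>t. homog N t \<noteq> {\<zero>\<^bsub>N\<^esub>}"
  have iff: "FF m \<inter> Vt es s \<subseteq> K" if "\<not> ?P s" for s
    using that unfolding homog_N K_eq by blast
  have low: "Min (es ` {..<m}) \<le> s" if "?P s" for s
  proof (rule ccontr)
    assume n: "\<not> Min (es ` {..<m}) \<le> s"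
    have "v = 0" if v: "v \<in> FF m" "v \<in> Vt es s" for v :: "('n, 'k) vec"
    proof
      fix x :: "nat \<times> ('n \<Rightarrow> int)"
      obtain b e where x: "x = (b, e)" by (cases x)
      show "v x = 0 x"
      proof (rule ccontr)
        assume "v x \<noteq> 0 x"
        hence nz: "v (b, e) \<noteq> 0" by (simp add: x)
        have be: "b < m" "\<forall>s. 0 \<le> e s" using v(1) nz unfolding FF_def by auto
        have "edeg e + es b = s" using v(2) nz unfolding Vt_def by blast
        moreover have "edeg e \<ge> 0" using be(2) by (simp add: edeg_def sum_nonneg)
        moreover have "Min (es ` {..<m}) \<le> es b" using be(1) by (intro Min_le) auto
        ultimately show False using n by linarith
      qed
    qed
    moreover have "(0 :: ('n, 'k) vec) \<in> FF m \<inter> Vt es s" using A0 fun_vs.subspace_0[OF Vt_subspace] by blast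
    ultimately have "FF m \<inter> Vt es s = {0 :: ('n, 'k) vec}" by blast
    hence "homog N s = {\<zero>\<^bsub>N\<^esub>}" unfolding homog_N by (simp only: image_insert image_empty g_zero)
    thus False using that by simp
  qed
  have Pt: "?P t" using neg iff by blast
  define D where "D = {s. ?P s \<and> s \<le> t}"
  have "D \<subseteq> {Min (es ` {..<m})..t}" unfolding D_def using low by (intro subsetI) (simp only: mem_Collect_eq atLeastAtMost_iff simp_thms)
  hence fin: "finite D" by (rule finite_subset) simp
  have ne: "D \<noteq> {}" unfolding D_def using Pt by blast
  have "indeg N = Min D"
    unfolding indeg_def
  proof (rule Least_equality)
    show "?P (Min D)" using Min_in[OF fin ne] by (simp add: D_def)
    fix s assume s: "?P s"
    show "Min D \<le> s"
    proof (cases "s \<le> t")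
      case True
      thus ?thesis using s fin by (intro Min_le) (auto simp: D_def)
    next
      case False
      have "Min D \<le> t" using Min_in[OF fin ne] by (simp add: D_def)
      thus ?thesis using False by simp
    qed
  qed
  moreover have "Min D \<le> t" using Min_in[OF fin ne] by (simp add: D_def)
  ultimately show False using assms by simp
qed

lemma rdim_le_k_dim_carrier: "rdim (FF m) K \<le> k_dim N (carrier N)"
  unfolding car
  by (rule rdim_le_k_dim[OF rep_axioms act_pconst order_refl FF_subspace]) (auto simp: K_eq)

lemma filter_seq_of_filter_regular:
  assumes fr: "filter_regular N l d" and "indeg N = 0"
  shows "filter_seq es m d K l"
proof
  have l: "l j \<in> poly_homog 1" if "j \<in> {1..d}" for j using fr that by (auto simp: filter_regular_def)
  show "gsubm es K" "K \<subseteq> FF m" using gK KF by auto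
  show "FF m \<inter> Vt es t \<subseteq> K" if "t < 0" for t by (rule below_indeg[OF assms(2) that])
  show "l j \<in> poly_homog 1" if "j \<in> {1..d}" for j by (rule l[OF that])
  show "v \<in> sat m (Kseq l m K j)" if j: "j < d" and v: "v \<in> FF m" "act (l (Suc j)) v \<in> Kseq l m K j" for j v
  proof -
    obtain \<epsilon>' where "presents m \<epsilon>' (mod_seq N l j) es (Kseq l m K j)" using presents_mod_seq[of j l] l j by force
    then interpret S: presents m \<epsilon>' "mod_seq N l j" es "Kseq l m K j" .
    show ?thesis
      by (rule S.sat_of_finite_length[OF l _ v]) (use bspec[OF fr[unfolded filter_regular_def], of "Suc j"] j in simp_all)
  qed
qed

end

section \<open>Chains of prime ideals\<close>

lemma linear_relation_exists:
  fixes v :: "'e \<Rightarrow> 'a \<Rightarrow> 'k::field"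
  assumes "finite A" "finite E" "card A < card E"
  shows "\<exists>q. (\<exists>e\<in>E. q e \<noteq> 0) \<and> (\<forall>a\<in>A. (\<Sum>e\<in>E. q e * v e a) = 0)"
  using assms
proof (induction A arbitrary: E v rule: finite_induct)
  case empty
  then obtain e where "e \<in> E" by fastforce
  thus ?case by (intro exI[of _ "\<lambda>_. 1"]) auto
next
  case (insert a A)
  show ?case
  proof (cases "\<forall>e\<in>E. v e a = 0")
    case True
    obtain q where "\<exists>e\<in>E. q e \<noteq> 0" "\<forall>b\<in>A. (\<Sum>e\<in>E. q e * v e b) = 0"
      using insert.IH[OF insert.prems(1), of v] insert.prems insert.hyps(1,2) by (auto simp: less_Suc_eq Suc_lessD)
    thus ?thesis using True by (intro exI[of _ q]) auto
  next
    case False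
    then obtain e0 where e0: "e0 \<in> E" "v e0 a \<noteq> 0" by blast
    let ?E = "E - {e0}"
    \<comment> \<open>Gaussian elimination: the unknown with number \<open>e0\<close> is expressed
      through the others by the equation \<open>a\<close>, with pivot \<open>v e0 a\<close>.\<close>
    define w where "w = (\<lambda>e b. v e b - v e a / v e0 a * v e0 b)"
    have "card A < card ?E" using insert e0 by simp
    then obtain q where q: "\<exists>e\<in>?E. q e \<noteq> 0" "\<And>b. b \<in> A \<Longrightarrow> (\<Sum>e\<in>?E. q e * w e b) = 0"
      using insert.IH[of ?E w] insert.prems by auto
    define c where "c = - (\<Sum>e\<in>?E. q e * v e a) / v e0 a"
    let ?q = "q(e0 := c)"
    have sum: "(\<Sum>e\<in>E. ?q e * v e b) = c * v e0 b + (\<Sum>e\<in>?E. q e * v e b)" for b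
    proof -
      have "(\<Sum>e\<in>?E. ?q e * v e b) = (\<Sum>e\<in>?E. q e * v e b)" by (rule sum.cong) auto
      thus ?thesis using sum.remove[OF insert.prems(1) e0(1), of "\<lambda>e. ?q e * v e b"] by simp
    qed
    have "(\<Sum>e\<in>?E. q e * w e b) = (\<Sum>e\<in>?E. q e * v e b) - (\<Sum>e\<in>?E. q e * v e a) / v e0 a * v e0 b" for b
      by (simp add: w_def algebra_simps sum_subtractf sum_divide_distrib sum_distrib_left)
    hence "(\<Sum>e\<in>E. ?q e * v e b) = 0" if "b \<in> A" for b unfolding sum unfolding c_def using q(2)[OF that] by simp
    moreover have "(\<Sum>e\<in>E. ?q e * v e a) = 0" unfolding sum unfolding c_def using e0(2) by simp
    moreover have "\<exists>e\<in>E. ?q e \<noteq> 0" using q(1) by auto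
    ultimately show ?thesis by blast
  qed
qed

lemma card_mon_deg_le: "card {a :: 'n::finite \<Rightarrow>\<^sub>0 nat. mon_deg a \<le> T} \<le> (T + 1) ^ CARD('n)"
proof -
  have "card {a :: 'n \<Rightarrow>\<^sub>0 nat. mon_deg a \<le> T} \<le> card (UNIV \<rightarrow>\<^sub>E {..T} :: ('n \<Rightarrow> nat) set)"
  proof (rule card_inj_on_le[of Poly_Mapping.lookup])
    show "inj_on Poly_Mapping.lookup {a :: 'n \<Rightarrow>\<^sub>0 nat. mon_deg a \<le> T}" by (rule inj_onI) (simp add: lookup_inject)
    have "Poly_Mapping.lookup a s \<le> mon_deg a" for a :: "'n \<Rightarrow>\<^sub>0 nat" and s
      unfolding mon_deg_def by (rule member_le_sum) auto
    thus "Poly_Mapping.lookup ` {a :: 'n \<Rightarrow>\<^sub>0 nat. mon_deg a \<le> T} \<subseteq> UNIV \<rightarrow>\<^sub>E {..T}" by (fastforce intro: order_trans)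
    show "finite (UNIV \<rightarrow>\<^sub>E {..T} :: ('n \<Rightarrow> nat) set)" by (rule finite_PiE) auto
  qed
  thus ?thesis by (simp add: card_PiE)
qed

lemma keys_prod_degree:
  fixes f :: "nat \<Rightarrow> ('n::finite, 'k::field) mpoly"
  assumes f: "\<And>j a. j < c \<Longrightarrow> a \<in> Poly_Mapping.keys (f j) \<Longrightarrow> mon_deg a \<le> D"
    and e: "\<And>j. j < c \<Longrightarrow> e j \<le> N"
  shows "a \<in> Poly_Mapping.keys (\<Prod>j<c. f j ^ e j) \<Longrightarrow> mon_deg a \<le> c * (N * D)"
  using assms
proof (induction c arbitrary: a)
  case 0
  thus ?case by (simp flip: single_one)
next
  case (Suc c)
  have fc: "mon_deg x \<le> D" if "x \<in> Poly_Mapping.keys (f c)" for x using Suc.prems(2)[of c x] that by simp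
  have pow: "mon_deg b \<le> k * D" if "b \<in> Poly_Mapping.keys (f c ^ k)" for k b
    using that
  proof (induction k arbitrary: b)
    case 0
    thus ?case by (simp flip: single_one)
  next
    case (Suc k)
    have "b \<in> Poly_Mapping.keys (f c * f c ^ k)" using Suc.prems by simp
    then obtain x y where xy: "b = x + y" "x \<in> Poly_Mapping.keys (f c)" "y \<in> Poly_Mapping.keys (f c ^ k)"
      using keys_mult[of "f c" "f c ^ k"] by blast
    have "mon_deg x \<le> D" using fc[OF xy(2)] .
    thus ?case using Suc.IH[OF xy(3)] xy(1) by simp
  qed
  have "a \<in> Poly_Mapping.keys ((\<Prod>j<c. f j ^ e j) * f c ^ e c)" using Suc.prems(1) by simp
  then obtain x y where xy: "a = x + y" "x \<in> Poly_Mapping.keys (\<Prod>j<c. f j ^ e j)" "y \<in> Poly_Mapping.keys (f c ^ e c)"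
    using keys_mult[of "\<Prod>j<c. f j ^ e j" "f c ^ e c"] by blast
  have "mon_deg x \<le> c * (N * D)" by (rule Suc.IH[OF xy(2)]) (use Suc.prems(2,3) in \<open>auto intro: less_SucI\<close>)
  moreover have "mon_deg y \<le> e c * D" by (rule pow[OF xy(3)])
  moreover have "e c * D \<le> N * D" using Suc.prems(3)[of c] by simp
  ultimately have "mon_deg x + mon_deg y \<le> c * (N * D) + N * D" by linarith
  thus ?case using xy(1) by simp
qed

lemma lookup_pconst_mult: "Poly_Mapping.lookup (pconst c * p) a = c * Poly_Mapping.lookup p a"
  for p :: "('n::finite, 'k::field) mpoly"
  using coefz_single_mult[of 0 c p "expo a"] by (simp add: pconst_def)

text \<open>With one more polynomial than variables, the products with exponents up to
  \<open>N\<close> outnumber the monomials that can occur in them once \<open>N\<close> is large,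
  since their number grows with a higher power of \<open>N\<close>.\<close>

lemma algebraic_dependence:
  fixes f :: "nat \<Rightarrow> ('n::finite, 'k::field) mpoly"
  assumes c: "c = Suc CARD('n)"
  shows "\<exists>E q. finite E \<and> E \<noteq> {} \<and> E \<subseteq> extensional {..<c} \<and> (\<forall>e\<in>E. q e \<noteq> 0) \<and>
    (\<Sum>e\<in>E. pconst (q e) * (\<Prod>j<c. f j ^ e j)) = 0"
proof -
  have "finite (\<Union>j<c. mon_deg ` Poly_Mapping.keys (f j))" by simp
  then obtain D where "\<forall>x\<in>(\<Union>j<c. mon_deg ` Poly_Mapping.keys (f j)). x \<le> D"
    using finite_nat_set_iff_bounded_le by blast
  hence D: "mon_deg a \<le> D" if "j < c" "a \<in> Poly_Mapping.keys (f j)" for j a using that by blast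
  \<comment> \<open>Chosen so that \<open>((c * D + 1) * (N + 1)) ^ CARD('n)\<close>, a bound for
    the number of monomials, equals \<open>N * (N + 1) ^ CARD('n)\<close>, which is less than the
    number \<open>(N + 1) ^ c\<close> of products.\<close>
  define N where "N = (c * D + 1) ^ CARD('n)"
  define E where "E = ({..<c} \<rightarrow>\<^sub>E {..N} :: (nat \<Rightarrow> nat) set)"
  define A where "A = {a :: 'n \<Rightarrow>\<^sub>0 nat. mon_deg a \<le> c * (N * D)}"
  have finE: "finite E" unfolding E_def by (rule finite_PiE) auto
  have finA: "finite A" unfolding A_def by (rule finite_mon_deg_le)
  have "card A \<le> (c * (N * D) + 1) ^ CARD('n)" unfolding A_def by (rule card_mon_deg_le)
  also have "\<dots> \<le> ((c * D + 1) * (N + 1)) ^ CARD('n)" by (rule power_mono) (auto simp: algebra_simps)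
  also have "\<dots> = N * (N + 1) ^ CARD('n)" by (simp only: power_mult_distrib) (simp only: N_def)
  also have "\<dots> < (N + 1) ^ c" unfolding c by simp
  also have "\<dots> = card E" unfolding E_def by (simp add: card_PiE)
  finally obtain q where q: "\<exists>e\<in>E. q e \<noteq> 0"
    "\<And>a. a \<in> A \<Longrightarrow> (\<Sum>e\<in>E. q e * Poly_Mapping.lookup (\<Prod>j<c. f j ^ e j) a) = 0"
    using linear_relation_exists[OF finA finE, of "\<lambda>e. Poly_Mapping.lookup (\<Prod>j<c. f j ^ e j)"] by blast
  have "(\<Sum>e\<in>E. pconst (q e) * (\<Prod>j<c. f j ^ e j)) = 0"
  proof (rule poly_mapping_eqI)
    fix a
    have "Poly_Mapping.lookup (\<Prod>j<c. f j ^ e j) a = 0" if "a \<notin> A" "e \<in> E" for e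
      using keys_prod_degree[of c f D e N a] D that by (auto simp: A_def E_def in_keys_iff)
    hence "(\<Sum>e\<in>E. q e * Poly_Mapping.lookup (\<Prod>j<c. f j ^ e j) a) = 0" using q(2)[of a] by (cases "a \<in> A") auto
    thus "Poly_Mapping.lookup (\<Sum>e\<in>E. pconst (q e) * (\<Prod>j<c. f j ^ e j)) a = Poly_Mapping.lookup 0 a"
      by (simp add: lookup_sum lookup_pconst_mult)
  qed
  moreover have "(\<Sum>e\<in>E. pconst (q e) * (\<Prod>j<c. f j ^ e j)) =
      (\<Sum>e\<in>{e\<in>E. q e \<noteq> 0}. pconst (q e) * (\<Prod>j<c. f j ^ e j))"
    by (rule sum.mono_neutral_right) (use finE in \<open>auto simp: pconst_def\<close>)
  ultimately have "(\<Sum>e\<in>{e\<in>E. q e \<noteq> 0}. pconst (q e) * (\<Prod>j<c. f j ^ e j)) = 0" by (simp only:)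
  moreover have "E \<subseteq> extensional {..<c}" by (auto simp: E_def PiE_def)
  hence "finite {e\<in>E. q e \<noteq> 0} \<and> {e\<in>E. q e \<noteq> 0} \<noteq> {} \<and> {e\<in>E. q e \<noteq> 0} \<subseteq> extensional {..<c} \<and>
      (\<forall>e\<in>{e\<in>E. q e \<noteq> 0}. q e \<noteq> 0)" using q(1) finE by fastforce
  ultimately show ?thesis by (elim conjE, intro exI[of _ "{e\<in>E. q e \<noteq> 0}"] exI[of _ q] conjI)
qed

text \<open>Choose \<open>f j\<close> in \<open>P (Suc j)\<close> outside \<open>P j\<close>. In an
  algebraic relation among them, the least power of \<open>f 0\<close> can be cancelled modulo the
  prime \<open>P 0\<close>; modulo \<open>P 1\<close> only the terms with that least power survive.
  Repeating this for each \<open>f j\<close> isolates a single term, a nonzero constant in a prime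
  ideal.\<close>

lemma prime_chain_length_le:
  fixes P :: "nat \<Rightarrow> ('n::finite, 'k::field) mpoly set"
  assumes P: "\<And>j. j \<le> c \<Longrightarrow> primeideal (P j) mpoly_ring" and strict: "\<And>j. j < c \<Longrightarrow> P j \<subset> P (Suc j)"
  shows "c \<le> CARD('n)"
proof (rule ccontr)
  assume "\<not> c \<le> CARD('n)"
  define d where "d = Suc CARD('n)"
  have d: "d \<le> c" using \<open>\<not> c \<le> CARD('n)\<close> by (simp add: d_def)
  have RU: "carrier (mpoly_ring :: ('n, 'k) mpoly ring) = UNIV" by (simp add: ring_of_type_algebra_def)
  have Rop: "p \<oplus>\<^bsub>mpoly_ring\<^esub> q = p + q" "p \<otimes>\<^bsub>mpoly_ring\<^esub> q = p * q" "\<zero>\<^bsub>mpoly_ring\<^esub> = (0 :: ('n, 'k) mpoly)"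
    for p q :: "('n, 'k) mpoly" by (simp_all add: ring_of_type_algebra_def)
  have zero: "0 \<in> P j" and add: "\<And>p q. p \<in> P j \<Longrightarrow> q \<in> P j \<Longrightarrow> p + q \<in> P j"
    and mult: "\<And>p q. q \<in> P j \<Longrightarrow> p * q \<in> P j" and prime: "\<And>p q. p * q \<in> P j \<Longrightarrow> p \<in> P j \<or> q \<in> P j"
    and proper: "1 \<notin> P j" if j: "j \<le> d" for j
  proof -
    interpret primeideal "P j" mpoly_ring by (rule P) (use j d in simp)
    show "0 \<in> P j" using additive_subgroup.zero_closed[OF is_additive_subgroup] by (simp add: Rop)
    show "p + q \<in> P j" if "p \<in> P j" "q \<in> P j" for p q using additive_subgroup.a_closed[OF is_additive_subgroup that] by (simp add: Rop)
    show m: "p * q \<in> P j" if "q \<in> P j" for p q using I_l_closed[OF that, of p] by (simp add: Rop RU)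
    show "p \<in> P j \<or> q \<in> P j" if "p * q \<in> P j" for p q using I_prime[of p q] that by (simp add: Rop RU)
    show "1 \<notin> P j" using m[of 1] I_notcarr RU by auto
  qed
  have diff: "p - q \<in> P j" if "j \<le> d" "p \<in> P j" "q \<in> P j" for p q j
    using add[OF that(1,2) mult[OF that(1,3), of "- 1"]] by simp
  have power: "p \<in> P j" if "j \<le> d" "p ^ k \<in> P j" for p j k
    using that(2) by (induction k) (use proper[OF that(1)] prime[OF that(1)] in auto)
  have sum: "(\<Sum>i\<in>J. g i) \<in> P j" if "j \<le> d" "\<And>i. i \<in> J \<Longrightarrow> g i \<in> P j" for j J and g :: "'b \<Rightarrow> _"
    using that(2) by (induction J rule: infinite_finite_induct) (use zero[OF that(1)] add[OF that(1)] in auto)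
  have "\<forall>j. \<exists>f. j < d \<longrightarrow> f \<in> P (Suc j) - P j" using strict d by (metis Diff_iff order_less_le_trans psubset_imp_ex_mem)
  then obtain f where f: "\<And>j. j < d \<Longrightarrow> f j \<in> P (Suc j)" "\<And>j. j < d \<Longrightarrow> f j \<notin> P j" by (metis Diff_iff)
  from algebraic_dependence[OF d_def, of f]
  obtain E q where E: "finite E" "E \<noteq> {}" "E \<subseteq> extensional {..<d}" "\<forall>e\<in>E. q e \<noteq> 0"
    and rel: "(\<Sum>e\<in>E. pconst (q e) * (\<Prod>j<d. f j ^ e j)) = 0" by (elim exE conjE)
  \<comment> \<open>The surviving exponent vectors agree below \<open>j\<close>, and the rest of
    their terms adds up to an element of \<open>P j\<close>. For \<open>j = d\<close> the exponent
    vectors coincide.\<close>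
  have step: "\<exists>E'\<subseteq>E. E' \<noteq> {} \<and> (\<forall>e\<in>E'. \<forall>e'\<in>E'. \<forall>i<j. e i = e' i) \<and>
      (\<Sum>e\<in>E'. pconst (q e) * (\<Prod>i\<in>{j..<d}. f i ^ e i)) \<in> P j" if "j \<le> d" for j
    using that
  proof (induction j)
    case 0
    show ?case using E(2) rel zero[of 0] by (intro exI[of _ E]) (simp add: lessThan_atLeast0)
  next
    case (Suc j)
    then obtain E' where E': "E' \<subseteq> E" "E' \<noteq> {}" "\<forall>e\<in>E'. \<forall>e'\<in>E'. \<forall>i<j. e i = e' i"
      "(\<Sum>e\<in>E'. pconst (q e) * (\<Prod>i\<in>{j..<d}. f i ^ e i)) \<in> P j" by auto
    have j: "j < d" "j \<le> d" "Suc j \<le> d" using Suc.prems by auto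
    have fin: "finite E'" using E(1) E'(1) finite_subset by blast
    define a where "a = Min ((\<lambda>e. e j) ` E')"
    have a: "a \<le> e j" if "e \<in> E'" for e unfolding a_def using that fin by (intro Min_le) auto
    have "a \<in> (\<lambda>e. e j) ` E'" unfolding a_def using fin E'(2) by (intro Min_in) auto
    then obtain e0 where e0: "e0 \<in> E'" "e0 j = a" by blast
    let ?g = "\<lambda>e. pconst (q e) * (\<Prod>i\<in>{Suc j..<d}. f i ^ e i)"
    have "(\<Sum>e\<in>E'. pconst (q e) * (\<Prod>i\<in>{j..<d}. f i ^ e i)) = f j ^ a * (\<Sum>e\<in>E'. f j ^ (e j - a) * ?g e)"
      unfolding sum_distrib_left
    proof (rule sum.cong[OF refl])
      fix e assume "e \<in> E'"
      hence "f j ^ e j = f j ^ a * f j ^ (e j - a)" using a by (simp flip: power_add)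
      thus "pconst (q e) * (\<Prod>i\<in>{j..<d}. f i ^ e i) = f j ^ a * (f j ^ (e j - a) * ?g e)"
        using j by (simp add: prod.atLeast_Suc_lessThan mult_ac)
    qed
    hence "f j ^ a * (\<Sum>e\<in>E'. f j ^ (e j - a) * ?g e) \<in> P j" using E'(4) by (simp only:)
    from prime[OF j(2) this] have "(\<Sum>e\<in>E'. f j ^ (e j - a) * ?g e) \<in> P j"
    proof
      assume "f j ^ a \<in> P j"
      from power[OF j(2) this] show ?thesis using f(2)[OF j(1)] by (rule notE[rotated])
    qed
    hence in1: "(\<Sum>e\<in>E'. f j ^ (e j - a) * ?g e) \<in> P (Suc j)" using strict[of j] j d by auto
    let ?E = "{e\<in>E'. e j = a}"
    have "(\<Sum>e\<in>E'. f j ^ (e j - a) * ?g e) = (\<Sum>e\<in>E' - ?E. f j ^ (e j - a) * ?g e) + (\<Sum>e\<in>?E. f j ^ (e j - a) * ?g e)"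
      by (rule sum.subset_diff) (use fin in auto)
    moreover have "(\<Sum>e\<in>?E. f j ^ (e j - a) * ?g e) = (\<Sum>e\<in>?E. ?g e)" by (rule sum.cong) auto
    \<comment> \<open>Terms with a larger exponent at \<open>j\<close> keep a factor
      \<open>f j\<close> after the cancellation and so drop out modulo
      \<open>P (Suc j)\<close>.\<close>
    moreover have rest: "(\<Sum>e\<in>E' - ?E. f j ^ (e j - a) * ?g e) \<in> P (Suc j)"
    proof (rule sum[OF j(3)])
      fix e assume "e \<in> E' - ?E"
      hence "\<exists>k. e j - a = Suc k" using a[of e] by (intro exI[of _ "e j - a - 1"]) auto
      then obtain k where k: "e j - a = Suc k" ..
      have "f j ^ (e j - a) * ?g e = (f j ^ k * ?g e) * f j" unfolding k power_Suc by (simp only: mult_ac)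
      thus "f j ^ (e j - a) * ?g e \<in> P (Suc j)" using mult[OF j(3) f(1)[OF j(1)]] by (simp only:)
    qed
    ultimately have "(\<Sum>e\<in>?E. ?g e) \<in> P (Suc j)" using diff[OF j(3) in1 rest] by (simp only: add_diff_cancel_left')
    moreover have "?E \<subseteq> E" "?E \<noteq> {}" using E'(1) e0 by auto
    moreover have "\<forall>e\<in>?E. \<forall>e'\<in>?E. \<forall>i<Suc j. e i = e' i" using E'(3) by (auto simp: less_Suc_eq)
    ultimately show ?case by (intro exI[of _ ?E]) blast
  qed
  obtain E' where E': "E' \<subseteq> E" "E' \<noteq> {}" "\<forall>e\<in>E'. \<forall>e'\<in>E'. \<forall>i<d. e i = e' i"
    "(\<Sum>e\<in>E'. pconst (q e) * (\<Prod>i\<in>{d..<d}. f i ^ e i)) \<in> P d" using step[OF order_refl] by blast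
  obtain e where e: "e \<in> E'" using E'(2) by blast
  have "e' = e" if "e' \<in> E'" for e'
    by (rule extensionalityI[of _ "{..<d}"]) (use that e E(3) E'(1,3) in auto)
  hence "E' = {e}" using e by blast
  hence "pconst (q e) \<in> P d" using E'(4) by simp
  hence "pconst (inverse (q e)) * pconst (q e) \<in> P d" by (rule mult[OF order_refl])
  moreover have "pconst (inverse (q e)) * pconst (q e) = (1 :: ('n, 'k) mpoly)"
    using E(4) E'(1) e by (simp add: pconst_def mult_single subset_iff)
  ultimately show False using proper[OF order_refl] by simp
qed

lemma mod_dim_le: "mod_dim M \<le> enat CARD('n)" for M :: "(('n::finite, 'k::field) mpoly, 'm) gmodule"
  unfolding mod_dim_def proof (rule Sup_least, clarify)
  fix c and P :: "nat \<Rightarrow> ('n, 'k) mpoly set"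
  assume "\<forall>j\<le>c. primeideal (P j) mpoly_ring \<and> annihilator M \<subseteq> P j" "\<forall>j<c. P j \<subset> P (Suc j)"
  hence "c \<le> CARD('n)" by (intro prime_chain_length_le[of c P]) auto
  thus "enat c \<le> enat CARD('n)" by simp
qed

section \<open>The bounds\<close>

theorem theorem4p5:
  fixes M :: "(('n::{finite,linorder}, 'k::field) mpoly, 'm) gmodule"
    and l :: "nat \<Rightarrow> ('n, 'k) mpoly"
    and d n :: nat
    and r :: "nat \<Rightarrow> int"
    and B :: enat
  defines "n \<equiv> CARD('n)"
    and "r \<equiv> \<lambda>i. reg (bar_mod (mod_seq M l i))"
    and "B \<equiv> k_dim (mod_seq M l d) (carrier (mod_seq M l d))"
  assumes "n \<ge> 2"
    and "graded_module M"
    and "finitely_generated M"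
    and "mod_dim M = enat d"
    and "d \<ge> 1"
    and "indeg M = 0"
    and "filter_regular M l d"
  shows "\<forall>i \<mu>. 0 < i \<and> i \<le> d \<longrightarrow>
     k_dim (graded_Ext (n - i) M poly_gmodule) (homog (graded_Ext (n - i) M poly_gmodule) \<mu>)
       \<le> B * binom (r (i - 1) + int d - int i) (d - i) * binom (\<mu> + r (i - 1) + int n - 1) (i - 1) \<and>
     k_dim (local_cohomology i M) (homog (local_cohomology i M) \<mu>)
       \<le> B * binom (r (i - 1) + int d - int i) (d - i) * binom (- \<mu> + r (i - 1) - 1) (i - 1)"
proof (intro allI impI)
  fix i :: nat and \<mu> :: int
  assume i: "0 < i \<and> i \<le> d"
  have dn: "d \<le> CARD('n)" using mod_dim_le[of M] assms(7) by simp
  \<comment> \<open>Ext refers to one chosen resolution; its augmentation also presents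
    \<open>M\<close>, so both bounds refer to the same \<open>K\<close>.\<close>
  obtain es \<phi> where res: "\<exists>\<epsilon>. graded_free_resolution M es \<phi> \<epsilon>"
    and Ext: "\<And>j. graded_Ext j M (poly_gmodule :: (('n, 'k) mpoly, _) gmodule) = Ext_of es \<phi> j poly_gmodule"
  proof -
    let ?P = "\<lambda>(es, \<phi>). \<exists>\<epsilon>. graded_free_resolution M es \<phi> \<epsilon>"
    have "\<exists>x. ?P x" using graded_free_resolution_exists[OF assms(5,6)] by auto
    hence P: "?P (SOME x. ?P x)" by (rule someI_ex)
    obtain es \<phi> where eq: "(SOME x. ?P x) = (es, \<phi>)" by (cases "SOME x. ?P x") blast
    show ?thesis
    proof (rule that[of es \<phi>])
      show "\<exists>\<epsilon>. graded_free_resolution M es \<phi> \<epsilon>" using P unfolding eq by simp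
      show "graded_Ext j M (poly_gmodule :: (('n, 'k) mpoly, _) gmodule) = Ext_of es \<phi> j poly_gmodule" for j
        unfolding graded_Ext_def eq by simp
    qed
  qed
  then obtain \<epsilon> where res: "graded_free_resolution M es \<phi> \<epsilon>" by blast
  let ?m = "length (es 0)" and ?e = "\<lambda>b. es 0 ! b"
  let ?K = "{v \<in> FF ?m. \<epsilon> (unemb ?m v) = \<zero>\<^bsub>M\<^esub>}"
  interpret M: presents ?m "\<lambda>v. \<epsilon> (unemb ?m v)" M ?e ?K by (rule resolution_free_res(1)[OF assms(5) res])
  interpret S: filter_seq ?e ?m d ?K l by (rule M.filter_seq_of_filter_regular[OF assms(10,9)])
  have lh: "l j \<in> poly_homog 1" if "j \<in> {1..d}" for j by (rule S.l[OF that])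
  have "\<exists>\<epsilon>'. presents ?m \<epsilon>' (mod_seq M l (i - 1)) ?e (Kseq l ?m ?K (i - 1))"
    by (rule M.presents_mod_seq) (use lh i in auto)
  then obtain \<epsilon>1 where p1: "presents ?m \<epsilon>1 (mod_seq M l (i - 1)) ?e (Kseq l ?m ?K (i - 1))" ..
  obtain \<epsilon>2 where p2: "presents ?m \<epsilon>2 (bar_mod (mod_seq M l (i - 1))) ?e (sat ?m (Kseq l ?m ?K (i - 1)))"
    using presents.presents_bar_mod[OF p1] ..
  \<comment> \<open>Cohomology of index 1 in degree \<open>t\<close> contributes
    \<open>1 + t\<close> to the regularity, so it vanishes already at
    \<open>t = r (i - 1)\<close>.\<close>
  have vanish: "hh ?e 1 t (FF ?m) (sat ?m (Kseq l ?m ?K (i - 1 + 0))) = 0" if "t \<ge> r (i - 1)" for t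
    using presents.hh_zero_above_reg[OF p2, of 1 t] that by (simp add: r_def)
  have "\<exists>\<epsilon>'. presents ?m \<epsilon>' (mod_seq M l d) ?e (Kseq l ?m ?K d)"
    by (rule M.presents_mod_seq) (use lh in auto)
  then obtain \<epsilon>3 where p3: "presents ?m \<epsilon>3 (mod_seq M l d) ?e (Kseq l ?m ?K d)" ..
  have B: "rdim (FF ?m) (Kseq l ?m ?K d) \<le> B" unfolding B_def by (rule presents.rdim_le_k_dim_carrier[OF p3])
  have bound: "hh ?e i t (FF ?m) ?K \<le> B * binom (r (i - 1) + int d - int i) (d - i) * binom (r (i - 1) - 1 - t) (i - 1)" for t
  proof -
    have "hh ?e (Suc (i - 1)) t (FF ?m) (Kseq l ?m ?K 0) \<le> rdim (FF ?m) (Kseq l ?m ?K d) *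
        binom (r (i - 1) + int d - int (Suc (i - 1 + 0))) (d - Suc (i - 1 + 0)) * binom (r (i - 1) - 1 - t) (i - 1)"
      by (rule S.hh_le[OF _ vanish]) (use i in auto)
    also have "\<dots> = rdim (FF ?m) (Kseq l ?m ?K d) * binom (r (i - 1) + int d - int i) (d - i) * binom (r (i - 1) - 1 - t) (i - 1)"
      using i by simp
    also have "\<dots> \<le> B * binom (r (i - 1) + int d - int i) (d - i) * binom (r (i - 1) - 1 - t) (i - 1)"
      by (intro mult_right_mono B) auto
    finally show ?thesis using i by simp
  qed
  \<comment> \<open>Duality leads from degree \<open>\<mu>\<close> to degree
    \<open>- n - \<mu>\<close>; inserted for \<open>t\<close>, this turns the upper entry
    \<open>r (i - 1) - 1 - t\<close> into \<open>\<mu> + r (i - 1) + n - 1\<close>.\<close>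
  have "k_dim (graded_Ext (n - i) M poly_gmodule) (homog (graded_Ext (n - i) M poly_gmodule) \<mu>)
      \<le> hh ?e (CARD('n) - (n - i)) (- int CARD('n) - \<mu>) (FF ?m) ?K"
    unfolding Ext by (rule k_dim_Ext_le[OF assms(5) res]) (use i dn n_def in auto)
  also have "CARD('n) - (n - i) = i" using i dn n_def by simp
  also have "hh ?e i (- int CARD('n) - \<mu>) (FF ?m) ?K
      \<le> B * binom (r (i - 1) + int d - int i) (d - i) * binom (\<mu> + r (i - 1) + int n - 1) (i - 1)"
    using bound[of "- int CARD('n) - \<mu>"] by (simp add: n_def algebra_simps)
  finally have 1: "k_dim (graded_Ext (n - i) M poly_gmodule) (homog (graded_Ext (n - i) M poly_gmodule) \<mu>)
      \<le> B * binom (r (i - 1) + int d - int i) (d - i) * binom (\<mu> + r (i - 1) + int n - 1) (i - 1)" .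
  have "k_dim (local_cohomology i M) (homog (local_cohomology i M) \<mu>) \<le> hh ?e i \<mu> (FF ?m) ?K"
    by (rule M.k_dim_local_cohomology)
  also have "\<dots> \<le> B * binom (r (i - 1) + int d - int i) (d - i) * binom (r (i - 1) - 1 - \<mu>) (i - 1)" by (rule bound)
  also have "r (i - 1) - 1 - \<mu> = - \<mu> + r (i - 1) - 1" by simp
  finally show "k_dim (graded_Ext (n - i) M poly_gmodule) (homog (graded_Ext (n - i) M poly_gmodule) \<mu>)
       \<le> B * binom (r (i - 1) + int d - int i) (d - i) * binom (\<mu> + r (i - 1) + int n - 1) (i - 1) \<and>
     k_dim (local_cohomology i M) (homog (local_cohomology i M) \<mu>)
       \<le> B * binom (r (i - 1) + int d - int i) (d - i) * binom (- \<mu> + r (i - 1) - 1) (i - 1)"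
    using 1 by blast
qed

end
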